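(* Let $\Gamma$ be an admissible boundary of class $\mathcal{C}^3$ and let $z$ be a real-valued boundary function with $z(\Gamma)\in\mathcal{C}^3(\Gamma)$. If $z$ is shape differentiable at $\Gamma$ in the direction $\boldsymbol{V}\in\mathcal{C}([0,\epsilon],V^3(\mathbf{D}))$, then $\Delta_\Gamma z:=\operatorname{div}_\Gamma\nabla_\Gamma z$ is also shape differentiable at $\Gamma$ in the direction $\boldsymbol{V}$, and its shape derivative is given by $$\begin{aligned}(\Delta_\Gamma z)'(\Gamma,\boldsymbol{V})&=\Delta_\Gamma z'(\Gamma,\boldsymbol{V})-2v_nD_\Gamma\boldsymbol{n}:D_\Gamma^2z+\left(\kappa\nabla_\Gamma v_n-2D_\Gamma\boldsymbol{n}\nabla_\Gamma v_n-v_n\nabla_\Gamma\kappa\right)\cdot\nabla_\Gamma z\\&=\Delta_\Gamma z'(\Gamma,\boldsymbol{V})-v_n\left(2D_\Gamma\boldsymbol{n}:D_\Gamma^2z+\nabla_\Gamma\kappa\cdot\nabla_\Gamma z\right)+\nabla_\Gamma v_n\cdot\left(\kappa\nabla_\Gamma z-2D_\Gamma\boldsymbol{n}\nabla_\Gamma z\right),\end{aligned}$$ where $v_n=\boldsymbol{V}(0)\cdot\boldsymbol{n}$ and $\kappa$ is the mean curvature of $\Gamma$.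
   Context: Velocity method: $\mathbf{D}\subset\mathbb{R}^N$ is a fixed hold-all domain and $V^k(\mathbf{D})=\mathcal{C}^k_0(\mathbf{D},\mathbb{R}^N)$ is the set of $\mathcal{C}^k$ vector fields $f$ such that $D^\alpha f$ has compact support in $\mathbf{D}$ for $0\le|\alpha|\le k$. A velocity field $\boldsymbol{V}\in\mathcal{C}([0,\epsilon],V^k(\mathbf{D}))$ defines trajectories $x(t)$ by $\dot x(t)=\boldsymbol{V}(t)\circ x(t)$, $x(0)=\mathrm{id}$; put $\boldsymbol{v}=\boldsymbol{V}(0)$. A domain is an open bounded set $\Omega$, a boundary is $\Gamma=\partial\Omega$, $\boldsymbol{n}$ is its unit normal pointing outward of $\Omega$, and $\Gamma_t=x(t)(\Gamma)$. Tangential calculus: for $f$ scalar and $\boldsymbol{w}$ vector valued on $\Gamma$, with any $\mathcal{C}^1$ extensions $F$, $\boldsymbol{W}$ to a neighborhood of $\Gamma$, $\nabla_\Gamma f=(I-\boldsymbol{n}\otimes\boldsymbol{n})\nabla F|_\Gamma$, $D_\Gamma\boldsymbol{w}=(D\boldsymbol{W}-D\boldsymbol{W}\boldsymbol{n}\otimes\boldsymbol{n})|_\Gamma$ and $\operatorname{div}_\Gamma\boldsymbol{w}=(\operatorname{div}\boldsymbol{W}-D\boldsymbol{W}\boldsymbol{n}\cdot\boldsymbol{n})|_\Gamma$ (independent of the extension); $D_\Gamma^2f=D_\Gamma(\nabla_\Gamma f)$. Here $(\boldsymbol{a}\otimes\boldsymbol{b})\boldsymbol{c}=(\boldsymbol{b}\cdot\boldsymbol{c})\boldsymbol{a}$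 and $S:T=\operatorname{tr}(S^TT)$. The mean curvature is the sum of the principal curvatures, $\kappa=\operatorname{div}_\Gamma\boldsymbol{n}$. Shape derivatives of boundary functions: a boundary function assigns to each admissible boundary $\Gamma$ (in particular to each $\Gamma_t$) a function $z(\Gamma)$ on $\Gamma$. If $z(\Gamma)\in\mathcal{C}^r(\Gamma)$, $1\le r\le k$, its material derivative is $\dot z(\Gamma,\boldsymbol{V})=\lim_{t\searrow0}\frac{z(\Gamma_t)\circ x(t)-z(\Gamma)}{t}$, the limit being taken in $\mathcal{C}^{r-1}(\Gamma)$; $z$ is shape differentiable at $\Gamma$ in the direction $\boldsymbol{V}$ if it exists, and the shape derivative is $z'(\Gamma,\boldsymbol{V})=\dot z(\Gamma,\boldsymbol{V})-\nabla_\Gamma z(\Gamma)\cdot\boldsymbol{v}$. *)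

theory Defs
  imports "HOL-Analysis.Analysis"
begin

section \<open>Functions of class \<open>C\<^sup>k\<close> and \<open>C\<^sup>k\<close> norms\<close>

text \<open>Meant for open sets \<open>S\<close>.\<close>

primrec Ck_on :: "nat \<Rightarrow> ('a::euclidean_space \<Rightarrow> 'b::real_normed_vector) \<Rightarrow> 'a set \<Rightarrow> bool" where
  "Ck_on 0 f S \<longleftrightarrow> continuous_on S f"
| "Ck_on (Suc k) f S \<longleftrightarrow>
     (\<forall>x\<in>S. f differentiable (at x)) \<and> (\<forall>h. Ck_on k (\<lambda>x. frechet_derivative f (at x) h) S)"

primrec iterated_deriv :: "'a list \<Rightarrow> ('a::euclidean_space \<Rightarrow> 'b::real_normed_vector) \<Rightarrow> 'a \<Rightarrow> 'b" where
  "iterated_deriv [] f = f"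
| "iterated_deriv (h # hs) f = iterated_deriv hs (\<lambda>x. frechet_derivative f (at x) h)"

text \<open>The supremum over the whole space of all partial derivatives of order at most \<open>k\<close>.\<close>

definition Ck_norm :: "nat \<Rightarrow> ('a::euclidean_space \<Rightarrow> 'b::real_normed_vector) \<Rightarrow> ennreal" where
  "Ck_norm k f =
     (SUP hs\<in>{hs. set hs \<subseteq> Basis \<and> length hs \<le> k}. SUP x. ennreal (norm (iterated_deriv hs f x)))"

text \<open>
  \<open>C\<^sup>k(\<Gamma>)\<close> consists of the restrictions to \<open>\<Gamma>\<close> of \<open>C\<^sup>k\<close> functions defined near \<open>\<Gamma>\<close>, with the
  quotient norm. On a compact hypersurface of class \<open>C\<^sup>k\<close> this is the space given by local charts,
  with an equivalent norm. The norm is infinite if there is no extension with bounded derivatives.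
\<close>

definition Ck_extension ::
    "nat \<Rightarrow> 'a::euclidean_space set \<Rightarrow> ('a \<Rightarrow> 'b::real_normed_vector) \<Rightarrow> ('a \<Rightarrow> 'b) \<Rightarrow> bool" where
  "Ck_extension k \<Gamma> f F \<longleftrightarrow>
     (\<exists>U. open U \<and> \<Gamma> \<subseteq> U \<and> Ck_on k F U) \<and> (\<forall>x\<in>\<Gamma>. F x = f x)"

definition Ck_bd :: "nat \<Rightarrow> 'a::euclidean_space set \<Rightarrow> ('a \<Rightarrow> 'b::real_normed_vector) set" where
  "Ck_bd k \<Gamma> = {f. \<exists>F. Ck_extension k \<Gamma> f F}"

definition Ck_bd_norm ::
    "nat \<Rightarrow> 'a::euclidean_space set \<Rightarrow> ('a \<Rightarrow> 'b::real_normed_vector) \<Rightarrow> ennreal" where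
  "Ck_bd_norm k \<Gamma> f = (INF F\<in>{F. Ck_on k F UNIV \<and> (\<forall>x\<in>\<Gamma>. F x = f x)}. Ck_norm k F)"


section \<open>Matrix notation\<close>

definition gradient :: "(real^'n \<Rightarrow> real) \<Rightarrow> real^'n \<Rightarrow> real^'n" where
  "gradient F x = (\<chi> i. frechet_derivative F (at x) (axis i 1))"

definition jacobian_matrix :: "(real^'n \<Rightarrow> real^'n) \<Rightarrow> real^'n \<Rightarrow> real^'n^'n" where
  "jacobian_matrix W x = matrix (frechet_derivative W (at x))"

definition divergence :: "(real^'n \<Rightarrow> real^'n) \<Rightarrow> real^'n \<Rightarrow> real" where
  "divergence W x = trace (jacobian_matrix W x)"

definition tensor :: "real^'n \<Rightarrow> real^'n \<Rightarrow> real^'n^'n" where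
  "tensor a b = (\<chi> i j. a $ i * b $ j)"

definition ddot :: "real^'n^'n \<Rightarrow> real^'n^'n \<Rightarrow> real" where
  "ddot S T = trace (transpose S ** T)"


section \<open>Domains, boundaries and the outward normal\<close>

definition defining_function ::
    "nat \<Rightarrow> (real^'n) set \<Rightarrow> (real^'n) set \<Rightarrow> (real^'n \<Rightarrow> real) \<Rightarrow> bool" where
  "defining_function k \<Omega> U \<phi> \<longleftrightarrow>
     open U \<and> Ck_on k \<phi> U \<and> (\<forall>x\<in>U. gradient \<phi> x \<noteq> 0) \<and>
     \<Omega> \<inter> U = {x\<in>U. \<phi> x < 0} \<and> frontier \<Omega> \<inter> U = {x\<in>U. \<phi> x = 0}"

definition Ck_domain :: "nat \<Rightarrow> (real^'n) set \<Rightarrow> bool" where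
  "Ck_domain k \<Omega> \<longleftrightarrow>
     open \<Omega> \<and> bounded \<Omega> \<and> (\<forall>p\<in>frontier \<Omega>. \<exists>U \<phi>. p \<in> U \<and> defining_function k \<Omega> U \<phi>)"

definition admissible_boundary :: "nat \<Rightarrow> (real^'n) set \<Rightarrow> (real^'n) set \<Rightarrow> bool" where
  "admissible_boundary k D \<Gamma> \<longleftrightarrow> (\<exists>\<Omega>. Ck_domain k \<Omega> \<and> \<Omega> \<subseteq> D \<and> \<Gamma> = frontier \<Omega>)"

text \<open>
  A boundary determines its domain: if two such domains have the same frontier \<open>\<Gamma>\<close>, then at each
  point of \<open>\<Gamma>\<close> they lie locally either on the same side or on opposite sides, so the union of their
  symmetric difference off \<open>\<Gamma>\<close> with the points of \<open>\<Gamma>\<close> of the second kind is bounded, open and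
  closed, hence empty.
\<close>

definition enclosed_domain :: "(real^'n) set \<Rightarrow> (real^'n) set" where
  "enclosed_domain \<Gamma> = (THE \<Omega>. Ck_domain 1 \<Omega> \<and> frontier \<Omega> = \<Gamma>)"

text \<open>
  The domain is locally the sublevel set of \<open>\<phi>\<close>, so the normalised gradient points outward; the
  half space \<open>{h. h \<bullet> gradient \<phi> p \<le> 0}\<close> does not depend on the choice of \<open>\<phi>\<close>.
\<close>

definition normal :: "(real^'n) set \<Rightarrow> real^'n \<Rightarrow> real^'n" where
  "normal \<Gamma> p =
     (THE \<nu>. \<exists>U \<phi>. p \<in> U \<and> defining_function 1 (enclosed_domain \<Gamma>) U \<phi> \<and>
        \<nu> = gradient \<phi> p /\<^sub>R norm (gradient \<phi> p))"


section \<open>Tangential calculus\<close>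

text \<open>On a boundary of class \<open>C\<^sup>1\<close> the operators below do not depend on the extension chosen.\<close>

definition extension ::
    "(real^'n) set \<Rightarrow> (real^'n \<Rightarrow> 'b::real_normed_vector) \<Rightarrow> real^'n \<Rightarrow> 'b" where
  "extension \<Gamma> f = (SOME F. Ck_extension 1 \<Gamma> f F)"

definition tgrad :: "(real^'n) set \<Rightarrow> (real^'n \<Rightarrow> real) \<Rightarrow> real^'n \<Rightarrow> real^'n" where
  "tgrad \<Gamma> f x =
     (mat 1 - tensor (normal \<Gamma> x) (normal \<Gamma> x)) *v gradient (extension \<Gamma> f) x"

definition tderiv :: "(real^'n) set \<Rightarrow> (real^'n \<Rightarrow> real^'n) \<Rightarrow> real^'n \<Rightarrow> real^'n^'n" where
  "tderiv \<Gamma> w x =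
     jacobian_matrix (extension \<Gamma> w) x
     - tensor (jacobian_matrix (extension \<Gamma> w) x *v normal \<Gamma> x) (normal \<Gamma> x)"

definition tdiv :: "(real^'n) set \<Rightarrow> (real^'n \<Rightarrow> real^'n) \<Rightarrow> real^'n \<Rightarrow> real" where
  "tdiv \<Gamma> w x =
     divergence (extension \<Gamma> w) x
     - (jacobian_matrix (extension \<Gamma> w) x *v normal \<Gamma> x) \<bullet> normal \<Gamma> x"

definition thessian :: "(real^'n) set \<Rightarrow> (real^'n \<Rightarrow> real) \<Rightarrow> real^'n \<Rightarrow> real^'n^'n" where
  "thessian \<Gamma> f = tderiv \<Gamma> (tgrad \<Gamma> f)"

definition laplace_beltrami :: "(real^'n) set \<Rightarrow> (real^'n \<Rightarrow> real) \<Rightarrow> real^'n \<Rightarrow> real" where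
  "laplace_beltrami \<Gamma> f = tdiv \<Gamma> (tgrad \<Gamma> f)"

definition mean_curvature :: "(real^'n) set \<Rightarrow> real^'n \<Rightarrow> real" where
  "mean_curvature \<Gamma> = tdiv \<Gamma> (normal \<Gamma>)"


section \<open>Velocity fields and trajectories\<close>

text \<open>
  Fields on \<open>D\<close> are extended by zero to the whole space. The support of a partial derivative is
  contained in that of the field.
\<close>

definition Ck_fields :: "nat \<Rightarrow> (real^'n) set \<Rightarrow> (real^'n \<Rightarrow> real^'n) set" where
  "Ck_fields k D =
     {f. Ck_on k f UNIV \<and> compact (closure {x. f x \<noteq> 0}) \<and> closure {x. f x \<noteq> 0} \<subseteq> D}"

definition velocity_field ::
    "nat \<Rightarrow> (real^'n) set \<Rightarrow> real \<Rightarrow> (real \<Rightarrow> real^'n \<Rightarrow> real^'n) \<Rightarrow> bool" where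
  "velocity_field k D \<epsilon> V \<longleftrightarrow>
     (\<forall>t\<in>{0..\<epsilon>}. V t \<in> Ck_fields k D) \<and>
     (\<forall>s\<in>{0..\<epsilon>}. ((\<lambda>t. Ck_norm k (\<lambda>x. V t x - V s x)) \<longlongrightarrow> 0) (at s within {0..\<epsilon>}))"

definition trajectories ::
    "real \<Rightarrow> (real \<Rightarrow> real^'n \<Rightarrow> real^'n) \<Rightarrow> (real \<Rightarrow> real^'n \<Rightarrow> real^'n) \<Rightarrow> bool" where
  "trajectories \<epsilon> V x \<longleftrightarrow>
     (\<forall>X. x 0 X = X \<and>
        (\<forall>t\<in>{0..\<epsilon>}. ((\<lambda>s. x s X) has_vector_derivative V t (x t X)) (at t within {0..\<epsilon>})))"


section \<open>Material and shape derivatives of boundary functions\<close>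

text \<open>Only the restriction of \<open>z \<Gamma>\<close> to \<open>\<Gamma>\<close> matters.\<close>

type_synonym 'n boundary_function = "(real^'n) set \<Rightarrow> real^'n \<Rightarrow> real"

definition has_material_derivative ::
    "nat \<Rightarrow> 'n::finite boundary_function \<Rightarrow> (real^'n) set \<Rightarrow> (real \<Rightarrow> real^'n \<Rightarrow> real^'n)
      \<Rightarrow> (real^'n \<Rightarrow> real) \<Rightarrow> bool" where
  "has_material_derivative r z \<Gamma> x g \<longleftrightarrow>
     1 \<le> r \<and> z \<Gamma> \<in> Ck_bd r \<Gamma> \<and> g \<in> Ck_bd (r - 1) \<Gamma> \<and>
     ((\<lambda>t. Ck_bd_norm (r - 1) \<Gamma> (\<lambda>X. (z (x t ` \<Gamma>) (x t X) - z \<Gamma> X) / t - g X)) \<longlongrightarrow> 0) (at_right 0)"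

definition shape_differentiable ::
    "nat \<Rightarrow> 'n::finite boundary_function \<Rightarrow> (real^'n) set \<Rightarrow> (real \<Rightarrow> real^'n \<Rightarrow> real^'n) \<Rightarrow> bool" where
  "shape_differentiable r z \<Gamma> x \<longleftrightarrow> (\<exists>g. has_material_derivative r z \<Gamma> x g)"

definition material_derivative ::
    "nat \<Rightarrow> 'n::finite boundary_function \<Rightarrow> (real^'n) set \<Rightarrow> (real \<Rightarrow> real^'n \<Rightarrow> real^'n)
      \<Rightarrow> real^'n \<Rightarrow> real" where
  "material_derivative r z \<Gamma> x = (SOME g. has_material_derivative r z \<Gamma> x g)"

text \<open>The argument \<open>v\<close> is the initial velocity of the trajectories \<open>x\<close>.\<close>

definition shape_derivative ::
    "nat \<Rightarrow> 'n::finite boundary_function \<Rightarrow> (real^'n) set \<Rightarrow> (real \<Rightarrow> real^'n \<Rightarrow> real^'n)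
      \<Rightarrow> (real^'n \<Rightarrow> real^'n) \<Rightarrow> real^'n \<Rightarrow> real" where
  "shape_derivative r z \<Gamma> x v X = material_derivative r z \<Gamma> x X - tgrad \<Gamma> (z \<Gamma>) X \<bullet> v X"

end

theory Submission
  imports Defs
begin

text \<open>
  Pull everything back to the fixed boundary by the flow. For small times the flow \<open>x t\<close> is a \<open>C\<^sup>2\<close>
  perturbation of the identity with \<open>x t = id + t v + o(t)\<close> in \<open>C\<^sup>2\<close>, so with \<open>B t\<close> the inverse of the
  Jacobian of \<open>x t\<close>, and with extensions of \<open>n\<close> and \<open>z\<close> to a neighbourhood of the boundary, the pulled
  back Laplacian is \<open>tr (D(W t) (B t) (P t))\<close>. Here \<open>P t\<close> is the projection along the pulled back normal
  and \<open>W t = (P t) (B t)\<^sup>T \<nabla>(z t)\<close> the pulled back tangential gradient. All the factors can be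
  differentiated at \<open>t = 0\<close> locally uniformly, which gives the material derivative. Its relation to the
  shape derivative is a pointwise identity for a unit field \<open>N\<close> near the boundary, in which only
  \<open>N \<bullet> DN = 0\<close>, the symmetry of \<open>P DN P\<close> and the symmetry of second derivatives enter. The extension
  of \<open>n\<close> is the normalised gradient of one defining function for the whole boundary.
\<close>

section \<open>Calculus of \<open>C\<^sup>k\<close> functions\<close>

text \<open>Orders of differentiability are tight. With \<open>z\<close> of class C^3 its material
  derivative is C^2; the Laplacian consumes two orders, so its own material derivative is measured
  in the C^0 norm. For the same reason the extended normal is C^2, and the flow is expanded in C^2,
  which draws on Lipschitz second derivatives of the velocity. The trajectories are given, but
  nothing is known about their dependence on the starting point: spatial differentiability up to
  order two has to be derived from the differential equation. The normal and the tangential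
  operators are defined by descriptions and choices, so that a boundary must first be shown to
  determine its domain, and the operators to be independent of the extension. The level function
  behind the extended normal is not a distance function; the derivative of the normal along itself
  need not vanish, and the terms containing it have to cancel.\<close>

abbreviation dd :: "('a::real_normed_vector \<Rightarrow> 'b::real_normed_vector) \<Rightarrow> 'a \<Rightarrow> 'a \<Rightarrow> 'b" where
  "dd f x \<equiv> frechet_derivative f (at x)"

lemma dd_eqI: "(f has_derivative f') (at x) \<Longrightarrow> dd f x = f'"
  by (metis frechet_derivative_at)

lemma has_derivative_dd: "f differentiable (at x) \<Longrightarrow> (f has_derivative dd f x) (at x)"
  by (simp add: frechet_derivative_works)

lemma dd_bounded_linear: "f differentiable (at x) \<Longrightarrow> bounded_linear (dd f x)"
  using has_derivative_bounded_linear has_derivative_dd by blast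

lemma dd_linear: "f differentiable (at x) \<Longrightarrow> linear (dd f x)"
  using dd_bounded_linear bounded_linear.linear by blast

text \<open>\<open>Ck_on\<close> speaks about fixed directions, and the C^k norms only about
  coordinate directions. This expansion is the bridge: estimates, limits and regularity in a varying
  direction follow from those along the finitely many basis vectors.\<close>

lemma dd_basis_expansion:
  fixes f :: "'a::euclidean_space \<Rightarrow> 'b::real_normed_vector"
  assumes "f differentiable (at x)"
  shows "dd f x h = (\<Sum>b\<in>Basis. (h \<bullet> b) *\<^sub>R dd f x b)"
proof -
  interpret linear "dd f x" using dd_linear[OF assms] .
  have "dd f x h = dd f x (\<Sum>b\<in>Basis. (h \<bullet> b) *\<^sub>R b)"
    by (simp add: euclidean_representation)
  also have "\<dots> = (\<Sum>b\<in>Basis. (h \<bullet> b) *\<^sub>R dd f x b)"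
    by (simp add: sum scaleR)
  finally show ?thesis .
qed

text \<open>The two functions have the same derivatives at \<open>x\<close>, so both sides are
  choices from one and the same predicate, whether or not a derivative exists.\<close>

lemma dd_transform:
  assumes "open S" "x \<in> S" "\<And>y. y \<in> S \<Longrightarrow> f y = g y"
  shows "dd f x = dd g x"
proof -
  have "(f has_derivative D) (at x) \<longleftrightarrow> (g has_derivative D) (at x)" for D
    using assms has_derivative_transform_within_open[of f D x UNIV S g]
      has_derivative_transform_within_open[of g D x UNIV S f] by auto
  then show ?thesis
    by (simp add: frechet_derivative_def)
qed

lemma differentiable_transform_open:
  assumes "open S" "x \<in> S" "\<And>y. y \<in> S \<Longrightarrow> f y = g y" "f differentiable (at x)"
  shows "g differentiable (at x)"
  using assms has_derivative_transform_within_open[of f _ x UNIV S g]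
  unfolding differentiable_def by blast

lemma Ck_on_cong:
  assumes "open S" "\<And>x. x \<in> S \<Longrightarrow> f x = g x" "Ck_on k f S"
  shows "Ck_on k g S"
  using assms
proof (induction k arbitrary: f g)
  case 0
  then show ?case by (metis Ck_on.simps(1) continuous_on_cong)
next
  case (Suc k)
  have "dd f x = dd g x" if "x \<in> S" for x
    using dd_transform[OF Suc.prems(1) that Suc.prems(2)] .
  then have "Ck_on k (\<lambda>x. dd g x h) S" for h
    using Suc.IH[of "\<lambda>x. dd f x h" "\<lambda>x. dd g x h"] Suc.prems by simp
  then show ?case
    using differentiable_transform_open[OF Suc.prems(1) _ Suc.prems(2)] Suc.prems(3) by auto
qed

lemma Ck_on_subset: "Ck_on k f S \<Longrightarrow> T \<subseteq> S \<Longrightarrow> Ck_on k f T"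
  by (induction k arbitrary: f) (auto intro: continuous_on_subset)

lemma Ck_on_SucI:
  assumes "open S" "\<And>x. x \<in> S \<Longrightarrow> (f has_derivative f' x) (at x)"
    and "\<And>h. Ck_on k (\<lambda>x. f' x h) S"
  shows "Ck_on (Suc k) f S"
proof -
  have "Ck_on k (\<lambda>x. dd f x h) S" for h
    by (rule Ck_on_cong[OF assms(1) _ assms(3)[of h]]) (simp add: dd_eqI[OF assms(2)])
  then show ?thesis
    using assms(2) by (auto simp: differentiable_def)
qed

lemma Ck_on_dd: "Ck_on (Suc k) f S \<Longrightarrow> Ck_on k (\<lambda>x. dd f x h) S"
  by simp

lemma Ck_on_Suc_has_derivative: "Ck_on (Suc k) f S \<Longrightarrow> x \<in> S \<Longrightarrow> (f has_derivative dd f x) (at x)"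
  by (simp add: has_derivative_dd)

lemma Ck_on_SucD: "Ck_on (Suc k) f S \<Longrightarrow> Ck_on k f S"
proof (induction k arbitrary: f)
  case 0
  then show ?case
    by (auto intro!: continuous_at_imp_continuous_on differentiable_imp_continuous_within)
qed simp

lemma Ck_on_mono: "Ck_on k f S \<Longrightarrow> j \<le> k \<Longrightarrow> Ck_on j f S"
  by (induction k arbitrary: f) (use Ck_on_SucD le_Suc_eq in blast)+

lemma Ck_on_continuous: "Ck_on k f S \<Longrightarrow> continuous_on S f"
  using Ck_on_mono[of k f S 0] by simp

lemma Ck_on_differentiable: "Ck_on k f S \<Longrightarrow> 0 < k \<Longrightarrow> x \<in> S \<Longrightarrow> f differentiable (at x)"
  by (cases k) auto

lemma Ck_on_isCont: "Ck_on k f S \<Longrightarrow> open S \<Longrightarrow> x \<in> S \<Longrightarrow> isCont f x"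
  using Ck_on_continuous continuous_on_eq_continuous_at by blast

lemma Ck_on_const: "Ck_on k (\<lambda>x. c) S"
  by (induction k arbitrary: c) (auto simp: frechet_derivative_const)

lemma Ck_on_bounded_linear:
  assumes "bounded_linear L" "open S" "Ck_on k f S"
  shows "Ck_on k (\<lambda>x. L (f x)) S"
  using assms(3)
proof (induction k arbitrary: f)
  case 0
  then show ?case using assms(1) by (simp add: bounded_linear.continuous_on)
next
  case (Suc k)
  show ?case
  proof (rule Ck_on_SucI[OF assms(2)])
    show "((\<lambda>x. L (f x)) has_derivative (\<lambda>h. L (dd f x h))) (at x)" if "x \<in> S" for x
      using bounded_linear.has_derivative[OF assms(1) Ck_on_Suc_has_derivative[OF Suc.prems that]] .
    show "Ck_on k (\<lambda>x. L (dd f x h)) S" for h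
      using Suc by simp
  qed
qed

lemma Ck_on_id: "open S \<Longrightarrow> Ck_on k (\<lambda>x. x) S"
proof (cases k)
  case (Suc j)
  assume "open S"
  then show ?thesis unfolding Suc
    by (intro Ck_on_SucI[where f'="\<lambda>x h. h"]) (auto intro: Ck_on_const)
qed simp

lemma Ck_on_add:
  assumes "open S" "Ck_on k f S" "Ck_on k g S"
  shows "Ck_on k (\<lambda>x. f x + g x) S"
  using assms(2,3)
proof (induction k arbitrary: f g)
  case (Suc k)
  show ?case
    by (rule Ck_on_SucI[OF assms(1), where f'="\<lambda>x h. dd f x h + dd g x h"])
      (use Suc in \<open>auto intro!: has_derivative_add has_derivative_dd\<close>)
qed (simp add: continuous_on_add)

text \<open>One product rule for all products in use: scalar multiples, inner products, tensors and
  matrix products are its instances.\<close>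

lemma Ck_on_bilinear:
  assumes B: "bounded_bilinear B" and S: "open S" and "Ck_on k f S" "Ck_on k g S"
  shows "Ck_on k (\<lambda>x. B (f x) (g x)) S"
  using assms(3,4)
proof (induction k arbitrary: f g)
  case 0
  then show ?case by (simp add: bounded_bilinear.continuous_on[OF B])
next
  case (Suc k)
  show ?case
  proof (rule Ck_on_SucI[OF S])
    show "((\<lambda>x. B (f x) (g x)) has_derivative (\<lambda>h. B (f x) (dd g x h) + B (dd f x h) (g x))) (at x)"
      if "x \<in> S" for x
      using Suc.prems that by (intro bounded_bilinear.FDERIV[OF B] has_derivative_dd) auto
    show "Ck_on k (\<lambda>x. B (f x) (dd g x h) + B (dd f x h) (g x)) S" for h
      by (intro Ck_on_add[OF S] Suc.IH Ck_on_dd Suc.prems Ck_on_SucD[OF Suc.prems(1)]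
          Ck_on_SucD[OF Suc.prems(2)])
  qed
qed

lemma Ck_on_minus: "open S \<Longrightarrow> Ck_on k f S \<Longrightarrow> Ck_on k (\<lambda>x. - f x) S"
  by (rule Ck_on_bounded_linear[OF bounded_linear_minus[OF bounded_linear_ident]])

lemma Ck_on_diff: "open S \<Longrightarrow> Ck_on k f S \<Longrightarrow> Ck_on k g S \<Longrightarrow> Ck_on k (\<lambda>x. f x - g x) S"
  using Ck_on_add[of S k f "\<lambda>x. - g x"] by (simp add: Ck_on_minus)

lemmas Ck_on_scaleR = Ck_on_bilinear[OF bounded_bilinear_scaleR]
lemmas Ck_on_mult = Ck_on_bilinear[OF bounded_bilinear_mult]
lemmas Ck_on_inner = Ck_on_bilinear[OF bounded_bilinear_inner]

lemma Ck_on_sum: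
  "open S \<Longrightarrow> (\<And>i. i \<in> I \<Longrightarrow> Ck_on k (f i) S) \<Longrightarrow> Ck_on k (\<lambda>x. \<Sum>i\<in>I. f i x) S"
  by (induction I rule: infinite_finite_induct) (auto intro: Ck_on_const Ck_on_add)

text \<open>The derivative \<open>dd g (f x) (dd f x h)\<close> has a direction that moves with
  \<open>x\<close>, which the recursion in \<open>Ck_on\<close> does not treat. After the basis
  expansion every summand is a product to which the induction hypothesis applies.\<close>

lemma Ck_on_compose:
  assumes S: "open S" and T: "open T" and "f ` S \<subseteq> T" "Ck_on k f S" "Ck_on k g T"
  shows "Ck_on k (\<lambda>x. g (f x)) S"
  using assms(3-5)
proof (induction k arbitrary: f g)
  case 0
  then show ?case by (auto intro: continuous_on_compose2)
next
  case (Suc k)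
  show ?case
  proof (rule Ck_on_SucI[OF S])
    fix x assume x: "x \<in> S"
    have g: "(g has_derivative dd g (f x)) (at (f x))"
      using Suc.prems x by (intro Ck_on_Suc_has_derivative) auto
    then show "((\<lambda>x. g (f x)) has_derivative (\<lambda>h. \<Sum>b\<in>Basis. (dd f x h \<bullet> b) *\<^sub>R dd g (f x) b)) (at x)"
      using has_derivative_compose[OF Ck_on_Suc_has_derivative[OF Suc.prems(2) x] g]
        dd_basis_expansion[OF differentiableI[OF g], symmetric] by simp
  next
    fix h
    show "Ck_on k (\<lambda>x. \<Sum>b\<in>Basis. (dd f x h \<bullet> b) *\<^sub>R dd g (f x) b) S"
    proof (intro Ck_on_sum Ck_on_scaleR Ck_on_inner S Ck_on_const)
      show "Ck_on k (\<lambda>x. dd f x h) S"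
        using Suc.prems(2) by simp
      show "Ck_on k (\<lambda>x. dd g (f x) b) S" for b
        using Suc.prems(1,3) Ck_on_SucD[OF Suc.prems(2)] by (intro Suc.IH[where g="\<lambda>y. dd g y b"]) auto
    qed
  qed
qed

lemma Ck_on_Un:
  assumes "Ck_on k f S" "Ck_on k f T" "open S" "open T"
  shows "Ck_on k f (S \<union> T)"
  using assms(1,2)
  by (induction k arbitrary: f) (auto simp: continuous_on_open_Un[OF assms(3,4)])

lemma Ck_on_powr: "Ck_on k (\<lambda>s::real. s powr a) {0<..}"
proof (induction k arbitrary: a)
  case 0
  show ?case by (auto intro!: continuous_intros)
next
  case (Suc k)
  show ?case
  proof (rule Ck_on_SucI)
    show "((\<lambda>s. s powr a) has_derivative (\<lambda>h. h * (a * x powr (a - 1)))) (at x)" if "x \<in> {0<..}" for x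
      using has_real_derivative_powr[of x a] that
      by (simp add: has_field_derivative_def mult_commute_abs)
  qed (auto intro!: Ck_on_mult Ck_on_const Suc)
qed

text \<open>A truncated power takes the place of a smooth bump: it is positive exactly for
  \<open>s > 0\<close>, and its derivative is a multiple of the next lower truncated power, which
  drives the induction.\<close>

lemma Ck_on_pos_part_power: "Ck_on k (\<lambda>s::real. max 0 s ^ Suc k) UNIV"
proof (induction k)
  case 0
  show ?case by (auto intro!: continuous_intros)
next
  case (Suc k)
  show ?case
  proof (rule Ck_on_SucI)
    fix x :: real
    have "((\<lambda>s. max 0 s ^ Suc (Suc k)) has_real_derivative (real (Suc (Suc k)) * max 0 x ^ Suc k)) (at x)"
    proof (cases "x = 0")
      case True
      have "((\<lambda>s::real. max 0 s ^ Suc (Suc k)) has_field_derivative 0) (at 0)"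
        unfolding has_field_derivative_iff
      proof (rule Lim_transform_bound[where g="\<lambda>y. \<bar>y\<bar> ^ Suc k"])
        show "\<forall>\<^sub>F y::real in at 0. norm ((max 0 y ^ Suc (Suc k) - max 0 0 ^ Suc (Suc k)) / (y - 0)) \<le> norm (\<bar>y\<bar> ^ Suc k)"
          by (intro always_eventually allI) (auto simp: max_def abs_mult divide_simps zero_le_mult_iff mult_le_0_iff)
        show "((\<lambda>y::real. \<bar>y\<bar> ^ Suc k) \<longlongrightarrow> 0) (at 0)"
          by (rule tendsto_eq_intros refl | simp)+
      qed
      then show ?thesis using True by simp
    next
      case False
      have "((\<lambda>s. max 0 s) has_real_derivative (if 0 < x then 1 else 0)) (at x)"
      proof (cases "0 < x")
        case True
        then show ?thesis
          using has_field_derivative_transform_within_open[OF DERIV_ident, where S="{0<..}" and a=x and g="\<lambda>s. max 0 s"]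
          by auto
      next
        case F: False
        then show ?thesis
          using False has_field_derivative_transform_within_open[OF DERIV_const[where k=0],
              where S="{..<0}" and a=x and g="\<lambda>s. max 0 s"]
          by auto
      qed
      from DERIV_power[OF this, of "Suc (Suc k)"] show ?thesis
        using False by (auto simp: max_def)
    qed
    then show "((\<lambda>s. max 0 s ^ Suc (Suc k)) has_derivative
        (\<lambda>h. h * (real (Suc (Suc k)) * max 0 x ^ Suc k))) (at x)"
      unfolding has_field_derivative_def by (simp only: mult_commute_abs)
  qed (use Suc in \<open>auto intro!: Ck_on_mult Ck_on_const\<close>)
qed

text \<open>The second difference of \<open>f\<close> over a small parallelogram with sides
  \<open>s *\<^sub>R h\<close> and \<open>s *\<^sub>R k\<close> is symmetric in \<open>h\<close> and
  \<open>k\<close>. The mean value theorem, applied twice and in either order, writes it as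
  \<open>s * s\<close> times one of the mixed derivatives at a point near \<open>x\<close>;
  continuity at \<open>x\<close> then identifies the two.\<close>

lemma dd_dd_symmetric_real:
  fixes f :: "'a::euclidean_space \<Rightarrow> real"
  assumes S: "open S" and f: "Ck_on 2 f S" and x: "x \<in> S"
  shows "dd (\<lambda>y. dd f y h) x k = dd (\<lambda>y. dd f y k) x h"
proof -
  have mixed: "\<exists>\<rho>\<in>{0<..<s}. \<exists>\<sigma>\<in>{0<..<s}. f (x + s *\<^sub>R h + s *\<^sub>R k) - f (x + s *\<^sub>R h) - f (x + s *\<^sub>R k) + f x
      = s * s * dd (\<lambda>y. dd f y h) (x + \<rho> *\<^sub>R h + \<sigma> *\<^sub>R k) k"
    if s: "0 < s" and sub: "\<And>\<rho> \<sigma>. \<rho> \<in> {0..s} \<Longrightarrow> \<sigma> \<in> {0..s} \<Longrightarrow> x + \<rho> *\<^sub>R h + \<sigma> *\<^sub>R k \<in> S" for s h k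
  proof -
    have df: "(f has_derivative dd f y) (at y)" if "y \<in> S" for y
      using f that by (auto simp: numeral_2_eq_2 intro: has_derivative_dd)
    have ddf: "((\<lambda>y. dd f y h) has_derivative dd (\<lambda>y. dd f y h) y) (at y)" if "y \<in> S" for y
      using f that by (auto simp: numeral_2_eq_2 intro: has_derivative_dd)
    have line: "((\<lambda>r. g (a + r *\<^sub>R b)) has_derivative (\<lambda>u. u * G b)) (at r)"
      if "(g has_derivative G) (at (a + r *\<^sub>R b))" for g :: "'a \<Rightarrow> real" and G a b r
    proof -
      interpret linear G using that has_derivative_linear by blast
      show ?thesis
        by (rule has_derivative_eq_rhs[OF has_derivative_compose[where f="\<lambda>r. a + r *\<^sub>R b" and g=g, OF _ that]])
          (auto intro!: derivative_eq_intros simp: scaleR)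
    qed
    have "\<exists>\<rho>\<in>{0<..<s}. (f (x + s *\<^sub>R k + s *\<^sub>R h) - f (x + s *\<^sub>R h)) - (f (x + s *\<^sub>R k + 0 *\<^sub>R h) - f (x + 0 *\<^sub>R h))
       = (s - 0) * dd f (x + s *\<^sub>R k + \<rho> *\<^sub>R h) h - (s - 0) * dd f (x + \<rho> *\<^sub>R h) h"
    proof (rule mvt_simple[OF s])
      fix r assume r: "0 \<le> r" "r \<le> s"
      have 1: "x + s *\<^sub>R k + r *\<^sub>R h \<in> S" and 2: "x + r *\<^sub>R h \<in> S"
        using sub[of r s] sub[of r 0] r s by (auto simp: algebra_simps)
      show "((\<lambda>r. f (x + s *\<^sub>R k + r *\<^sub>R h) - f (x + r *\<^sub>R h)) has_derivative
          (\<lambda>u. u * dd f (x + s *\<^sub>R k + r *\<^sub>R h) h - u * dd f (x + r *\<^sub>R h) h)) (at r within {0..s})"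
        using has_derivative_diff[OF line[OF df[OF 1]] line[OF df[OF 2]]] by (rule has_derivative_at_withinI)
    qed
    then obtain \<rho> where \<rho>: "\<rho> \<in> {0<..<s}"
      and e1: "f (x + s *\<^sub>R h + s *\<^sub>R k) - f (x + s *\<^sub>R h) - f (x + s *\<^sub>R k) + f x
        = s * (dd f (x + \<rho> *\<^sub>R h + s *\<^sub>R k) h - dd f (x + \<rho> *\<^sub>R h + 0 *\<^sub>R k) h)"
      by (auto simp: algebra_simps)
    have "\<exists>\<sigma>\<in>{0<..<s}. dd f (x + \<rho> *\<^sub>R h + s *\<^sub>R k) h - dd f (x + \<rho> *\<^sub>R h + 0 *\<^sub>R k) h
        = (s - 0) * dd (\<lambda>y. dd f y h) (x + \<rho> *\<^sub>R h + \<sigma> *\<^sub>R k) k"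
    proof (rule mvt_simple[OF s])
      fix r assume r: "0 \<le> r" "r \<le> s"
      have "x + \<rho> *\<^sub>R h + r *\<^sub>R k \<in> S"
        using sub[of \<rho> r] \<rho> r by auto
      from line[OF ddf[OF this]]
      show "((\<lambda>r. dd f (x + \<rho> *\<^sub>R h + r *\<^sub>R k) h) has_derivative
          (\<lambda>u. u * dd (\<lambda>y. dd f y h) (x + \<rho> *\<^sub>R h + r *\<^sub>R k) k)) (at r within {0..s})"
        by (rule has_derivative_at_withinI)
    qed
    then show ?thesis
      using e1 \<rho> by (force simp: mult.assoc)
  qed
  let ?A = "\<lambda>y. dd (\<lambda>y. dd f y h) y k" and ?B = "\<lambda>y. dd (\<lambda>y. dd f y k) y h"
  have cont: "isCont ?A x" "isCont ?B x"
    using f S x by (auto simp: numeral_2_eq_2 continuous_on_eq_continuous_at)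
  have "dist (?A x) (?B x) \<le> 0 + e" if e: "e > 0" for e
  proof -
    obtain d1 where d1: "d1 > 0" "\<And>y. dist y x < d1 \<Longrightarrow> dist (?A y) (?A x) < e / 2"
      using cont(1) e unfolding continuous_at_eps_delta by (meson half_gt_zero)
    obtain d2 where d2: "d2 > 0" "\<And>y. dist y x < d2 \<Longrightarrow> dist (?B y) (?B x) < e / 2"
      using cont(2) e unfolding continuous_at_eps_delta by (meson half_gt_zero)
    obtain d3 where d3: "d3 > 0" "ball x d3 \<subseteq> S"
      using S x openE by blast
    define d where "d = min d1 (min d2 d3)"
    define M where "M = norm h + norm k + 1"
    \<comment> \<open>With this side length the whole parallelogram lies within \<open>d / 2\<close>
      of \<open>x\<close>, hence in \<open>S\<close> and where both mixed derivatives differ by less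
      than \<open>e / 2\<close> from their values at \<open>x\<close>.\<close>
    define s where "s = d / (2 * M)"
    have d: "d > 0" using d1 d2 d3 by (simp add: d_def)
    have np: "M > 0" unfolding M_def by (smt (verit) norm_ge_zero)
    have s: "s > 0" unfolding s_def using d np by simp
    have near: "dist (x + \<rho> *\<^sub>R h + \<sigma> *\<^sub>R k) x < d" if "\<rho> \<in> {0..s}" "\<sigma> \<in> {0..s}" for \<rho> \<sigma>
    proof -
      have "dist (x + \<rho> *\<^sub>R h + \<sigma> *\<^sub>R k) x \<le> \<rho> * norm h + \<sigma> * norm k"
        using norm_triangle_ineq[of "\<rho> *\<^sub>R h" "\<sigma> *\<^sub>R k"] that by (simp add: dist_norm)
      also have "\<dots> \<le> s * norm h + s * norm k"
        using that by (intro add_mono mult_right_mono) auto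
      also have "\<dots> \<le> s * M"
        using s by (simp add: M_def algebra_simps)
      also have "\<dots> = d / 2" using np by (simp add: s_def)
      finally show ?thesis using d by simp
    qed
    have near': "dist (x + \<sigma> *\<^sub>R k + \<rho> *\<^sub>R h) x < d" if "\<rho> \<in> {0..s}" "\<sigma> \<in> {0..s}" for \<rho> \<sigma>
      using near[OF that] by (simp add: algebra_simps)
    have in_S: "y \<in> S" if "dist y x < d" for y
      using that d3 by (auto simp: d_def dist_commute)
    obtain \<rho> \<sigma> where 1: "\<rho> \<in> {0<..<s}" "\<sigma> \<in> {0<..<s}"
      "f (x + s *\<^sub>R h + s *\<^sub>R k) - f (x + s *\<^sub>R h) - f (x + s *\<^sub>R k) + f x = s * s * ?A (x + \<rho> *\<^sub>R h + \<sigma> *\<^sub>R k)"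
      using mixed[of s h k, OF s in_S[OF near]] by blast
    obtain \<sigma>' \<rho>' where 2: "\<rho>' \<in> {0<..<s}" "\<sigma>' \<in> {0<..<s}"
      "f (x + s *\<^sub>R k + s *\<^sub>R h) - f (x + s *\<^sub>R k) - f (x + s *\<^sub>R h) + f x = s * s * ?B (x + \<sigma>' *\<^sub>R k + \<rho>' *\<^sub>R h)"
      using mixed[of s k h, OF s in_S[OF near']] by blast
    have "x + s *\<^sub>R k + s *\<^sub>R h = x + s *\<^sub>R h + s *\<^sub>R k" by simp
    then have "s * s * ?A (x + \<rho> *\<^sub>R h + \<sigma> *\<^sub>R k) = s * s * ?B (x + \<sigma>' *\<^sub>R k + \<rho>' *\<^sub>R h)"
      using 1(3) 2(3) by (smt (verit, best))
    then have eq: "?A (x + \<rho> *\<^sub>R h + \<sigma> *\<^sub>R k) = ?B (x + \<sigma>' *\<^sub>R k + \<rho>' *\<^sub>R h)"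
      using s by simp
    have "dist (?A (x + \<rho> *\<^sub>R h + \<sigma> *\<^sub>R k)) (?A x) < e / 2"
      using d1(2)[of "x + \<rho> *\<^sub>R h + \<sigma> *\<^sub>R k"] near[of \<rho> \<sigma>] 1 by (simp add: d_def)
    moreover have "dist (?B (x + \<sigma>' *\<^sub>R k + \<rho>' *\<^sub>R h)) (?B x) < e / 2"
      using d2(2)[of "x + \<sigma>' *\<^sub>R k + \<rho>' *\<^sub>R h"] near'[of \<rho>' \<sigma>'] 2 by (simp add: d_def)
    ultimately have "dist (?A x) (?B x) < e / 2 + e / 2"
      using eq by (metis dist_commute dist_triangle_half_l field_sum_of_halves)
    then show ?thesis by simp
  qed
  then show ?thesis
    by (metis field_le_epsilon dist_le_zero_iff)
qed

lemma dd_bounded_linear_compose: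
  assumes "bounded_linear L" "f differentiable (at x)"
  shows "dd (\<lambda>x. L (f x)) x = (\<lambda>h. L (dd f x h))"
  using bounded_linear.has_derivative[OF assms(1) has_derivative_dd[OF assms(2)]] by (rule dd_eqI)

lemma dd_dd_symmetric:
  fixes f :: "'a::euclidean_space \<Rightarrow> 'b::euclidean_space"
  assumes S: "open S" and f: "Ck_on 2 f S" and x: "x \<in> S"
  shows "dd (\<lambda>y. dd f y h) x k = dd (\<lambda>y. dd f y k) x h"
proof (rule euclidean_eqI)
  fix b :: 'b assume "b \<in> Basis"
  have bl: "bounded_linear (\<lambda>y::'b. y \<bullet> b)" by (rule bounded_linear_inner_left)
  have eq: "dd (\<lambda>y. dd f y h) x k \<bullet> b = dd (\<lambda>y. dd (\<lambda>y. f y \<bullet> b) y h) x k" for h k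
  proof -
    have "dd (\<lambda>y. dd (\<lambda>y. f y \<bullet> b) y h) x = dd (\<lambda>y. dd f y h \<bullet> b) x"
      by (rule dd_transform[OF S x])
        (use f in \<open>simp add: dd_bounded_linear_compose[OF bl] numeral_2_eq_2\<close>)
    also have "\<dots> = (\<lambda>k. dd (\<lambda>y. dd f y h) x k \<bullet> b)"
      by (rule dd_bounded_linear_compose[OF bl]) (use f x in \<open>auto simp: numeral_2_eq_2\<close>)
    finally show ?thesis by simp
  qed
  have "Ck_on 2 (\<lambda>y. f y \<bullet> b) S"
    by (rule Ck_on_bounded_linear[OF bl S f])
  from dd_dd_symmetric_real[OF S this x, of h k]
  show "dd (\<lambda>y. dd f y h) x k \<bullet> b = dd (\<lambda>y. dd f y k) x h \<bullet> b"
    unfolding eq .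
qed

section \<open>Matrices and tensors\<close>

lemma tensor_vec: "tensor a b *v c = (b \<bullet> c) *\<^sub>R a"
  by (simp add: vec_eq_iff tensor_def matrix_vector_mult_def inner_vec_def sum_distrib_left mult_ac)

lemma matrix_mul_tensor: "A ** tensor a b = tensor (A *v a) b"
  by (simp add: vec_eq_iff tensor_def matrix_matrix_mult_def matrix_vector_mult_def sum_distrib_left mult_ac)

lemma tensor_mul_matrix: "tensor a b ** A = tensor a (transpose A *v b)"
  by (vector tensor_def matrix_matrix_mult_def matrix_vector_mult_def transpose_def
      sum_distrib_left mult_ac)

lemma transpose_tensor: "transpose (tensor a b) = tensor b a"
  by (vector tensor_def transpose_def mult_ac)

lemma trace_tensor: "trace (tensor a b) = a \<bullet> b"
  by (simp add: trace_def tensor_def inner_vec_def)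

lemma matrix_eqI: "(\<And>h. A *v h = B *v h) \<Longrightarrow> A = B"
  for A B :: "real^'n^'m"
  by (simp add: matrix_eq)

lemma inner_matrix_vec: "x \<bullet> (A *v y) = (transpose A *v x) \<bullet> y"
  for A :: "real^'n^'m"
  by (simp add: dot_lmul_matrix transpose_matrix_vector)

lemma bounded_bilinear_tensor: "bounded_bilinear (tensor :: real^'n \<Rightarrow> real^'n \<Rightarrow> real^'n^'n)"
  unfolding bilinear_conv_bounded_bilinear[symmetric] bilinear_def
  by (auto intro!: linearI; vector tensor_def algebra_simps)

lemma bounded_bilinear_matrix_mul:
  "bounded_bilinear ((**) :: real^'n^'n \<Rightarrow> real^'n^'n \<Rightarrow> real^'n^'n)"
  unfolding bilinear_conv_bounded_bilinear[symmetric] bilinear_def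
  by (auto intro!: linearI;
      simp add: matrix_matrix_mult_def vec_eq_iff sum.distrib algebra_simps sum_distrib_left)

lemma bounded_bilinear_matrix_vec:
  "bounded_bilinear ((*v) :: real^'n^'n \<Rightarrow> real^'n \<Rightarrow> real^'n)"
  unfolding bilinear_conv_bounded_bilinear[symmetric] bilinear_def
  by (auto intro!: linearI;
      simp add: matrix_vector_mult_def vec_eq_iff sum.distrib algebra_simps sum_distrib_left)

lemma bounded_linear_transpose: "bounded_linear (transpose :: real^'n^'n \<Rightarrow> real^'n^'n)"
  by (intro linear_conv_bounded_linear[THEN iffD1] linearI) (simp_all add: transpose_def vec_eq_iff)

lemma bounded_linear_trace: "bounded_linear (trace :: real^'n^'n \<Rightarrow> real)"
  by (intro linear_conv_bounded_linear[THEN iffD1] linearI)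
    (simp_all add: trace_def sum.distrib sum_distrib_left)

text \<open>For a unit vector this is the orthogonal projection onto its complement. The formula is
  kept for arbitrary vectors, so that it can be differentiated along a moving normal.\<close>

definition tproj :: "real^'n \<Rightarrow> real^'n^'n" where
  "tproj \<nu> = mat 1 - tensor \<nu> \<nu>"

lemma tproj_vec: "tproj \<nu> *v h = h - (\<nu> \<bullet> h) *\<^sub>R \<nu>"
  by (simp add: tproj_def matrix_vector_mult_diff_rdistrib tensor_vec)

lemma transpose_tproj: "transpose (tproj \<nu>) = tproj \<nu>"
proof -
  interpret bounded_linear "transpose :: real^'a^'a \<Rightarrow> real^'a^'a" by (rule bounded_linear_transpose)
  show ?thesis by (simp add: tproj_def diff transpose_tensor transpose_mat)
qed

lemma tproj_orthogonal: "norm \<nu> = 1 \<Longrightarrow> \<nu> \<bullet> (tproj \<nu> *v h) = 0"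
  by (simp add: tproj_vec inner_diff_right dot_square_norm)

lemma tproj_normal: "norm \<nu> = 1 \<Longrightarrow> tproj \<nu> *v \<nu> = 0"
  by (simp add: tproj_vec dot_square_norm)

lemma tproj_tangent: "\<nu> \<bullet> h = 0 \<Longrightarrow> tproj \<nu> *v h = h"
  by (simp add: tproj_vec)

lemma inner_tproj: "(tproj \<nu> *v a) \<bullet> b = a \<bullet> (tproj \<nu> *v b)"
  by (simp add: inner_matrix_vec transpose_tproj)

section \<open>Gradients and Jacobians\<close>

lemma dd_gradient:
  assumes "F differentiable (at x)"
  shows "dd F x h = gradient F x \<bullet> h"
proof -
  interpret linear "dd F x" using dd_linear[OF assms] .
  have "dd F x h = dd F x (\<Sum>i\<in>UNIV. (h $ i) *\<^sub>R axis i 1)"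
    using basis_expansion[of h] by (simp add: scalar_mult_eq_scaleR)
  also have "\<dots> = gradient F x \<bullet> h"
    by (simp add: sum scaleR gradient_def inner_vec_def mult.commute)
  finally show ?thesis .
qed

lemma dd_jacobian: "W differentiable (at x) \<Longrightarrow> dd W x h = jacobian_matrix W x *v h"
  by (simp add: jacobian_matrix_def matrix_works dd_linear)

lemma gradientI: "(F has_derivative (\<lambda>h. g \<bullet> h)) (at x) \<Longrightarrow> gradient F x = g"
  by (metis dd_eqI dd_gradient differentiableI vector_eq_rdot inner_commute)

lemma jacobianI: "(W has_derivative (\<lambda>h. A *v h)) (at x) \<Longrightarrow> jacobian_matrix W x = A"
  by (metis dd_eqI dd_jacobian differentiableI matrix_eqI)

lemma Ck_on_gradient:
  assumes "open U" "Ck_on (Suc k) F U"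
  shows "Ck_on k (gradient F) U"
proof -
  have "gradient F = (\<lambda>x. \<Sum>i\<in>UNIV. dd F x (axis i 1) *\<^sub>R axis i 1)"
    using basis_expansion[of "gradient F _"] by (auto simp: scalar_mult_eq_scaleR gradient_def)
  then show ?thesis
    using assms by (auto intro!: Ck_on_sum Ck_on_scaleR Ck_on_const)
qed

lemma Ck_on_jacobian:
  fixes W :: "real^'n \<Rightarrow> real^'n"
  assumes "open U" "Ck_on (Suc k) W U"
  shows "Ck_on k (jacobian_matrix W) U"
proof -
  have "jacobian_matrix W = (\<lambda>x. \<Sum>i\<in>UNIV. tensor (dd W x (axis i 1)) (axis i 1))"
    by (rule ext)
      (simp add: jacobian_matrix_def matrix_def tensor_def vec_eq_iff axis_def if_distrib cong: if_cong)
  then show ?thesis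
    using assms by (auto intro!: Ck_on_sum Ck_on_bilinear[OF bounded_bilinear_tensor] Ck_on_const)
qed

section \<open>Boundaries of class \<open>C\<^sup>1\<close>\<close>

lemma defining_function_mono:
  "defining_function k \<Omega> U \<phi> \<Longrightarrow> j \<le> k \<Longrightarrow> defining_function j \<Omega> U \<phi>"
  unfolding defining_function_def using Ck_on_mono by blast

lemma Ck_domain_mono: "Ck_domain k \<Omega> \<Longrightarrow> j \<le> k \<Longrightarrow> Ck_domain j \<Omega>"
  unfolding Ck_domain_def using defining_function_mono by meson

section \<open>Level sets, their two sides and the domain they bound\<close>

lemma line_derivative:
  assumes "f differentiable (at (p + s *\<^sub>R h))"
  shows "((\<lambda>t. f (p + t *\<^sub>R h)) has_real_derivative dd f (p + s *\<^sub>R h) h) (at s)"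
proof -
  interpret linear "dd f (p + s *\<^sub>R h)" using dd_linear[OF assms] .
  have "((\<lambda>t. f (p + t *\<^sub>R h)) has_derivative (\<lambda>t. dd f (p + s *\<^sub>R h) (t *\<^sub>R h))) (at s)"
    by (rule has_derivative_compose[where f="\<lambda>t. p + t *\<^sub>R h" and g=f, OF _ has_derivative_dd[OF assms]])
      (auto intro!: derivative_eq_intros)
  then show ?thesis
    by (simp add: has_field_derivative_def scaleR mult_commute_abs)
qed

lemma negative_direction:
  assumes "f differentiable (at p)" "f p = 0" "dd f p h < 0"
  shows "\<forall>\<^sub>F t in at_right 0. f (p + t *\<^sub>R h) < (0::real)"
proof -
  have "((\<lambda>t. f (p + t *\<^sub>R h)) has_real_derivative dd f p h) (at 0)"
    using line_derivative[of f p 0 h] assms by simp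
  from DERIV_neg_dec_right[OF this assms(3)] obtain d where
    "d > 0" "\<forall>t>0. t < d \<longrightarrow> f (p + t *\<^sub>R h) < 0"
    using assms(2) by auto
  then show ?thesis
    by (auto simp: eventually_at_right[of 0 1])
qed

lemma positive_direction:
  assumes "f differentiable (at p)" "f p = 0" "dd f p h > 0"
  shows "\<forall>\<^sub>F t in at_right 0. f (p + t *\<^sub>R h) > (0::real)"
proof -
  have "((\<lambda>t. f (p + t *\<^sub>R h)) has_real_derivative dd f p h) (at 0)"
    using line_derivative[of f p 0 h] assms by simp
  from DERIV_pos_inc_right[OF this assms(3)] obtain d where
    "d > 0" "\<forall>t>0. t < d \<longrightarrow> f (p + t *\<^sub>R h) > 0"
    using assms(2) by auto
  then show ?thesis
    by (auto simp: eventually_at_right[of 0 1])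
qed

lemma line_eventually_in:
  assumes "open U" "(p::'a::real_normed_vector) \<in> U"
  shows "\<forall>\<^sub>F t in at_right 0. p + t *\<^sub>R h \<in> U"
proof -
  have "((\<lambda>t::real. p + t *\<^sub>R h) \<longlongrightarrow> p + 0 *\<^sub>R h) (at_right 0)"
    by (intro tendsto_intros)
  then show ?thesis using assms by (auto intro: topological_tendstoD)
qed

text \<open>A direction in which \<open>\<phi>\<close> decreases leads from \<open>p\<close> into
  the domain, so \<open>\<psi>\<close> cannot increase in it. An open half space is thus contained
  in the closed half space of the other gradient, which forces the gradients to be positive
  multiples of each other.\<close>

lemma gradients_parallel:
  assumes "defining_function 1 \<Omega> U \<phi>" "defining_function 1 \<Omega> V \<psi>"
    and "p \<in> U" "p \<in> V" "p \<in> frontier \<Omega>"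
  shows "\<exists>c>0. gradient \<psi> p = c *\<^sub>R gradient \<phi> p"
proof -
  define a b where "a = gradient \<phi> p" and "b = gradient \<psi> p"
  have nz: "a \<noteq> 0" "b \<noteq> 0"
    using assms by (auto simp: a_def b_def defining_function_def)
  have diff: "\<phi> differentiable (at p)" "\<psi> differentiable (at p)"
    using assms by (auto simp: defining_function_def intro: Ck_on_differentiable)
  have zero: "\<phi> p = 0" "\<psi> p = 0"
    using assms by (auto simp: defining_function_def)
  have half: "b \<bullet> h \<le> 0" if "a \<bullet> h < 0" for h
  proof (rule ccontr)
    assume "\<not> b \<bullet> h \<le> 0"
    then have "\<forall>\<^sub>F t in at_right 0. \<psi> (p + t *\<^sub>R h) > 0"
      using diff zero by (intro positive_direction) (auto simp: dd_gradient b_def)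
    moreover have "\<forall>\<^sub>F t in at_right 0. \<phi> (p + t *\<^sub>R h) < 0"
      using diff zero that by (intro negative_direction) (auto simp: dd_gradient a_def)
    moreover have "\<forall>\<^sub>F t in at_right 0. p + t *\<^sub>R h \<in> U \<inter> V"
      using assms by (intro line_eventually_in) (auto simp: defining_function_def)
    ultimately have "\<forall>\<^sub>F t::real in at_right 0. False"
    proof eventually_elim
      case (elim t)
      then have "p + t *\<^sub>R h \<in> \<Omega>" using assms(1) by (auto simp: defining_function_def)
      moreover have "\<Omega> \<inter> V = {x\<in>V. \<psi> x < 0}" using assms(2) by (simp add: defining_function_def)
      ultimately have "\<psi> (p + t *\<^sub>R h) < 0" using elim by blast
      then show ?case using elim by simp
    qed
    then show False by simp
  qed
  \<comment> \<open>\<open>c *\<^sub>R a\<close> is the part of \<open>b\<close> along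
    \<open>a\<close>, and the rest \<open>r\<close> is orthogonal to \<open>a\<close>. Testing the
    half space inclusion with \<open>r - e *\<^sub>R a\<close> bounds \<open>r \<bullet> r\<close>
    by \<open>e * (a \<bullet> b)\<close> for every positive \<open>e\<close>.\<close>
  define c where "c = (a \<bullet> b) / (a \<bullet> a)"
  define r where "r = b - c *\<^sub>R a"
  have ar: "a \<bullet> r = 0"
    using nz by (simp add: r_def c_def inner_diff_right)
  have br: "b \<bullet> r = r \<bullet> r"
    using ar by (simp add: r_def inner_diff_left inner_diff_right inner_commute)
  have le: "r \<bullet> r \<le> e * (a \<bullet> b)" if "e > 0" for e
    using half[of "r - e *\<^sub>R a"] that nz ar br
    by (simp add: inner_diff_right inner_commute)
  have ab: "a \<bullet> b \<ge> 0"
    using half[of "- a"] nz by (simp add: inner_commute)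
  have "r \<bullet> r \<le> 0 + e" if "e > 0" for e
  proof -
    have "r \<bullet> r \<le> (e / (a \<bullet> b + 1)) * (a \<bullet> b)"
      using le[of "e / (a \<bullet> b + 1)"] that ab by simp
    also have "\<dots> \<le> (e / (a \<bullet> b + 1)) * (a \<bullet> b + 1)"
      using that ab by (intro mult_left_mono) auto
    also have "\<dots> = e" using ab by (simp add: add_nonneg_eq_0_iff)
    finally show ?thesis by simp
  qed
  then have "r = 0"
    by (metis field_le_epsilon inner_ge_zero inner_eq_zero_iff order_antisym)
  then have bca: "b = c *\<^sub>R a" by (simp add: r_def)
  then have "c \<noteq> 0" using nz by auto
  moreover have "c \<ge> 0" using ab by (simp add: c_def)
  ultimately show ?thesis using bca by (auto simp: a_def b_def intro!: exI[of _ c])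
qed

text \<open>
  By the intermediate value theorem \<open>\<phi>\<close> has zeros close to \<open>p\<close> in directions arbitrarily close to \<open>\<tau>\<close>.
\<close>

lemma tangential_derivative_zero:
  fixes \<phi> :: "'a::euclidean_space \<Rightarrow> real" and f :: "'a \<Rightarrow> 'b::real_normed_vector"
  assumes U: "open U" "p \<in> U" and \<phi>: "Ck_on 1 \<phi> U" "\<phi> p = 0" "dd \<phi> p \<tau> = 0" "dd \<phi> p \<nu> > 0"
    and f: "f differentiable (at p)" "\<And>x. x \<in> U \<Longrightarrow> \<phi> x = 0 \<Longrightarrow> f x = 0"
  shows "dd f p \<tau> = 0"
proof -
  have d\<phi>: "\<phi> differentiable (at p)" using \<phi> U by (auto intro: Ck_on_differentiable)
  interpret \<phi>: linear "dd \<phi> p" using dd_linear[OF d\<phi>] .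
  interpret f: linear "dd f p" using dd_linear[OF f(1)] .
  define K where "K = norm (dd f p \<nu>) + norm \<tau> + norm \<nu>"
  have K0: "K \<ge> 0" by (simp add: K_def)
  \<comment> \<open>The zero found lies in a direction
    \<open>\<tau> + \<eta> *\<^sub>R \<nu>\<close> with \<open>\<bar>\<eta>\<bar> \<le> e\<close>.
    Replacing it by \<open>\<tau>\<close> costs \<open>e\<close> times the norm of
    \<open>dd f p \<nu>\<close>, and differentiability of \<open>f\<close> costs \<open>e\<close>
    times the norm of the direction; \<open>K\<close> adds these constants.\<close>
  have bound: "norm (dd f p \<tau>) \<le> e * K" if e: "0 < e" "e \<le> 1" for e
  proof -
    have "\<forall>\<^sub>F t in at_right 0. \<phi> (p + t *\<^sub>R (\<tau> + e *\<^sub>R \<nu>)) > 0"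
      using \<phi> e by (intro positive_direction d\<phi>) (auto simp: \<phi>.add \<phi>.scaleR)
    moreover have "\<forall>\<^sub>F t in at_right 0. \<phi> (p + t *\<^sub>R (\<tau> - e *\<^sub>R \<nu>)) < 0"
      using \<phi> e by (intro negative_direction d\<phi>) (auto simp: \<phi>.diff \<phi>.scaleR)
    moreover obtain r where r: "r > 0" "ball p r \<subseteq> U"
      using U openE by blast
    obtain d where d: "d > 0" "\<And>y. norm (y - p) < d \<Longrightarrow> norm (f y - f p - dd f p (y - p)) \<le> e * norm (y - p)"
      using has_derivative_dd[OF f(1)] e(1) unfolding has_derivative_at_alt by blast
    define m where "m = min r d"
    define M where "M = norm \<tau> + norm \<nu> + 1"
    have M: "M > 0" unfolding M_def by (smt (verit) norm_ge_zero)
    have m: "m > 0" using r d by (simp add: m_def)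
    have "\<forall>\<^sub>F t in at_right 0. t \<in> {0<..<m / M}"
      using m M by (intro eventually_at_right_real) auto
    ultimately have "\<forall>\<^sub>F t::real in at_right 0. norm (dd f p \<tau>) \<le> e * K"
    proof eventually_elim
      case (elim t)
      have near: "norm (t *\<^sub>R (\<tau> + \<eta> *\<^sub>R \<nu>)) < m" if "\<bar>\<eta>\<bar> \<le> e" for \<eta>
      proof -
        have "norm (\<tau> + \<eta> *\<^sub>R \<nu>) \<le> norm \<tau> + \<bar>\<eta>\<bar> * norm \<nu>"
          using norm_triangle_ineq[of \<tau> "\<eta> *\<^sub>R \<nu>"] by simp
        also have "\<dots> \<le> norm \<tau> + 1 * norm \<nu>"
          using that e by (intro add_left_mono mult_right_mono) auto
        also have "\<dots> < M" by (simp add: M_def)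
        finally have "t * norm (\<tau> + \<eta> *\<^sub>R \<nu>) < t * M" using elim by simp
        also have "\<dots> < m" using elim M by (auto simp: field_simps)
        finally show ?thesis using elim by simp
      qed
      have "continuous_on {-e..e} (\<lambda>\<eta>. \<phi> (p + t *\<^sub>R (\<tau> + \<eta> *\<^sub>R \<nu>)))"
      proof (rule continuous_on_compose2[OF Ck_on_continuous[OF \<phi>(1)]])
        show "(\<lambda>\<eta>. p + t *\<^sub>R (\<tau> + \<eta> *\<^sub>R \<nu>)) ` {-e..e} \<subseteq> U"
          using near r by (auto simp: m_def dist_norm abs_le_iff intro!: subsetD[OF r(2)])
      qed (intro continuous_intros)
      moreover have "\<phi> (p + t *\<^sub>R (\<tau> + (-e) *\<^sub>R \<nu>)) \<le> 0" "0 \<le> \<phi> (p + t *\<^sub>R (\<tau> + e *\<^sub>R \<nu>))"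
        using elim by auto
      ultimately obtain \<eta> where \<eta>: "-e \<le> \<eta>" "\<eta> \<le> e" "\<phi> (p + t *\<^sub>R (\<tau> + \<eta> *\<^sub>R \<nu>)) = 0"
        using IVT'[of "\<lambda>\<eta>. \<phi> (p + t *\<^sub>R (\<tau> + \<eta> *\<^sub>R \<nu>))" "-e" 0 e] e by auto
      then have ab: "\<bar>\<eta>\<bar> \<le> e" by simp
      let ?k = "t *\<^sub>R (\<tau> + \<eta> *\<^sub>R \<nu>)"
      have "p + ?k \<in> U" using near[OF ab] r by (auto simp: m_def dist_norm intro!: subsetD[OF r(2)])
      then have "f (p + ?k) = 0" using f(2) \<eta> by blast
      moreover have "f p = 0" using f(2) U \<phi> by blast
      ultimately have "norm (dd f p ?k) \<le> e * norm ?k"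
        using d(2)[of "p + ?k"] near[OF ab] by (simp add: m_def)
      then have "t * norm (dd f p (\<tau> + \<eta> *\<^sub>R \<nu>)) \<le> t * (e * norm (\<tau> + \<eta> *\<^sub>R \<nu>))"
        using elim by (simp add: f.scaleR mult_ac)
      then have 1: "norm (dd f p \<tau> + \<eta> *\<^sub>R dd f p \<nu>) \<le> e * norm (\<tau> + \<eta> *\<^sub>R \<nu>)"
        using elim by (simp add: f.add f.scaleR)
      have "norm (dd f p \<tau>) \<le> norm (dd f p \<tau> + \<eta> *\<^sub>R dd f p \<nu>) + norm (\<eta> *\<^sub>R dd f p \<nu>)"
        by (metis add_diff_cancel_right' norm_triangle_ineq4)
      also have "\<dots> \<le> e * (norm \<tau> + norm \<nu>) + e * norm (dd f p \<nu>)"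
      proof (rule add_mono)
        have "norm (\<tau> + \<eta> *\<^sub>R \<nu>) \<le> norm \<tau> + \<bar>\<eta>\<bar> * norm \<nu>"
          using norm_triangle_ineq[of \<tau> "\<eta> *\<^sub>R \<nu>"] by simp
        also have "\<dots> \<le> norm \<tau> + 1 * norm \<nu>"
          using ab e by (intro add_left_mono mult_right_mono) auto
        finally show "norm (dd f p \<tau> + \<eta> *\<^sub>R dd f p \<nu>) \<le> e * (norm \<tau> + norm \<nu>)"
          using 1 e by (smt (verit) mult_left_mono)
        show "norm (\<eta> *\<^sub>R dd f p \<nu>) \<le> e * norm (dd f p \<nu>)"
          using ab by (auto intro: mult_right_mono)
      qed
      also have "\<dots> = e * K" by (simp add: K_def algebra_simps)
      finally show ?case .
    qed
    then show ?thesis by simp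
  qed
  have "norm (dd f p \<tau>) \<le> 0 + e" if e: "e > 0" for e
  proof -
    let ?e = "min 1 (e / (K + 1))"
    have "norm (dd f p \<tau>) \<le> ?e * K" using e K0 by (intro bound) auto
    also have "\<dots> \<le> e / (K + 1) * (K + 1)" using e K0 by (intro mult_mono) auto
    also have "\<dots> = e" using K0 by simp
    finally show ?thesis by simp
  qed
  then show ?thesis by (metis field_le_epsilon norm_le_zero_iff)
qed

text \<open>
  The connecting set is a segment in the direction \<open>- gradient \<phi> p\<close> followed by a small ball around \<open>q\<close>.
\<close>

lemma one_sided_component:
  fixes \<phi> :: "real^'n \<Rightarrow> real"
  assumes U: "open U" "p \<in> U" and \<phi>: "Ck_on 1 \<phi> U" "\<phi> p = 0" "gradient \<phi> p \<noteq> 0"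
  obtains W q where "open W" "p \<in> W" "W \<subseteq> U"
    "\<And>x. x \<in> W \<Longrightarrow> \<phi> x < 0 \<Longrightarrow> connected_component {y\<in>U. \<phi> y < 0} x q"
proof -
  define \<nu> where "\<nu> = gradient \<phi> p"
  have \<nu>: "\<nu> \<noteq> 0" using \<phi> by (simp add: \<nu>_def)
  have d\<phi>: "\<phi> differentiable (at x)" if "x \<in> U" for x
    using \<phi> that by (auto intro: Ck_on_differentiable)
  have "isCont (\<lambda>x. dd \<phi> x \<nu>) p"
    using \<phi>(1) U by (simp add: continuous_on_eq_continuous_at)
  moreover have "dd \<phi> p \<nu> > 0"
    using \<nu> by (simp add: dd_gradient[OF d\<phi>[OF U(2)]] flip: \<nu>_def)
  ultimately have "\<forall>\<^sub>F x in nhds p. dd \<phi> x \<nu> > 0"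
    unfolding isCont_def using order_tendstoD(1) by (metis tendsto_at_iff_tendsto_nhds)
  moreover have "\<forall>\<^sub>F x in nhds p. x \<in> U"
    using U by (simp add: eventually_nhds_in_open)
  ultimately have "\<forall>\<^sub>F x in nhds p. x \<in> U \<and> dd \<phi> x \<nu> > 0"
    by (rule eventually_conj[rotated])
  then obtain r where r: "r > 0" "\<And>x. x \<in> ball p r \<Longrightarrow> x \<in> U" "\<And>x. x \<in> ball p r \<Longrightarrow> dd \<phi> x \<nu> > 0"
    by (auto simp: eventually_nhds_metric dist_commute)
  have "\<forall>\<^sub>F s in at_right 0. \<phi> (p + s *\<^sub>R (- \<nu>)) < 0"
  proof (rule negative_direction[OF d\<phi>[OF U(2)] \<phi>(2)])
    interpret linear "dd \<phi> p" using dd_linear[OF d\<phi>[OF U(2)]] .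
    show "dd \<phi> p (- \<nu>) < 0" using \<open>dd \<phi> p \<nu> > 0\<close> by (simp add: neg)
  qed
  moreover have "\<forall>\<^sub>F s in at_right 0. p + s *\<^sub>R (- \<nu>) \<in> ball p (r / 2)"
    using r by (intro line_eventually_in) auto
  moreover have "\<forall>\<^sub>F s::real in at_right 0. s > 0"
    by (simp add: eventually_at_right_less)
  ultimately have "\<forall>\<^sub>F s in at_right 0. s > 0 \<and> \<phi> (p - s *\<^sub>R \<nu>) < 0 \<and> p - s *\<^sub>R \<nu> \<in> ball p (r / 2)"
    by eventually_elim auto
  then obtain \<sigma> where \<sigma>: "\<sigma> > 0" "\<phi> (p - \<sigma> *\<^sub>R \<nu>) < 0" "p - \<sigma> *\<^sub>R \<nu> \<in> ball p (r / 2)"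
    using eventually_happens trivial_limit_at_right_real by (metis (no_types, lifting))
  define q where "q = p - \<sigma> *\<^sub>R \<nu>"
  have "q \<in> U" using \<sigma> r by (auto simp: q_def)
  then have "isCont \<phi> q" using Ck_on_isCont \<phi> U by blast
  then have "\<forall>\<^sub>F x in nhds q. \<phi> x < 0"
    using \<sigma>(2) order_tendstoD(2) unfolding isCont_def q_def
    by (metis tendsto_at_iff_tendsto_nhds)
  then obtain \<rho>0 where \<rho>0: "\<rho>0 > 0" "\<And>x. x \<in> ball q \<rho>0 \<Longrightarrow> \<phi> x < 0"
    by (auto simp: eventually_nhds_metric dist_commute)
  \<comment> \<open>The bound \<open>r / 2\<close> leaves room for a shift of length below
    \<open>r / 2\<close>, so segments starting in \<open>ball p \<rho>\<close> stay where
    \<open>\<phi>\<close> is monotone along \<open>\<nu>\<close>; the bound \<open>\<rho>0\<close>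
    keeps the ball around \<open>q\<close> on the negative side.\<close>
  define \<rho> where "\<rho> = min \<rho>0 (r / 2)"
  have \<rho>: "\<rho> > 0" "\<rho> \<le> r / 2" "\<And>x. x \<in> ball q \<rho> \<Longrightarrow> \<phi> x < 0"
    using \<rho>0 r by (auto simp: \<rho>_def)
  have inr: "x - s *\<^sub>R \<nu> \<in> ball p r" if "x \<in> ball p \<rho>" "0 \<le> s" "s \<le> \<sigma>" for x s
  proof -
    have "norm (p - (x - s *\<^sub>R \<nu>)) \<le> norm (p - x) + norm (s *\<^sub>R \<nu>)"
      by (metis diff_diff_eq2 norm_triangle_ineq add_diff_eq diff_add_eq)
    also have "norm (s *\<^sub>R \<nu>) \<le> \<sigma> * norm \<nu>" using that by (auto intro: mult_right_mono)
    also have "\<sigma> * norm \<nu> < r / 2" using \<sigma> by (auto simp: dist_norm)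
    also have "norm (p - x) < r / 2" using that \<rho> by (auto simp: dist_norm)
    finally show ?thesis by (simp add: dist_norm)
  qed
  show ?thesis
  proof (rule that[of "ball p \<rho>" q])
    show "ball p \<rho> \<subseteq> U" using r \<rho> by fastforce
    fix x assume x: "x \<in> ball p \<rho>" "\<phi> x < 0"
    have dec: "\<phi> (x - s *\<^sub>R \<nu>) \<le> \<phi> x" if s: "0 \<le> s" "s \<le> \<sigma>" for s
    proof -
      have "\<phi> (x + s *\<^sub>R (- \<nu>)) \<le> \<phi> (x + 0 *\<^sub>R (- \<nu>))"
      proof (rule DERIV_nonpos_imp_nonincreasing[OF s(1)])
        fix u assume u: "0 \<le> u" "u \<le> s"
        then have in_ball: "x + u *\<^sub>R (- \<nu>) \<in> ball p r" using inr[OF x(1), of u] s by simp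
        interpret linear "dd \<phi> (x + u *\<^sub>R (- \<nu>))"
          using dd_linear[OF d\<phi>[OF r(2)[OF in_ball]]] .
        have "dd \<phi> (x + u *\<^sub>R (- \<nu>)) (- \<nu>) \<le> 0"
          using r(3)[OF in_ball] by (simp only: neg)
        then show "\<exists>y. ((\<lambda>u. \<phi> (x + u *\<^sub>R (- \<nu>))) has_real_derivative y) (at u) \<and> y \<le> 0"
          using line_derivative[OF d\<phi>[OF r(2)[OF in_ball]]] by blast
      qed
      then show ?thesis by simp
    qed
    have seg: "\<exists>s\<ge>0. s \<le> \<sigma> \<and> y = x - s *\<^sub>R \<nu>" if y: "y \<in> closed_segment x (x - \<sigma> *\<^sub>R \<nu>)" for y
    proof -
      obtain u where "0 \<le> u" "u \<le> 1" "y = (1 - u) *\<^sub>R x + u *\<^sub>R (x - \<sigma> *\<^sub>R \<nu>)"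
        using y by (auto simp: in_segment)
      then show ?thesis
        using \<sigma>(1) by (intro exI[of _ "u * \<sigma>"]) (auto simp: algebra_simps mult_left_le_one_le)
    qed
    let ?C = "closed_segment x (x - \<sigma> *\<^sub>R \<nu>) \<union> ball q \<rho>"
    have end_in: "x - \<sigma> *\<^sub>R \<nu> \<in> ball q \<rho>"
      using x by (simp add: q_def dist_norm)
    have "connected ?C"
      using end_in by (intro connected_Un) auto
    moreover have "closed_segment x (x - \<sigma> *\<^sub>R \<nu>) \<subseteq> {y\<in>U. \<phi> y < 0}"
      using seg dec inr[OF x(1)] r(2) x(2) by (smt (verit, best) mem_Collect_eq subsetI)
    moreover have "ball q \<rho> \<subseteq> {y\<in>U. \<phi> y < 0}"
    proof
      fix y assume y: "y \<in> ball q \<rho>"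
      have "dist p y \<le> dist p q + dist q y" by (rule dist_triangle)
      also have "\<dots> < r" using \<sigma>(3) y \<rho> by (simp add: q_def)
      finally show "y \<in> {y\<in>U. \<phi> y < 0}" using r(2) \<rho>(3)[OF y] by simp
    qed
    ultimately show "connected_component {y\<in>U. \<phi> y < 0} x q"
      unfolding connected_component_def using \<rho> by (intro exI[of _ ?C]) auto
  qed (use \<rho> in auto)
qed

text \<open>Near \<open>p\<close> each side of the first level function lies in one component off
  \<Gamma> (apply the preceding lemma to \<open>\<phi>\<close> and to its negative), and a connected
  set that misses the frontier of \<open>\<Omega>2\<close> is inside or outside
  \<open>\<Omega>2\<close>. So membership in \<open>\<Omega>2\<close> is decided by the two points
  \<open>q\<close> and \<open>q'\<close>, exactly one of which belongs to it.\<close>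

lemma locally_same_or_opposite_side:
  fixes \<Omega>1 \<Omega>2 :: "(real^'n) set"
  assumes "Ck_domain 1 \<Omega>1" "Ck_domain 1 \<Omega>2" "frontier \<Omega>1 = \<Gamma>" "frontier \<Omega>2 = \<Gamma>" "p \<in> \<Gamma>"
  shows "\<exists>W. open W \<and> p \<in> W \<and>
    ((\<forall>x\<in>W-\<Gamma>. x \<in> \<Omega>1 \<longleftrightarrow> x \<in> \<Omega>2) \<or> (\<forall>x\<in>W-\<Gamma>. x \<in> \<Omega>1 \<longleftrightarrow> x \<notin> \<Omega>2))"
proof -
  obtain U \<phi> where U: "p \<in> U" and \<phi>: "defining_function 1 \<Omega>1 U \<phi>"
    using assms by (auto simp: Ck_domain_def)
  obtain U' \<psi> where U': "p \<in> U'" and \<psi>: "defining_function 1 \<Omega>2 U' \<psi>"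
    using assms by (auto simp: Ck_domain_def)
  have \<phi>': "open U" "Ck_on 1 \<phi> U" "gradient \<phi> p \<noteq> 0"
    "\<Omega>1 \<inter> U = {x\<in>U. \<phi> x < 0}" "\<Gamma> \<inter> U = {x\<in>U. \<phi> x = 0}"
    using \<phi> U assms by (auto simp: defining_function_def)
  have \<psi>': "open U'" "Ck_on 1 \<psi> U'" "gradient \<psi> p \<noteq> 0"
    "\<Omega>2 \<inter> U' = {x\<in>U'. \<psi> x < 0}" "\<Gamma> \<inter> U' = {x\<in>U'. \<psi> x = 0}"
    using \<psi> U' assms by (auto simp: defining_function_def)
  have p0: "\<phi> p = 0" "\<psi> p = 0" using \<phi>' \<psi>' U U' assms by auto
  obtain W q where W: "open W" "p \<in> W" "W \<subseteq> U"
    "\<And>x. x \<in> W \<Longrightarrow> \<phi> x < 0 \<Longrightarrow> connected_component {y\<in>U. \<phi> y < 0} x q"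
    using one_sided_component[OF \<phi>'(1) U \<phi>'(2) p0(1) \<phi>'(3)] by metis
  have d\<phi>: "\<phi> differentiable (at p)" using Ck_on_differentiable[OF \<phi>'(2)] U by auto
  have gm: "gradient (\<lambda>x. - \<phi> x) p \<noteq> 0"
  proof -
    have "gradient (\<lambda>x. - \<phi> x) p = - gradient \<phi> p"
      using has_derivative_minus[OF has_derivative_dd[OF d\<phi>]]
      by (intro gradientI) (simp add: dd_gradient[OF d\<phi>])
    then show ?thesis using \<phi>' by simp
  qed
  obtain W' q' where W': "open W'" "p \<in> W'" "W' \<subseteq> U"
    "\<And>x. x \<in> W' \<Longrightarrow> - \<phi> x < 0 \<Longrightarrow> connected_component {y\<in>U. - \<phi> y < 0} x q'"
    using one_sided_component[OF \<phi>'(1) U Ck_on_minus[OF \<phi>'(1,2)] _ gm] p0 by auto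
  have side: "x \<in> \<Omega>2 \<longleftrightarrow> y \<in> \<Omega>2" if S: "connected_component S x y" "S \<inter> \<Gamma> = {}" for S x y
  proof -
    obtain C where C: "connected C" "C \<subseteq> S" "x \<in> C" "y \<in> C"
      using S(1) unfolding connected_component_def by blast
    then have "C \<inter> frontier \<Omega>2 = {}" using S assms by blast
    then have "C \<subseteq> \<Omega>2 \<or> C \<inter> \<Omega>2 = {}" using connected_Int_frontier[OF C(1)] by blast
    then show ?thesis using C by blast
  qed
  have neg: "x \<in> \<Omega>2 \<longleftrightarrow> q \<in> \<Omega>2" if "x \<in> W" "x \<in> \<Omega>1" for x
  proof (rule side[OF W(4)[OF that(1)]])
    show "\<phi> x < 0" using that W(3) \<phi>'(4) by blast
    have "y \<notin> \<Gamma>" if "y \<in> U" "\<phi> y < 0" for y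
    proof
      assume "y \<in> \<Gamma>"
      then have "\<phi> y = 0" using that(1) \<phi>'(5) by blast
      then show False using that by simp
    qed
    then show "{y \<in> U. \<phi> y < 0} \<inter> \<Gamma> = {}" by blast
  qed
  have pos: "x \<in> \<Omega>2 \<longleftrightarrow> q' \<in> \<Omega>2" if x: "x \<in> W'" "x \<notin> \<Omega>1" "x \<notin> \<Gamma>" for x
  proof (rule side[OF W'(4)[OF x(1)]])
    have "\<not> \<phi> x < 0" "\<phi> x \<noteq> 0" using x W'(3) \<phi>'(4,5) by blast+
    then show "- \<phi> x < 0" by simp
    have "y \<notin> \<Gamma>" if "y \<in> U" "- \<phi> y < 0" for y
    proof
      assume "y \<in> \<Gamma>"
      then have "\<phi> y = 0" using that(1) \<phi>'(5) by blast
      then show False using that by simp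
    qed
    then show "{y \<in> U. - \<phi> y < 0} \<inter> \<Gamma> = {}" by blast
  qed
  have \<Omega>2\<Gamma>: "\<Omega>2 \<inter> \<Gamma> = {}"
    using assms by (auto simp: Ck_domain_def frontier_def interior_open)
  \<comment> \<open>Otherwise \<open>\<Omega>2\<close> would contain every point near
    \<open>p\<close> off \<Gamma>, but the points on the ray along \<open>gradient \<psi> p\<close>
    are off \<Gamma> and outside \<open>\<Omega>2\<close>.\<close>
  have "\<not> (q \<in> \<Omega>2 \<and> q' \<in> \<Omega>2)"
  proof
    assume "q \<in> \<Omega>2 \<and> q' \<in> \<Omega>2"
    then have all: "x \<in> \<Omega>2" if "x \<in> W \<inter> W'" "x \<notin> \<Gamma>" for x
      using that neg pos by blast
    have d\<psi>: "\<psi> differentiable (at p)" using Ck_on_differentiable[OF \<psi>'(2)] U' by auto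
    have "\<forall>\<^sub>F t in at_right 0. \<psi> (p + t *\<^sub>R gradient \<psi> p) > 0"
      using \<psi>'(3) by (intro positive_direction[OF d\<psi> p0(2)]) (simp add: dd_gradient[OF d\<psi>])
    moreover have "\<forall>\<^sub>F t in at_right 0. p + t *\<^sub>R gradient \<psi> p \<in> U' \<inter> (W \<inter> W')"
      using W W' U' \<psi>' by (intro line_eventually_in) auto
    ultimately have "\<forall>\<^sub>F t::real in at_right 0. False"
    proof eventually_elim
      case (elim t)
      then have "p + t *\<^sub>R gradient \<psi> p \<notin> \<Gamma>" using \<psi>'(5) by force
      then have "p + t *\<^sub>R gradient \<psi> p \<in> \<Omega>2" using all elim by blast
      then show ?case using \<psi>'(4) elim by force
    qed
    then show False by simp
  qed
  \<comment> \<open>Otherwise \<open>\<Omega>2\<close> would miss a neighbourhood of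
    \<open>p\<close>, although \<open>p\<close> is in its closure.\<close>
  moreover have "q \<in> \<Omega>2 \<or> q' \<in> \<Omega>2"
  proof (rule ccontr)
    assume "\<not> (q \<in> \<Omega>2 \<or> q' \<in> \<Omega>2)"
    then have "x \<notin> \<Omega>2" if "x \<in> W \<inter> W'" for x
      using that neg pos \<Omega>2\<Gamma> by blast
    moreover have "p \<in> closure \<Omega>2" using assms by (auto simp: frontier_def)
    ultimately show False
      using W(1,2) W'(1,2) open_Int_closure_eq_empty[of "W \<inter> W'" \<Omega>2] by blast
  qed
  ultimately have "(\<forall>x\<in>W\<inter>W'-\<Gamma>. x \<in> \<Omega>1 \<longleftrightarrow> x \<in> \<Omega>2) \<or> (\<forall>x\<in>W\<inter>W'-\<Gamma>. x \<in> \<Omega>1 \<longleftrightarrow> x \<notin> \<Omega>2)"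
    using neg pos by (smt (verit) Diff_iff IntE)
  then show ?thesis
    using W W' by (intro exI[of _ "W \<inter> W'"]) auto
qed

text \<open>Connectedness of the whole space: \<open>A\<close> and \<open>B\<close> collect the
  points near which the domains lie on opposite sides and on the same side of \<Gamma>. By
  boundedness some point is outside both closures, hence in \<open>B\<close>, so \<open>A\<close> is
  empty.\<close>

lemma C1_domain_unique:
  fixes \<Omega>1 \<Omega>2 :: "(real^'n) set"
  assumes dom: "Ck_domain 1 \<Omega>1" "Ck_domain 1 \<Omega>2" and fr: "frontier \<Omega>1 = \<Gamma>" "frontier \<Omega>2 = \<Gamma>"
  shows "\<Omega>1 = \<Omega>2"
proof -
  define A where "A = {p. \<exists>W. open W \<and> p \<in> W \<and> (\<forall>x\<in>W-\<Gamma>. x \<in> \<Omega>1 \<longleftrightarrow> x \<notin> \<Omega>2)}"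
  define B where "B = {p. \<exists>W. open W \<and> p \<in> W \<and> (\<forall>x\<in>W-\<Gamma>. x \<in> \<Omega>1 \<longleftrightarrow> x \<in> \<Omega>2)}"
  have op: "open \<Omega>1" "open \<Omega>2" "bounded \<Omega>1" "bounded \<Omega>2" using dom by (auto simp: Ck_domain_def)
  have disj: "\<Omega>1 \<inter> \<Gamma> = {}" "\<Omega>2 \<inter> \<Gamma> = {}" using op fr by (auto simp: frontier_def interior_open)
  have "open {p. \<exists>W. open W \<and> p \<in> W \<and> Q W}" for Q :: "(real^'n) set \<Rightarrow> bool"
  proof -
    have eq: "{p. \<exists>W. open W \<and> p \<in> W \<and> Q W} = \<Union>{W. open W \<and> Q W}" by auto
    show ?thesis unfolding eq by (rule open_Union) simp
  qed
  note op_rule = this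
  have "open A" unfolding A_def by (rule op_rule)
  have "open B" unfolding B_def by (rule op_rule)
  have off: "p \<in> \<Omega> \<or> p \<in> - closure \<Omega>" if "p \<notin> \<Gamma>" "open \<Omega>" "frontier \<Omega> = \<Gamma>" for p \<Omega>
    using that by (auto simp: frontier_def interior_open)
  have cover: "p \<in> A \<or> p \<in> B" for p
  proof (cases "p \<in> \<Gamma>")
    case True
    obtain W where "open W" "p \<in> W" and W: "(\<forall>x\<in>W-\<Gamma>. x \<in> \<Omega>1 \<longleftrightarrow> x \<in> \<Omega>2) \<or> (\<forall>x\<in>W-\<Gamma>. x \<in> \<Omega>1 \<longleftrightarrow> x \<notin> \<Omega>2)"
      using locally_same_or_opposite_side[OF dom fr True] by auto
    from W show ?thesis
    proof
      assume "\<forall>x\<in>W-\<Gamma>. x \<in> \<Omega>1 \<longleftrightarrow> x \<in> \<Omega>2"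
      then have "p \<in> B" unfolding B_def using \<open>open W\<close> \<open>p \<in> W\<close> by auto
      then show ?thesis by simp
    next
      assume "\<forall>x\<in>W-\<Gamma>. x \<in> \<Omega>1 \<longleftrightarrow> x \<notin> \<Omega>2"
      then have "p \<in> A" unfolding A_def using \<open>open W\<close> \<open>p \<in> W\<close> by auto
      then show ?thesis by simp
    qed
  next
    case False
    have nb: "\<exists>W. open W \<and> p \<in> W \<and> (\<forall>x\<in>W. x \<in> \<Omega> \<longleftrightarrow> p \<in> \<Omega>)" if "open \<Omega>" "frontier \<Omega> = \<Gamma>" for \<Omega>
    proof (cases "p \<in> \<Omega>")
      case True
      then show ?thesis using that by blast
    next
      case F: False
      then have "p \<in> - closure \<Omega>" using off[OF False that] by blast
      moreover have "x \<notin> \<Omega>" if "x \<in> - closure \<Omega>" for x using that closure_subset by blast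
      ultimately show ?thesis using F by (intro exI[of _ "- closure \<Omega>"]) auto
    qed
    obtain W1 where W1: "open W1" "p \<in> W1" "\<forall>x\<in>W1. x \<in> \<Omega>1 \<longleftrightarrow> p \<in> \<Omega>1"
      using nb[OF op(1) fr(1)] by blast
    obtain W2 where W2: "open W2" "p \<in> W2" "\<forall>x\<in>W2. x \<in> \<Omega>2 \<longleftrightarrow> p \<in> \<Omega>2"
      using nb[OF op(2) fr(2)] by blast
    have W12: "open (W1 \<inter> W2)" "p \<in> W1 \<inter> W2" using W1 W2 by auto
    show ?thesis
    proof (cases "p \<in> \<Omega>1 \<longleftrightarrow> p \<in> \<Omega>2")
      case True
      then have "\<forall>x\<in>W1\<inter>W2-\<Gamma>. x \<in> \<Omega>1 \<longleftrightarrow> x \<in> \<Omega>2" using W1 W2 by blast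
      then show ?thesis using W12 unfolding B_def by blast
    next
      case False
      then have "\<forall>x\<in>W1\<inter>W2-\<Gamma>. x \<in> \<Omega>1 \<longleftrightarrow> x \<notin> \<Omega>2" using W1 W2 by blast
      then show ?thesis using W12 unfolding A_def by blast
    qed
  qed
  \<comment> \<open>A common point would have a neighbourhood contained in \<Gamma>; yet a point of
    \<Gamma> is a limit of points of \<open>\<Omega>1\<close>, which is disjoint from
    \<Gamma>.\<close>
  have AB: "A \<inter> B = {}"
  proof (rule ccontr)
    assume "A \<inter> B \<noteq> {}"
    then obtain p W W' where W: "open W" "p \<in> W" "\<forall>x\<in>W-\<Gamma>. x \<in> \<Omega>1 \<longleftrightarrow> x \<notin> \<Omega>2"
      "open W'" "p \<in> W'" "\<forall>x\<in>W'-\<Gamma>. x \<in> \<Omega>1 \<longleftrightarrow> x \<in> \<Omega>2"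
      unfolding A_def B_def by blast
    then have sub: "W \<inter> W' \<subseteq> \<Gamma>" by blast
    then have "p \<in> closure \<Omega>1" using W fr by (auto simp: frontier_def)
    then have "W \<inter> W' \<inter> \<Omega>1 \<noteq> {}"
      using W open_Int_closure_eq_empty[of "W \<inter> W'" \<Omega>1] by blast
    then show False using sub disj by blast
  qed
  have "bounded (closure \<Omega>1 \<union> closure \<Omega>2)" using op by auto
  then obtain y where y: "y \<notin> closure \<Omega>1 \<union> closure \<Omega>2"
    using not_bounded_UNIV by (metis UNIV_eq_I)
  have "y \<in> B"
  proof -
    have "\<forall>x\<in>- (closure \<Omega>1 \<union> closure \<Omega>2) - \<Gamma>. x \<in> \<Omega>1 \<longleftrightarrow> x \<in> \<Omega>2"
      using closure_subset by blast
    then show ?thesis unfolding B_def using y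
      by (intro CollectI exI[of _ "- (closure \<Omega>1 \<union> closure \<Omega>2)"]) auto
  qed
  then have "A = {}"
    using connected_UNIV[where 'a="real^'n"] \<open>open A\<close> \<open>open B\<close> AB cover
    unfolding connected_def by (metis Int_UNIV_right UnI1 UnI2 disjoint_iff subsetI UNIV_I)
  then have B: "p \<in> B" for p using cover by blast
  have "x \<in> \<Omega>1 \<longleftrightarrow> x \<in> \<Omega>2" for x
  proof (cases "x \<in> \<Gamma>")
    case True
    then show ?thesis using disj by blast
  next
    case False
    then show ?thesis using B[of x] unfolding B_def by blast
  qed
  then show ?thesis by blast
qed

lemma enclosed_domain_eq:
  assumes "Ck_domain 1 \<Omega>"
  shows "enclosed_domain (frontier \<Omega>) = \<Omega>"
  unfolding enclosed_domain_def
  by (rule the_equality) (use assms C1_domain_unique in auto)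

text \<open>Any two level functions at \<open>p\<close> have positively parallel gradients, so the
  description in \<open>normal\<close> is a definite one and may be evaluated with whichever level
  function is at hand.\<close>

lemma normal_eq:
  assumes "Ck_domain 1 \<Omega>" "defining_function 1 \<Omega> U \<phi>" "p \<in> U" "p \<in> frontier \<Omega>"
  shows "normal (frontier \<Omega>) p = gradient \<phi> p /\<^sub>R norm (gradient \<phi> p)"
  unfolding normal_def enclosed_domain_eq[OF assms(1)]
proof (rule the_equality)
  show "\<exists>U \<phi>'. p \<in> U \<and> defining_function 1 \<Omega> U \<phi>' \<and>
      gradient \<phi> p /\<^sub>R norm (gradient \<phi> p) = gradient \<phi>' p /\<^sub>R norm (gradient \<phi>' p)"
    using assms by blast
next
  fix \<nu> assume "\<exists>U \<phi>. p \<in> U \<and> defining_function 1 \<Omega> U \<phi> \<and> \<nu> = gradient \<phi> p /\<^sub>R norm (gradient \<phi> p)"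
  then obtain V \<psi> where \<psi>: "p \<in> V" "defining_function 1 \<Omega> V \<psi>" "\<nu> = gradient \<psi> p /\<^sub>R norm (gradient \<psi> p)"
    by blast
  obtain c where "c > 0" "gradient \<psi> p = c *\<^sub>R gradient \<phi> p"
    using gradients_parallel[OF assms(2) \<psi>(2) assms(3) \<psi>(1) assms(4)] by blast
  then show "\<nu> = gradient \<phi> p /\<^sub>R norm (gradient \<phi> p)"
    using \<psi>(3) by simp
qed

text \<open>Local level functions are glued with nonnegative bumps. All of them have the sign
  prescribed by the domain, so the sum keeps it. On the boundary the level functions vanish, hence
  only their own derivatives survive in the product rule; these gradients are positively parallel,
  nothing cancels, and the gradient of the sum is nonzero.\<close>

lemma global_defining_function:
  fixes \<Omega> :: "(real^'n) set"
  assumes dom: "Ck_domain (Suc k) \<Omega>"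
  obtains U \<Phi> where "frontier \<Omega> \<subseteq> U" "defining_function (Suc k) \<Omega> U \<Phi>"
proof -
  define \<Gamma> where "\<Gamma> = frontier \<Omega>"
  have op: "open \<Omega>" "bounded \<Omega>" using dom by (auto simp: Ck_domain_def)
  have "\<forall>p\<in>\<Gamma>. \<exists>U \<phi> r. p \<in> U \<and> defining_function (Suc k) \<Omega> U \<phi> \<and> r > 0 \<and> cball p r \<subseteq> U"
  proof
    fix p assume "p \<in> \<Gamma>"
    then obtain U \<phi> where U: "p \<in> U" "defining_function (Suc k) \<Omega> U \<phi>"
      using dom by (auto simp: Ck_domain_def \<Gamma>_def)
    then show "\<exists>U \<phi> r. p \<in> U \<and> defining_function (Suc k) \<Omega> U \<phi> \<and> r > 0 \<and> cball p r \<subseteq> U"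
      by (meson defining_function_def open_contains_cball_eq)
  qed
  then obtain U \<phi> r where loc: "\<And>p. p \<in> \<Gamma> \<Longrightarrow> p \<in> U p"
    "\<And>p. p \<in> \<Gamma> \<Longrightarrow> defining_function (Suc k) \<Omega> (U p) (\<phi> p)"
    "\<And>p. p \<in> \<Gamma> \<Longrightarrow> r p > 0" "\<And>p. p \<in> \<Gamma> \<Longrightarrow> cball p (r p) \<subseteq> U p"
    by metis
  have \<phi>: "open (U p)" "Ck_on (Suc k) (\<phi> p) (U p)" "\<And>x. x \<in> U p \<Longrightarrow> x \<in> \<Omega> \<longleftrightarrow> \<phi> p x < 0"
    "\<And>x. x \<in> U p \<Longrightarrow> x \<in> \<Gamma> \<longleftrightarrow> \<phi> p x = 0" if "p \<in> \<Gamma>" for p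
    using loc(2)[OF that] unfolding defining_function_def \<Gamma>_def by blast+
  have "compact \<Gamma>" using op by (simp add: \<Gamma>_def compact_frontier_bounded)
  moreover have "\<Gamma> \<subseteq> (\<Union>p\<in>\<Gamma>. ball p (r p))" using loc(3) by force
  ultimately obtain F where F: "F \<subseteq> \<Gamma>" "finite F" "\<Gamma> \<subseteq> (\<Union>p\<in>F. ball p (r p))"
    using compactE_image[of \<Gamma> \<Gamma> "\<lambda>p. ball p (r p)"] by auto
  have inU: "x \<in> U p" if "p \<in> \<Gamma>" "x \<in> ball p (r p)" for p x
    using loc(4)[OF that(1)] that(2) ball_subset_cball by blast
  \<comment> \<open>The exponent makes the bump of class C^(k+1), like the level functions. For
    \<open>p\<close> on the boundary it is positive exactly on an open ball whose closure lies in
    \<open>U p\<close>, so the product with \<open>\<phi> p\<close> is C^(k+1) on the whole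
    space.\<close>
  define \<psi> where "\<psi> p x = max 0 ((r p)\<^sup>2 - (x - p) \<bullet> (x - p)) ^ Suc (Suc k)" for p x
  define \<theta> where "\<theta> p x = \<psi> p x * \<phi> p x" for p x
  define \<Phi> where "\<Phi> x = (\<Sum>p\<in>F. \<theta> p x)" for x
  have \<psi>pos: "\<psi> p x > 0" if "p \<in> \<Gamma>" "x \<in> ball p (r p)" for p x
  proof -
    have "norm (x - p) < r p" using that by (simp add: dist_norm norm_minus_commute)
    then have "(norm (x - p))\<^sup>2 < (r p)\<^sup>2" by (simp add: power_strict_mono)
    then show ?thesis by (simp add: \<psi>_def power2_norm_eq_inner)
  qed
  have \<psi>zero: "\<psi> p x = 0" if "p \<in> \<Gamma>" "x \<notin> ball p (r p)" for p x
  proof -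
    have "r p \<le> norm (x - p)" using that by (simp add: dist_norm norm_minus_commute)
    then have "(r p)\<^sup>2 \<le> (norm (x - p))\<^sup>2" using loc(3)[OF that(1)] by (intro power_mono) auto
    then show ?thesis by (simp add: \<psi>_def power2_norm_eq_inner)
  qed
  have \<psi>0: "\<psi> p x \<ge> 0" for p x by (simp add: \<psi>_def)
  have \<psi>C: "Ck_on (Suc k) (\<psi> p) S" if "open S" for p S
  proof -
    have "Ck_on (Suc k) (\<lambda>x. (r p)\<^sup>2 - (x - p) \<bullet> (x - p)) S"
      using that by (intro Ck_on_diff Ck_on_inner Ck_on_const Ck_on_id)
    from Ck_on_compose[OF that open_UNIV _ this Ck_on_pos_part_power] show ?thesis
      by (simp add: \<psi>_def[abs_def])
  qed
  have \<theta>C: "Ck_on (Suc k) (\<theta> p) UNIV" if p: "p \<in> \<Gamma>" for p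
  proof -
    have "Ck_on (Suc k) (\<theta> p) (U p)"
      unfolding \<theta>_def using \<phi>[OF p] by (intro Ck_on_mult \<psi>C)
    moreover have "Ck_on (Suc k) (\<theta> p) (- cball p (r p))"
      by (rule Ck_on_cong[OF _ _ Ck_on_const[of _ 0]]) (use \<psi>zero[OF p] in \<open>auto simp: \<theta>_def\<close>)
    ultimately have "Ck_on (Suc k) (\<theta> p) (U p \<union> - cball p (r p))"
      using \<phi>(1)[OF p] by (intro Ck_on_Un) auto
    moreover have "U p \<union> - cball p (r p) = UNIV" using loc(4)[OF p] by blast
    ultimately show ?thesis by simp
  qed
  have \<Phi>C: "Ck_on (Suc k) \<Phi> UNIV"
    unfolding \<Phi>_def using F \<theta>C by (intro Ck_on_sum) auto
  have d\<theta>: "\<theta> p differentiable (at x)" if "p \<in> \<Gamma>" for p x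
    using Ck_on_differentiable[OF \<theta>C[OF that]] by auto
  have d\<Phi>: "\<Phi> differentiable (at x)" for x
    using Ck_on_differentiable[OF \<Phi>C] by auto
  have gradient_nz: "gradient \<Phi> x \<noteq> 0" if x: "x \<in> \<Gamma>" for x
  proof -
    obtain q where q: "q \<in> F" "x \<in> ball q (r q)" using F x by blast
    then have q': "q \<in> \<Gamma>" "x \<in> U q" using F loc(4) ball_subset_cball by blast+
    define \<nu> where "\<nu> = gradient (\<phi> q) x"
    have \<nu>: "\<nu> \<noteq> 0" using loc(2)[OF q'(1)] q' by (auto simp: defining_function_def \<nu>_def)
    \<comment> \<open>All gradients are tested against the one from a chart \<open>q\<close> whose
      ball contains \<open>x\<close>: every summand is nonnegative, and that of \<open>q\<close> is
      positive.\<close>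
    have summand: "dd (\<theta> p) x \<nu> \<ge> 0 \<and> (x \<in> ball p (r p) \<longrightarrow> dd (\<theta> p) x \<nu> > 0)" if p: "p \<in> F" for p
    proof (cases "x \<in> U p")
      case True
      have pG: "p \<in> \<Gamma>" using p F by blast
      have d\<phi>: "\<phi> p differentiable (at x)" using Ck_on_differentiable[OF \<phi>(2)[OF pG]] True by auto
      have d\<psi>: "\<psi> p differentiable (at x)" using Ck_on_differentiable[OF \<psi>C[OF open_UNIV]] by auto
      have "(\<theta> p has_derivative (\<lambda>h. \<psi> p x * dd (\<phi> p) x h + dd (\<psi> p) x h * \<phi> p x)) (at x)"
        unfolding \<theta>_def[abs_def]
        by (rule has_derivative_mult[OF has_derivative_dd[OF d\<psi>] has_derivative_dd[OF d\<phi>]])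
      moreover have "\<phi> p x = 0" using \<phi>(4)[OF pG True] x by simp
      ultimately have eq: "dd (\<theta> p) x \<nu> = \<psi> p x * (gradient (\<phi> p) x \<bullet> \<nu>)"
        by (simp add: dd_eqI dd_gradient[OF d\<phi>])
      obtain c where "c > 0" "gradient (\<phi> p) x = c *\<^sub>R gradient (\<phi> q) x"
        using gradients_parallel[OF defining_function_mono[OF loc(2)[OF q'(1)]]
            defining_function_mono[OF loc(2)[OF pG]] q'(2) True] x by (auto simp: \<Gamma>_def)
      then have pos: "gradient (\<phi> p) x \<bullet> \<nu> > 0" using \<nu> by (simp flip: \<nu>_def)
      then show ?thesis using eq \<psi>0 \<psi>pos[OF pG] by simp
    next
      case False
      have pG: "p \<in> \<Gamma>" using p F by blast
      then have "x \<in> - cball p (r p)" using False loc(4) by blast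
      moreover have "\<theta> p y = 0" if "y \<in> - cball p (r p)" for y
        using \<psi>zero[OF pG, of y] that by (simp add: \<theta>_def)
      ultimately have "dd (\<theta> p) x = dd (\<lambda>y. 0) x"
        by (intro dd_transform[of "- cball p (r p)"]) auto
      then show ?thesis using False inU[OF pG] by (auto simp: frechet_derivative_const)
    qed
    have "(\<Phi> has_derivative (\<lambda>h. \<Sum>p\<in>F. dd (\<theta> p) x h)) (at x)"
      unfolding \<Phi>_def[abs_def] using F d\<theta> by (intro has_derivative_sum has_derivative_dd) auto
    then have "dd \<Phi> x \<nu> = (\<Sum>p\<in>F. dd (\<theta> p) x \<nu>)" by (simp add: dd_eqI)
    also have "\<dots> > 0" using summand q F by (intro sum_pos2[of F q]) auto
    finally show ?thesis using dd_gradient[OF d\<Phi>, of x \<nu>] by auto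
  qed
  \<comment> \<open>The gradient is known to be nonzero only on \<Gamma>, so the neighbourhood is
    cut down to where this persists.\<close>
  define G where "G = (\<Union>p\<in>F. ball p (r p)) \<inter> {x. gradient \<Phi> x \<noteq> 0}"
  have "open {x. gradient \<Phi> x \<noteq> 0}"
  proof -
    have "continuous_on UNIV (gradient \<Phi>)"
      using Ck_on_continuous[OF Ck_on_gradient[OF open_UNIV \<Phi>C]] .
    then have "open (gradient \<Phi> -` (- {0}))" by (intro open_vimage) auto
    then show ?thesis by (simp add: vimage_def)
  qed
  then have "open G" unfolding G_def by auto
  have sgn: "(x \<in> \<Omega> \<longrightarrow> \<Phi> x < 0) \<and> (x \<in> \<Gamma> \<longrightarrow> \<Phi> x = 0) \<and> (x \<notin> \<Omega> \<and> x \<notin> \<Gamma> \<longrightarrow> \<Phi> x > 0)" if x: "x \<in> G" for x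
  proof -
    obtain q where q: "q \<in> F" "x \<in> ball q (r q)" using x by (auto simp: G_def)
    have val: "p \<in> \<Gamma> \<and> (x \<in> ball p (r p) \<longrightarrow> \<psi> p x > 0 \<and> x \<in> U p) \<and> (x \<notin> ball p (r p) \<longrightarrow> \<theta> p x = 0)"
      if "p \<in> F" for p
      using that F \<psi>pos[of p x] \<psi>zero[of p x] inU[of p x]
      by (auto simp: \<theta>_def simp del: mem_ball)
    have neg: "\<theta> p x < 0" if "p \<in> F" "x \<in> ball p (r p)" "x \<in> \<Omega>" for p
      using val[OF that(1)] that \<phi>(3)[of p x] by (auto simp: \<theta>_def mult_pos_neg)
    have zero: "\<theta> p x = 0" if "p \<in> F" "x \<in> \<Gamma>" for p
      using val[OF that(1)] that \<phi>(4)[of p x] by (auto simp: \<theta>_def)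
    have pos: "\<theta> p x > 0" if "p \<in> F" "x \<in> ball p (r p)" "x \<notin> \<Omega>" "x \<notin> \<Gamma>" for p
    proof -
      have "\<phi> p x > 0" using val[OF that(1)] that \<phi>(3,4)[of p x] by (metis linorder_neqE_linordered_idom)
      then show ?thesis using val[OF that(1)] that by (simp add: \<theta>_def)
    qed
    have "\<Phi> x < 0" if "x \<in> \<Omega>"
    proof -
      have "(\<Sum>p\<in>F. - \<theta> p x) > 0"
        using q F neg val that by (intro sum_pos2[of F q]) (auto, force)
      then show ?thesis by (simp add: \<Phi>_def sum_negf)
    qed
    moreover have "\<Phi> x = 0" if "x \<in> \<Gamma>" using zero that by (simp add: \<Phi>_def)
    moreover have "\<Phi> x > 0" if "x \<notin> \<Omega>" "x \<notin> \<Gamma>"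
      unfolding \<Phi>_def using q F pos val that by (intro sum_pos2[of F q]) (auto, force)
    ultimately show ?thesis by blast
  qed
  show ?thesis
  proof (rule that[of G \<Phi>])
    show "frontier \<Omega> \<subseteq> G" using F gradient_nz by (auto simp: G_def \<Gamma>_def)
    have "\<Omega> \<inter> \<Gamma> = {}" using op by (auto simp: \<Gamma>_def frontier_def interior_open)
    then have "\<Omega> \<inter> G = {x\<in>G. \<Phi> x < 0}" "\<Gamma> \<inter> G = {x\<in>G. \<Phi> x = 0}"
      using sgn by (auto, (metis less_irrefl not_less_iff_gr_or_eq)+)
    moreover have "Ck_on (Suc k) \<Phi> G" using Ck_on_subset[OF \<Phi>C] by blast
    moreover have "\<forall>x\<in>G. gradient \<Phi> x \<noteq> 0" by (simp add: G_def)
    ultimately show "defining_function (Suc k) \<Omega> G \<Phi>"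
      using \<open>open G\<close> unfolding defining_function_def \<Gamma>_def by blast
  qed
qed

section \<open>Independence of the extension\<close>

text \<open>The images of the boundary under the flow are handled at this regularity, which suffices
  for the tangential operators on them.\<close>

definition C1_boundary :: "(real^'n) set \<Rightarrow> bool" where
  "C1_boundary \<Gamma> \<longleftrightarrow> (\<exists>\<Omega>. Ck_domain 1 \<Omega> \<and> \<Gamma> = frontier \<Omega>)"

lemma C1_boundary_local:
  assumes "C1_boundary \<Gamma>" "p \<in> \<Gamma>"
  obtains U \<phi> where "open U" "p \<in> U" "Ck_on 1 \<phi> U" "\<phi> p = 0" "gradient \<phi> p \<noteq> 0"
    "\<And>x. x \<in> U \<Longrightarrow> x \<in> \<Gamma> \<longleftrightarrow> \<phi> x = 0"
    "normal \<Gamma> p = gradient \<phi> p /\<^sub>R norm (gradient \<phi> p)"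
proof -
  obtain \<Omega> where \<Omega>: "Ck_domain 1 \<Omega>" "\<Gamma> = frontier \<Omega>" using assms by (auto simp: C1_boundary_def)
  then obtain U \<phi> where U: "p \<in> U" "defining_function 1 \<Omega> U \<phi>"
    using assms by (auto simp: Ck_domain_def)
  have "normal \<Gamma> p = gradient \<phi> p /\<^sub>R norm (gradient \<phi> p)"
    using normal_eq[OF \<Omega>(1) U(2,1)] assms \<Omega> by simp
  with U \<Omega> assms show ?thesis
    by (intro that[of U \<phi>]) (auto simp: defining_function_def)
qed

lemma norm_normal: "C1_boundary \<Gamma> \<Longrightarrow> p \<in> \<Gamma> \<Longrightarrow> norm (normal \<Gamma> p) = 1"
  using C1_boundary_local[of \<Gamma> p] by force

text \<open>The difference of two extensions vanishes on \<Gamma>, so its derivative along \<Gamma>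
  is zero.\<close>

lemma extension_tangential:
  fixes F G :: "real^'n \<Rightarrow> 'b::real_normed_vector"
  assumes \<Gamma>: "C1_boundary \<Gamma>" "p \<in> \<Gamma>" and "Ck_extension 1 \<Gamma> f F" "Ck_extension 1 \<Gamma> f G"
    and \<tau>: "normal \<Gamma> p \<bullet> \<tau> = 0"
  shows "dd F p \<tau> = dd G p \<tau>"
proof -
  obtain U \<phi> where U: "open U" "p \<in> U" "Ck_on 1 \<phi> U" "\<phi> p = 0" "gradient \<phi> p \<noteq> 0"
    "\<And>x. x \<in> U \<Longrightarrow> x \<in> \<Gamma> \<longleftrightarrow> \<phi> x = 0" "normal \<Gamma> p = gradient \<phi> p /\<^sub>R norm (gradient \<phi> p)"
    using C1_boundary_local[OF \<Gamma>] by blast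
  have d\<phi>: "\<phi> differentiable (at p)" using Ck_on_differentiable[OF U(3)] U by auto
  have d: "F differentiable (at p)" "G differentiable (at p)"
    using assms by (auto simp: Ck_extension_def intro: Ck_on_differentiable)
  have "dd (\<lambda>x. F x - G x) p \<tau> = 0"
  proof (rule tangential_derivative_zero[OF U(1-4)])
    show "dd \<phi> p \<tau> = 0" "dd \<phi> p (gradient \<phi> p) > 0"
      using \<tau> U(5,7) by (simp_all add: dd_gradient[OF d\<phi>])
    show "(\<lambda>x. F x - G x) differentiable at p" using d by simp
    show "F x - G x = 0" if "x \<in> U" "\<phi> x = 0" for x
      using that U(6) assms by (simp add: Ck_extension_def)
  qed
  moreover have "dd (\<lambda>x. F x - G x) p = (\<lambda>h. dd F p h - dd G p h)"
    using d by (intro dd_eqI has_derivative_diff has_derivative_dd)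
  ultimately show ?thesis by simp
qed

lemma extension_is_extension: "Ck_extension 1 \<Gamma> f F \<Longrightarrow> Ck_extension 1 \<Gamma> f (extension \<Gamma> f)"
  unfolding extension_def by (rule someI[of "Ck_extension 1 \<Gamma> f"])

lemma Ck_extension_differentiable: "Ck_extension 1 \<Gamma> f F \<Longrightarrow> p \<in> \<Gamma> \<Longrightarrow> F differentiable (at p)"
  unfolding Ck_extension_def using Ck_on_differentiable[of 1 F] by (metis subsetD zero_less_one)

text \<open>The definition works with an arbitrarily chosen extension. Here it is replaced by any
  convenient one, such as the pushforward of a function defined near the original boundary.\<close>

lemma tgrad_extension:
  assumes \<Gamma>: "C1_boundary \<Gamma>" "p \<in> \<Gamma>" and F: "Ck_extension 1 \<Gamma> f F"
  shows "tgrad \<Gamma> f p = tproj (normal \<Gamma> p) *v gradient F p"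
proof -
  let ?\<nu> = "normal \<Gamma> p" and ?E = "extension \<Gamma> f"
  have E: "Ck_extension 1 \<Gamma> f ?E" using extension_is_extension[OF F] .
  have "(tproj ?\<nu> *v gradient ?E p) \<bullet> h = (tproj ?\<nu> *v gradient F p) \<bullet> h" for h
    using extension_tangential[OF \<Gamma> E F tproj_orthogonal[OF norm_normal[OF \<Gamma>]], of h]
    by (simp add: inner_tproj dd_gradient Ck_extension_differentiable[OF E \<Gamma>(2)]
        Ck_extension_differentiable[OF F \<Gamma>(2)])
  then show ?thesis
    unfolding tgrad_def tproj_def[symmetric] by (metis vector_eq_rdot)
qed

lemma jacobian_tproj:
  "jacobian_matrix W p - tensor (jacobian_matrix W p *v \<nu>) \<nu> = jacobian_matrix W p ** tproj \<nu>"
  by (rule matrix_eqI)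
    (simp add: matrix_vector_mul_assoc[symmetric] matrix_vector_mult_diff_rdistrib tensor_vec
      tproj_vec matrix_vector_mult_diff_distrib matrix_vector_mult_scaleR)

lemma jacobian_tproj_extension:
  assumes \<Gamma>: "C1_boundary \<Gamma>" "p \<in> \<Gamma>" and F: "Ck_extension 1 \<Gamma> f F"
  shows "jacobian_matrix (extension \<Gamma> f) p ** tproj (normal \<Gamma> p) = jacobian_matrix F p ** tproj (normal \<Gamma> p)"
proof (rule matrix_eqI)
  fix h
  have E: "Ck_extension 1 \<Gamma> f (extension \<Gamma> f)" using extension_is_extension[OF F] .
  show "jacobian_matrix (extension \<Gamma> f) p ** tproj (normal \<Gamma> p) *v h
      = jacobian_matrix F p ** tproj (normal \<Gamma> p) *v h"
    using extension_tangential[OF \<Gamma> E F tproj_orthogonal[OF norm_normal[OF \<Gamma>]], of h]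
    by (simp add: matrix_vector_mul_assoc[symmetric] dd_jacobian Ck_extension_differentiable[OF E \<Gamma>(2)]
        Ck_extension_differentiable[OF F \<Gamma>(2)])
qed

lemma tderiv_extension:
  assumes "C1_boundary \<Gamma>" "p \<in> \<Gamma>" "Ck_extension 1 \<Gamma> w W"
  shows "tderiv \<Gamma> w p = jacobian_matrix W p ** tproj (normal \<Gamma> p)"
  unfolding tderiv_def jacobian_tproj jacobian_tproj_extension[OF assms] ..

lemma tdiv_extension:
  assumes "C1_boundary \<Gamma>" "p \<in> \<Gamma>" "Ck_extension 1 \<Gamma> w W"
  shows "tdiv \<Gamma> w p = trace (jacobian_matrix W p ** tproj (normal \<Gamma> p))"
proof -
  have "tdiv \<Gamma> w p = trace (tderiv \<Gamma> w p)"
    by (simp add: tdiv_def tderiv_def divergence_def trace_sub trace_tensor)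
  then show ?thesis using tderiv_extension[OF assms] by simp
qed

section \<open>Differentiability of flows for small times\<close>

text \<open>The mean value inequality for \<open>d t - t *\<^sub>R l\<close>. With
  \<open>l = 0\<close> it bounds increments; with \<open>l\<close> the limit of the velocity it
  compares the difference quotient at time 0 with that limit.\<close>

lemma vector_derivative_bound:
  fixes d :: "real \<Rightarrow> 'a::real_inner"
  assumes d: "\<And>t. t \<in> {0..T} \<Longrightarrow> (d has_vector_derivative d' t) (at t within {0..T})"
    and B: "\<And>t. 0 < t \<Longrightarrow> t < s \<Longrightarrow> norm (d' t - l) \<le> B" and s: "0 \<le> s" "s \<le> T"
  shows "norm (d s - d 0 - s *\<^sub>R l) \<le> s * B"
proof (cases "s = 0")
  case False
  let ?g = "\<lambda>t. d t - t *\<^sub>R l"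
  have "\<exists>t\<in>{0<..<s}. norm (?g s - ?g 0) \<le> norm ((s - 0) *\<^sub>R (d' t - l))"
  proof (rule mvt_general)
    have "continuous_on {0..T} d"
      using d has_vector_derivative_continuous continuous_on_eq_continuous_within by blast
    then show "continuous_on {0..s} ?g"
      using s by (intro continuous_intros) (auto elim: continuous_on_subset)
    fix t assume t: "0 < t" "t < s"
    then have "(d has_vector_derivative d' t) (at t)"
      using d[of t] s by (simp add: at_within_Icc_at)
    then show "(?g has_derivative (\<lambda>h. h *\<^sub>R (d' t - l))) (at t)"
      unfolding has_vector_derivative_def
      by (auto intro!: derivative_eq_intros simp: algebra_simps)
  qed (use False s in auto)
  then obtain t where t: "t \<in> {0<..<s}" "norm (d s - s *\<^sub>R l - d 0) \<le> s * norm (d' t - l)"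
    using s by auto
  moreover have "d s - s *\<^sub>R l - d 0 = d s - d 0 - s *\<^sub>R l" by simp
  moreover have "s * norm (d' t - l) \<le> s * B"
    using B[of t] s t by (intro mult_left_mono) auto
  ultimately show ?thesis using t(2) by (metis order_trans)
qed simp

text \<open>Instead of an exponential bound, evaluate at a time \<open>s\<close> where the norm of
  \<open>d\<close> is largest. The mean value inequality bounds this maximum by the initial norm
  plus \<open>T * c\<close> plus \<open>L * T\<close> times itself, and
  \<open>L * T \<le> 1 / 2\<close> absorbs the last term. Hence the factor 2.\<close>

lemma small_time_gronwall:
  fixes d :: "real \<Rightarrow> 'a::real_inner"
  assumes d: "\<And>t. t \<in> {0..T} \<Longrightarrow> (d has_vector_derivative d' t) (at t within {0..T})"
    and d': "\<And>t. t \<in> {0..T} \<Longrightarrow> norm (d' t) \<le> L * norm (d t) + c"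
    and "L * T \<le> 1 / 2" "0 \<le> L" "0 \<le> c" and t: "t \<in> {0..T}"
  shows "norm (d t) \<le> 2 * norm (d 0) + 2 * T * c"
proof -
  have "continuous_on {0..T} (\<lambda>t. norm (d t))"
    using d has_vector_derivative_continuous continuous_on_eq_continuous_within
    by (intro continuous_on_norm) blast
  then obtain s where s: "s \<in> {0..T}" "\<And>u. u \<in> {0..T} \<Longrightarrow> norm (d u) \<le> norm (d s)"
    using continuous_attains_sup[of "{0..T}" "\<lambda>t. norm (d t)"] t by force
  have "norm (d s - d 0 - s *\<^sub>R 0) \<le> s * (L * norm (d s) + c)"
  proof (rule vector_derivative_bound[OF d])
    show "norm (d' u - 0) \<le> L * norm (d s) + c" if "0 < u" "u < s" for u
      using d'[of u] s(2)[of u] that s(1) mult_left_mono[OF s(2)[of u] \<open>0 \<le> L\<close>] by auto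
  qed (use s in auto)
  also have "\<dots> \<le> T * (L * norm (d s) + c)"
    using s assms by (intro mult_right_mono) auto
  also have "\<dots> = (L * T) * norm (d s) + T * c" by (simp add: algebra_simps)
  also have "\<dots> \<le> 1 / 2 * norm (d s) + T * c"
    using assms by (intro add_mono mult_right_mono) auto
  finally have "norm (d s) \<le> 2 * norm (d 0) + 2 * T * c"
    using norm_triangle_sub[of "d s" "d 0"] by simp
  then show ?thesis using s(2)[OF t] by simp
qed

text \<open>A family of trajectories whose starting point depends on the parameter in an affine way,
  with linear part \<open>\<iota>\<close>. It is stated abstractly because it is used twice: for the
  flow, and for the flow paired with one of its directional derivatives. The convex set
  \<open>K\<close> confines the values, since the field of the second use has a bounded Lipschitz
  derivative only where its second argument is bounded.\<close>

locale small_flow =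
  fixes W :: "real \<Rightarrow> 'a::euclidean_space \<Rightarrow> 'a" and W' :: "real \<Rightarrow> 'a \<Rightarrow> 'a \<Rightarrow> 'a"
    and K :: "'a set" and T L M :: real
    and y :: "real \<Rightarrow> 'p::euclidean_space \<Rightarrow> 'a" and \<iota> :: "'p \<Rightarrow> 'a"
  assumes params: "0 < T" "0 \<le> L" "L * T \<le> 1 / 2" "0 \<le> M" and K: "convex K"
    and deriv: "t \<in> {0..T} \<Longrightarrow> u \<in> K \<Longrightarrow> (W t has_derivative W' t u) (at u)"
    and bound: "t \<in> {0..T} \<Longrightarrow> u \<in> K \<Longrightarrow> norm (W' t u h) \<le> L * norm h"
    and lip: "t \<in> {0..T} \<Longrightarrow> u \<in> K \<Longrightarrow> w \<in> K \<Longrightarrow>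
      norm (W' t u h - W' t w h) \<le> M * norm (u - w) * norm h"
    and inK: "t \<in> {0..T} \<Longrightarrow> y t p \<in> K"
    and traj: "t \<in> {0..T} \<Longrightarrow> ((\<lambda>t. y t p) has_vector_derivative W t (y t p)) (at t within {0..T})"
    and \<iota>: "bounded_linear \<iota>" and initial: "y 0 p - y 0 q = \<iota> (p - q)"
begin

lemma W_lipschitz:
  assumes "t \<in> {0..T}" "u \<in> K" "w \<in> K"
  shows "norm (W t u - W t w) \<le> L * norm (u - w)"
proof (rule differentiable_bound[OF K])
  show "(W t has_derivative W' t v) (at v within K)" if "v \<in> K" for v
    using deriv[OF assms(1) that] by (rule has_derivative_at_withinI)
  show "onorm (W' t v) \<le> L" if "v \<in> K" for v
    using bound[OF assms(1) that] by (intro onorm_bound params)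
qed (use assms in auto)

lemma W_taylor:
  assumes t: "t \<in> {0..T}" and u: "u \<in> K" "w \<in> K"
  shows "norm (W t w - W t u - W' t u (w - u)) \<le> M * (norm (w - u))\<^sup>2"
proof -
  have seg: "closed_segment u w \<subseteq> K" using u K by (simp add: closed_segment_subset)
  have "norm (W t w - W t u - W' t u (w - u)) \<le> norm (w - u) * (M * norm (w - u))"
  proof (rule differentiable_bound_linearization[where S="closed_segment u w" and f'="W' t"])
    show "u + s *\<^sub>R (w - u) \<in> closed_segment u w" if "s \<in> {0..1}" for s
      using that by (auto simp: in_segment algebra_simps intro!: exI[of _ s])
    show "(W t has_derivative W' t v) (at v within closed_segment u w)" if "v \<in> closed_segment u w" for v
      using deriv[OF t] that seg by (auto intro: has_derivative_at_withinI)
    fix v assume v: "v \<in> closed_segment u w"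
    then have vu: "norm (v - u) \<le> norm (w - u)"
      using segment_bound1 by blast
    show "onorm (W' t v - W' t u) \<le> M * norm (w - u)"
    proof (rule onorm_bound)
      fix h
      have "norm (W' t v h - W' t u h) \<le> M * norm (v - u) * norm h"
        using lip[OF t] u v seg by blast
      also have "\<dots> \<le> M * norm (w - u) * norm h"
        using vu params by (intro mult_right_mono mult_left_mono) auto
      finally show "norm ((W' t v - W' t u) h) \<le> M * norm (w - u) * norm h" by simp
    qed (use params in simp)
  qed simp
  then show ?thesis by (simp add: power2_eq_square algebra_simps)
qed

lemma y_lipschitz:
  assumes "t \<in> {0..T}"
  shows "norm (y t p - y t q) \<le> 2 * norm (\<iota> (p - q))"
proof -
  have "norm (y t p - y t q) \<le> 2 * norm (y 0 p - y 0 q) + 2 * T * 0"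
  proof (rule small_time_gronwall[where d="\<lambda>t. y t p - y t q" and L=L and c=0 and T=T])
    show "((\<lambda>t. y t p - y t q) has_vector_derivative W s (y s p) - W s (y s q)) (at s within {0..T})"
      if "s \<in> {0..T}" for s
      using that by (intro has_vector_derivative_diff traj)
    show "norm (W s (y s p) - W s (y s q)) \<le> L * norm (y s p - y s q) + 0" if "s \<in> {0..T}" for s
      using W_lipschitz[OF that inK[OF that] inK[OF that]] by simp
  qed (use params assms in auto)
  then show ?thesis by (simp add: initial)
qed

text \<open>
  The difference quotients in \<open>p\<close> form a Cauchy family by Gronwall's inequality. So the derivative \<open>Q\<close>
  and its linear differential equation are obtained without an existence theorem for that equation.
\<close>

definition quot :: "'p \<Rightarrow> 'p \<Rightarrow> real \<Rightarrow> real \<Rightarrow> 'a" where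
  "quot p h s t = (y t (p + s *\<^sub>R h) - y t p) /\<^sub>R s"

definition quot' :: "'p \<Rightarrow> 'p \<Rightarrow> real \<Rightarrow> real \<Rightarrow> 'a" where
  "quot' p h s t = (W t (y t (p + s *\<^sub>R h)) - W t (y t p)) /\<^sub>R s"

lemma \<iota>_scaleR: "\<iota> (s *\<^sub>R h) = s *\<^sub>R \<iota> h"
  using \<iota> by (simp add: bounded_linear.linear linear_scale)

lemma quot_bound:
  assumes "t \<in> {0..T}" "s \<noteq> 0"
  shows "norm (quot p h s t) \<le> 2 * norm (\<iota> h)"
proof -
  have "norm (y t (p + s *\<^sub>R h) - y t p) \<le> \<bar>s\<bar> * (2 * norm (\<iota> h))"
    using y_lipschitz[OF assms(1), of "p + s *\<^sub>R h" p] by (simp add: \<iota>_scaleR)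
  moreover have "norm (quot p h s t) = norm (y t (p + s *\<^sub>R h) - y t p) / \<bar>s\<bar>"
    by (simp add: quot_def divide_inverse mult.commute)
  ultimately show ?thesis using assms(2) by (simp add: pos_divide_le_eq mult.commute)
qed

lemma quot_derivative:
  assumes "t \<in> {0..T}"
  shows "(quot p h s has_vector_derivative quot' p h s t) (at t within {0..T})"
  unfolding quot_def[abs_def] quot'_def
  using bounded_linear.has_vector_derivative[OF bounded_linear_scaleR_right
      has_vector_derivative_diff[OF traj traj, OF assms assms]] .

text \<open>By the quadratic Taylor bound the quotients solve the linearised equation up to an error
  of order \<open>s\<close>. The 4 is the square of the Lipschitz constant 2 of the flow.\<close>

lemma quot_linearized:
  assumes t: "t \<in> {0..T}" and s: "s \<noteq> 0"
  shows "norm (quot' p h s t - W' t (y t p) (quot p h s t)) \<le> \<bar>s\<bar> * (4 * M * (norm (\<iota> h))\<^sup>2)"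
proof -
  interpret bounded_linear "W' t (y t p)"
    using deriv[OF t inK[OF t]] has_derivative_bounded_linear by blast
  let ?d = "y t (p + s *\<^sub>R h) - y t p"
  have W'q: "W' t (y t p) (quot p h s t) = W' t (y t p) ?d /\<^sub>R s"
    by (simp only: quot_def scaleR)
  have "norm (quot' p h s t - W' t (y t p) (quot p h s t))
      = norm ((W t (y t (p + s *\<^sub>R h)) - W t (y t p) - W' t (y t p) ?d) /\<^sub>R s)"
    by (simp only: quot'_def W'q scaleR_diff_right[symmetric])
  also have "\<dots> \<le> M * (norm ?d)\<^sup>2 / \<bar>s\<bar>"
    using divide_right_mono[OF W_taylor[OF t inK[OF t] inK[OF t], of "p + s *\<^sub>R h" p], of "\<bar>s\<bar>"]
    by (simp add: divide_inverse mult.commute)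
  also have "\<dots> \<le> M * (2 * \<bar>s\<bar> * norm (\<iota> h))\<^sup>2 / \<bar>s\<bar>"
    using y_lipschitz[OF t, of "p + s *\<^sub>R h" p] params
    by (intro divide_right_mono mult_left_mono power_mono) (auto simp: \<iota>_scaleR)
  also have "\<dots> = \<bar>s\<bar> * (4 * M * (norm (\<iota> h))\<^sup>2)"
    using s by (simp add: power2_eq_square)
  finally show ?thesis .
qed

text \<open>All quotients start at \<open>\<iota> h\<close>, so the difference of two of them is
  driven only by their linearisation errors.\<close>

lemma quot_cauchy:
  assumes t: "t \<in> {0..T}" and s: "s \<noteq> 0" "r \<noteq> 0"
  shows "norm (quot p h s t - quot p h r t) \<le> (\<bar>s\<bar> + \<bar>r\<bar>) * (8 * T * M * (norm (\<iota> h))\<^sup>2)"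
proof -
  let ?d = "\<lambda>t. quot p h s t - quot p h r t" and ?c = "(\<bar>s\<bar> + \<bar>r\<bar>) * (4 * M * (norm (\<iota> h))\<^sup>2)"
  have "norm (?d t) \<le> 2 * norm (?d 0) + 2 * T * ?c"
  proof (rule small_time_gronwall[where d="?d" and L=L and T=T])
    fix u assume u: "u \<in> {0..T}"
    show "(?d has_vector_derivative quot' p h s u - quot' p h r u) (at u within {0..T})"
      using u by (intro has_vector_derivative_diff quot_derivative)
    interpret bounded_linear "W' u (y u p)"
      using deriv[OF u inK[OF u]] has_derivative_bounded_linear by blast
    have "quot' p h s u - quot' p h r u = W' u (y u p) (?d u)
       + (quot' p h s u - W' u (y u p) (quot p h s u)) - (quot' p h r u - W' u (y u p) (quot p h r u))"
      by (simp add: diff)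
    also have "norm \<dots> \<le> L * norm (?d u) + \<bar>s\<bar> * (4 * M * (norm (\<iota> h))\<^sup>2) + \<bar>r\<bar> * (4 * M * (norm (\<iota> h))\<^sup>2)"
      by (intro norm_triangle_le_diff norm_triangle_le add_mono bound quot_linearized u inK s)
    finally show "norm (quot' p h s u - quot' p h r u) \<le> L * norm (?d u) + ?c"
      by (simp add: algebra_simps)
  qed (use params t in auto)
  moreover have "?d 0 = 0"
    using initial[of "p + s *\<^sub>R h" p] initial[of "p + r *\<^sub>R h" p] s by (simp add: quot_def \<iota>_scaleR)
  ultimately show ?thesis by (simp add: algebra_simps)
qed

text \<open>One sequence of steps is enough to define the limit, because the Cauchy estimate
  compares it with every other nonzero step; \<open>quot_error\<close> records the result.\<close>

definition Q :: "real \<Rightarrow> 'p \<Rightarrow> 'p \<Rightarrow> 'a" where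
  "Q t p h = lim (\<lambda>n. quot p h (inverse (real (Suc n))) t)"

lemma quot_tendsto:
  assumes t: "t \<in> {0..T}"
  shows "(\<lambda>n. quot p h (inverse (real (Suc n))) t) \<longlonglongrightarrow> Q t p h"
proof -
  let ?C = "8 * T * M * (norm (\<iota> h))\<^sup>2"
  have "Cauchy (\<lambda>n. quot p h (inverse (real (Suc n))) t)"
  proof (rule metric_CauchyI)
    fix e :: real assume e: "e > 0"
    have "(\<lambda>n. inverse (real (Suc n)) * (2 * ?C)) \<longlonglongrightarrow> 0 * (2 * ?C)"
      by (intro tendsto_intros LIMSEQ_inverse_real_of_nat)
    then have "\<forall>\<^sub>F n in sequentially. inverse (real (Suc n)) * (2 * ?C) < e"
      using e by (intro order_tendstoD) auto
    then obtain N where N: "inverse (real (Suc N)) * (2 * ?C) < e"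
      by (auto simp: eventually_sequentially)
    show "\<exists>N. \<forall>m\<ge>N. \<forall>n\<ge>N. dist (quot p h (inverse (real (Suc m))) t) (quot p h (inverse (real (Suc n))) t) < e"
    proof (intro exI[of _ N] allI impI)
      fix m n assume "m \<ge> N" "n \<ge> N"
      then have le: "inverse (real (Suc m)) \<le> inverse (real (Suc N))" "inverse (real (Suc n)) \<le> inverse (real (Suc N))"
        by (auto intro!: le_imp_inverse_le simp del: of_nat_Suc)
      have "dist (quot p h (inverse (real (Suc m))) t) (quot p h (inverse (real (Suc n))) t)
          \<le> (\<bar>inverse (real (Suc m))\<bar> + \<bar>inverse (real (Suc n))\<bar>) * ?C"
        unfolding dist_norm by (intro quot_cauchy t) auto
      also have "\<dots> \<le> (inverse (real (Suc N)) + inverse (real (Suc N))) * ?C"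
      proof (rule mult_right_mono)
        have "inverse (real (Suc k)) > 0" for k by simp
        from this[of m] this[of n] show "\<bar>inverse (real (Suc m))\<bar> + \<bar>inverse (real (Suc n))\<bar>
            \<le> inverse (real (Suc N)) + inverse (real (Suc N))"
          using le by linarith
      qed (use params in simp)
      also have "\<dots> < e" using N by (simp add: algebra_simps)
      finally show "dist (quot p h (inverse (real (Suc m))) t) (quot p h (inverse (real (Suc n))) t) < e" .
    qed
  qed
  then show ?thesis
    unfolding Q_def using Cauchy_convergent convergent_LIMSEQ_iff by blast
qed

lemma quot_error:
  assumes t: "t \<in> {0..T}" and s: "s \<noteq> 0"
  shows "norm (quot p h s t - Q t p h) \<le> \<bar>s\<bar> * (8 * T * M * (norm (\<iota> h))\<^sup>2)"
proof (rule tendsto_le[OF sequentially_bot])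
  let ?C = "8 * T * M * (norm (\<iota> h))\<^sup>2"
  show "(\<lambda>n. norm (quot p h s t - quot p h (inverse (real (Suc n))) t)) \<longlonglongrightarrow> norm (quot p h s t - Q t p h)"
    by (intro tendsto_intros quot_tendsto t)
  have "(\<lambda>n. (\<bar>s\<bar> + inverse (real (Suc n))) * ?C) \<longlonglongrightarrow> (\<bar>s\<bar> + 0) * ?C"
    by (intro tendsto_intros LIMSEQ_inverse_real_of_nat)
  then show "(\<lambda>n. (\<bar>s\<bar> + inverse (real (Suc n))) * ?C) \<longlonglongrightarrow> \<bar>s\<bar> * ?C" by simp
  show "\<forall>\<^sub>F n in sequentially. norm (quot p h s t - quot p h (inverse (real (Suc n))) t)
      \<le> (\<bar>s\<bar> + inverse (real (Suc n))) * ?C"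
  proof (intro always_eventually allI)
    fix n
    have "inverse (real (Suc n)) > 0" by simp
    then show "norm (quot p h s t - quot p h (inverse (real (Suc n))) t) \<le> (\<bar>s\<bar> + inverse (real (Suc n))) * ?C"
      using quot_cauchy[OF t s, of "inverse (real (Suc n))" p h] by (simp del: of_nat_Suc)
  qed
qed

lemma Q_bound: "t \<in> {0..T} \<Longrightarrow> norm (Q t p h) \<le> 2 * norm (\<iota> h)"
  by (rule Lim_norm_ubound[OF sequentially_bot quot_tendsto])
    (auto intro!: always_eventually quot_bound simp del: of_nat_Suc)

lemma Q_initial: "Q 0 p h = \<iota> h"
proof -
  have "quot p h (inverse (real (Suc n))) 0 = \<iota> h" for n
    using initial[of "p + inverse (real (Suc n)) *\<^sub>R h" p] by (simp add: quot_def \<iota>_scaleR)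
  then show ?thesis
    using quot_tendsto[of 0 p h] params by (simp add: LIMSEQ_const_iff)
qed

text \<open>A limit of functions with uniformly convergent derivatives is differentiable. The
  derivatives \<open>quot'\<close> converge uniformly in time, because the linearisation error and
  the distance of a quotient to its limit are both of the order of the step.\<close>

lemma Q_ode:
  assumes t: "t \<in> {0..T}"
  shows "((\<lambda>t. Q t p h) has_vector_derivative W' t (y t p) (Q t p h)) (at t within {0..T})"
proof -
  let ?s = "\<lambda>n. inverse (real (Suc n))" and ?C = "8 * T * M * (norm (\<iota> h))\<^sup>2" and ?D = "4 * M * (norm (\<iota> h))\<^sup>2"
  have "\<exists>g. \<forall>u\<in>{0..T}. (\<lambda>n. quot p h (?s n) u) \<longlonglongrightarrow> g u \<and>
     (g has_derivative (\<lambda>r. r *\<^sub>R W' u (y u p) (Q u p h))) (at u within {0..T})"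
  proof (rule has_derivative_sequence)
    show "(quot p h (?s n) has_derivative (\<lambda>r. r *\<^sub>R quot' p h (?s n) u)) (at u within {0..T})"
      if "u \<in> {0..T}" for n u
      using quot_derivative[OF that] by (simp add: has_vector_derivative_def)
    show "0 \<in> {0..T}" using params by simp
    then show "(\<lambda>n. quot p h (?s n) 0) \<longlonglongrightarrow> Q 0 p h" by (rule quot_tendsto)
    fix e :: real assume e: "e > 0"
    have "(\<lambda>n. ?s n * (L * ?C + ?D)) \<longlonglongrightarrow> 0 * (L * ?C + ?D)"
      by (intro tendsto_intros LIMSEQ_inverse_real_of_nat)
    then have "\<forall>\<^sub>F n in sequentially. ?s n * (L * ?C + ?D) < e"
      using e by (intro order_tendstoD) auto
    then show "\<forall>\<^sub>F n in sequentially. \<forall>u\<in>{0..T}. \<forall>r.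
        norm (r *\<^sub>R quot' p h (?s n) u - r *\<^sub>R W' u (y u p) (Q u p h)) \<le> e * norm r"
    proof eventually_elim
      case (elim n)
      show ?case
      proof (intro ballI allI)
        fix u r assume u: "u \<in> {0..T}"
        interpret bounded_linear "W' u (y u p)"
          using deriv[OF u inK[OF u]] has_derivative_bounded_linear by blast
        have "quot' p h (?s n) u - W' u (y u p) (Q u p h)
          = (quot' p h (?s n) u - W' u (y u p) (quot p h (?s n) u)) + W' u (y u p) (quot p h (?s n) u - Q u p h)"
          by (simp add: diff)
        also have "norm \<dots> \<le> \<bar>?s n\<bar> * ?D + L * (\<bar>?s n\<bar> * ?C)"
          by (intro norm_triangle_le add_mono quot_linearized order_trans[OF bound mult_left_mono] quot_error u inK params) auto
        also have "\<dots> = ?s n * (L * ?C + ?D)" by (simp add: algebra_simps)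
        also have "\<dots> \<le> e" using elim by simp
        finally have "norm (quot' p h (?s n) u - W' u (y u p) (Q u p h)) \<le> e" .
        then have "\<bar>r\<bar> * norm (quot' p h (?s n) u - W' u (y u p) (Q u p h)) \<le> \<bar>r\<bar> * e"
          by (intro mult_left_mono) auto
        then show "norm (r *\<^sub>R quot' p h (?s n) u - r *\<^sub>R W' u (y u p) (Q u p h)) \<le> e * norm r"
          by (simp add: scaleR_diff_right[symmetric] mult.commute del: of_nat_Suc)
      qed
    qed
  qed simp
  then obtain g where g: "\<And>u. u \<in> {0..T} \<Longrightarrow> (\<lambda>n. quot p h (?s n) u) \<longlonglongrightarrow> g u"
    "\<And>u. u \<in> {0..T} \<Longrightarrow> (g has_derivative (\<lambda>r. r *\<^sub>R W' u (y u p) (Q u p h))) (at u within {0..T})"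
    by blast
  have "g u = Q u p h" if "u \<in> {0..T}" for u
    using LIMSEQ_unique[OF g(1)[OF that] quot_tendsto[OF that]] .
  then show ?thesis
    using g(2)[OF t] t unfolding has_vector_derivative_def
    by (metis (no_types, lifting) has_derivative_transform)
qed

text \<open>The defect of additivity or homogeneity solves the same linear equation with initial
  value zero, so it vanishes by the Gronwall bound.\<close>

lemma Q_linear:
  assumes t: "t \<in> {0..T}"
  shows "linear (Q t p)"
proof -
  have uniq: "d t = 0"
    if d: "\<And>u. u \<in> {0..T} \<Longrightarrow> (d has_vector_derivative W' u (y u p) (d u)) (at u within {0..T})" "d 0 = 0"
    for d :: "real \<Rightarrow> 'a"
  proof -
    have "norm (d t) \<le> 2 * norm (d 0) + 2 * T * 0"
      by (rule small_time_gronwall[where L=L and T=T, OF d(1)]) (use bound inK params t in auto)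
    then show ?thesis using d(2) by simp
  qed
  have lin: "bounded_linear (W' u (y u p))" if "u \<in> {0..T}" for u
    using deriv[OF that inK[OF that]] has_derivative_bounded_linear by blast
  interpret \<iota>: bounded_linear \<iota> by (rule \<iota>)
  show ?thesis
  proof (rule linearI)
    fix h k
    have "Q t p (h + k) - Q t p h - Q t p k = 0"
    proof (rule uniq)
      fix u assume u: "u \<in> {0..T}"
      interpret bounded_linear "W' u (y u p)" by (rule lin[OF u])
      show "((\<lambda>t. Q t p (h + k) - Q t p h - Q t p k) has_vector_derivative
          W' u (y u p) (Q u p (h + k) - Q u p h - Q u p k)) (at u within {0..T})"
        unfolding diff by (intro has_vector_derivative_diff Q_ode u)
    qed (simp add: Q_initial \<iota>.add)
    then show "Q t p (h + k) = Q t p h + Q t p k" by (simp add: algebra_simps)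
  next
    fix c h
    have "Q t p (c *\<^sub>R h) - c *\<^sub>R Q t p h = 0"
    proof (rule uniq)
      fix u assume u: "u \<in> {0..T}"
      interpret bounded_linear "W' u (y u p)" by (rule lin[OF u])
      show "((\<lambda>t. Q t p (c *\<^sub>R h) - c *\<^sub>R Q t p h) has_vector_derivative
          W' u (y u p) (Q u p (c *\<^sub>R h) - c *\<^sub>R Q u p h)) (at u within {0..T})"
        unfolding diff scaleR
        by (intro has_vector_derivative_diff Q_ode u
            bounded_linear.has_vector_derivative[OF bounded_linear_scaleR_right])
    qed (simp add: Q_initial \<iota>_scaleR)
    then show "Q t p (c *\<^sub>R h) = c *\<^sub>R Q t p h" by simp
  qed
qed

text \<open>The error bound for quotients is quadratic in the direction. Used with step 1 and
  direction \<open>q - p\<close> it becomes the remainder estimate of a Frechet derivative.\<close>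

lemma y_has_derivative:
  assumes t: "t \<in> {0..T}"
  shows "(y t has_derivative Q t p) (at p)"
proof -
  obtain B where B: "\<And>h. norm (\<iota> h) \<le> norm h * B" "B > 0"
    using bounded_linear.pos_bounded[OF \<iota>] by blast
  let ?C = "8 * T * M"
  have err: "norm (y t q - y t p - Q t p (q - p)) \<le> ?C * B\<^sup>2 * norm (q - p) * norm (q - p)" for q
  proof -
    have "norm (y t q - y t p - Q t p (q - p)) \<le> ?C * (norm (\<iota> (q - p)))\<^sup>2"
      using quot_error[OF t, of 1 p "q - p"] by (simp add: quot_def)
    also have "\<dots> \<le> ?C * (norm (q - p) * B)\<^sup>2"
      using B(1) params by (intro mult_left_mono power_mono) auto
    finally show ?thesis by (simp add: power2_eq_square algebra_simps)
  qed
  have bl: "bounded_linear (Q t p)" using Q_linear[OF t] linear_conv_bounded_linear by blast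
  show ?thesis
  unfolding has_derivative_at_alt
  proof (intro conjI bl allI impI)
    fix e :: real assume e: "e > 0"
    let ?c = "?C * B\<^sup>2"
    have c: "?c \<ge> 0" using params by simp
    show "\<exists>d>0. \<forall>q. norm (q - p) < d \<longrightarrow> norm (y t q - y t p - Q t p (q - p)) \<le> e * norm (q - p)"
    proof (intro exI[of _ "e / (?c + 1)"] conjI allI impI)
      show "e / (?c + 1) > 0" using c by (intro divide_pos_pos e) linarith
      fix q assume q: "norm (q - p) < e / (?c + 1)"
      have "?c * norm (q - p) \<le> (?c + 1) * norm (q - p)" by (simp add: algebra_simps)
      also have "\<dots> \<le> e" using q c by (simp add: field_simps)
      finally have "?c * norm (q - p) * norm (q - p) \<le> e * norm (q - p)"
        by (intro mult_right_mono) auto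
      then show "norm (y t q - y t p - Q t p (q - p)) \<le> e * norm (q - p)"
        using err[of q] by simp
    qed
  qed
qed

text \<open>The difference of two solutions with different base points satisfies a Gronwall
  inequality whose inhomogeneity is the change of \<open>W'\<close> between the two
  trajectories.\<close>

lemma Q_continuous:
  assumes t: "t \<in> {0..T}"
  shows "continuous_on UNIV (\<lambda>p. Q t p h)"
proof -
  obtain B where B: "\<And>h. norm (\<iota> h) \<le> norm h * B" "B > 0"
    using bounded_linear.pos_bounded[OF \<iota>] by blast
  have est: "norm (Q t p h - Q t q h) \<le> 8 * T * M * norm (\<iota> h) * norm (\<iota> (p - q))" for p q
  proof -
    let ?d = "\<lambda>t. Q t p h - Q t q h" and ?c = "M * (2 * norm (\<iota> (p - q))) * (2 * norm (\<iota> h))"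
    have "norm (?d t) \<le> 2 * norm (?d 0) + 2 * T * ?c"
    proof (rule small_time_gronwall[where d="?d" and L=L and T=T])
      fix u assume u: "u \<in> {0..T}"
      show "(?d has_vector_derivative W' u (y u p) (Q u p h) - W' u (y u q) (Q u q h)) (at u within {0..T})"
        by (intro has_vector_derivative_diff Q_ode u)
      interpret bounded_linear "W' u (y u p)"
        using deriv[OF u inK[OF u]] has_derivative_bounded_linear by blast
      have "W' u (y u p) (Q u p h) - W' u (y u q) (Q u q h)
        = W' u (y u p) (?d u) + (W' u (y u p) (Q u q h) - W' u (y u q) (Q u q h))"
        by (simp add: diff)
      also have "norm \<dots> \<le> L * norm (?d u) + ?c"
        by (intro norm_triangle_le add_mono bound u inK order_trans[OF lip mult_mono]
            mult_left_mono y_lipschitz Q_bound mult_nonneg_nonneg params norm_ge_zero) auto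
      finally show "norm (W' u (y u p) (Q u p h) - W' u (y u q) (Q u q h)) \<le> L * norm (?d u) + ?c" .
    qed (use params t in auto)
    then show ?thesis by (simp add: Q_initial algebra_simps)
  qed
  show ?thesis
    unfolding continuous_on_iff
  proof (intro ballI allI impI)
    fix p :: 'p and e :: real assume e: "e > 0"
    let ?c = "8 * T * M * norm (\<iota> h) * B"
    have c: "?c \<ge> 0" using params B by simp
    show "\<exists>d>0. \<forall>q\<in>UNIV. dist q p < d \<longrightarrow> dist (Q t q h) (Q t p h) < e"
    proof (intro exI[of _ "e / (?c + 1)"] conjI ballI impI)
      show "e / (?c + 1) > 0" using c by (intro divide_pos_pos e) linarith
      fix q assume q: "dist q p < e / (?c + 1)"
      have "dist (Q t q h) (Q t p h) \<le> 8 * T * M * norm (\<iota> h) * norm (\<iota> (q - p))"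
        using est by (simp add: dist_norm)
      also have "\<dots> \<le> 8 * T * M * norm (\<iota> h) * (norm (q - p) * B)"
        using params B by (intro mult_left_mono) auto
      also have "\<dots> \<le> (?c + 1) * dist q p" by (simp add: dist_norm algebra_simps)
      also have "\<dots> < e" using q c by (simp add: field_simps)
      finally show "dist (Q t q h) (Q t p h) < e" .
    qed
  qed
qed

end

text \<open>
  Uniform convergence as \<open>t \<searrow> 0\<close> near a point \<open>p\<close> is expressed by convergence of functions of
  \<open>(t, q)\<close> along the following filter, for which the usual limit theorems are available.
\<close>

abbreviation near :: "'a::topological_space \<Rightarrow> (real \<times> 'a) filter" where
  "near p \<equiv> at_right 0 \<times>\<^sub>F nhds p"

lemma eventually_near_time: "eventually P (at_right 0) \<Longrightarrow> \<forall>\<^sub>F (t, q) in near p. P t"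
  unfolding case_prod_unfold by (rule eventually_compose_filterlim[OF _ filterlim_fst])

lemma eventually_near_space: "eventually P (nhds p) \<Longrightarrow> \<forall>\<^sub>F (t, q) in near p. P q"
  unfolding case_prod_unfold by (rule eventually_compose_filterlim[OF _ filterlim_snd])

lemma eventually_near_product:
  assumes "\<forall>\<^sub>F (t, q) in near p. P t q"
  shows "\<exists>d>0. \<exists>S. open S \<and> p \<in> S \<and> (\<forall>t q. 0 < t \<longrightarrow> t < d \<longrightarrow> q \<in> S \<longrightarrow> P t q)"
proof -
  obtain A B where "eventually A (at_right 0)" "eventually B (nhds p)" and AB: "\<And>t q. A t \<Longrightarrow> B q \<Longrightarrow> P t q"
    using assms by (auto simp: eventually_prod_filter)
  then obtain d S where "d > 0" "\<And>t. 0 < t \<Longrightarrow> t < d \<Longrightarrow> A t" "open S" "p \<in> S" "\<And>q. q \<in> S \<Longrightarrow> B q"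
    by (auto simp: eventually_at_right[of 0 1] eventually_nhds)
  then show ?thesis using AB by (intro exI[of _ d]) blast
qed

lemma tendsto_near_space: "(f \<longlongrightarrow> l) (nhds p) \<Longrightarrow> ((\<lambda>(t, q). f q) \<longlongrightarrow> l) (near p)"
  unfolding case_prod_unfold by (rule filterlim_compose[OF _ filterlim_snd])

lemma tendsto_near_time: "(f \<longlongrightarrow> l) (at_right 0) \<Longrightarrow> ((\<lambda>(t, q). f t) \<longlongrightarrow> l) (near p)"
  unfolding case_prod_unfold by (rule filterlim_compose[OF _ filterlim_fst])

lemma isCont_near: "isCont f p \<Longrightarrow> ((\<lambda>(t, q). f q) \<longlongrightarrow> f p) (near p)"
  by (rule tendsto_near_space) (simp add: isCont_def tendsto_at_iff_tendsto_nhds)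

text \<open>Uniform convergence of the functions allows their arguments to move with time; this is
  how continuity of the velocity in time enters.\<close>

lemma tendsto_near_uniform:
  fixes f :: "real \<Rightarrow> 'b::metric_space \<Rightarrow> 'c::real_normed_vector"
  assumes f: "uniform_limit UNIV f g (at_right 0)" and g: "isCont g u0"
    and u: "((\<lambda>(t, q). u t q) \<longlongrightarrow> u0) (near p)"
  shows "((\<lambda>(t, q). f t (u t q)) \<longlongrightarrow> g u0) (near p)"
proof -
  have "((\<lambda>(t, q). f t (u t q) - g (u t q)) \<longlongrightarrow> 0) (near p)"
  proof (rule tendstoI)
    fix e :: real assume "e > 0"
    then have "\<forall>\<^sub>F t in at_right 0. \<forall>v. dist (f t v) (g v) < e"
      using f by (auto simp: uniform_limit_iff)
    from eventually_near_time[OF this, of p]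
    show "\<forall>\<^sub>F z in near p. dist (case z of (t, q) \<Rightarrow> f t (u t q) - g (u t q)) 0 < e"
      by eventually_elim (auto simp: dist_norm)
  qed
  moreover have "((\<lambda>(t, q). g (u t q)) \<longlongrightarrow> g u0) (near p)"
    using isCont_tendsto_compose[OF g u] by (simp add: case_prod_unfold)
  ultimately show ?thesis
    using tendsto_add by (fastforce simp: case_prod_unfold)
qed

lemma tendsto_near_trajectory:
  fixes c :: "real \<Rightarrow> 'p::t2_space \<Rightarrow> 'b::real_inner"
  assumes T: "0 < T"
    and c: "\<And>t q. t \<in> {0..T} \<Longrightarrow> ((\<lambda>t. c t q) has_vector_derivative c' t q) (at t within {0..T})"
    and B: "\<And>t q. t \<in> {0..T} \<Longrightarrow> norm (c' t q) \<le> B"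
    and c0: "isCont (c 0) p"
  shows "((\<lambda>(t, q). c t q) \<longlongrightarrow> c 0 p) (near p)"
proof -
  have "((\<lambda>(t, q). c t q - c 0 q) \<longlongrightarrow> 0) (near p)"
  proof (rule Lim_null_comparison)
    have "\<forall>\<^sub>F t in at_right 0. t \<in> {0<..<T}" using T by (rule eventually_at_right_real)
    from eventually_near_time[OF this, of p]
    show "\<forall>\<^sub>F z in near p. norm (case z of (t, q) \<Rightarrow> c t q - c 0 q) \<le> (case z of (t, q) \<Rightarrow> t * B)"
    proof eventually_elim
      case (elim z)
      obtain t q where z: "z = (t, q)" by (cases z)
      have "norm (c t q - c 0 q - t *\<^sub>R 0) \<le> t * B"
        by (rule vector_derivative_bound[OF c]) (use elim z B in auto)
      then show ?case by (simp add: z)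
    qed
    show "((\<lambda>(t, q). t * B) \<longlongrightarrow> 0) (near p)"
      by (rule tendsto_near_time) (rule tendsto_eq_intros refl | simp)+
  qed
  from tendsto_add[OF this isCont_near[OF c0]] show ?thesis
    by (simp add: case_prod_unfold)
qed

lemma trajectory_quotient:
  fixes c :: "real \<Rightarrow> 'p::t2_space \<Rightarrow> 'b::real_inner"
  assumes T: "0 < T"
    and c: "\<And>t q. t \<in> {0..T} \<Longrightarrow> ((\<lambda>t. c t q) has_vector_derivative c' t q) (at t within {0..T})"
    and lim: "((\<lambda>(t, q). c' t q) \<longlongrightarrow> l) (near p)"
  shows "((\<lambda>(t, q). (c t q - c 0 q) /\<^sub>R t) \<longlongrightarrow> l) (near p)"
proof (rule tendstoI)
  fix e :: real assume e: "e > 0"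
  then have "\<forall>\<^sub>F z in near p. dist (case z of (t, q) \<Rightarrow> c' t q) l < e / 2"
    using lim by (intro tendstoD) auto
  then have "\<forall>\<^sub>F (t, q) in near p. norm (c' t q - l) < e / 2"
    by (simp add: case_prod_unfold dist_norm)
  \<comment> \<open>The mean value inequality runs over all times between 0 and \<open>t\<close>
    with \<open>q\<close> fixed, so closeness of the velocity to \<open>l\<close> is needed on a
    product neighbourhood.\<close>
  then obtain d S where d: "d > 0" "open S" "p \<in> S"
    "\<And>t q. 0 < t \<Longrightarrow> t < d \<Longrightarrow> q \<in> S \<Longrightarrow> norm (c' t q - l) < e / 2"
    using eventually_near_product by (metis (no_types, lifting))
  have "\<forall>\<^sub>F t in at_right 0. t \<in> {0<..<min d T}" using T d by (intro eventually_at_right_real) auto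
  moreover have "\<forall>\<^sub>F q in nhds p. q \<in> S" using d by (simp add: eventually_nhds_in_open)
  ultimately have "\<forall>\<^sub>F (t, q) in near p. t \<in> {0<..<min d T} \<and> q \<in> S"
    by (auto simp: eventually_prod_filter)
  then show "\<forall>\<^sub>F z in near p. dist (case z of (t, q) \<Rightarrow> (c t q - c 0 q) /\<^sub>R t) l < e"
  proof eventually_elim
    case (elim z)
    obtain t q where z: "z = (t, q)" by (cases z)
    have t: "0 < t" "t < d" "t < T" "q \<in> S" using elim z by auto
    have "norm (c t q - c 0 q - t *\<^sub>R l) \<le> t * (e / 2)"
      by (rule vector_derivative_bound[OF c]) (use t d in \<open>auto intro: less_imp_le\<close>)
    moreover have "(c t q - c 0 q) /\<^sub>R t - l = (c t q - c 0 q - t *\<^sub>R l) /\<^sub>R t"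
      using t by (simp add: scaleR_diff_right)
    then have "norm ((c t q - c 0 q) /\<^sub>R t - l) = norm (c t q - c 0 q - t *\<^sub>R l) / t"
      using t by (simp add: divide_inverse mult.commute)
    ultimately have "norm ((c t q - c 0 q) /\<^sub>R t - l) \<le> e / 2"
      using t by (simp add: pos_divide_le_eq mult.commute)
    then show ?case using e by (simp add: z dist_norm)
  qed
qed

section \<open>The flow of a C^3 velocity and its second derivatives in space\<close>

lemma dd_bound_of_basis:
  fixes f :: "'a::euclidean_space \<Rightarrow> 'b::real_normed_vector"
  assumes "f differentiable (at x)" "\<And>b. b \<in> Basis \<Longrightarrow> norm (dd f x b) \<le> C"
  shows "norm (dd f x h) \<le> real DIM('a) * C * norm h"
proof -
  have "norm (dd f x h) \<le> (\<Sum>b\<in>Basis. norm ((h \<bullet> b) *\<^sub>R dd f x b))"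
    unfolding dd_basis_expansion[OF assms(1), of h] by (rule norm_sum)
  also have "\<dots> \<le> (\<Sum>b\<in>(Basis::'a set). norm h * C)"
  proof (rule sum_mono)
    fix b :: 'a assume b: "b \<in> Basis"
    show "norm ((h \<bullet> b) *\<^sub>R dd f x b) \<le> norm h * C"
      unfolding norm_scaleR using b
      by (intro mult_mono assms(2)) (simp_all add: Basis_le_norm)
  qed
  finally show ?thesis by (simp add: algebra_simps)
qed

lemma lipschitz_of_dd:
  fixes f :: "'a::real_normed_vector \<Rightarrow> 'b::real_normed_vector"
  assumes "\<And>x. f differentiable (at x)" "\<And>x h. norm (dd f x h) \<le> C * norm h" "0 \<le> C"
  shows "norm (f x - f y) \<le> C * norm (x - y)"
  using assms by (intro differentiable_bound[of UNIV f "dd f"] onorm_bound) (auto intro: has_derivative_dd)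

lemma dd_dd_expansion:
  fixes f :: "'a::euclidean_space \<Rightarrow> 'b::real_normed_vector"
  assumes f: "Ck_on 2 f UNIV"
  shows "((\<lambda>u. dd f u h) has_derivative (\<lambda>k. \<Sum>b\<in>Basis. (h \<bullet> b) *\<^sub>R dd (\<lambda>u. dd f u b) x k)) (at x)"
    and "dd (\<lambda>u. dd f u h) x k = (\<Sum>b\<in>Basis. (h \<bullet> b) *\<^sub>R dd (\<lambda>u. dd f u b) x k)"
proof -
  have d: "f differentiable (at u)" "(\<lambda>u. dd f u h) differentiable (at u)" for u h
    using f by (auto simp: numeral_2_eq_2)
  have eq: "(\<lambda>u. dd f u h) = (\<lambda>u. \<Sum>b\<in>Basis. (h \<bullet> b) *\<^sub>R dd f u b)"
    by (rule ext) (rule dd_basis_expansion[OF d(1)])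
  show *: "((\<lambda>u. dd f u h) has_derivative (\<lambda>k. \<Sum>b\<in>Basis. (h \<bullet> b) *\<^sub>R dd (\<lambda>u. dd f u b) x k)) (at x)"
    unfolding eq
    by (rule has_derivative_sum) (rule has_derivative_scaleR_right[OF has_derivative_dd[OF d(2)]])
  show "dd (\<lambda>u. dd f u h) x k = (\<Sum>b\<in>Basis. (h \<bullet> b) *\<^sub>R dd (\<lambda>u. dd f u b) x k)"
    by (rule fun_cong[OF dd_eqI[OF *]])
qed

lemma dd_dd_diff:
  fixes f :: "'a::euclidean_space \<Rightarrow> 'b::real_normed_vector"
  assumes f: "Ck_on 2 f UNIV"
  shows "dd (\<lambda>u. dd f u (h - h')) x k = dd (\<lambda>u. dd f u h) x k - dd (\<lambda>u. dd f u h') x k"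
  by (simp add: dd_dd_expansion(2)[OF f, of h] dd_dd_expansion(2)[OF f, of h']
      dd_dd_expansion(2)[OF f, of "h - h'"] inner_diff_left scaleR_diff_left sum_subtractf)

lemma norm_fst_snd_le: "norm (fst z) \<le> norm z" "norm (snd z) \<le> norm z"
  by (metis norm_fst_le prod.collapse, metis norm_snd_le prod.collapse)

text \<open>Uniform bounds for the field on a short time interval. The smallness
  \<open>4 * C * T \<le> 1 / 2\<close> is dictated by the second flow below, whose field has
  Lipschitz constant \<open>4 * C\<close>. The two uniform limits express continuity at time 0 of
  the first and second derivatives of the field.\<close>

locale C3_flow =
  fixes V x :: "real \<Rightarrow> 'a::euclidean_space \<Rightarrow> 'a" and T C :: real
  assumes params: "0 < T" "0 \<le> C" "4 * C * T \<le> 1 / 2"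
    and C3: "t \<in> {0..T} \<Longrightarrow> Ck_on 3 (V t) UNIV"
    and bound0: "t \<in> {0..T} \<Longrightarrow> norm (V t u) \<le> C"
    and bound1: "t \<in> {0..T} \<Longrightarrow> norm (dd (V t) u h) \<le> C * norm h"
    and bound2: "t \<in> {0..T} \<Longrightarrow> norm (dd (\<lambda>u. dd (V t) u h) u k) \<le> C * norm h * norm k"
    and lip2: "t \<in> {0..T} \<Longrightarrow> norm (dd (\<lambda>u. dd (V t) u h) u k - dd (\<lambda>u. dd (V t) u h) w k)
      \<le> C * norm (u - w) * norm h * norm k"
    and start: "x 0 X = X"
    and traj: "t \<in> {0..T} \<Longrightarrow> ((\<lambda>t. x t X) has_vector_derivative V t (x t X)) (at t within {0..T})"
    and lim1: "uniform_limit UNIV (\<lambda>t u. dd (V t) u h) (\<lambda>u. dd (V 0) u h) (at_right 0)"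
    and lim2: "uniform_limit UNIV (\<lambda>t u. dd (\<lambda>u. dd (V t) u h) u k) (\<lambda>u. dd (\<lambda>u. dd (V 0) u h) u k) (at_right 0)"
begin

lemma C2: "t \<in> {0..T} \<Longrightarrow> Ck_on 2 (V t) UNIV"
  using Ck_on_mono[OF C3] by simp

lemma dV: "t \<in> {0..T} \<Longrightarrow> V t differentiable (at u)"
  using Ck_on_differentiable[OF C3] by simp

lemma ddV: "t \<in> {0..T} \<Longrightarrow> (\<lambda>u. dd (V t) u h) differentiable (at u)"
  using C2 by (simp add: numeral_2_eq_2)

lemma lip1: "t \<in> {0..T} \<Longrightarrow> norm (dd (V t) u h - dd (V t) w h) \<le> C * norm (u - w) * norm h"
  using lipschitz_of_dd[of "\<lambda>u. dd (V t) u h" "C * norm h" u w] ddV bound2[of t h] params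
  by (simp add: mult_ac)

lemma dV_linear: "t \<in> {0..T} \<Longrightarrow> linear (dd (V t) u)"
  using dV dd_linear by blast

sublocale first: small_flow V "\<lambda>t. dd (V t)" UNIV T C C x "\<lambda>h. h"
proof (rule small_flow.intro)
  show "bounded_linear (\<lambda>h::'a. h)" by (rule bounded_linear_ident)
  have "0 \<le> C * T" using params by simp
  then show "C * T \<le> 1 / 2" using params by (simp add: mult.assoc)
qed (use params has_derivative_dd[OF dV] bound1 lip1 traj start in auto)

lemma x_has_derivative: "t \<in> {0..T} \<Longrightarrow> (x t has_derivative first.Q t X) (at X)"
  using first.y_has_derivative .

lemma dd_x: "t \<in> {0..T} \<Longrightarrow> dd (x t) X = first.Q t X"
  using dd_eqI[OF x_has_derivative] .

lemma dd_x_start: "dd (x 0) X h = h"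
  using dd_x[of 0] first.Q_initial params by simp

lemma dd_x_bound: "t \<in> {0..T} \<Longrightarrow> norm (dd (x t) X h) \<le> 2 * norm h"
  using first.Q_bound dd_x by simp

text \<open>
  The pair of \<open>x t\<close> and its derivative in a fixed direction is again a trajectory, of the field \<open>W t\<close>, so
  second derivatives of \<open>x t\<close> are first derivatives of this second flow.
\<close>

definition W :: "real \<Rightarrow> 'a \<times> 'a \<Rightarrow> 'a \<times> 'a" where
  "W t z = (V t (fst z), dd (V t) (fst z) (snd z))"

definition W' :: "real \<Rightarrow> 'a \<times> 'a \<Rightarrow> 'a \<times> 'a \<Rightarrow> 'a \<times> 'a" where
  "W' t z h = (dd (V t) (fst z) (fst h),
    dd (\<lambda>u. dd (V t) u (snd z)) (fst z) (fst h) + dd (V t) (fst z) (snd h))"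

lemma W_has_derivative:
  assumes t: "t \<in> {0..T}"
  shows "(W t has_derivative W' t z) (at z)"
proof -
  have fst: "(fst has_derivative fst) (at z)" and snd: "(snd has_derivative snd) (at z)"
    by (auto intro!: bounded_linear_imp_has_derivative bounded_linear_fst bounded_linear_snd)
  have 1: "((\<lambda>z. V t (fst z)) has_derivative (\<lambda>h. dd (V t) (fst z) (fst h))) (at z)"
    using has_derivative_compose[OF fst has_derivative_dd[OF dV[OF t]]] .
  have 2: "((\<lambda>z. \<Sum>b\<in>Basis. (snd z \<bullet> b) *\<^sub>R dd (V t) (fst z) b) has_derivative
     (\<lambda>h. \<Sum>b\<in>Basis. (snd z \<bullet> b) *\<^sub>R dd (\<lambda>u. dd (V t) u b) (fst z) (fst h) + (snd h \<bullet> b) *\<^sub>R dd (V t) (fst z) b)) (at z)"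
    by (intro has_derivative_sum has_derivative_scaleR has_derivative_inner_left snd
        has_derivative_compose[OF fst, of "\<lambda>u. dd (V t) u _"] has_derivative_dd ddV t)
  have "(\<Sum>b\<in>Basis. (snd z \<bullet> b) *\<^sub>R dd (V t) (fst z) b) = dd (V t) (fst z) (snd z)" for z
    by (rule dd_basis_expansion[OF dV[OF t], symmetric])
  moreover have "(\<Sum>b\<in>Basis. (snd z \<bullet> b) *\<^sub>R dd (\<lambda>u. dd (V t) u b) (fst z) (fst h) + (snd h \<bullet> b) *\<^sub>R dd (V t) (fst z) b)
     = dd (\<lambda>u. dd (V t) u (snd z)) (fst z) (fst h) + dd (V t) (fst z) (snd h)" for h
    unfolding sum.distrib dd_dd_expansion(2)[OF C2[OF t], of "snd z"]
    using dd_basis_expansion[OF dV[OF t], of "fst z" "snd h"] by simp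
  ultimately show ?thesis
    unfolding W_def[abs_def] W'_def[abs_def] using has_derivative_Pair[OF 1 2] by simp
qed

text \<open>In a direction of norm at most 1 the derivative of the flow has norm at most 2, which
  fixes the set of values. The constants add up the parts of \<open>W'\<close> with second argument
  of norm at most 2: \<open>4 * C\<close> is \<open>C + 2 * C + C\<close>, and \<open>5 * C\<close>
  is \<open>C + 2 * C + C + C\<close>.\<close>

lemma second_flow:
  assumes \<xi>: "norm \<xi> \<le> 1"
  shows "small_flow W W' (UNIV \<times> cball 0 2) T (4 * C) (5 * C) (\<lambda>t X. (x t X, dd (x t) X \<xi>)) (\<lambda>h. (h, 0))"
proof (rule small_flow.intro)
  show "0 < T" "0 \<le> 4 * C" "4 * C * T \<le> 1 / 2" "0 \<le> 5 * C" using params by auto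
  show "convex ((UNIV::'a set) \<times> cball (0::'a) 2)" by (simp add: convex_Times)
  show "(W t has_derivative W' t u) (at u)" if "t \<in> {0..T}" for t u using W_has_derivative[OF that] .
  show "bounded_linear (\<lambda>h::'a. (h, 0::'a))"
    by (intro bounded_linear_Pair bounded_linear_ident bounded_linear_zero)
  show "(x 0 p, dd (x 0) p \<xi>) - (x 0 q, dd (x 0) q \<xi>) = (p - q, 0)" for p q
    by (simp add: start dd_x_start)
  show "((\<lambda>t. (x t p, dd (x t) p \<xi>)) has_vector_derivative W t (x t p, dd (x t) p \<xi>)) (at t within {0..T})"
    if t: "t \<in> {0..T}" for t p
  proof -
    have "((\<lambda>t. (x t p, first.Q t p \<xi>)) has_vector_derivative (V t (x t p), dd (V t) (x t p) (first.Q t p \<xi>)))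
        (at t within {0..T})"
      by (intro has_vector_derivative_Pair traj first.Q_ode t)
    then have "((\<lambda>t. (x t p, dd (x t) p \<xi>)) has_vector_derivative (V t (x t p), dd (V t) (x t p) (first.Q t p \<xi>)))
        (at t within {0..T})"
      by (rule has_vector_derivative_transform[OF t, rotated]) (simp add: dd_x)
    then show ?thesis by (simp add: W_def dd_x[OF t])
  qed
  show "(x t p, dd (x t) p \<xi>) \<in> UNIV \<times> cball 0 2" if "t \<in> {0..T}" for t p
    using dd_x_bound[OF that, of p \<xi>] \<xi> by simp
  fix t and u h :: "'a \<times> 'a" assume t: "t \<in> {0..T}" and u: "u \<in> UNIV \<times> cball 0 2"
  have u2: "norm (snd u) \<le> 2" using u by auto
  have "norm (W' t u h) \<le> norm (dd (V t) (fst u) (fst h))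
      + (norm (dd (\<lambda>v. dd (V t) v (snd u)) (fst u) (fst h)) + norm (dd (V t) (fst u) (snd h)))"
    unfolding W'_def using norm_Pair_le norm_triangle_ineq by (smt (verit))
  also have "\<dots> \<le> C * norm h + (C * 2 * norm h + C * norm h)"
    using params u2 norm_fst_snd_le[of h]
    by (intro add_mono order_trans[OF bound1] order_trans[OF bound2] mult_mono t mult_nonneg_nonneg) auto
  finally show "norm (W' t u h) \<le> 4 * C * norm h" by simp
  fix w :: "'a \<times> 'a" assume w: "w \<in> UNIV \<times> cball 0 2"
  let ?D = "\<lambda>\<xi> u k. dd (\<lambda>v. dd (V t) v \<xi>) u k"
  have split: "W' t u h - W' t w h = (dd (V t) (fst u) (fst h) - dd (V t) (fst w) (fst h),
     (?D (snd u) (fst u) (fst h) - ?D (snd u) (fst w) (fst h)) + ?D (snd u - snd w) (fst w) (fst h)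
     + (dd (V t) (fst u) (snd h) - dd (V t) (fst w) (snd h)))"
    by (simp add: W'_def dd_dd_diff[OF C2[OF t]])
  have "norm (W' t u h - W' t w h) \<le> norm (dd (V t) (fst u) (fst h) - dd (V t) (fst w) (fst h))
    + (norm (?D (snd u) (fst u) (fst h) - ?D (snd u) (fst w) (fst h)) + norm (?D (snd u - snd w) (fst w) (fst h))
     + norm (dd (V t) (fst u) (snd h) - dd (V t) (fst w) (snd h)))"
    unfolding split using norm_Pair_le norm_triangle_ineq by (smt (verit))
  also have "\<dots> \<le> C * norm (u - w) * norm h + (C * norm (u - w) * 2 * norm h + C * norm (u - w) * norm h
     + C * norm (u - w) * norm h)"
    using params u2 norm_fst_snd_le[of h] norm_fst_snd_le[of "u - w"]
    by (intro add_mono order_trans[OF lip1] order_trans[OF lip2] order_trans[OF bound2] mult_mono t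
        mult_nonneg_nonneg) auto
  finally show "norm (W' t u h - W' t w h) \<le> 5 * C * norm (u - w) * norm h" by (simp add: mult_ac)
qed

text \<open>In the derivative of the second flow, the first component is the derivative of
  \<open>x t\<close> and the second is the desired second derivative. The last claim is the second
  variational equation, where the second derivative of the field acts as a source.\<close>

lemma dd_x_derivative:
  assumes \<xi>: "norm \<xi> \<le> 1" and t: "t \<in> {0..T}"
  shows "(\<lambda>X. dd (x t) X \<xi>) differentiable (at X)"
    and "continuous_on UNIV (\<lambda>X. dd (\<lambda>X. dd (x t) X \<xi>) X k)"
    and "dd (\<lambda>X. dd (x 0) X \<xi>) X k = 0"
    and "norm (dd (\<lambda>X. dd (x t) X \<xi>) X k) \<le> 2 * norm k"
    and "((\<lambda>t. dd (\<lambda>X. dd (x t) X \<xi>) X k) has_vector_derivative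
      dd (\<lambda>u. dd (V t) u (dd (x t) X \<xi>)) (x t X) (dd (x t) X k)
      + dd (V t) (x t X) (dd (\<lambda>X. dd (x t) X \<xi>) X k)) (at t within {0..T})"
proof -
  interpret second: small_flow W W' "UNIV \<times> cball 0 2" T "4 * C" "5 * C" "\<lambda>t X. (x t X, dd (x t) X \<xi>)" "\<lambda>h. (h, 0)"
    by (rule second_flow[OF \<xi>])
  have d: "((\<lambda>X. dd (x t) X \<xi>) has_derivative (\<lambda>k. snd (second.Q t X k))) (at X)"
    "(x t has_derivative (\<lambda>k. fst (second.Q t X k))) (at X)" if "t \<in> {0..T}" for t X
    using has_derivative_snd[OF second.y_has_derivative[OF that]]
      has_derivative_fst[OF second.y_has_derivative[OF that]] by auto
  note dd_eq = dd_eqI[OF d(1)] dd_eqI[OF d(2)]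
  show "(\<lambda>X. dd (x t) X \<xi>) differentiable (at X)" using d(1)[OF t] by (rule differentiableI)
  show "continuous_on UNIV (\<lambda>X. dd (\<lambda>X. dd (x t) X \<xi>) X k)"
    unfolding dd_eq(1)[OF t] by (intro continuous_intros second.Q_continuous t)
  show "dd (\<lambda>X. dd (x 0) X \<xi>) X k = 0"
    using dd_eq(1)[of 0] params by (simp add: second.Q_initial)
  show "norm (dd (\<lambda>X. dd (x t) X \<xi>) X k) \<le> 2 * norm k"
    unfolding dd_eq(1)[OF t] using order_trans[OF norm_fst_snd_le(2) second.Q_bound[OF t, of X k]]
    by (simp add: norm_Pair)
  have "((\<lambda>t. snd (second.Q t X k)) has_vector_derivative snd (W' t (x t X, dd (x t) X \<xi>) (second.Q t X k)))
      (at t within {0..T})"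
    using bounded_linear.has_vector_derivative[OF bounded_linear_snd second.Q_ode[OF t]] .
  then have "((\<lambda>t. dd (\<lambda>X. dd (x t) X \<xi>) X k) has_vector_derivative
      snd (W' t (x t X, dd (x t) X \<xi>) (second.Q t X k))) (at t within {0..T})"
    by (rule has_vector_derivative_transform[OF t, rotated]) (simp add: dd_eqI[OF d(1)])
  moreover have "snd (W' t (x t X, dd (x t) X \<xi>) (second.Q t X k))
     = dd (\<lambda>u. dd (V t) u (dd (x t) X \<xi>)) (x t X) (dd (x t) X k)
      + dd (V t) (x t X) (dd (\<lambda>X. dd (x t) X \<xi>) X k)"
    by (simp only: W'_def fst_conv snd_conv dd_eq(1)[OF t] fun_cong[OF dd_eq(2)[OF t], symmetric])
  ultimately show "((\<lambda>t. dd (\<lambda>X. dd (x t) X \<xi>) X k) has_vector_derivative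
      dd (\<lambda>u. dd (V t) u (dd (x t) X \<xi>)) (x t X) (dd (x t) X k)
      + dd (V t) (x t X) (dd (\<lambda>X. dd (x t) X \<xi>) X k)) (at t within {0..T})" by simp
qed

text \<open>Basis vectors have norm 1 and are covered by the preceding lemma; linearity carries the
  result to all directions.\<close>

lemma x_C2:
  assumes t: "t \<in> {0..T}"
  shows "Ck_on 2 (x t) UNIV"
proof -
  have "Ck_on 1 (\<lambda>X. dd (x t) X b) UNIV" if "b \<in> Basis" for b
    using dd_x_derivative[OF _ t, of b] that by simp
  then have "Ck_on 1 (\<lambda>X. \<Sum>b\<in>Basis. (h \<bullet> b) *\<^sub>R dd (x t) X b) UNIV" for h
    by (intro Ck_on_sum Ck_on_scaleR Ck_on_const) auto
  moreover have "(\<lambda>X. \<Sum>b\<in>Basis. (h \<bullet> b) *\<^sub>R dd (x t) X b) = (\<lambda>X. dd (x t) X h)" for h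
    using dd_basis_expansion[OF differentiableI[OF x_has_derivative[OF t]], of _ h] by simp
  ultimately have "Ck_on 1 (\<lambda>X. dd (x t) X h) UNIV" for h
    by simp
  then show ?thesis
    using differentiableI[OF x_has_derivative[OF t]] by (simp add: numeral_2_eq_2)
qed

lemma x_near: "((\<lambda>(t, X). x t X) \<longlongrightarrow> X0) (near X0)"
proof -
  have "((\<lambda>(t, X). x t X) \<longlongrightarrow> x 0 X0) (near X0)"
  proof (rule tendsto_near_trajectory[OF params(1) traj bound0])
    have "x 0 = (\<lambda>X. X)" by (rule ext) (rule start)
    then show "isCont (x 0) X0" by simp
  qed
  then show ?thesis by (simp add: start)
qed

text \<open>\<open>lim1\<close> covers fixed directions; the basis expansion separates the moving
  direction from the moving base point.\<close>

lemma dV_near: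
  assumes "((\<lambda>(t, X). u t X) \<longlongrightarrow> u0) (near X0)" "((\<lambda>(t, X). h t X) \<longlongrightarrow> h0) (near X0)"
  shows "((\<lambda>(t, X). dd (V t) (u t X) (h t X)) \<longlongrightarrow> dd (V 0) u0 h0) (near X0)"
proof -
  have "((\<lambda>(t, X). \<Sum>b\<in>Basis. (h t X \<bullet> b) *\<^sub>R dd (V t) (u t X) b) \<longlongrightarrow> (\<Sum>b\<in>Basis. (h0 \<bullet> b) *\<^sub>R dd (V 0) u0 b)) (near X0)"
    unfolding case_prod_unfold
    by (intro tendsto_intros assms[unfolded case_prod_unfold]
        tendsto_near_uniform[OF lim1 _ assms(1), unfolded case_prod_unfold]
        differentiable_imp_continuous_within ddV) (use params in auto)
  moreover have "\<forall>\<^sub>F t in at_right 0. t \<in> {0<..<T}" using params by (intro eventually_at_right_real)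
  from eventually_near_time[OF this, of X0]
  have "\<forall>\<^sub>F z in near X0. (case z of (t, X) \<Rightarrow> \<Sum>b\<in>Basis. (h t X \<bullet> b) *\<^sub>R dd (V t) (u t X) b)
      = (case z of (t, X) \<Rightarrow> dd (V t) (u t X) (h t X))"
    by eventually_elim (auto simp: dd_basis_expansion[OF dV, symmetric])
  ultimately have "((\<lambda>(t, X). dd (V t) (u t X) (h t X)) \<longlongrightarrow> (\<Sum>b\<in>Basis. (h0 \<bullet> b) *\<^sub>R dd (V 0) u0 b)) (near X0)"
    using tendsto_cong by blast
  then show ?thesis using params by (simp add: dd_basis_expansion[OF dV, symmetric])
qed

lemma ddV_near:
  assumes u: "((\<lambda>(t, X). u t X) \<longlongrightarrow> u0) (near X0)" and h: "((\<lambda>(t, X). h t X) \<longlongrightarrow> h0) (near X0)"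
    and k: "((\<lambda>(t, X). k t X) \<longlongrightarrow> k0) (near X0)"
  shows "((\<lambda>(t, X). dd (\<lambda>v. dd (V t) v (h t X)) (u t X) (k t X)) \<longlongrightarrow> dd (\<lambda>v. dd (V 0) v h0) u0 k0) (near X0)"
proof -
  have expand: "dd (\<lambda>v. dd (V t) v h) u k =
     (\<Sum>b\<in>Basis. (h \<bullet> b) *\<^sub>R (\<Sum>c\<in>Basis. (k \<bullet> c) *\<^sub>R dd (\<lambda>v. dd (V t) v b) u c))" if t: "t \<in> {0..T}" for t u h k
    unfolding dd_dd_expansion(2)[OF C2[OF t], of h] by (simp add: dd_basis_expansion[OF ddV[OF t], symmetric])
  have cont: "isCont (\<lambda>u. dd (\<lambda>v. dd (V 0) v b) u c) u0" for b c
    using C2[of 0] params by (simp add: numeral_2_eq_2 continuous_on_eq_continuous_at)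
  have "((\<lambda>(t, X). \<Sum>b\<in>Basis. (h t X \<bullet> b) *\<^sub>R (\<Sum>c\<in>Basis. (k t X \<bullet> c) *\<^sub>R dd (\<lambda>v. dd (V t) v b) (u t X) c))
     \<longlongrightarrow> (\<Sum>b\<in>Basis. (h0 \<bullet> b) *\<^sub>R (\<Sum>c\<in>Basis. (k0 \<bullet> c) *\<^sub>R dd (\<lambda>v. dd (V 0) v b) u0 c))) (near X0)"
    unfolding case_prod_unfold
    by (intro tendsto_intros assms[unfolded case_prod_unfold]
        tendsto_near_uniform[OF lim2 cont u, unfolded case_prod_unfold])
  moreover have "\<forall>\<^sub>F t in at_right 0. t \<in> {0<..<T}" using params by (intro eventually_at_right_real)
  from eventually_near_time[OF this, of X0]
  have "\<forall>\<^sub>F z in near X0.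
      (case z of (t, X) \<Rightarrow> \<Sum>b\<in>Basis. (h t X \<bullet> b) *\<^sub>R (\<Sum>c\<in>Basis. (k t X \<bullet> c) *\<^sub>R dd (\<lambda>v. dd (V t) v b) (u t X) c))
      = (case z of (t, X) \<Rightarrow> dd (\<lambda>v. dd (V t) v (h t X)) (u t X) (k t X))"
    by eventually_elim (auto simp: expand[symmetric])
  ultimately have "((\<lambda>(t, X). dd (\<lambda>v. dd (V t) v (h t X)) (u t X) (k t X)) \<longlongrightarrow>
      (\<Sum>b\<in>Basis. (h0 \<bullet> b) *\<^sub>R (\<Sum>c\<in>Basis. (k0 \<bullet> c) *\<^sub>R dd (\<lambda>v. dd (V 0) v b) u0 c))) (near X0)"
    using tendsto_cong by blast
  then show ?thesis using params by (simp add: expand[symmetric])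
qed

lemma dd_x_traj:
  assumes t: "t \<in> {0..T}"
  shows "((\<lambda>t. dd (x t) X h) has_vector_derivative dd (V t) (x t X) (dd (x t) X h)) (at t within {0..T})"
proof -
  have "((\<lambda>t. first.Q t X h) has_vector_derivative dd (V t) (x t X) (first.Q t X h)) (at t within {0..T})"
    by (rule first.Q_ode[OF t])
  then have "((\<lambda>t. dd (x t) X h) has_vector_derivative dd (V t) (x t X) (first.Q t X h)) (at t within {0..T})"
    by (rule has_vector_derivative_transform[OF t, rotated]) (simp add: dd_x)
  then show ?thesis by (simp add: dd_x[OF t])
qed

lemma dd_x_near: "((\<lambda>(t, X). dd (x t) X h) \<longlongrightarrow> h) (near X0)"
proof -
  have "((\<lambda>(t, X). dd (x t) X h) \<longlongrightarrow> dd (x 0) X0 h) (near X0)"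
  proof (rule tendsto_near_trajectory[OF params(1) dd_x_traj])
    show "norm (dd (V t) (x t X) (dd (x t) X h)) \<le> C * (2 * norm h)" if "t \<in> {0..T}" for t X
      using params by (intro order_trans[OF bound1] mult_left_mono dd_x_bound that) auto
  qed (simp_all add: dd_x_start[abs_def])
  then show ?thesis by (simp add: dd_x_start)
qed

lemma dd_x_quotient: "((\<lambda>(t, X). (dd (x t) X h - h) /\<^sub>R t) \<longlongrightarrow> dd (V 0) X0 h) (near X0)"
proof -
  have "((\<lambda>(t, X). (dd (x t) X h - dd (x 0) X h) /\<^sub>R t) \<longlongrightarrow> dd (V 0) X0 h) (near X0)"
    by (rule trajectory_quotient[OF params(1) dd_x_traj dV_near[OF x_near dd_x_near]])
  then show ?thesis by (simp add: dd_x_start)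
qed

text \<open>The second derivative vanishes at time 0, so no initial value is subtracted. In the
  second variational equation the term with the first derivative of the field tends to 0, and the
  source tends to the second derivative of \<open>V 0\<close>.\<close>

lemma dd_dd_x_quotient:
  assumes b: "b \<in> Basis"
  shows "((\<lambda>(t, X). dd (\<lambda>X. dd (x t) X b) X k /\<^sub>R t) \<longlongrightarrow> dd (\<lambda>X. dd (V 0) X b) X0 k) (near X0)"
proof -
  have b1: "norm b \<le> 1" using b by simp
  have zero: "0 \<in> {0..T}" using params by simp
  let ?c = "\<lambda>t X. dd (\<lambda>X. dd (x t) X b) X k"
  let ?c' = "\<lambda>t X. dd (\<lambda>u. dd (V t) u (dd (x t) X b)) (x t X) (dd (x t) X k) + dd (V t) (x t X) (?c t X)"
  note ode = dd_x_derivative(5)[OF b1]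
  have "((\<lambda>(t, X). ?c t X) \<longlongrightarrow> ?c 0 X0) (near X0)"
  proof (rule tendsto_near_trajectory[OF params(1) ode])
    show "norm (?c' t X) \<le> C * (2 * norm b) * (2 * norm k) + C * (2 * norm k)" if t: "t \<in> {0..T}" for t X
      using params by (intro norm_triangle_le add_mono order_trans[OF bound2] order_trans[OF bound1]
          mult_left_mono mult_mono dd_x_bound dd_x_derivative(4) b1 t) auto
    have "?c 0 = (\<lambda>X. 0)" by (rule ext) (rule dd_x_derivative(3)[OF b1 zero])
    then show "isCont (?c 0) X0" by simp
  qed
  then have c: "((\<lambda>(t, X). ?c t X) \<longlongrightarrow> 0) (near X0)"
    using dd_x_derivative(3)[OF b1 zero] by simp
  have "((\<lambda>(t, X). ?c' t X) \<longlongrightarrow> dd (\<lambda>u. dd (V 0) u b) X0 k + dd (V 0) X0 0) (near X0)"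
    using tendsto_add[OF ddV_near[OF x_near dd_x_near dd_x_near] dV_near[OF x_near c]]
    by (simp add: case_prod_unfold)
  from trajectory_quotient[OF params(1) ode this] show ?thesis
    using dd_x_derivative(3)[OF b1 zero] dV_linear[OF zero, of X0] by (simp add: linear_0)
qed

text \<open>The Lipschitz constant of \<open>x t\<close> minus the identity is at most
  \<open>2 * C * T\<close>, from the constants \<open>C\<close> of the field and 2 of the flow. This
  is what makes \<open>x t\<close> a global diffeomorphism for small times.\<close>

lemma x_lipschitz_perturbation:
  assumes t: "t \<in> {0..T}"
  shows "norm (x t X - x t Y - (X - Y)) \<le> norm (X - Y) / 2"
proof -
  let ?d = "\<lambda>t. x t X - x t Y"
  have "norm (?d t - ?d 0 - t *\<^sub>R 0) \<le> t * (C * (2 * norm (X - Y)))"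
  proof (rule vector_derivative_bound)
    show "(?d has_vector_derivative V s (x s X) - V s (x s Y)) (at s within {0..T})" if "s \<in> {0..T}" for s
      by (intro has_vector_derivative_diff traj that)
    show "norm (V s (x s X) - V s (x s Y) - 0) \<le> C * (2 * norm (X - Y))" if "0 < s" "s < t" for s
    proof -
      have s: "s \<in> {0..T}" using that t by auto
      have "norm (V s (x s X) - V s (x s Y)) \<le> C * norm (x s X - x s Y)"
        by (rule first.W_lipschitz[OF s]) auto
      also have "\<dots> \<le> C * (2 * norm (X - Y))"
        using first.y_lipschitz[OF s, of X Y] params by (intro mult_left_mono) auto
      finally show ?thesis by simp
    qed
  qed (use t in auto)
  also have "\<dots> \<le> T * (C * (2 * norm (X - Y)))" using t params by (intro mult_right_mono) auto
  also have "\<dots> = (2 * C * T) * norm (X - Y)" by (simp add: algebra_simps)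
  also have "\<dots> \<le> 1 / 2 * norm (X - Y)" using params by (intro mult_right_mono) auto
  finally show ?thesis by (simp add: start)
qed

end

section \<open>Velocity fields\<close>

lemma norm_basis_sum_le:
  fixes g :: "'a::euclidean_space \<Rightarrow> 'b::real_normed_vector"
  assumes "\<And>b. b \<in> Basis \<Longrightarrow> norm (g b) \<le> M"
  shows "norm (\<Sum>b\<in>Basis. (h \<bullet> b) *\<^sub>R g b) \<le> real DIM('a) * norm h * M"
proof -
  have "norm (\<Sum>b\<in>Basis. (h \<bullet> b) *\<^sub>R g b) \<le> (\<Sum>b\<in>Basis. norm ((h \<bullet> b) *\<^sub>R g b))"
    by (rule norm_sum)
  also have "\<dots> \<le> (\<Sum>b\<in>(Basis::'a set). norm h * M)"
  proof (rule sum_mono)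
    fix b :: 'a assume b: "b \<in> Basis"
    show "norm ((h \<bullet> b) *\<^sub>R g b) \<le> norm h * M"
      unfolding norm_scaleR using b by (intro mult_mono assms) (simp_all add: Basis_le_norm)
  qed
  finally show ?thesis by simp
qed

text \<open>The C^3 norm controls derivatives along basis vectors, and each general direction costs
  a factor of the dimension. The third derivatives appear as a Lipschitz constant of the second
  ones.\<close>

lemma C3_operator_bounds:
  fixes f :: "'a::euclidean_space \<Rightarrow> 'b::euclidean_space"
  defines "d \<equiv> real DIM('a)"
  assumes f: "Ck_on 3 f UNIV"
    and M: "\<And>hs x. set hs \<subseteq> Basis \<Longrightarrow> length hs \<le> 3 \<Longrightarrow> norm (iterated_deriv hs f x) \<le> M"
  shows "norm (f u) \<le> M"
    and "norm (dd f u h) \<le> d * norm h * M"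
    and "norm (dd (\<lambda>u. dd f u h) u k) \<le> d * norm h * (d * norm k * M)"
    and "norm (dd (\<lambda>u. dd f u h) u k - dd (\<lambda>u. dd f u h) w k) \<le> d * norm h * (d * norm k * (d * M * norm (u - w)))"
proof -
  have f2: "Ck_on 2 f UNIV" using Ck_on_mono[OF f] by simp
  have df: "f differentiable (at u)" "(\<lambda>u. dd f u h) differentiable (at u)"
    "(\<lambda>u. dd (\<lambda>u. dd f u h) u k) differentiable (at u)" for u h k
    using f by (simp_all add: numeral_3_eq_3)
  show "norm (f u) \<le> M" using M[of "[]" u] by simp
  then have M0: "0 \<le> M" using norm_ge_zero order_trans by blast
  have 1: "norm (dd f u b) \<le> M" if "b \<in> Basis" for u b
    using M[of "[b]" u] that by simp
  have 2: "norm (dd (\<lambda>u. dd f u b) u c) \<le> M" if "b \<in> Basis" "c \<in> Basis" for u b c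
    using M[of "[b, c]" u] that by simp
  have 3: "norm (dd (\<lambda>u. dd (\<lambda>u. dd f u b) u c) u e) \<le> M" if "b \<in> Basis" "c \<in> Basis" "e \<in> Basis" for u b c e
    using M[of "[b, c, e]" u] that by simp
  show "norm (dd f u h) \<le> d * norm h * M"
    unfolding dd_basis_expansion[OF df(1), of u h] d_def by (intro norm_basis_sum_le 1)
  have expand: "dd (\<lambda>u. dd f u h) u k = (\<Sum>b\<in>Basis. (h \<bullet> b) *\<^sub>R (\<Sum>c\<in>Basis. (k \<bullet> c) *\<^sub>R dd (\<lambda>u. dd f u b) u c))" for u
    unfolding dd_dd_expansion(2)[OF f2, of h] by (simp add: dd_basis_expansion[OF df(2), symmetric])
  show "norm (dd (\<lambda>u. dd f u h) u k) \<le> d * norm h * (d * norm k * M)"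
    unfolding expand[of u] d_def by (intro norm_basis_sum_le 2)
  have "dd (\<lambda>u. dd f u h) u k - dd (\<lambda>u. dd f u h) w k = (\<Sum>b\<in>Basis. (h \<bullet> b) *\<^sub>R (\<Sum>c\<in>Basis. (k \<bullet> c) *\<^sub>R
      (dd (\<lambda>u. dd f u b) u c - dd (\<lambda>u. dd f u b) w c)))"
    unfolding expand[of u] expand[of w] by (simp add: sum_subtractf scaleR_diff_right)
  also have "norm \<dots> \<le> d * norm h * (d * norm k * (d * M * norm (u - w)))"
    unfolding d_def
  proof (intro norm_basis_sum_le)
    fix b c :: 'a assume "b \<in> Basis" "c \<in> Basis"
    then have bd: "norm (dd (\<lambda>u. dd (\<lambda>u. dd f u b) u c) v h) \<le> real DIM('a) * M * norm h" for v h
      using dd_bound_of_basis[OF df(3), of b c v M h] 3 by blast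
    show "norm (dd (\<lambda>u. dd f u b) u c - dd (\<lambda>u. dd f u b) w c) \<le> real DIM('a) * M * norm (u - w)"
      using M0 by (intro lipschitz_of_dd[OF df(3) bd]) simp
  qed
  finally show "norm (dd (\<lambda>u. dd f u h) u k - dd (\<lambda>u. dd f u h) w k) \<le> d * norm h * (d * norm k * (d * M * norm (u - w)))" .
qed

lemma iterated_deriv_diff:
  fixes f g :: "'a::euclidean_space \<Rightarrow> 'b::real_normed_vector"
  assumes "Ck_on k f UNIV" "Ck_on k g UNIV" "length hs \<le> k"
  shows "iterated_deriv hs (\<lambda>x. f x - g x) = (\<lambda>x. iterated_deriv hs f x - iterated_deriv hs g x)"
  using assms
proof (induction hs arbitrary: k f g)
  case (Cons h hs)
  then obtain j where k: "k = Suc j" by (cases k) auto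
  have "dd (\<lambda>x. f x - g x) x = (\<lambda>h. dd f x h - dd g x h)" for x
    using Cons.prems k by (intro dd_eqI has_derivative_diff has_derivative_dd) auto
  then show ?case
    using Cons.IH[of j "\<lambda>x. dd f x h" "\<lambda>x. dd g x h"] Cons.prems k by simp
qed simp

lemma iterated_deriv_continuous:
  "Ck_on k f UNIV \<Longrightarrow> length hs \<le> k \<Longrightarrow> continuous_on UNIV (iterated_deriv hs f)"
proof (induction hs arbitrary: k f)
  case (Cons h hs)
  then obtain j where k: "k = Suc j" by (cases k) auto
  then show ?case using Cons.IH[of j "\<lambda>x. dd f x h"] Cons.prems by simp
qed (simp add: Ck_on_continuous)

lemma iterated_deriv_zero_outside:
  assumes "closed S" "\<And>x. x \<notin> S \<Longrightarrow> f x = 0" "x \<notin> S"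
  shows "iterated_deriv hs f x = 0"
  using assms(2,3)
proof (induction hs arbitrary: f x)
  case (Cons h hs)
  have "dd f y h = 0" if "y \<notin> S" for y
    using dd_transform[of "- S" y f "\<lambda>x. 0"] assms(1) that Cons.prems
    by (simp add: frechet_derivative_const open_Compl)
  then show ?case using Cons by simp
qed simp

lemma Ck_norm_bound:
  assumes "Ck_norm k f \<le> ennreal c" "0 \<le> c" "set hs \<subseteq> Basis" "length hs \<le> k"
  shows "norm (iterated_deriv hs f x) \<le> c"
proof -
  have "ennreal (norm (iterated_deriv hs f x)) \<le> (SUP x. ennreal (norm (iterated_deriv hs f x)))"
    by (rule SUP_upper) simp
  also have "\<dots> \<le> Ck_norm k f"
    unfolding Ck_norm_def using assms by (intro SUP_upper) auto
  also have "\<dots> \<le> ennreal c" by (rule assms)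
  finally show ?thesis using assms by simp
qed

text \<open>Derivatives vanish off the support and are bounded on it by compactness, and there are
  finitely many of them along basis vectors.\<close>

lemma compact_support_derivative_bound:
  fixes f :: "'a::euclidean_space \<Rightarrow> 'b::real_normed_vector"
  assumes f: "Ck_on k f UNIV" and c: "compact (closure {x. f x \<noteq> 0})"
  obtains M where "0 \<le> M" "\<And>hs x. set hs \<subseteq> Basis \<Longrightarrow> length hs \<le> k \<Longrightarrow> norm (iterated_deriv hs f x) \<le> M"
proof -
  let ?S = "closure {x. f x \<noteq> 0}" and ?I = "{hs::'a list. set hs \<subseteq> Basis \<and> length hs \<le> k}"
  have "\<exists>C\<ge>0. \<forall>x. norm (iterated_deriv hs f x) \<le> C" if hs: "hs \<in> ?I" for hs
  proof -
    have "continuous_on ?S (iterated_deriv hs f)"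
      using iterated_deriv_continuous[OF f, of hs] hs continuous_on_subset by blast
    then have "bounded (iterated_deriv hs f ` ?S)"
      using c compact_continuous_image compact_imp_bounded by blast
    then obtain C where C: "C > 0" "\<And>x. x \<in> ?S \<Longrightarrow> norm (iterated_deriv hs f x) \<le> C"
      by (auto simp: bounded_pos)
    have "f x = 0" if "x \<notin> ?S" for x
      using closure_subset[of "{x. f x \<noteq> 0}"] that by auto
    then have zero: "iterated_deriv hs f x = 0" if "x \<notin> ?S" for x
      by (rule iterated_deriv_zero_outside[OF closed_closure _ that])
    have "norm (iterated_deriv hs f x) \<le> C" for x
      using C zero[of x] by (cases "x \<in> ?S") auto
    then show ?thesis using C(1) by (intro exI[of _ C]) auto
  qed
  then have "\<forall>hs\<in>?I. \<exists>C\<ge>0. \<forall>x. norm (iterated_deriv hs f x) \<le> C" by (rule ballI)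
  from bchoice[OF this] obtain C where *: "\<forall>hs\<in>?I. C hs \<ge> 0 \<and> (\<forall>x. norm (iterated_deriv hs f x) \<le> C hs)"
    by (rule exE)
  have C: "0 \<le> C hs" "norm (iterated_deriv hs f x) \<le> C hs" if "hs \<in> ?I" for hs x
    using bspec[OF * that] by simp_all
  have fin: "finite ?I" by (rule finite_lists_length_le) simp
  show ?thesis
  proof (rule that[of "sum C ?I"])
    show "0 \<le> sum C ?I" using C by (intro sum_nonneg) auto
    fix hs :: "'a list" and x assume hs: "set hs \<subseteq> Basis" "length hs \<le> k"
    then have "norm (iterated_deriv hs f x) \<le> C hs" using C(2)[of hs x] by simp
    also have "\<dots> \<le> sum C ?I" using C(1) hs fin by (intro member_le_sum) auto
    finally show "norm (iterated_deriv hs f x) \<le> sum C ?I" .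
  qed
qed

text \<open>Compact support bounds the derivatives of \<open>V 0\<close>; continuity of the velocity
  in the C^3 norm carries this bound to small times and gives the uniform limits.\<close>

lemma velocity_field_C3_flow:
  fixes V x :: "real \<Rightarrow> real^'n \<Rightarrow> real^'n"
  assumes \<epsilon>: "0 < \<epsilon>" and V: "velocity_field 3 D \<epsilon> V" and x: "trajectories \<epsilon> V x"
  obtains T C where "C3_flow V x T C"
proof -
  let ?d = "real DIM(real^'n)"
  have V3: "Ck_on 3 (V t) UNIV" if "t \<in> {0..\<epsilon>}" for t
    using V that by (auto simp: velocity_field_def Ck_fields_def)
  have "compact (closure {x. V 0 x \<noteq> 0})"
    using V \<epsilon> by (auto simp: velocity_field_def Ck_fields_def)
  then obtain M0 where M0: "0 \<le> M0"
    "\<And>hs x. set hs \<subseteq> Basis \<Longrightarrow> length hs \<le> 3 \<Longrightarrow> norm (iterated_deriv hs (V 0) x) \<le> M0"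
    using compact_support_derivative_bound[OF V3[of 0]] \<epsilon> by auto
  have "((\<lambda>t. Ck_norm 3 (\<lambda>x. V t x - V 0 x)) \<longlongrightarrow> 0) (at 0 within {0..\<epsilon>})"
    using V \<epsilon> by (simp add: velocity_field_def)
  then have lim: "((\<lambda>t. Ck_norm 3 (\<lambda>x. V t x - V 0 x)) \<longlongrightarrow> 0) (at_right 0)"
    using \<epsilon> by (simp add: at_within_Icc_at_right)
  have small: "\<forall>\<^sub>F t in at_right 0. 0 < t \<and> t < \<epsilon> \<and> (\<forall>hs x. set hs \<subseteq> Basis \<longrightarrow> length hs \<le> 3 \<longrightarrow>
      norm (iterated_deriv hs (\<lambda>x. V t x - V 0 x) x) \<le> e)" if e: "e > 0" for e
  proof -
    have "\<forall>\<^sub>F t in at_right 0. Ck_norm 3 (\<lambda>x. V t x - V 0 x) < ennreal e"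
      using lim e by (intro order_tendstoD) auto
    moreover have "\<forall>\<^sub>F t in at_right 0. t \<in> {0<..<\<epsilon>}" using \<epsilon> by (rule eventually_at_right_real)
    ultimately show ?thesis
    proof eventually_elim
      case (elim t)
      then show ?case
        using Ck_norm_bound[of 3 "\<lambda>x. V t x - V 0 x" e] e by auto
    qed
  qed
  obtain d0 where d0: "d0 > 0" "\<And>t hs x. 0 < t \<Longrightarrow> t < d0 \<Longrightarrow> set hs \<subseteq> Basis \<Longrightarrow> length hs \<le> 3 \<Longrightarrow>
      norm (iterated_deriv hs (\<lambda>x. V t x - V 0 x) x) \<le> 1"
    using small[of 1] by (auto simp: eventually_at_right[of 0 1])
  \<comment> \<open>\<open>M0\<close> bounds the derivatives of \<open>V 0\<close>, and 1 those of
    \<open>V t - V 0\<close> for times below \<open>d0\<close>. The three factors of the dimension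
    in \<open>C\<close> pay for up to three directions, and \<open>1 / (8 * C)\<close> in
    \<open>T\<close> is what \<open>4 * C * T \<le> 1 / 2\<close> asks for.\<close>
  define M where "M = M0 + 1"
  define C where "C = ?d * ?d * ?d * M"
  define T where "T = min (min \<epsilon> (d0 / 2)) (1 / (8 * C))"
  have d1: "?d \<ge> 1" by (simp add: DIM_positive Suc_leI)
  have M1: "M \<ge> 1" using M0 by (simp add: M_def)
  have dM: "M \<le> ?d * M" "?d * M \<le> ?d * (?d * M)" "?d * (?d * M) \<le> ?d * (?d * (?d * M))"
    using d1 M1 by (auto intro!: mult_left_mono mult_le_cancel_right1[THEN iffD2] simp del: DIM_cart)
  have CM: "C = ?d * (?d * (?d * M))" by (simp add: C_def)
  have C1: "C \<ge> 1" using dM M1 CM by linarith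
  have T: "0 < T" "T \<le> \<epsilon>" "T < d0" "4 * C * T \<le> 1 / 2"
  proof -
    show "0 < T" using \<epsilon> d0 C1 by (simp add: T_def)
    show "T \<le> \<epsilon>" "T < d0" using d0 by (auto simp: T_def min_def)
    have "4 * C * T \<le> 4 * C * (1 / (8 * C))" using C1 by (intro mult_left_mono) (auto simp: T_def)
    then show "4 * C * T \<le> 1 / 2" using C1 by simp
  qed
  have V3': "Ck_on 3 (V t) UNIV" if "t \<in> {0..T}" for t using V3 that T by auto
  have bd: "norm (iterated_deriv hs (V t) x) \<le> M"
    if t: "t \<in> {0..T}" and hs: "set hs \<subseteq> Basis" "length hs \<le> 3" for t hs x
  proof (cases "t = 0")
    case True
    then show ?thesis using M0(2)[OF hs, of x] by (simp add: M_def)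
  next
    case False
    have "iterated_deriv hs (V t) x = iterated_deriv hs (\<lambda>x. V t x - V 0 x) x + iterated_deriv hs (V 0) x"
      using iterated_deriv_diff[OF V3'[OF t] V3[of 0] hs(2)] \<epsilon> by simp
    also have "norm \<dots> \<le> 1 + M0"
      using False t T by (intro norm_triangle_le add_mono d0 M0 hs) auto
    finally show ?thesis by (simp add: M_def)
  qed
  have le: "?d * a * M \<le> C * a" "?d * a * (?d * b * M) \<le> C * a * b" if "0 \<le> a" "0 \<le> b" for a b
  proof -
    have "?d * M * a \<le> C * a" using that dM CM by (intro mult_right_mono) linarith+
    then show "?d * a * M \<le> C * a" by (simp add: mult_ac)
    have "?d * (?d * M) * (a * b) \<le> C * (a * b)" using that dM CM by (intro mult_right_mono) (linarith | simp)+
    then show "?d * a * (?d * b * M) \<le> C * a * b" by (simp add: mult_ac)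
  qed
  have diff3: "Ck_on 3 (\<lambda>x. V t x - V 0 x) UNIV" if "0 < t" "t < \<epsilon>" for t
    using V3[of t] V3[of 0] that by (intro Ck_on_diff) auto
  have ddiff: "dd (\<lambda>x. V t x - V 0 x) u h = dd (V t) u h - dd (V 0) u h" if "0 < t" "t < \<epsilon>" for t u h
  proof -
    have "V t differentiable (at u)" "V 0 differentiable (at u)"
      using V3[of t] V3[of 0] that by (auto intro: Ck_on_differentiable)
    then have "dd (\<lambda>x. V t x - V 0 x) u = (\<lambda>h. dd (V t) u h - dd (V 0) u h)"
      by (intro dd_eqI has_derivative_diff has_derivative_dd)
    then show ?thesis by simp
  qed
  have dddiff: "dd (\<lambda>u. dd (\<lambda>x. V t x - V 0 x) u h) u k = dd (\<lambda>u. dd (V t) u h) u k - dd (\<lambda>u. dd (V 0) u h) u k"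
    if "0 < t" "t < \<epsilon>" for t u h k
  proof -
    have "(\<lambda>u. dd (V t) u h) differentiable (at u)" "(\<lambda>u. dd (V 0) u h) differentiable (at u)"
      using V3[of t] V3[of 0] that by (auto simp: numeral_3_eq_3)
    then have "dd (\<lambda>u. dd (V t) u h - dd (V 0) u h) u = (\<lambda>k. dd (\<lambda>u. dd (V t) u h) u k - dd (\<lambda>u. dd (V 0) u h) u k)"
      by (intro dd_eqI has_derivative_diff has_derivative_dd)
    then show ?thesis by (simp add: ddiff[OF that])
  qed
  \<comment> \<open>Any estimate that is linear in the C^3 size of \<open>V t - V 0\<close> yields a
    uniform limit; the denominator \<open>\<bar>K\<bar> + 1\<close> below avoids a distinction on
    the sign of \<open>K\<close>.\<close>
  have unif: "uniform_limit UNIV f g (at_right 0)"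
    if B: "\<And>t e u. 0 < t \<Longrightarrow> t < \<epsilon> \<Longrightarrow> 0 < e \<Longrightarrow> (\<And>hs x. set hs \<subseteq> Basis \<Longrightarrow> length hs \<le> 3 \<Longrightarrow>
      norm (iterated_deriv hs (\<lambda>x. V t x - V 0 x) x) \<le> e) \<Longrightarrow> norm (f t u - g u) \<le> K * e"
    for f :: "real \<Rightarrow> real^'n \<Rightarrow> real^'n" and g K
  proof (rule uniform_limitI)
    fix e :: real assume e: "e > 0"
    define e' where "e' = e / (\<bar>K\<bar> + 1) / 2"
    have e': "e' > 0" using e unfolding e'_def by (intro divide_pos_pos) auto
    have Ke: "K * e' < e"
    proof -
      have "K * e' \<le> (\<bar>K\<bar> + 1) * e'" using e' by (intro mult_right_mono) auto
      also have "\<dots> = e / 2" unfolding e'_def by (simp add: field_simps)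
      finally show ?thesis using e by simp
    qed
    from small[OF e'] show "\<forall>\<^sub>F t in at_right 0. \<forall>u\<in>UNIV. dist (f t u) (g u) < e"
    proof eventually_elim
      case (elim t)
      then have "norm (f t u - g u) \<le> K * e'" for u using B[of t e' u] e' by blast
      then show ?case using Ke by (auto simp: dist_norm intro: le_less_trans)
    qed
  qed
  have "C3_flow V x T C"
  proof (rule C3_flow.intro)
    show "0 < T" "0 \<le> C" "4 * C * T \<le> 1 / 2" using T C1 by auto
    show "x 0 X = X" for X using x by (simp add: trajectories_def)
    show "uniform_limit UNIV (\<lambda>t u. dd (V t) u h) (\<lambda>u. dd (V 0) u h) (at_right 0)" for h
    proof (rule unif[where K="?d * norm h"])
      fix t e u
      assume "0 < t" "t < \<epsilon>" and e: "\<And>hs x. set hs \<subseteq> Basis \<Longrightarrow> length hs \<le> 3 \<Longrightarrow>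
        norm (iterated_deriv hs (\<lambda>x. V t x - V 0 x) x) \<le> e"
      then show "norm (dd (V t) u h - dd (V 0) u h) \<le> ?d * norm h * e"
        using C3_operator_bounds(2)[OF diff3 e, where u=u and h=h] by (simp add: ddiff)
    qed
    show "uniform_limit UNIV (\<lambda>t u. dd (\<lambda>u. dd (V t) u h) u k) (\<lambda>u. dd (\<lambda>u. dd (V 0) u h) u k) (at_right 0)" for h k
    proof (rule unif[where K="?d * norm h * (?d * norm k)"])
      fix t e u
      assume "0 < t" "t < \<epsilon>" and e: "\<And>hs x. set hs \<subseteq> Basis \<Longrightarrow> length hs \<le> 3 \<Longrightarrow>
        norm (iterated_deriv hs (\<lambda>x. V t x - V 0 x) x) \<le> e"
      then show "norm (dd (\<lambda>u. dd (V t) u h) u k - dd (\<lambda>u. dd (V 0) u h) u k) \<le> ?d * norm h * (?d * norm k) * e"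
        using C3_operator_bounds(3)[OF diff3 e, where u=u and h=h and k=k] by (simp add: dddiff mult_ac)
    qed
    fix t assume t: "t \<in> {0..T}"
    note ob = C3_operator_bounds[OF V3'[OF t] bd[OF t]]
    show "Ck_on 3 (V t) UNIV" by (rule V3'[OF t])
    show "((\<lambda>t. x t X) has_vector_derivative V t (x t X)) (at t within {0..T})" for X
    proof (rule has_vector_derivative_within_subset)
      show "((\<lambda>t. x t X) has_vector_derivative V t (x t X)) (at t within {0..\<epsilon>})"
        using x t T by (simp add: trajectories_def)
      show "{0..T} \<subseteq> {0..\<epsilon>}" using T by auto
    qed
    show "norm (V t u) \<le> C" for u using ob(1)[of u] dM CM by linarith
    show "norm (dd (V t) u h) \<le> C * norm h" for u h
      using order_trans[OF ob(2) le(1)[of "norm h" 0]] by simp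
    show "norm (dd (\<lambda>u. dd (V t) u h) u k) \<le> C * norm h * norm k" for u h k
      using order_trans[OF ob(3) le(2)] by simp
    show "norm (dd (\<lambda>u. dd (V t) u h) u k - dd (\<lambda>u. dd (V t) u h) w k) \<le> C * norm (u - w) * norm h * norm k" for u w h k
      using ob(4)[where h=h and u=u and k=k and w=w] by (simp add: C_def mult_ac)
  qed
  then show ?thesis by (rule that)
qed

section \<open>Perturbations of the identity\<close>

text \<open>The norm of the matrix type is Euclidean, while the available estimates are of operator
  type. Writing a matrix as a sum over its columns passes from one to the other.\<close>

lemma norm_matrix_bound:
  obtains K where "0 < K"
    "\<And>(A::real^'n^'n) c. (\<And>h. norm (A *v h) \<le> c * norm h) \<Longrightarrow> 0 \<le> c \<Longrightarrow> norm A \<le> K * c"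
proof -
  obtain K0 where K0: "0 < K0" "\<And>a b. norm (tensor a (b::real^'n)) \<le> norm a * norm b * K0"
    using bounded_bilinear.pos_bounded[OF bounded_bilinear_tensor] by blast
  show ?thesis
  proof (rule that[of "real CARD('n) * K0"])
    fix A :: "real^'n^'n" and c assume A: "\<And>h. norm (A *v h) \<le> c * norm h" and c: "0 \<le> c"
    have "A = (\<Sum>i\<in>UNIV. tensor (A *v axis i 1) (axis i 1))"
      by (simp add: tensor_def vec_eq_iff axis_def matrix_vector_mult_def if_distrib cong: if_cong)
    then have "norm A \<le> (\<Sum>i\<in>(UNIV::'n set). norm (tensor (A *v axis i 1) (axis i 1)))"
      by (metis norm_sum)
    also have "\<dots> \<le> (\<Sum>i\<in>(UNIV::'n set). K0 * c)"
    proof (rule sum_mono)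
      fix i :: 'n
      have "norm (tensor (A *v axis i 1) (axis i 1)) \<le> norm (A *v axis i 1) * norm (axis i 1 :: real^'n) * K0"
        by (rule K0)
      also have "\<dots> \<le> (c * 1) * 1 * K0"
        using A[of "axis i 1"] K0(1) c by (intro mult_right_mono) (auto simp: norm_axis_1)
      finally show "norm (tensor (A *v axis i 1) (axis i 1)) \<le> K0 * c" by (simp add: mult_ac)
    qed
    finally show "norm A \<le> real CARD('n) * K0 * c" by simp
  qed (use K0 in simp)
qed

text \<open>The resolvent identity, from which both continuity and differentiability of inversion
  are read off.\<close>

lemma inverse_matrix_diff:
  fixes A B :: "real^'n^'n"
  assumes "A' ** A = mat 1" "B ** B' = mat 1"
  shows "A' - B' = - (A' ** (A - B) ** B')"
proof -
  interpret bounded_bilinear "(**) :: real^'n^'n \<Rightarrow> real^'n^'n \<Rightarrow> real^'n^'n" by (rule bounded_bilinear_matrix_mul)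
  have "A' ** (A - B) ** B' = (A' ** A) ** B' - A' ** (B ** B')"
    by (simp add: diff_left diff_right matrix_mul_assoc)
  then show ?thesis using assms by simp
qed

lemma inverse_matrix_continuous:
  fixes A B :: "'a \<Rightarrow> real^'n^'n"
  assumes A: "(A \<longlongrightarrow> A0) F" and B: "\<forall>\<^sub>F x in F. B x ** A x = mat 1" "\<forall>\<^sub>F x in F. norm (B x) \<le> K" and B0: "A0 ** B0 = mat 1"
  shows "(B \<longlongrightarrow> B0) F"
proof -
  interpret bounded_bilinear "(**) :: real^'n^'n \<Rightarrow> real^'n^'n \<Rightarrow> real^'n^'n" by (rule bounded_bilinear_matrix_mul)
  obtain k where "k > 0 \<and> (\<forall>(a::real^'n^'n) b::real^'n^'n. norm (a ** b) \<le> norm a * norm b * k)"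
    using pos_bounded by (rule exE)
  then have k: "0 < k" "norm (a ** b) \<le> norm a * norm b * k" for a b :: "real^'n^'n"
    by simp_all
  have "((\<lambda>x. B x - B0) \<longlongrightarrow> 0) F"
  proof (rule Lim_null_comparison)
    have "((\<lambda>x. K * norm (A x - A0) * k * norm B0 * k) \<longlongrightarrow> K * norm (A0 - A0) * k * norm B0 * k) F"
      by (intro tendsto_intros A)
    then show "((\<lambda>x. K * norm (A x - A0) * k * norm B0 * k) \<longlongrightarrow> 0) F" by simp
    from B show "\<forall>\<^sub>F x in F. norm (B x - B0) \<le> K * norm (A x - A0) * k * norm B0 * k"
    proof eventually_elim
      case (elim x)
      have "norm (B x - B0) = norm (B x ** (A x - A0) ** B0)"
        unfolding inverse_matrix_diff[OF elim(1) B0] by simp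
      also have "\<dots> \<le> norm (B x ** (A x - A0)) * norm B0 * k" by (rule k)
      also have "\<dots> \<le> (norm (B x) * norm (A x - A0) * k) * norm B0 * k"
        using k by (intro mult_right_mono) auto
      also have "\<dots> \<le> (K * norm (A x - A0) * k) * norm B0 * k"
        using k elim by (intro mult_right_mono) auto
      finally show ?case .
    qed
  qed
  then show ?thesis by (simp add: LIM_zero_iff)
qed

text \<open>In the resolvent identity the increment of \<open>A\<close> is replaced by its linear
  part, with an error of smaller order, and the left factor \<open>B y\<close> by
  \<open>B x\<close>, with an error that tends to 0 by continuity.\<close>

lemma inverse_matrix_has_derivative:
  fixes A B :: "'a::real_normed_vector \<Rightarrow> real^'n^'n"
  assumes S: "open S" "x \<in> S" and AB: "\<And>y. y \<in> S \<Longrightarrow> A y ** B y = mat 1" "\<And>y. y \<in> S \<Longrightarrow> B y ** A y = mat 1"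
    and A: "(A has_derivative A') (at x)" and B: "isCont B x"
  shows "(B has_derivative (\<lambda>h. - (B x ** A' h ** B x))) (at x)"
proof -
  interpret bb: bounded_bilinear "(**) :: real^'n^'n \<Rightarrow> real^'n^'n \<Rightarrow> real^'n^'n" by (rule bounded_bilinear_matrix_mul)
  interpret A': bounded_linear A' using A by (rule has_derivative_bounded_linear)
  obtain k where "k > 0 \<and> (\<forall>(a::real^'n^'n) b::real^'n^'n. norm (a ** b) \<le> norm a * norm b * k)"
    using bb.pos_bounded by (rule exE)
  then have k: "0 < k" "norm (a ** b) \<le> norm a * norm b * k" for a b :: "real^'n^'n"
    by simp_all
  have bl: "bounded_linear (\<lambda>h. - (B x ** A' h ** B x))"
    by (rule bounded_linear_minus[OF bounded_linear_compose[OF bb.bounded_linear_left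
          bounded_linear_compose[OF bb.bounded_linear_right A'.bounded_linear_axioms]]])
  obtain K' where K': "K' > 0" "\<And>h. norm (A' h) \<le> norm h * K'" using A'.pos_bounded by blast
  have "((\<lambda>y. norm (B y - B x - (- (B x ** A' (y - x) ** B x))) / norm (y - x)) \<longlongrightarrow> 0) (at x)"
  proof (rule Lim_null_comparison)
    let ?r = "\<lambda>y. norm (A y - A x - A' (y - x)) / norm (y - x)"
    let ?E = "\<lambda>y. (norm (B y) * ?r y * k + norm (B y - B x) * K' * k) * norm (B x) * k"
    have r: "(?r \<longlongrightarrow> 0) (at x)" using A by (simp add: has_derivative_iff_norm)
    have Bx: "(B \<longlongrightarrow> B x) (at x)" using B by (simp add: isCont_def)
    have "(?E \<longlongrightarrow> (norm (B x) * 0 * k + norm (B x - B x) * K' * k) * norm (B x) * k) (at x)"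
      by (intro tendsto_intros r Bx)
    then show "(?E \<longlongrightarrow> 0) (at x)" by simp
    have "\<forall>\<^sub>F y in at x. y \<in> S" using S by (simp add: eventually_at_in_open')
    moreover have "\<forall>\<^sub>F y in at x. y \<noteq> x" by (simp add: eventually_at_filter)
    ultimately show "\<forall>\<^sub>F y in at x. norm (norm (B y - B x - (- (B x ** A' (y - x) ** B x))) / norm (y - x)) \<le> ?E y"
    proof eventually_elim
      case (elim y)
      have "B y - B x - (- (B x ** A' (y - x) ** B x))
        = - (B y ** (A y - A x) ** B x) + B x ** A' (y - x) ** B x"
        using inverse_matrix_diff[OF AB(2)[OF elim(1)] AB(1)[OF S(2)]] by simp
      also have "\<dots> = - ((B y ** (A y - A x - A' (y - x)) + (B y - B x) ** A' (y - x)) ** B x)"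
        by (simp add: bb.diff_right bb.diff_left bb.add_left bb.minus_left)
      finally have "norm (B y - B x - (- (B x ** A' (y - x) ** B x)))
        = norm ((B y ** (A y - A x - A' (y - x)) + (B y - B x) ** A' (y - x)) ** B x)" by simp
      also have "\<dots> \<le> norm (B y ** (A y - A x - A' (y - x)) + (B y - B x) ** A' (y - x)) * norm (B x) * k"
        by (rule k)
      also have "\<dots> \<le> (norm (B y) * norm (A y - A x - A' (y - x)) * k + norm (B y - B x) * (norm (y - x) * K') * k) * norm (B x) * k"
        using k(1)
        by (intro mult_right_mono norm_triangle_le add_mono k(2) order_trans[OF k(2) mult_right_mono]
            mult_left_mono K'(2)) auto
      also have "\<dots> = ?E y * norm (y - x)"
        using elim(2) by (simp add: field_simps)
      finally show ?case using elim(2) by (simp add: pos_divide_le_eq)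
    qed
  qed
  then show ?thesis using bl by (simp add: has_derivative_iff_norm)
qed

lemma lipschitz_derivative_bound:
  assumes f: "(f has_derivative f') (at x)" and L: "\<And>y. norm (f y - f x) \<le> L * norm (y - x)"
  shows "norm (f' h) \<le> L * norm h"
proof -
  interpret bounded_linear f' using f by (rule has_derivative_bounded_linear)
  have "norm (f' h) \<le> L * norm h + e" if e: "e > 0" for e
  proof -
    define e' where "e' = e / (norm h + 1)"
    have e': "e' > 0" using e by (simp add: e'_def add_nonneg_pos)
    have "e' * norm h \<le> e' * (norm h + 1)" using e' by simp
    also have "\<dots> = e" unfolding e'_def by (simp add: add_nonneg_eq_0_iff)
    finally have e'h: "e' * norm h \<le> e" .
    obtain d where d: "d > 0" "\<And>y. norm (y - x) < d \<Longrightarrow> norm (f y - f x - f' (y - x)) \<le> e' * norm (y - x)"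
      using f e' unfolding has_derivative_at_alt by blast
    define s where "s = d / (2 * (norm h + 1))"
    have s: "s > 0" using d by (simp add: s_def add_nonneg_pos)
    have "s * norm h < d"
    proof -
      have "s * norm h \<le> s * (norm h + 1)" using s by simp
      also have "\<dots> = d / 2" unfolding s_def by (simp add: field_simps add_nonneg_eq_0_iff)
      finally show ?thesis using d by simp
    qed
    then have "norm (f (x + s *\<^sub>R h) - f x - s *\<^sub>R f' h) \<le> e' * (s * norm h)"
      using d(2)[of "x + s *\<^sub>R h"] s by (simp add: scaleR)
    moreover have "norm (f (x + s *\<^sub>R h) - f x) \<le> L * (s * norm h)"
      using L[of "x + s *\<^sub>R h"] s by simp
    moreover have "norm (s *\<^sub>R f' h) \<le> norm (f (x + s *\<^sub>R h) - f x) + norm (f (x + s *\<^sub>R h) - f x - s *\<^sub>R f' h)"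
      by (metis norm_triangle_sub norm_minus_commute)
    ultimately have "s * norm (f' h) \<le> s * (L * norm h + e' * norm h)"
      using s by (simp add: algebra_simps)
    then have "norm (f' h) \<le> L * norm h + e' * norm h" using s by simp
    then show ?thesis using e'h by simp
  qed
  then show ?thesis by (rule field_le_epsilon)
qed

lemma Ck_on_transpose: "open S \<Longrightarrow> Ck_on k A S \<Longrightarrow> Ck_on k (\<lambda>x. transpose (A x :: real^'n^'n)) S"
  by (rule Ck_on_bounded_linear[OF bounded_linear_transpose])

lemmas Ck_on_matrix_vec = Ck_on_bilinear[OF bounded_bilinear_matrix_vec]
lemmas Ck_on_matrix_mul = Ck_on_bilinear[OF bounded_bilinear_matrix_mul]
lemmas Ck_on_tensor = Ck_on_bilinear[OF bounded_bilinear_tensor]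

lemma Ck_on_tproj: "open S \<Longrightarrow> Ck_on k N S \<Longrightarrow> Ck_on k (\<lambda>x. tproj (N x)) S"
  unfolding tproj_def by (intro Ck_on_diff Ck_on_const Ck_on_tensor)

text \<open>The normalising factor is written as a real power of the squared length, because powers
  have convenient differentiation rules in space and in time.\<close>

lemma inverse_norm_powr: "inverse (norm x) = (x \<bullet> x) powr (- (1 / 2))"
  by (cases "x = 0") (simp_all add: powr_minus powr_half_sqrt norm_eq_sqrt_inner)

lemma Ck_on_normalize:
  fixes f :: "'a::euclidean_space \<Rightarrow> 'b::euclidean_space"
  assumes S: "open S" and f: "Ck_on k f S" "\<And>x. x \<in> S \<Longrightarrow> f x \<noteq> 0"
  shows "Ck_on k (\<lambda>x. f x /\<^sub>R norm (f x)) S"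
proof -
  have "Ck_on k (\<lambda>x. (f x \<bullet> f x) powr (- (1 / 2))) S"
    by (rule Ck_on_compose[OF S open_greaterThan _ Ck_on_inner[OF S f(1) f(1)] Ck_on_powr])
      (use f(2) in auto)
  then show ?thesis
    unfolding inverse_norm_powr by (intro Ck_on_scaleR S f)
qed

text \<open>Normals transform as covectors: if \<open>B\<close> is the inverse Jacobian of a
  diffeomorphism and \<open>\<nu>\<close> is normal to a surface, this is the unit normal of the
  image, being the normalised gradient of the pushed forward level function.\<close>

definition conormal :: "real^'n^'n \<Rightarrow> real^'n \<Rightarrow> real^'n" where
  "conormal B \<nu> = (transpose B *v \<nu>) /\<^sub>R norm (transpose B *v \<nu>)"

lemma conormal_scaleR: "0 < c \<Longrightarrow> conormal B (c *\<^sub>R \<nu>) = conormal B \<nu>"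
  by (simp add: conormal_def matrix_vector_mult_scaleR)

text \<open>A perturbation of the identity with Lipschitz constant 1/2 is globally invertible, and
  both the inverse and its Jacobian are bounded with the constant 2, uniformly along the
  flow.\<close>

locale small_diffeo =
  fixes \<psi> :: "real^'n \<Rightarrow> real^'n"
  assumes C2: "Ck_on 2 \<psi> UNIV"
    and perturbation: "norm (\<psi> X - \<psi> Y - (X - Y)) \<le> norm (X - Y) / 2"
begin

definition \<theta> :: "real^'n \<Rightarrow> real^'n" where "\<theta> = inv \<psi>"

definition B :: "real^'n \<Rightarrow> real^'n^'n" where "B X = matrix_inv (jacobian_matrix \<psi> X)"

lemma expanding: "norm (X - Y) \<le> 2 * norm (\<psi> X - \<psi> Y)"
  using perturbation[of X Y] norm_triangle_sub[of "X - Y" "\<psi> X - \<psi> Y"]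
  by (simp add: norm_minus_commute)

lemma inj: "inj \<psi>"
  using expanding by (metis injI norm_eq_zero norm_le_zero_iff eq_iff_diff_eq_0 mult_zero_right)

text \<open>\<open>y = \<psi> X\<close> says that \<open>X\<close> is a fixed point of
  \<open>\<lambda>X. y - (\<psi> X - X)\<close>, a contraction with constant 1/2.\<close>

lemma surj: "surj \<psi>"
proof -
  have "\<exists>X. y = \<psi> X" for y
  proof -
    let ?f = "\<lambda>X. y - (\<psi> X - X)"
    have "\<exists>!X. ?f X = X"
    proof (rule banach_fix_type)
      show "\<forall>X Y. dist (?f X) (?f Y) \<le> (1 / 2) * dist X Y"
      proof (intro allI)
        fix X Y
        have "?f X - ?f Y = - (\<psi> X - \<psi> Y - (X - Y))" by simp
        then show "dist (?f X) (?f Y) \<le> (1 / 2) * dist X Y"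
          unfolding dist_norm using perturbation[of X Y] by (simp only: norm_minus_cancel)
      qed
    qed auto
    then obtain X where "?f X = X" by blast
    then have "y = \<psi> X" by (simp add: algebra_simps)
    then show ?thesis by blast
  qed
  then show ?thesis by (auto simp: surj_def)
qed

lemma \<theta>\<psi> [simp]: "\<theta> (\<psi> X) = X" and \<psi>\<theta> [simp]: "\<psi> (\<theta> y) = y"
  using inj surj by (simp_all add: \<theta>_def surj_f_inv_f)

lemma d\<psi>: "\<psi> differentiable (at X)"
  using Ck_on_differentiable[OF C2] by simp

lemma \<psi>_continuous: "continuous_on S \<psi>"
  using Ck_on_continuous[OF C2] continuous_on_subset by blast

lemma \<theta>_lipschitz: "norm (\<theta> y - \<theta> z) \<le> 2 * norm (y - z)"
  using expanding[of "\<theta> y" "\<theta> z"] by simp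

lemma \<theta>_continuous: "continuous_on S \<theta>"
proof -
  have "2-lipschitz_on UNIV \<theta>"
    using \<theta>_lipschitz by (intro lipschitz_onI) (auto simp: dist_norm)
  then show ?thesis
    using lipschitz_on_continuous_on continuous_on_subset by blast
qed

lemma image_eq_vimage: "\<psi> ` S = \<theta> -` S"
  by (auto simp: image_iff) (metis \<psi>\<theta>)

lemma open_image: "open S \<Longrightarrow> open (\<psi> ` S)"
  unfolding image_eq_vimage by (rule open_vimage[OF _ \<theta>_continuous])

lemma closed_image: "closed S \<Longrightarrow> closed (\<psi> ` S)"
  unfolding image_eq_vimage by (rule closed_vimage[OF _ \<theta>_continuous])

lemma closure_image: "closure (\<psi> ` S) = \<psi> ` closure S"
proof
  show "closure (\<psi> ` S) \<subseteq> \<psi> ` closure S"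
    by (intro closure_minimal closed_image image_mono closure_subset closed_closure)
  show "\<psi> ` closure S \<subseteq> closure (\<psi> ` S)"
    by (intro image_closure_subset \<psi>_continuous closed_closure closure_subset)
qed

lemma frontier_image:
  assumes "open S"
  shows "frontier (\<psi> ` S) = \<psi> ` frontier S"
  using assms open_image[OF assms] closure_image[of S] inj
  by (simp add: frontier_def interior_open image_set_diff)

lemma jacobian_close: "norm (jacobian_matrix \<psi> X *v h - h) \<le> norm h / 2"
proof -
  have "((\<lambda>Y. \<psi> Y - Y) has_derivative (\<lambda>h. dd \<psi> X h - h)) (at X)"
    by (intro has_derivative_diff has_derivative_dd d\<psi> has_derivative_ident)
  from lipschitz_derivative_bound[OF this, of "1 / 2" h] perturbation[of _ X] show ?thesis
    by (simp add: dd_jacobian[OF d\<psi>] algebra_simps)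
qed

lemma jacobian_expanding: "norm h \<le> 2 * norm (jacobian_matrix \<psi> X *v h)"
  using jacobian_close[of X h] norm_triangle_sub[of h "jacobian_matrix \<psi> X *v h"]
  by (simp add: norm_minus_commute)

text \<open>The matrix inverse is defined by choice, so its properties come from an existing
  inverse: the expansion bound gives injectivity, and a left inverse of a square matrix is
  two-sided.\<close>

lemma jacobian_inverse: "jacobian_matrix \<psi> X ** B X = mat 1" "B X ** jacobian_matrix \<psi> X = mat 1"
proof -
  let ?J = "jacobian_matrix \<psi> X"
  have "inj ((*v) ?J)"
  proof (rule injI)
    fix h k assume "?J *v h = ?J *v k"
    then have "?J *v (h - k) = 0" by (simp add: matrix_vector_mult_diff_distrib)
    then show "h = k" using jacobian_expanding[of "h - k" X] by simp
  qed
  then obtain C where "C ** ?J = mat 1" using matrix_left_invertible_injective by blast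
  then have "\<exists>C. ?J ** C = mat 1 \<and> C ** ?J = mat 1" using matrix_left_right_inverse by blast
  from someI_ex[OF this] show "?J ** B X = mat 1" "B X ** ?J = mat 1"
    by (simp_all add: B_def matrix_inv_def)
qed

lemma B_vec_bound: "norm (B X *v h) \<le> 2 * norm h"
  using jacobian_expanding[of "B X *v h" X]
  by (simp add: matrix_vector_mul_assoc jacobian_inverse)

lemma jacobian_C1: "Ck_on 1 (jacobian_matrix \<psi>) UNIV"
  using Ck_on_jacobian[of UNIV 1 \<psi>] C2 by (simp add: numeral_2_eq_2)

lemma isCont_B: "isCont B X"
proof -
  obtain K where K: "0 < K" "\<And>(A::real^'n^'n) c. (\<And>h. norm (A *v h) \<le> c * norm h) \<Longrightarrow> 0 \<le> c \<Longrightarrow> norm A \<le> K * c"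
    using norm_matrix_bound by blast
  have "(jacobian_matrix \<psi> \<longlongrightarrow> jacobian_matrix \<psi> X) (at X)"
    using Ck_on_isCont[OF jacobian_C1] by (simp add: isCont_def)
  then show ?thesis
    unfolding isCont_def
    by (rule inverse_matrix_continuous[where K="K * 2"])
      (auto intro!: always_eventually K B_vec_bound simp: jacobian_inverse)
qed

lemma B_has_derivative: "(B has_derivative (\<lambda>h. - (B X ** dd (jacobian_matrix \<psi>) X h ** B X))) (at X)"
  by (rule inverse_matrix_has_derivative[OF open_UNIV])
    (auto simp: jacobian_inverse isCont_B intro!: has_derivative_dd Ck_on_differentiable[OF jacobian_C1])

lemma B_C1: "Ck_on 1 B UNIV"
proof -
  have B0: "Ck_on 0 B UNIV"
    using isCont_B by (simp add: continuous_on_eq_continuous_at)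
  have "Ck_on (Suc 0) B UNIV"
  proof (rule Ck_on_SucI[OF open_UNIV B_has_derivative])
    show "Ck_on 0 (\<lambda>X. - (B X ** dd (jacobian_matrix \<psi>) X h ** B X)) UNIV" for h
      using jacobian_C1 by (intro Ck_on_minus Ck_on_matrix_mul B0) auto
  qed
  then show ?thesis by simp
qed

lemma \<theta>_has_derivative: "(\<theta> has_derivative (\<lambda>h. B X *v h)) (at (\<psi> X))"
proof (rule has_derivative_inverse_basic_x[where f=\<psi> and x=X and T=UNIV and f'="(*v) (jacobian_matrix \<psi> X)"])
  have "dd \<psi> X = (*v) (jacobian_matrix \<psi> X)" by (rule ext) (rule dd_jacobian[OF d\<psi>])
  then show "(\<psi> has_derivative (*v) (jacobian_matrix \<psi> X)) (at X)"
    using has_derivative_dd[OF d\<psi>, of X] by simp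
  show "bounded_linear ((*v) (B X))" by (rule matrix_vector_mul_bounded_linear)
  show "(*v) (B X) \<circ> (*v) (jacobian_matrix \<psi> X) = id"
    by (auto simp: matrix_vector_mul_assoc jacobian_inverse)
  show "continuous (at (\<psi> X)) \<theta>"
    using \<theta>_continuous[of UNIV] by (simp add: continuous_on_eq_continuous_at)
qed auto

lemma pushforward_has_derivative:
  assumes "f differentiable (at X)"
  shows "((\<lambda>y. f (\<theta> y)) has_derivative (\<lambda>h. dd f X (B X *v h))) (at (\<psi> X))"
  using has_derivative_compose[OF \<theta>_has_derivative, of f "dd f X" X] has_derivative_dd[OF assms] by simp

lemma pushforward_C1:
  fixes f :: "real^'n \<Rightarrow> 'b::real_normed_vector"
  assumes U: "open U" and f: "Ck_on 1 f U"
  shows "Ck_on 1 (\<lambda>y. f (\<theta> y)) (\<psi> ` U)"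
proof -
  have df: "f differentiable (at X)" if "X \<in> U" for X
    using Ck_on_differentiable[OF f] that by simp
  have "Ck_on (Suc 0) (\<lambda>y. f (\<theta> y)) (\<psi> ` U)"
  proof (rule Ck_on_SucI[OF open_image[OF U]])
    show "((\<lambda>y. f (\<theta> y)) has_derivative (\<lambda>h. dd f (\<theta> y) (B (\<theta> y) *v h))) (at y)" if "y \<in> \<psi> ` U" for y
      using pushforward_has_derivative[OF df] that by auto
    fix h
    have "continuous_on U (\<lambda>X. \<Sum>b\<in>Basis. ((B X *v h) \<bullet> b) *\<^sub>R dd f X b)"
      using f by (intro continuous_intros bounded_bilinear.continuous_on[OF bounded_bilinear_matrix_vec]
          continuous_on_subset[OF Ck_on_continuous[OF B_C1]]) auto
    then have "continuous_on U (\<lambda>X. dd f X (B X *v h))"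
      by (rule continuous_on_eq) (simp add: dd_basis_expansion[OF df, symmetric])
    then have "continuous_on (\<psi> ` U) (\<lambda>y. dd f (\<theta> y) (B (\<theta> y) *v h))"
      by (rule continuous_on_compose2[OF _ \<theta>_continuous]) auto
    then show "Ck_on 0 (\<lambda>y. dd f (\<theta> y) (B (\<theta> y) *v h)) (\<psi> ` U)" by simp
  qed
  then show ?thesis by simp
qed

lemma gradient_pushforward:
  assumes "f differentiable (at X)"
  shows "gradient (\<lambda>y. f (\<theta> y)) (\<psi> X) = transpose (B X) *v gradient f X"
  using pushforward_has_derivative[OF assms]
  by (intro gradientI) (simp add: dd_gradient[OF assms] inner_matrix_vec)

lemma jacobian_pushforward:
  assumes "W differentiable (at X)"
  shows "jacobian_matrix (\<lambda>y. W (\<theta> y)) (\<psi> X) = jacobian_matrix W X ** B X"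
  using pushforward_has_derivative[OF assms]
  by (intro jacobianI) (simp add: dd_jacobian[OF assms] matrix_vector_mul_assoc)

lemma transpose_B_nonzero: "\<nu> \<noteq> 0 \<Longrightarrow> transpose (B X) *v \<nu> \<noteq> 0"
proof
  assume "\<nu> \<noteq> 0" "transpose (B X) *v \<nu> = 0"
  then have "\<nu> \<bullet> (B X *v (jacobian_matrix \<psi> X *v \<nu>)) = 0" by (simp add: inner_matrix_vec)
  then show False using \<open>\<nu> \<noteq> 0\<close> by (simp add: matrix_vector_mul_assoc jacobian_inverse)
qed

section \<open>Domains, normals and tangential operators under a small diffeomorphism\<close>

context
  fixes \<Omega> U :: "(real^'n) set" and \<Phi> :: "real^'n \<Rightarrow> real"
  assumes \<Omega>: "Ck_domain 1 \<Omega>" and sub: "frontier \<Omega> \<subseteq> U" and \<Phi>: "defining_function 1 \<Omega> U \<Phi>"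
begin

lemma \<Phi>': "open U" "Ck_on 1 \<Phi> U" "\<And>X. X \<in> U \<Longrightarrow> gradient \<Phi> X \<noteq> 0" "\<And>X. X \<in> U \<Longrightarrow> \<Phi> differentiable (at X)"
  using \<Phi> Ck_on_differentiable[of 1 \<Phi> U] by (auto simp: defining_function_def)

text \<open>Composition with the inverse keeps the sign conditions, and the gradient stays nonzero
  because the transposed inverse Jacobian is injective.\<close>

lemma pushforward_defining_function: "defining_function 1 (\<psi> ` \<Omega>) (\<psi> ` U) (\<lambda>y. \<Phi> (\<theta> y))"
proof -
  have "open \<Omega>" using \<Omega> by (simp add: Ck_domain_def)
  moreover have "gradient (\<lambda>y. \<Phi> (\<theta> y)) y \<noteq> 0" if "y \<in> \<psi> ` U" for y
    using that transpose_B_nonzero \<Phi>' by (auto simp: gradient_pushforward)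
  moreover have "\<psi> ` \<Omega> \<inter> \<psi> ` U = {y \<in> \<psi> ` U. \<Phi> (\<theta> y) < 0}"
    "\<psi> ` frontier \<Omega> \<inter> \<psi> ` U = {y \<in> \<psi> ` U. \<Phi> (\<theta> y) = 0}"
    using \<Phi> unfolding defining_function_def image_eq_vimage by blast+
  ultimately show ?thesis
    unfolding defining_function_def
    using open_image[OF \<Phi>'(1)] pushforward_C1[OF \<Phi>'(1,2)] by (simp add: frontier_image)
qed

lemma pushforward_domain: "Ck_domain 1 (\<psi> ` \<Omega>)"
proof -
  have op: "open \<Omega>" "bounded \<Omega>" using \<Omega> by (auto simp: Ck_domain_def)
  have "bounded (\<psi> ` closure \<Omega>)"
    using op by (intro compact_imp_bounded compact_continuous_image \<psi>_continuous) auto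
  then have "bounded (\<psi> ` \<Omega>)"
    by (rule bounded_subset) (use closure_subset in blast)
  moreover have "p \<in> \<psi> ` U" if "p \<in> frontier (\<psi> ` \<Omega>)" for p
    using that sub op by (auto simp: frontier_image)
  ultimately show ?thesis
    using op open_image pushforward_defining_function unfolding Ck_domain_def by blast
qed

lemma pushforward_boundary: "C1_boundary (\<psi> ` frontier \<Omega>)"
  unfolding C1_boundary_def using pushforward_domain \<Omega>
  by (metis Ck_domain_def frontier_image)

lemma normal_pushforward:
  assumes X: "X \<in> frontier \<Omega>"
  shows "normal (\<psi> ` frontier \<Omega>) (\<psi> X) = conormal (B X) (gradient \<Phi> X)"
proof -
  have op: "open \<Omega>" using \<Omega> by (simp add: Ck_domain_def)
  have XU: "X \<in> U" using X sub by blast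
  have "normal (frontier (\<psi> ` \<Omega>)) (\<psi> X) = gradient (\<lambda>y. \<Phi> (\<theta> y)) (\<psi> X) /\<^sub>R norm (gradient (\<lambda>y. \<Phi> (\<theta> y)) (\<psi> X))"
    using X XU by (intro normal_eq[OF pushforward_domain pushforward_defining_function]) (auto simp: frontier_image[OF op])
  then show ?thesis
    by (simp add: frontier_image[OF op] gradient_pushforward[OF \<Phi>'(4)[OF XU]] conormal_def)
qed

text \<open>On the image, \<open>F\<close> and \<open>W\<close> composed with the inverse are
  legitimate extensions. The chain rule turns their derivatives into those of \<open>F\<close> and
  \<open>W\<close> times the inverse Jacobian, so every derivative is taken near the fixed
  boundary.\<close>

lemma laplace_beltrami_pushforward:
  fixes f F :: "real^'n \<Rightarrow> real" and W :: "real^'n \<Rightarrow> real^'n"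
  assumes G: "open G" "frontier \<Omega> \<subseteq> G" and F: "Ck_on 2 F G" "\<And>X. X \<in> frontier \<Omega> \<Longrightarrow> f (\<psi> X) = F X"
    and W: "Ck_on 1 W G"
      "\<And>X. X \<in> frontier \<Omega> \<Longrightarrow> W X = tproj (conormal (B X) (gradient \<Phi> X)) *v (transpose (B X) *v gradient F X)"
    and X: "X \<in> frontier \<Omega>"
  shows "laplace_beltrami (\<psi> ` frontier \<Omega>) f (\<psi> X)
    = trace (jacobian_matrix W X ** B X ** tproj (conormal (B X) (gradient \<Phi> X)))"
proof -
  let ?\<Gamma> = "\<psi> ` frontier \<Omega>"
  have dF: "F differentiable (at Y)" "W differentiable (at Y)" if "Y \<in> frontier \<Omega>" for Y
    using Ck_on_differentiable[OF F(1)] Ck_on_differentiable[OF W(1)] that G by auto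
  have ext: "Ck_extension 1 ?\<Gamma> f (\<lambda>y. F (\<theta> y))"
    unfolding Ck_extension_def using G F Ck_on_mono[OF F(1), of 1]
    by (intro conjI exI[of _ "\<psi> ` G"] open_image pushforward_C1) auto
  have tg: "tgrad ?\<Gamma> f (\<psi> Y) = W Y" if Y: "Y \<in> frontier \<Omega>" for Y
    using tgrad_extension[OF pushforward_boundary _ ext, of "\<psi> Y"] Y
    by (simp add: normal_pushforward gradient_pushforward dF W)
  have "Ck_extension 1 ?\<Gamma> (tgrad ?\<Gamma> f) (\<lambda>y. W (\<theta> y))"
    unfolding Ck_extension_def using G W tg
    by (intro conjI exI[of _ "\<psi> ` G"] open_image pushforward_C1) auto
  from tdiv_extension[OF pushforward_boundary _ this, of "\<psi> X"] X show ?thesis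
    by (simp add: laplace_beltrami_def normal_pushforward jacobian_pushforward dF)
qed

end

end

section \<open>One-parameter families of functions\<close>

text \<open>A one-sided derivative at time 0, locally uniform in space since the limit lets the
  point move to \<open>p\<close> as well. Continuity of \<open>f 0\<close> is included so that
  product rules hold for this notion.\<close>

definition has_time_derivative ::
    "(real \<Rightarrow> 'a::t2_space \<Rightarrow> 'b::real_normed_vector) \<Rightarrow> 'a \<Rightarrow> 'b \<Rightarrow> bool" where
  "has_time_derivative f p l \<longleftrightarrow>
     isCont (f 0) p \<and> ((\<lambda>(t, q). (f t q - f 0 q) /\<^sub>R t) \<longlongrightarrow> l) (near p)"

lemma eventually_near_pos: "\<forall>\<^sub>F (t, q) in near p. 0 < t"
  by (rule eventually_near_time) (simp add: eventually_at_right_less)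

lemma has_time_derivative_tendsto:
  assumes "has_time_derivative f p l"
  shows "((\<lambda>(t, q). f t q) \<longlongrightarrow> f 0 p) (near p)"
proof -
  have t: "((\<lambda>(t, q). t) \<longlongrightarrow> 0) (near p)"
    by (rule tendsto_near_time) (simp add: tendsto_ident_at)
  have q: "((\<lambda>(t, q). (f t q - f 0 q) /\<^sub>R t) \<longlongrightarrow> l) (near p)" and c: "isCont (f 0) p"
    using assms by (auto simp: has_time_derivative_def)
  have "((\<lambda>(t, q). f 0 q + t *\<^sub>R ((f t q - f 0 q) /\<^sub>R t)) \<longlongrightarrow> f 0 p) (near p)"
    using tendsto_add[OF isCont_near[OF c] tendsto_scaleR[OF t q]] by (simp add: case_prod_unfold)
  moreover have "\<forall>\<^sub>F z in near p. (case z of (t, q) \<Rightarrow> f 0 q + t *\<^sub>R ((f t q - f 0 q) /\<^sub>R t)) = (case z of (t, q) \<Rightarrow> f t q)"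
    using eventually_near_pos[of p] by eventually_elim auto
  ultimately show ?thesis by (rule Lim_transform_eventually)
qed

lemma has_time_derivative_cong:
  assumes f: "has_time_derivative f p l" and ev: "\<forall>\<^sub>F (t, q) in near p. f t q = g t q"
    and ev0: "\<forall>\<^sub>F q in nhds p. f 0 q = g 0 q"
  shows "has_time_derivative g p l"
proof -
  have "isCont (g 0) p" using f isCont_cong[OF ev0] by (simp add: has_time_derivative_def)
  moreover have "\<forall>\<^sub>F z in near p. (case z of (t, q) \<Rightarrow> (f t q - f 0 q) /\<^sub>R t) = (case z of (t, q) \<Rightarrow> (g t q - g 0 q) /\<^sub>R t)"
    using ev eventually_near_space[OF ev0] by eventually_elim auto
  then have "((\<lambda>(t, q). (g t q - g 0 q) /\<^sub>R t) \<longlongrightarrow> l) (near p)"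
    by (rule Lim_transform_eventually[OF conjunct2[OF f[unfolded has_time_derivative_def]]])
  ultimately show ?thesis by (simp add: has_time_derivative_def)
qed

lemma has_time_derivative_const: "isCont f p \<Longrightarrow> has_time_derivative (\<lambda>t. f) p 0"
  by (simp add: has_time_derivative_def case_prod_unfold)

lemma has_time_derivative_linear:
  assumes L: "bounded_linear L" and f: "has_time_derivative f p l"
  shows "has_time_derivative (\<lambda>t q. L (f t q)) p (L l)"
proof -
  interpret bounded_linear L by (rule L)
  have "((\<lambda>z. L (case z of (t, q) \<Rightarrow> (f t q - f 0 q) /\<^sub>R t)) \<longlongrightarrow> L l) (near p)"
    using f by (intro tendsto) (simp add: has_time_derivative_def)
  then have "((\<lambda>(t, q). (L (f t q) - L (f 0 q)) /\<^sub>R t) \<longlongrightarrow> L l) (near p)"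
    by (simp add: case_prod_unfold scaleR diff)
  moreover have "isCont (\<lambda>q. L (f 0 q)) p" using f by (intro isCont) (simp add: has_time_derivative_def)
  ultimately show ?thesis by (simp add: has_time_derivative_def)
qed

lemma has_time_derivative_add:
  assumes f: "has_time_derivative f p l" and g: "has_time_derivative g p m"
  shows "has_time_derivative (\<lambda>t q. f t q + g t q) p (l + m)"
proof -
  have fl: "((\<lambda>(t, q). (f t q - f 0 q) /\<^sub>R t) \<longlongrightarrow> l) (near p)"
    and gl: "((\<lambda>(t, q). (g t q - g 0 q) /\<^sub>R t) \<longlongrightarrow> m) (near p)"
    using f g by (simp_all add: has_time_derivative_def)
  note tendsto_add[OF fl gl]
  then have "((\<lambda>(t, q). (f t q + g t q - (f 0 q + g 0 q)) /\<^sub>R t) \<longlongrightarrow> l + m) (near p)"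
    by (simp add: case_prod_unfold scaleR_add_right[symmetric] add_diff_add)
  then show ?thesis using f g by (simp add: has_time_derivative_def)
qed

lemma has_time_derivative_sum:
  assumes "\<And>i. i \<in> I \<Longrightarrow> has_time_derivative (f i) p (l i)"
  shows "has_time_derivative (\<lambda>t q. \<Sum>i\<in>I. f i t q) p (\<Sum>i\<in>I. l i)"
  using assms by (induction I rule: infinite_finite_induct)
    (auto intro: has_time_derivative_const has_time_derivative_add)

lemma has_time_derivative_bilinear:
  assumes B: "bounded_bilinear B" and f: "has_time_derivative f p l" and g: "has_time_derivative g p m"
  shows "has_time_derivative (\<lambda>t q. B (f t q) (g t q)) p (B l (g 0 p) + B (f 0 p) m)"
proof -
  interpret bounded_bilinear B by (rule B)
  have c: "isCont (f 0) p" "isCont (g 0) p" using f g by (auto simp: has_time_derivative_def)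
  have "((\<lambda>z. B (case z of (t, q) \<Rightarrow> (f t q - f 0 q) /\<^sub>R t) (case z of (t, q) \<Rightarrow> g t q)
      + B (case z of (t, q) \<Rightarrow> f 0 q) (case z of (t, q) \<Rightarrow> (g t q - g 0 q) /\<^sub>R t)) \<longlongrightarrow> B l (g 0 p) + B (f 0 p) m) (near p)"
  proof -
    have fl: "((\<lambda>(t, q). (f t q - f 0 q) /\<^sub>R t) \<longlongrightarrow> l) (near p)"
      and gl: "((\<lambda>(t, q). (g t q - g 0 q) /\<^sub>R t) \<longlongrightarrow> m) (near p)"
      using f g by (simp_all add: has_time_derivative_def)
    show ?thesis
      by (rule tendsto_add[OF tendsto[OF fl has_time_derivative_tendsto[OF g]] tendsto[OF isCont_near[OF c(1)] gl]])
  qed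
  moreover have "B ((a - a0) /\<^sub>R t) b + B a0 ((b - b0) /\<^sub>R t) = (B a b - B a0 b0) /\<^sub>R t" for a a0 b b0 t
    by (simp add: scaleR_left scaleR_right diff_left diff_right scaleR_add_right[symmetric])
  ultimately have "((\<lambda>(t, q). (B (f t q) (g t q) - B (f 0 q) (g 0 q)) /\<^sub>R t) \<longlongrightarrow> B l (g 0 p) + B (f 0 p) m) (near p)"
    by (simp add: case_prod_unfold)
  moreover have "isCont (\<lambda>q. B (f 0 q) (g 0 q)) p"
    using c by (intro isCont)
  ultimately show ?thesis by (simp add: has_time_derivative_def)
qed

text \<open>
  A family \<open>f\<close> with \<open>f t = f 0 + t f' + o(t)\<close> in \<open>C\<^sup>1\<close>, locally uniformly near \<open>p\<close>. The derivatives of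
  \<open>f'\<close> are the time derivatives of those of \<open>f\<close>, which is what makes the product rules below
  commute with differentiation in space.
\<close>

definition C1_family ::
    "(real \<Rightarrow> 'a::euclidean_space \<Rightarrow> 'b::real_normed_vector) \<Rightarrow> ('a \<Rightarrow> 'b) \<Rightarrow> 'a \<Rightarrow> bool" where
  "C1_family f f' p \<longleftrightarrow>
     (\<exists>U. open U \<and> p \<in> U \<and> Ck_on 1 (f 0) U \<and> Ck_on 1 f' U) \<and>
     (\<forall>\<^sub>F (t, q) in near p. f t differentiable (at q)) \<and>
     has_time_derivative f p (f' p) \<and>
     (\<forall>h. has_time_derivative (\<lambda>t q. dd (f t) q h) p (dd f' p h))"

lemma C1_familyD:
  assumes "C1_family f f' p"
  shows "has_time_derivative f p (f' p)" "has_time_derivative (\<lambda>t q. dd (f t) q h) p (dd f' p h)"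
    "f 0 differentiable (at p)" "f' differentiable (at p)"
    "\<forall>\<^sub>F (t, q) in near p. f t differentiable (at q)"
    "\<forall>\<^sub>F q in nhds p. f 0 differentiable (at q)"
proof -
  obtain U where U: "open U" "p \<in> U" "Ck_on 1 (f 0) U" "Ck_on 1 f' U"
    using assms by (auto simp: C1_family_def)
  then show "f 0 differentiable (at p)" "f' differentiable (at p)"
    by (auto intro: Ck_on_differentiable)
  have "\<forall>\<^sub>F q in nhds p. q \<in> U" using U by (simp add: eventually_nhds_in_open)
  then show "\<forall>\<^sub>F q in nhds p. f 0 differentiable (at q)"
    by eventually_elim (use U in \<open>auto intro: Ck_on_differentiable\<close>)
qed (use assms in \<open>auto simp: C1_family_def\<close>)

lemma C1_familyI:
  assumes "\<exists>U. open U \<and> p \<in> U \<and> Ck_on 1 (f 0) U \<and> Ck_on 1 f' U"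
    and "\<forall>\<^sub>F (t, q) in near p. f t differentiable (at q)"
    and "has_time_derivative f p (f' p)"
    and "\<And>h. has_time_derivative (\<lambda>t q. dd (f t) q h) p (dd f' p h)"
  shows "C1_family f f' p"
  using assms unfolding C1_family_def by blast

section \<open>Rules of calculus for families expanded to first order in C^1\<close>

lemma C1_family_const:
  assumes "open U" "p \<in> U" "Ck_on 1 f U"
  shows "C1_family (\<lambda>t. f) (\<lambda>q. 0) p"
proof -
  have "\<forall>\<^sub>F q in nhds p. q \<in> U" using assms by (simp add: eventually_nhds_in_open)
  from eventually_near_space[OF this]
  have "\<forall>\<^sub>F (t, q) in near p. f differentiable (at q)"
    by eventually_elim (use assms in \<open>auto intro: Ck_on_differentiable\<close>)
  moreover have "isCont f p" "isCont (\<lambda>q. dd f q h) p" for h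
    using Ck_on_isCont[OF assms(3)] assms by (auto simp: continuous_on_eq_continuous_at)
  ultimately show ?thesis
    unfolding C1_family_def using assms
    by (auto intro!: has_time_derivative_const Ck_on_const exI[of _ U] simp: frechet_derivative_const)
qed

lemma C1_family_linear:
  assumes L: "bounded_linear L" and f: "C1_family f f' p"
  shows "C1_family (\<lambda>t q. L (f t q)) (\<lambda>q. L (f' q)) p"
proof -
  note F = C1_familyD[OF f]
  obtain U where U: "open U" "p \<in> U" "Ck_on 1 (f 0) U" "Ck_on 1 f' U"
    using f by (auto simp: C1_family_def)
  have A1: "\<exists>U. open U \<and> p \<in> U \<and> Ck_on 1 (\<lambda>q. L (f 0 q)) U \<and> Ck_on 1 (\<lambda>q. L (f' q)) U"
    using U by (intro exI[of _ U] conjI Ck_on_bounded_linear[OF L])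
  have d: "(\<lambda>q. L (g q)) differentiable (at q)" if "g differentiable (at q)" for g q
    using bounded_linear.has_derivative[OF L has_derivative_dd[OF that]] by (rule differentiableI)
  have A2: "\<forall>\<^sub>F (t, q) in near p. (\<lambda>q. L (f t q)) differentiable (at q)"
    using F(5) by eventually_elim (auto intro: d)
  have A3: "has_time_derivative (\<lambda>t q. dd (\<lambda>q. L (f t q)) q h) p (dd (\<lambda>q. L (f' q)) p h)" for h
  proof (rule has_time_derivative_cong)
    show "has_time_derivative (\<lambda>t q. L (dd (f t) q h)) p (dd (\<lambda>q. L (f' q)) p h)"
      unfolding dd_bounded_linear_compose[OF L F(4)] by (rule has_time_derivative_linear[OF L F(2)])
    show "\<forall>\<^sub>F (t, q) in near p. L (dd (f t) q h) = dd (\<lambda>q. L (f t q)) q h"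
      using F(5) by eventually_elim (auto simp: dd_bounded_linear_compose[OF L])
    show "\<forall>\<^sub>F q in nhds p. L (dd (f 0) q h) = dd (\<lambda>q. L (f 0 q)) q h"
      using F(6) by eventually_elim (auto simp: dd_bounded_linear_compose[OF L])
  qed
  show ?thesis by (rule C1_familyI[OF A1 A2 has_time_derivative_linear[OF L F(1)] A3])
qed

lemma C1_family_add:
  assumes f: "C1_family f f' p" and g: "C1_family g g' p"
  shows "C1_family (\<lambda>t q. f t q + g t q) (\<lambda>q. f' q + g' q) p"
proof -
  note F = C1_familyD[OF f] and G = C1_familyD[OF g]
  obtain U1 where U1: "open U1" "p \<in> U1" "Ck_on 1 (f 0) U1" "Ck_on 1 f' U1"
    using f by (auto simp: C1_family_def)
  obtain U2 where U2: "open U2" "p \<in> U2" "Ck_on 1 (g 0) U2" "Ck_on 1 g' U2"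
    using g by (auto simp: C1_family_def)
  have A1: "\<exists>U. open U \<and> p \<in> U \<and> Ck_on 1 (\<lambda>q. f 0 q + g 0 q) U \<and> Ck_on 1 (\<lambda>q. f' q + g' q) U"
  proof (intro exI[of _ "U1 \<inter> U2"] conjI Ck_on_add)
    show "Ck_on 1 (f 0) (U1 \<inter> U2)" by (rule Ck_on_subset[OF U1(3)]) simp
    show "Ck_on 1 f' (U1 \<inter> U2)" by (rule Ck_on_subset[OF U1(4)]) simp
    show "Ck_on 1 (g 0) (U1 \<inter> U2)" by (rule Ck_on_subset[OF U2(3)]) simp
    show "Ck_on 1 g' (U1 \<inter> U2)" by (rule Ck_on_subset[OF U2(4)]) simp
  qed (use U1 U2 in auto)
  have A2: "\<forall>\<^sub>F (t, q) in near p. (\<lambda>q. f t q + g t q) differentiable (at q)"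
    using F(5) G(5) by eventually_elim auto
  have dd: "dd (\<lambda>q. a q + b q) q = (\<lambda>h. dd a q h + dd b q h)"
    if "a differentiable (at q)" "b differentiable (at q)" for a b :: "'a \<Rightarrow> 'b" and q
    using that by (intro dd_eqI has_derivative_add has_derivative_dd)
  have A3: "has_time_derivative (\<lambda>t q. dd (\<lambda>q. f t q + g t q) q h) p (dd (\<lambda>q. f' q + g' q) p h)" for h
  proof (rule has_time_derivative_cong)
    show "has_time_derivative (\<lambda>t q. dd (f t) q h + dd (g t) q h) p (dd (\<lambda>q. f' q + g' q) p h)"
      unfolding dd[OF F(4) G(4)] by (intro has_time_derivative_add F G)
    show "\<forall>\<^sub>F (t, q) in near p. dd (f t) q h + dd (g t) q h = dd (\<lambda>q. f t q + g t q) q h"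
      using F(5) G(5) by eventually_elim (auto simp: dd)
    show "\<forall>\<^sub>F q in nhds p. dd (f 0) q h + dd (g 0) q h = dd (\<lambda>q. f 0 q + g 0 q) q h"
      using F(6) G(6) by eventually_elim (auto simp: dd)
  qed
  show ?thesis by (rule C1_familyI[OF A1 A2 has_time_derivative_add[OF F(1) G(1)] A3])
qed

lemma C1_family_sum:
  assumes "finite I" "\<And>i. i \<in> I \<Longrightarrow> C1_family (f i) (f' i) p"
  shows "C1_family (\<lambda>t q. \<Sum>i\<in>I. f i t q) (\<lambda>q. \<Sum>i\<in>I. f' i q) p"
  using assms
  by (induction I rule: finite_induct)
    (auto intro: C1_family_add C1_family_const[of UNIV] Ck_on_const simp del: One_nat_def)

text \<open>This is the form in which the pulled back function enters: its first order part is
  known, and the remainder, after division by \<open>t\<close>, tends to 0 together with its first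
  derivatives.\<close>

lemma C1_family_perturbation:
  assumes U: "open U" "p \<in> U" and f: "Ck_on 1 f U" and g: "Ck_on 1 g U"
    and r: "\<forall>\<^sub>F t in at_right 0. \<forall>q. r t differentiable (at q)"
    and r0: "((\<lambda>(t, q). r t q) \<longlongrightarrow> 0) (near p)" "\<And>h. ((\<lambda>(t, q). dd (r t) q h) \<longlongrightarrow> 0) (near p)"
  shows "C1_family (\<lambda>t q. f q + t *\<^sub>R (g q + r t q)) g p"
proof (rule C1_familyI)
  have evU: "\<forall>\<^sub>F q in nhds p. q \<in> U" using U by (simp add: eventually_nhds_in_open)
  have dfg: "f differentiable (at q)" "g differentiable (at q)" if "q \<in> U" for q
    using f g that by (auto intro: Ck_on_differentiable)
  have cont: "isCont f p" "isCont g p" "isCont (\<lambda>q. dd f q h) p" "isCont (\<lambda>q. dd g q h) p" for h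
    using Ck_on_isCont[OF f] Ck_on_isCont[OF g] f g U by (auto simp: continuous_on_eq_continuous_at)
  have quotient: "has_time_derivative (\<lambda>t q. a q + t *\<^sub>R (b q + c t q)) p (b p)"
    if "isCont a p" "isCont b p" "((\<lambda>(t, q). c t q) \<longlongrightarrow> 0) (near p)" for a b :: "'a \<Rightarrow> 'b" and c
  proof -
    have "((\<lambda>z. (case z of (t, q) \<Rightarrow> b q) + (case z of (t, q) \<Rightarrow> c t q)) \<longlongrightarrow> b p + 0) (near p)"
      by (rule tendsto_add[OF isCont_near[OF that(2)] that(3)])
    then have "((\<lambda>z. (case z of (t, q) \<Rightarrow> b q) + (case z of (t, q) \<Rightarrow> c t q)) \<longlongrightarrow> b p) (near p)" by simp
    moreover have "\<forall>\<^sub>F z in near p. (case z of (t, q) \<Rightarrow> b q) + (case z of (t, q) \<Rightarrow> c t q)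
      = (case z of (t, q) \<Rightarrow> (a q + t *\<^sub>R (b q + c t q) - (a q + 0 *\<^sub>R (b q + c 0 q))) /\<^sub>R t)"
      using eventually_near_pos[of p] by eventually_elim auto
    ultimately have "((\<lambda>(t, q). (a q + t *\<^sub>R (b q + c t q) - (a q + 0 *\<^sub>R (b q + c 0 q))) /\<^sub>R t) \<longlongrightarrow> b p) (near p)"
      by (rule Lim_transform_eventually)
    then show ?thesis using that(1) by (simp add: has_time_derivative_def)
  qed
  show "\<exists>U. open U \<and> p \<in> U \<and> Ck_on 1 (\<lambda>q. f q + 0 *\<^sub>R (g q + r 0 q)) U \<and> Ck_on 1 g U"
    using U f g by (intro exI[of _ U]) simp
  have rd: "((\<lambda>q. f q + t *\<^sub>R (g q + r t q)) has_derivative (\<lambda>h. dd f q h + t *\<^sub>R (dd g q h + dd (r t) q h))) (at q)"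
    if "q \<in> U" "r t differentiable (at q)" for t q
    using that by (intro has_derivative_add has_derivative_scaleR_right has_derivative_dd dfg)
  have both: "\<forall>\<^sub>F (t, q) in near p. q \<in> U \<and> r t differentiable (at q)"
    using eventually_near_time[OF r, of p] eventually_near_space[OF evU] by eventually_elim auto
  then show "\<forall>\<^sub>F (t, q) in near p. (\<lambda>q. f q + t *\<^sub>R (g q + r t q)) differentiable (at q)"
    by eventually_elim (auto intro: differentiableI[OF rd])
  show "has_time_derivative (\<lambda>t q. f q + t *\<^sub>R (g q + r t q)) p (g p)"
    by (rule quotient[OF cont(1,2) r0(1)])
  fix h
  show "has_time_derivative (\<lambda>t q. dd (\<lambda>q. f q + t *\<^sub>R (g q + r t q)) q h) p (dd g p h)"
  proof (rule has_time_derivative_cong[OF quotient[OF cont(3,4) r0(2)]])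
    show "\<forall>\<^sub>F (t, q) in near p. dd f q h + t *\<^sub>R (dd g q h + dd (r t) q h) = dd (\<lambda>q. f q + t *\<^sub>R (g q + r t q)) q h"
      using both by eventually_elim (auto simp: dd_eqI[OF rd])
    show "\<forall>\<^sub>F q in nhds p. dd f q h + 0 *\<^sub>R (dd g q h + dd (r 0) q h) = dd (\<lambda>q. f q + 0 *\<^sub>R (g q + r 0 q)) q h"
      by simp
  qed
qed

lemma dd_bilinear:
  assumes "bounded_bilinear B" "f differentiable (at q)" "g differentiable (at q)"
  shows "dd (\<lambda>q. B (f q) (g q)) q h = B (dd f q h) (g q) + B (f q) (dd g q h)"
  using dd_eqI[OF bounded_bilinear.FDERIV[OF assms(1) has_derivative_dd[OF assms(2)] has_derivative_dd[OF assms(3)]]]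
  by (simp add: add.commute)

lemma differentiable_bilinear:
  assumes "bounded_bilinear B" "f differentiable (at q)" "g differentiable (at q)"
  shows "(\<lambda>q. B (f q) (g q)) differentiable (at q)"
  using bounded_bilinear.FDERIV[OF assms(1) has_derivative_dd[OF assms(2)] has_derivative_dd[OF assms(3)]]
  by (rule differentiableI)

text \<open>The time derivative of the spatial derivative and the spatial derivative of the time
  derivative expand into the same four products.\<close>

lemma C1_family_bilinear:
  assumes B: "bounded_bilinear B" and f: "C1_family f f' p" and g: "C1_family g g' p"
  shows "C1_family (\<lambda>t q. B (f t q) (g t q)) (\<lambda>q. B (f' q) (g 0 q) + B (f 0 q) (g' q)) p"
proof -
  note F = C1_familyD[OF f] and G = C1_familyD[OF g]
  obtain U1 where U1: "open U1" "p \<in> U1" "Ck_on 1 (f 0) U1" "Ck_on 1 f' U1"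
    using f by (auto simp: C1_family_def)
  obtain U2 where U2: "open U2" "p \<in> U2" "Ck_on 1 (g 0) U2" "Ck_on 1 g' U2"
    using g by (auto simp: C1_family_def)
  let ?U = "U1 \<inter> U2"
  have "open ?U" "p \<in> ?U" using U1 U2 by auto
  moreover have "Ck_on 1 (f 0) ?U" by (rule Ck_on_subset[OF U1(3)]) simp
  moreover have "Ck_on 1 f' ?U" by (rule Ck_on_subset[OF U1(4)]) simp
  moreover have "Ck_on 1 (g 0) ?U" by (rule Ck_on_subset[OF U2(3)]) simp
  moreover have "Ck_on 1 g' ?U" by (rule Ck_on_subset[OF U2(4)]) simp
  ultimately have A1: "\<exists>U. open U \<and> p \<in> U \<and> Ck_on 1 (\<lambda>q. B (f 0 q) (g 0 q)) U \<and>
      Ck_on 1 (\<lambda>q. B (f' q) (g 0 q) + B (f 0 q) (g' q)) U"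
    by (intro exI[of _ ?U] conjI Ck_on_add Ck_on_bilinear[OF B])
  have A2: "\<forall>\<^sub>F (t, q) in near p. (\<lambda>q. B (f t q) (g t q)) differentiable (at q)"
    using F(5) G(5) by eventually_elim (auto intro: differentiable_bilinear[OF B])
  have A3: "has_time_derivative (\<lambda>t q. dd (\<lambda>q. B (f t q) (g t q)) q h) p
      (dd (\<lambda>q. B (f' q) (g 0 q) + B (f 0 q) (g' q)) p h)" for h
  proof (rule has_time_derivative_cong)
    have "dd (\<lambda>q. B (f' q) (g 0 q) + B (f 0 q) (g' q)) p h
      = dd (\<lambda>q. B (f' q) (g 0 q)) p h + dd (\<lambda>q. B (f 0 q) (g' q)) p h"
      by (rule fun_cong[OF dd_eqI[OF has_derivative_add[OF has_derivative_dd has_derivative_dd]]])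
        (intro differentiable_bilinear[OF B] F G)+
    also have "\<dots> = (B (dd f' p h) (g 0 p) + B (dd (f 0) p h) (g' p)) + (B (f' p) (dd (g 0) p h) + B (f 0 p) (dd g' p h))"
      by (simp add: dd_bilinear[OF B F(4) G(3)] dd_bilinear[OF B F(3) G(4)])
    finally have eq: "dd (\<lambda>q. B (f' q) (g 0 q) + B (f 0 q) (g' q)) p h = \<dots>" .
    show "has_time_derivative (\<lambda>t q. B (dd (f t) q h) (g t q) + B (f t q) (dd (g t) q h)) p
      (dd (\<lambda>q. B (f' q) (g 0 q) + B (f 0 q) (g' q)) p h)"
      unfolding eq by (intro has_time_derivative_add has_time_derivative_bilinear[OF B] F G)
    show "\<forall>\<^sub>F (t, q) in near p. B (dd (f t) q h) (g t q) + B (f t q) (dd (g t) q h) = dd (\<lambda>q. B (f t q) (g t q)) q h"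
      using F(5) G(5) by eventually_elim (auto simp: dd_bilinear[OF B])
    show "\<forall>\<^sub>F q in nhds p. B (dd (f 0) q h) (g 0 q) + B (f 0 q) (dd (g 0) q h) = dd (\<lambda>q. B (f 0 q) (g 0 q)) q h"
      using F(6) G(6) by eventually_elim (auto simp: dd_bilinear[OF B])
  qed
  show ?thesis by (rule C1_familyI[OF A1 A2 has_time_derivative_bilinear[OF B F(1) G(1)] A3])
qed

text \<open>Simplified formulas for time derivatives hold only near \<open>p\<close>, for example
  where the extended normal has unit length.\<close>

lemma C1_family_cong_derivative:
  assumes f: "C1_family f f' p" and U: "open U" "p \<in> U" "\<And>q. q \<in> U \<Longrightarrow> f' q = g q"
  shows "C1_family f g p"
proof -
  obtain U1 where U1: "open U1" "p \<in> U1" "Ck_on 1 (f 0) U1" "Ck_on 1 f' U1"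
    using f by (auto simp: C1_family_def)
  have "Ck_on 1 g (U1 \<inter> U)"
    by (rule Ck_on_cong[OF _ _ Ck_on_subset[OF U1(4)]]) (use U U1 in auto)
  moreover have "Ck_on 1 (f 0) (U1 \<inter> U)" by (rule Ck_on_subset[OF U1(3)]) simp
  ultimately have "\<exists>U. open U \<and> p \<in> U \<and> Ck_on 1 (f 0) U \<and> Ck_on 1 g U"
    using U U1 by (intro exI[of _ "U1 \<inter> U"]) auto
  moreover have "dd f' p = dd g p" using dd_transform[OF U] .
  moreover have "f' p = g p" using U by blast
  ultimately show ?thesis using f unfolding C1_family_def by simp
qed

lemma powr_has_derivative:
  fixes f :: "'a::real_normed_vector \<Rightarrow> real"
  assumes "f differentiable (at q)" "0 < f q"
  shows "((\<lambda>q. f q powr a) has_derivative (\<lambda>h. (a * f q powr (a - 1)) * dd f q h)) (at q)"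
proof -
  have "((\<lambda>s. s powr a) has_derivative (*) (a * f q powr (a - 1))) (at (f q))"
    using has_real_derivative_powr[OF assms(2), of a] by (simp add: has_field_derivative_def)
  from has_derivative_compose[OF has_derivative_dd[OF assms(1)] this] show ?thesis .
qed

text \<open>The base is 1 at time 0, being the squared length of a unit normal. Writing
  \<open>s powr a - 1\<close> as a continuous factor times \<open>s - 1\<close> makes the quotient a
  product of two convergent terms.\<close>

lemma has_time_derivative_powr:
  assumes s: "has_time_derivative s p l" and one: "\<forall>\<^sub>F q in nhds p. s 0 q = (1::real)"
  shows "has_time_derivative (\<lambda>t q. s t q powr a) p (a * l)"
proof -
  have s1: "s 0 p = 1" using one eventually_nhds_x_imp_x by blast
  have "((\<lambda>s. s powr a) has_real_derivative a) (at (1::real))"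
    using has_real_derivative_powr[of 1 a] by simp
  then obtain g where g: "\<And>z. z powr a - 1 = g z * (z - 1)" "isCont g 1" "g 1 = a"
    unfolding CARAT_DERIV by auto
  have "((\<lambda>(t, q). s t q) \<longlongrightarrow> 1) (near p)"
    using has_time_derivative_tendsto[OF s] s1 by simp
  from isCont_tendsto_compose[OF g(2) this] have "((\<lambda>(t, q). g (s t q)) \<longlongrightarrow> a) (near p)"
    by (simp add: case_prod_unfold g(3))
  moreover have "((\<lambda>(t, q). (s t q - s 0 q) /\<^sub>R t) \<longlongrightarrow> l) (near p)"
    using s by (simp add: has_time_derivative_def)
  ultimately have "((\<lambda>z. (case z of (t, q) \<Rightarrow> g (s t q)) * (case z of (t, q) \<Rightarrow> (s t q - s 0 q) /\<^sub>R t)) \<longlongrightarrow> a * l) (near p)"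
    by (rule tendsto_mult)
  moreover have "\<forall>\<^sub>F z in near p. (case z of (t, q) \<Rightarrow> g (s t q)) * (case z of (t, q) \<Rightarrow> (s t q - s 0 q) /\<^sub>R t)
      = (case z of (t, q) \<Rightarrow> (s t q powr a - s 0 q powr a) /\<^sub>R t)"
    using eventually_near_space[OF one] by eventually_elim (auto simp: g(1))
  ultimately have "((\<lambda>(t, q). (s t q powr a - s 0 q powr a) /\<^sub>R t) \<longlongrightarrow> a * l) (near p)"
    by (rule Lim_transform_eventually)
  moreover have "isCont (\<lambda>q. s 0 q powr a) p"
    using s s1 by (intro continuous_intros) (auto simp: has_time_derivative_def)
  ultimately show ?thesis by (simp add: has_time_derivative_def)
qed

lemma C1_family_powr:
  assumes s: "C1_family s s' p" and U: "open U" "p \<in> U" and one: "\<And>q. q \<in> U \<Longrightarrow> s 0 q = (1::real)"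
  shows "C1_family (\<lambda>t q. s t q powr a) (\<lambda>q. a * s' q) p"
proof -
  note S = C1_familyD[OF s]
  have ev: "\<forall>\<^sub>F q in nhds p. q \<in> U" using U by (simp add: eventually_nhds_in_open)
  then have ev1: "\<forall>\<^sub>F q in nhds p. s 0 q = 1" by eventually_elim (rule one)
  obtain U1 where U1: "open U1" "p \<in> U1" "Ck_on 1 (s 0) U1" "Ck_on 1 s' U1"
    using s by (auto simp: C1_family_def)
  have "Ck_on 1 (\<lambda>q. s 0 q powr a) (U1 \<inter> U)"
    by (rule Ck_on_cong[OF _ _ Ck_on_const[of _ 1]]) (use U U1 one in auto)
  moreover have "Ck_on 1 (\<lambda>q. a * s' q) (U1 \<inter> U)"
    by (rule Ck_on_subset[of _ _ U1]) (intro Ck_on_mult U1 Ck_on_const, simp)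
  ultimately have A1: "\<exists>U. open U \<and> p \<in> U \<and> Ck_on 1 (\<lambda>q. s 0 q powr a) U \<and> Ck_on 1 (\<lambda>q. a * s' q) U"
    using U U1 by (intro exI[of _ "U1 \<inter> U"]) auto
  have "((\<lambda>(t, q). s t q) \<longlongrightarrow> 1) (near p)"
    using has_time_derivative_tendsto[OF S(1)] one[OF U(2)] by simp
  then have "\<forall>\<^sub>F z in near p. (case z of (t, q) \<Rightarrow> s t q) > 0" by (rule order_tendstoD) simp
  then have pos: "\<forall>\<^sub>F (t, q) in near p. s t q > 0" by eventually_elim auto
  have A2: "\<forall>\<^sub>F (t, q) in near p. (\<lambda>q. s t q powr a) differentiable (at q)"
    using pos S(5) by eventually_elim (auto intro!: differentiableI powr_has_derivative)
  have A3: "has_time_derivative (\<lambda>t q. dd (\<lambda>q. s t q powr a) q h) p (dd (\<lambda>q. a * s' q) p h)" for h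
  proof (rule has_time_derivative_cong)
    \<comment> \<open>Near \<open>p\<close> the initial function is constant, so its spatial
      derivative vanishes. The zero term is kept in \<open>eq\<close>, which has to match the output
      of the product rule.\<close>
    have "dd (s 0) p = dd (\<lambda>q. 1) p" by (rule dd_transform[OF U one])
    then have "dd (s 0) p h = 0" by (simp add: frechet_derivative_const)
    moreover have "dd (\<lambda>q. a * s' q) p h = a * dd s' p h"
      using dd_bounded_linear_compose[OF bounded_linear_mult_right S(4), of a] by simp
    ultimately have eq: "dd (\<lambda>q. a * s' q) p h = (a * ((a - 1) * s' p)) * dd (s 0) p h + (a * s 0 p powr (a - 1)) * dd s' p h"
      by (simp add: one[OF U(2)])
    show "has_time_derivative (\<lambda>t q. (a * s t q powr (a - 1)) * dd (s t) q h) p (dd (\<lambda>q. a * s' q) p h)"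
      unfolding eq
      by (intro has_time_derivative_bilinear[OF bounded_bilinear_mult]
          has_time_derivative_linear[OF bounded_linear_mult_right] has_time_derivative_powr S ev1)
    show "\<forall>\<^sub>F (t, q) in near p. (a * s t q powr (a - 1)) * dd (s t) q h = dd (\<lambda>q. s t q powr a) q h"
      using pos S(5) by eventually_elim (auto simp: dd_eqI[OF powr_has_derivative])
    show "\<forall>\<^sub>F q in nhds p. (a * s 0 q powr (a - 1)) * dd (s 0) q h = dd (\<lambda>q. s 0 q powr a) q h"
      using ev1 S(6) by eventually_elim (auto simp: dd_eqI[OF powr_has_derivative])
  qed
  show ?thesis by (rule C1_familyI[OF A1 A2 has_time_derivative_powr[OF S(1) ev1] A3])
qed

text \<open>Inversion has derivative \<open>- J'\<close> at the identity. The bound and the spatial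
  derivative of \<open>B t\<close> are asked for at all small positive times; there they come from
  the diffeomorphism property of the flow.\<close>

lemma C1_family_inverse:
  fixes J B :: "real \<Rightarrow> 'a::euclidean_space \<Rightarrow> real^'n^'n"
  assumes J: "C1_family J J' p" and J0: "\<And>q. J 0 q = mat 1" and B0: "\<And>q. B 0 q = mat 1"
    and ev: "\<forall>\<^sub>F t in at_right 0. \<forall>q. B t q ** J t q = mat 1 \<and> norm (B t q) \<le> K \<and>
      (B t has_derivative (\<lambda>h. - (B t q ** dd (J t) q h ** B t q))) (at q)"
  shows "C1_family B (\<lambda>q. - J' q) p"
proof -
  interpret mm: bounded_bilinear "(**) :: real^'n^'n \<Rightarrow> real^'n^'n \<Rightarrow> real^'n^'n"
    by (rule bounded_bilinear_matrix_mul)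
  note F = C1_familyD[OF J]
  note ev' = eventually_near_time[OF ev, of p]
  have bl: "bounded_linear (uminus :: real^'n^'n \<Rightarrow> real^'n^'n)"
    by (rule bounded_linear_minus[OF bounded_linear_ident])
  obtain U where U: "open U" "p \<in> U" "Ck_on 1 (J 0) U" "Ck_on 1 J' U"
    using J by (auto simp: C1_family_def)
  have B0': "B 0 = (\<lambda>q. mat 1)" by (rule ext) (rule B0)
  have J0': "J 0 = (\<lambda>q. mat 1)" by (rule ext) (rule J0)
  have A1: "\<exists>U. open U \<and> p \<in> U \<and> Ck_on 1 (B 0) U \<and> Ck_on 1 (\<lambda>q. - J' q) U"
    unfolding B0' using U by (intro exI[of _ U] conjI Ck_on_const Ck_on_minus)
  have A2: "\<forall>\<^sub>F (t, q) in near p. B t differentiable (at q)"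
    using ev' by eventually_elim (auto intro: differentiableI)
  have tB: "has_time_derivative B p (- J' p)"
  proof -
    have Blim: "((\<lambda>(t, q). B t q) \<longlongrightarrow> mat 1) (near p)"
    proof (rule inverse_matrix_continuous)
      show "((\<lambda>(t, q). J t q) \<longlongrightarrow> mat 1) (near p)"
        using has_time_derivative_tendsto[OF F(1)] by (simp add: J0)
      show "\<forall>\<^sub>F z in near p. (case z of (t, q) \<Rightarrow> B t q) ** (case z of (t, q) \<Rightarrow> J t q) = mat 1"
        using ev' by eventually_elim auto
      show "\<forall>\<^sub>F z in near p. norm (case z of (t, q) \<Rightarrow> B t q) \<le> K"
        using ev' by eventually_elim auto
    qed simp
    have "((\<lambda>(t, q). (J t q - J 0 q) /\<^sub>R t) \<longlongrightarrow> J' p) (near p)"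
      using F(1) by (simp add: has_time_derivative_def)
    from tendsto_minus[OF mm.tendsto[OF Blim this]]
    have "((\<lambda>z. - ((case z of (t, q) \<Rightarrow> B t q) ** (case z of (t, q) \<Rightarrow> (J t q - J 0 q) /\<^sub>R t))) \<longlongrightarrow> - J' p) (near p)"
      by simp
    moreover have "\<forall>\<^sub>F z in near p. - ((case z of (t, q) \<Rightarrow> B t q) ** (case z of (t, q) \<Rightarrow> (J t q - J 0 q) /\<^sub>R t))
        = (case z of (t, q) \<Rightarrow> (B t q - B 0 q) /\<^sub>R t)"
      using ev'
    proof eventually_elim
      case (elim z)
      obtain t q where z: "z = (t, q)" by (cases z)
      have BJ: "B t q ** J t q = mat 1" using elim z by simp
      have "B t q - mat 1 = - (B t q ** (J t q - mat 1) ** mat 1)"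
        by (rule inverse_matrix_diff[OF BJ]) simp
      then show ?case by (simp add: z B0 J0 mm.scaleR_right)
    qed
    ultimately have "((\<lambda>(t, q). (B t q - B 0 q) /\<^sub>R t) \<longlongrightarrow> - J' p) (near p)"
      by (rule Lim_transform_eventually)
    then show ?thesis by (simp add: has_time_derivative_def B0')
  qed
  have A3: "has_time_derivative (\<lambda>t q. dd (B t) q h) p (dd (\<lambda>q. - J' q) p h)" for h
  proof (rule has_time_derivative_cong)
    have "dd (\<lambda>q. - J' q) p h = - dd J' p h"
      using dd_bounded_linear_compose[OF bl F(4)] by simp
    \<comment> \<open>The terms with the vanishing spatial derivative of \<open>J 0\<close> are
      written out so that the product rule applies literally.\<close>
    then have eq: "dd (\<lambda>q. - J' q) p h = - (((- J' p) ** dd (J 0) p h + B 0 p ** dd J' p h) ** B 0 p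
        + (B 0 p ** dd (J 0) p h) ** (- J' p))"
      by (simp add: J0' B0 frechet_derivative_const mm.zero_right mm.zero_left)
    show "has_time_derivative (\<lambda>t q. - (B t q ** dd (J t) q h ** B t q)) p (dd (\<lambda>q. - J' q) p h)"
      unfolding eq
      by (intro has_time_derivative_linear[OF bl] has_time_derivative_bilinear[OF bounded_bilinear_matrix_mul] tB F)
    show "\<forall>\<^sub>F (t, q) in near p. - (B t q ** dd (J t) q h ** B t q) = dd (B t) q h"
      using ev'
    proof eventually_elim
      case (elim z)
      obtain t q where z: "z = (t, q)" by (cases z)
      have "(B t has_derivative (\<lambda>h. - (B t q ** dd (J t) q h ** B t q))) (at q)" using elim z by simp
      from dd_eqI[OF this] show ?case by (simp add: z)
    qed
    show "\<forall>\<^sub>F q in nhds p. - (B 0 q ** dd (J 0) q h ** B 0 q) = dd (B 0) q h"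
      by (simp add: B0' J0' frechet_derivative_const mm.zero_right mm.zero_left)
  qed
  show ?thesis by (rule C1_familyI[OF A1 A2 tB A3])
qed

lemma jacobian_columns: "jacobian_matrix W q = (\<Sum>i\<in>UNIV. tensor (dd W q (axis i 1)) (axis i 1))"
  by (simp add: jacobian_matrix_def matrix_def tensor_def vec_eq_iff axis_def if_distrib cong: if_cong)

lemma C1_family_jacobian:
  fixes W :: "real \<Rightarrow> real^'n \<Rightarrow> real^'n"
  assumes "C1_family W W' p"
  shows "has_time_derivative (\<lambda>t. jacobian_matrix (W t)) p (jacobian_matrix W' p)"
proof -
  have "has_time_derivative (\<lambda>t q. \<Sum>i\<in>UNIV. tensor (dd (W t) q (axis i 1)) (axis i 1)) p
      (\<Sum>i\<in>UNIV. tensor (dd W' p (axis i 1)) (axis i 1))"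
    by (intro has_time_derivative_sum has_time_derivative_linear[OF
          bounded_bilinear.bounded_linear_left[OF bounded_bilinear_tensor]] C1_familyD[OF assms])
  then show ?thesis by (simp add: jacobian_columns[abs_def])
qed

section \<open>The pointwise identity\<close>

declare transpose_matrix_vector [simp del]

section \<open>Product rules for matrix fields and symmetry of second derivatives\<close>

lemma matrix_vec_has_derivative:
  fixes A :: "'a::real_normed_vector \<Rightarrow> real^'n^'n"
  assumes "(A has_derivative A') (at x)" "(a has_derivative a') (at x)"
  shows "((\<lambda>x. A x *v a x) has_derivative (\<lambda>h. A x *v a' h + A' h *v a x)) (at x)"
  using bounded_bilinear.FDERIV[OF bounded_bilinear_matrix_vec assms] .

lemma matrix_mul_has_derivative:
  fixes A B :: "'a::real_normed_vector \<Rightarrow> real^'n^'n"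
  assumes "(A has_derivative A') (at x)" "(B has_derivative B') (at x)"
  shows "((\<lambda>x. A x ** B x) has_derivative (\<lambda>h. A x ** B' h + A' h ** B x)) (at x)"
  using bounded_bilinear.FDERIV[OF bounded_bilinear_matrix_mul assms] .

lemma tproj_has_derivative:
  assumes "(N has_derivative N') (at x)"
  shows "((\<lambda>x. tproj (N x)) has_derivative (\<lambda>h. - (tensor (N x) (N' h) + tensor (N' h) (N x)))) (at x)"
  unfolding tproj_def
  by (auto intro!: derivative_eq_intros bounded_bilinear.FDERIV[OF bounded_bilinear_tensor assms assms])

lemma trace_mul_tensor: "trace (A ** tensor a b) = (A *v a) \<bullet> b"
  by (simp add: matrix_mul_tensor trace_tensor)

lemma trace_tensor_mul: "trace (tensor a b ** A) = b \<bullet> (A *v a)"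
  unfolding tensor_mul_matrix trace_tensor inner_matrix_vec[of b A a] by (rule inner_commute)

lemma trace_scaleR: "trace (c *\<^sub>R A) = c * trace A"
  for A :: "real^'n^'n"
  by (simp add: trace_def sum_distrib_left)

lemma trace_minus: "trace (- A) = - trace A"
  for A :: "real^'n^'n"
  by (simp add: trace_def sum_negf)

lemma has_derivative_gradient: "F differentiable (at x) \<Longrightarrow> (F has_derivative (\<lambda>h. gradient F x \<bullet> h)) (at x)"
  using has_derivative_dd[of F x] dd_gradient[of F x] by (metis ext)

lemma has_derivative_jacobian:
  "W differentiable (at x) \<Longrightarrow> (W has_derivative (\<lambda>h. jacobian_matrix W x *v h)) (at x)"
  using has_derivative_dd[of W x] dd_jacobian[of W x] by (metis ext)

text \<open>Used to exchange roles: the derivative in direction \<open>h\<close> applied to a fixed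
  vector becomes a fixed matrix applied to \<open>h\<close>, of which a trace can be taken.\<close>

lemma dd_jacobian_symmetric:
  fixes W :: "real^'n \<Rightarrow> real^'n"
  assumes U: "open U" "q \<in> U" and W: "Ck_on 2 W U"
  shows "dd (jacobian_matrix W) q h *v k = dd (jacobian_matrix W) q k *v h"
proof -
  have J: "jacobian_matrix W differentiable (at q)"
    using Ck_on_jacobian[of U 1 W] W U by (intro Ck_on_differentiable[of 1]) (auto simp: numeral_2_eq_2)
  have eq: "dd (jacobian_matrix W) q h *v k = dd (\<lambda>y. dd W y k) q h" for h k
  proof -
    have "dd (\<lambda>y. dd W y k) q = dd (\<lambda>y. jacobian_matrix W y *v k) q"
      by (rule dd_transform[OF U]) (use W in \<open>auto intro!: dd_jacobian intro: Ck_on_differentiable\<close>)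
    also have "\<dots> = (\<lambda>h. jacobian_matrix W q *v 0 + dd (jacobian_matrix W) q h *v k)"
      by (intro dd_eqI matrix_vec_has_derivative has_derivative_dd J has_derivative_const)
    finally show ?thesis by simp
  qed
  show ?thesis
    unfolding eq by (rule dd_dd_symmetric[OF U(1) W U(2)])
qed

lemma gradient_jacobian_symmetric:
  assumes U: "open U" "q \<in> U" and F: "Ck_on 2 F U"
  shows "transpose (jacobian_matrix (gradient F) q) = jacobian_matrix (gradient F) q"
proof (rule matrix_eqI)
  fix k
  have G: "gradient F differentiable (at q)"
    using Ck_on_gradient[of U 1 F] F U by (intro Ck_on_differentiable[of 1]) (auto simp: numeral_2_eq_2)
  have eq: "dd (\<lambda>y. dd F y k) q h = (jacobian_matrix (gradient F) q *v h) \<bullet> k" for h k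
  proof -
    have "dd (\<lambda>y. dd F y k) q = dd (\<lambda>y. gradient F y \<bullet> k) q"
      by (rule dd_transform[OF U]) (use F in \<open>auto intro!: dd_gradient intro: Ck_on_differentiable\<close>)
    also have "\<dots> = (\<lambda>h. (jacobian_matrix (gradient F) q *v h) \<bullet> k)"
      by (intro dd_eqI has_derivative_inner_left has_derivative_jacobian G)
    finally show ?thesis by simp
  qed
  have "(transpose (jacobian_matrix (gradient F) q) *v k) \<bullet> h = (jacobian_matrix (gradient F) q *v k) \<bullet> h" for h
  proof -
    have "(transpose (jacobian_matrix (gradient F) q) *v k) \<bullet> h = (jacobian_matrix (gradient F) q *v h) \<bullet> k"
      unfolding inner_matrix_vec[symmetric] by (rule inner_commute)
    also have "\<dots> = (jacobian_matrix (gradient F) q *v k) \<bullet> h"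
      using dd_dd_symmetric[OF U(1) F U(2), of k h] unfolding eq .
    finally show ?thesis .
  qed
  then show "transpose (jacobian_matrix (gradient F) q) *v k = jacobian_matrix (gradient F) q *v k"
    by (metis vector_eq_rdot)
qed

text \<open>\<open>N\<close> is a unit field near the boundary whose tangential Jacobian is
  symmetric. It may differ from the gradient of a distance function, and then the derivative of
  \<open>N\<close> along \<open>N\<close> is nonzero; the projections in \<open>\<kappa>\<close> and
  \<open>L\<close> remove the normal directions. \<open>G\<close> has the regularity C^2 of a
  material derivative of a C^3 function.\<close>

locale tangential_setting =
  fixes U :: "(real^'n) set" and N v :: "real^'n \<Rightarrow> real^'n" and Z G :: "real^'n \<Rightarrow> real"
  assumes U: "open U" and N2: "Ck_on 2 N U" and unit: "q \<in> U \<Longrightarrow> norm (N q) = 1"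
    and sym: "q \<in> U \<Longrightarrow> transpose (tproj (N q) ** jacobian_matrix N q ** tproj (N q))
      = tproj (N q) ** jacobian_matrix N q ** tproj (N q)"
    and Z3: "Ck_on 3 Z U" and G2: "Ck_on 2 G U" and v2: "Ck_on 2 v U"
begin

text \<open>
  \<open>u\<close> is the tangential part of \<open>v\<close>, \<open>w\<close> extends \<open>v\<^sub>n\<close>, \<open>\<tau>\<close> extends \<open>\<nabla>\<^sub>\<Gamma> v\<^sub>n\<close>, and \<open>Zs\<close> extends
  \<open>z'\<close> when \<open>G\<close> extends the material derivative of \<open>z\<close>. The functions ending in \<open>dot\<close> are the time
  derivatives at \<open>0\<close> of the pulled back normal, projection and tangential gradient of \<open>z\<close>.
\<close>

definition "P q = tproj (N q)"
definition "M q = jacobian_matrix N q"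
definition "W q = P q *v gradient Z q"
definition "w q = v q \<bullet> N q"
definition "u q = P q *v v q"
definition "\<tau> q = P q *v gradient w q"
definition "\<kappa> q = trace (M q ** P q)"
definition "Zs q = G q - gradient Z q \<bullet> u q"
definition "Ndot q = - (P q *v (transpose (jacobian_matrix v q) *v N q))"
definition "Pdot q = - (tensor (N q) (Ndot q) + tensor (Ndot q) (N q))"
definition "Wdot q = P q *v (gradient G q - transpose (jacobian_matrix v q) *v gradient Z q) + Pdot q *v gradient Z q"
definition "L q = trace (jacobian_matrix W q ** P q)"
text \<open>The shape derivative of the tangential gradient of \<open>z\<close>: the tangential
  gradient of \<open>z'\<close>, a normal part due to the turning of the surface, and a change
  through its curvature. What is left of \<open>Wdot\<close> is transport along
  \<open>u\<close>.\<close>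

definition "\<omega> q = P q *v gradient Zs q + (\<tau> q \<bullet> gradient Z q) *\<^sub>R N q - w q *\<^sub>R (M q *v W q)"

lemma regularity:
  shows P2: "Ck_on 2 P U" and M1: "Ck_on 1 M U" and gradZ2: "Ck_on 2 (gradient Z) U"
    and W2: "Ck_on 2 W U" and w2: "Ck_on 2 w U" and u2: "Ck_on 2 u U"
    and \<tau>1: "Ck_on 1 \<tau> U" and Zs2: "Ck_on 2 Zs U" and gradZs1: "Ck_on 1 (gradient Zs) U"
    and C1: "Ck_on 1 (jacobian_matrix W) U" and \<kappa>1: "Ck_on 1 \<kappa> U" and L1: "Ck_on 1 L U"
    and \<omega>1: "Ck_on 1 \<omega> U"
proof -
  show P: "Ck_on 2 P U" unfolding P_def[abs_def] by (intro Ck_on_tproj U N2)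
  show M: "Ck_on 1 M U" unfolding M_def[abs_def] using Ck_on_jacobian[of U 1 N] U N2 by (simp add: numeral_2_eq_2)
  show gZ: "Ck_on 2 (gradient Z) U" using Ck_on_gradient[of U 2 Z] U Z3 by (simp add: numeral_3_eq_3 numeral_2_eq_2)
  show W: "Ck_on 2 W U" unfolding W_def[abs_def] by (intro Ck_on_matrix_vec U P gZ)
  show w: "Ck_on 2 w U" unfolding w_def[abs_def] by (intro Ck_on_inner U v2 N2)
  show u: "Ck_on 2 u U" unfolding u_def[abs_def] by (intro Ck_on_matrix_vec U P v2)
  have gw: "Ck_on 1 (gradient w) U" using Ck_on_gradient[of U 1 w] U w by (simp add: numeral_2_eq_2)
  have P1: "Ck_on 1 P U" "Ck_on 1 (gradient Z) U" "Ck_on 1 N U" "Ck_on 1 w U" "Ck_on 1 W U"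
    using Ck_on_mono[of 2 _ U 1] P gZ N2 w W by auto
  show \<tau>: "Ck_on 1 \<tau> U" unfolding \<tau>_def[abs_def] by (intro Ck_on_matrix_vec U P1 gw)
  show Zs: "Ck_on 2 Zs U" unfolding Zs_def[abs_def] by (intro Ck_on_diff Ck_on_inner U G2 gZ u)
  show gZs: "Ck_on 1 (gradient Zs) U" using Ck_on_gradient[of U 1 Zs] U Zs by (simp add: numeral_2_eq_2)
  show C: "Ck_on 1 (jacobian_matrix W) U" using Ck_on_jacobian[of U 1 W] U W by (simp add: numeral_2_eq_2)
  show "Ck_on 1 \<kappa> U" unfolding \<kappa>_def[abs_def]
    by (intro Ck_on_bounded_linear[OF bounded_linear_trace U] Ck_on_matrix_mul U M P1)
  show "Ck_on 1 L U" unfolding L_def[abs_def]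
    by (intro Ck_on_bounded_linear[OF bounded_linear_trace U] Ck_on_matrix_mul U C P1)
  show "Ck_on 1 \<omega> U" unfolding \<omega>_def[abs_def]
    by (intro Ck_on_diff Ck_on_add Ck_on_scaleR Ck_on_inner Ck_on_matrix_vec U P1 gZs \<tau> M)
qed

section \<open>The extended normal and the moving tangential gradient at a fixed point\<close>

context
  fixes q assumes q: "q \<in> U"
begin

lemma diffs:
  "N differentiable (at q)" "v differentiable (at q)" "G differentiable (at q)" "gradient Z differentiable (at q)"
  "W differentiable (at q)" "w differentiable (at q)" "u differentiable (at q)" "Zs differentiable (at q)"
  "M differentiable (at q)" "P differentiable (at q)" "jacobian_matrix W differentiable (at q)"
  "\<omega> differentiable (at q)"
  using N2 v2 G2 gradZ2 W2 w2 u2 Zs2 M1 P2 C1 \<omega>1 q by (auto intro: Ck_on_differentiable)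

text \<open>Differentiate the constant function \<open>N x \<bullet> N x\<close>.\<close>

lemma normal_inner_M: "N q \<bullet> (M q *v h) = 0"
proof -
  have "((\<lambda>x. N x \<bullet> N x) has_derivative (\<lambda>h. N q \<bullet> (M q *v h) + (M q *v h) \<bullet> N q)) (at q)"
    unfolding M_def by (intro has_derivative_inner has_derivative_jacobian diffs)
  moreover have "((\<lambda>x. N x \<bullet> N x) has_derivative (\<lambda>h. 0)) (at q)"
    by (rule has_derivative_transform_within_open[OF has_derivative_const U q, of 1])
      (use unit in \<open>simp add: dot_square_norm\<close>)
  ultimately have "(\<lambda>h. N q \<bullet> (M q *v h) + (M q *v h) \<bullet> N q) = (\<lambda>h. 0)"
    by (rule has_derivative_unique)
  then have "N q \<bullet> (M q *v h) + (M q *v h) \<bullet> N q = 0" by (rule fun_cong)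
  then show ?thesis by (simp add: inner_commute[of _ "N q"])
qed

lemma P_M: "P q *v (M q *v h) = M q *v h"
  unfolding P_def by (rule tproj_tangent[OF normal_inner_M])

text \<open>Since \<open>P\<close> leaves the values of \<open>M\<close> fixed, symmetry of the
  tangential Jacobian says that \<open>P\<close> times the transpose of \<open>M\<close> is
  \<open>M\<close> times \<open>P\<close>. This is the symmetry of the second fundamental form, for
  a normal field that may vary along normals.\<close>

lemma P_transpose_M: "P q *v (transpose (M q) *v h) = M q *v (P q *v h)"
proof -
  have PM: "P q ** M q = M q"
    by (rule matrix_eqI) (simp add: matrix_vector_mul_assoc[symmetric] P_M)
  have "transpose (P q ** M q ** P q) = P q ** M q ** P q"
    using sym[OF q] by (simp add: P_def M_def)
  then have "P q ** transpose (M q) = M q ** P q"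
    unfolding PM by (simp add: matrix_transpose_mul P_def transpose_tproj)
  then show ?thesis by (simp add: matrix_vector_mul_assoc)
qed

lemma P_P: "P q *v (P q *v h) = P q *v h"
  unfolding P_def by (intro tproj_tangent tproj_orthogonal unit q)

lemma inner_P: "(P q *v a) \<bullet> b = a \<bullet> (P q *v b)"
  unfolding P_def by (rule inner_tproj)

lemma M_symmetric: "P q *v a = a \<Longrightarrow> P q *v b = b \<Longrightarrow> (M q *v a) \<bullet> b = a \<bullet> (M q *v b)"
  by (metis P_transpose_M inner_P inner_commute inner_matrix_vec)

lemma P_W: "P q *v W q = W q" and P_\<tau>: "P q *v \<tau> q = \<tau> q"
  by (simp_all add: W_def \<tau>_def P_P)

lemma P_has_derivative:
  "(P has_derivative (\<lambda>h. - (tensor (N q) (M q *v h) + tensor (M q *v h) (N q)))) (at q)"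
  unfolding P_def[abs_def] M_def by (intro tproj_has_derivative has_derivative_jacobian diffs)

lemma dd_P: "dd P q h = - (tensor (N q) (M q *v h) + tensor (M q *v h) (N q))"
  by (rule fun_cong[OF dd_eqI[OF P_has_derivative]])

lemma gradient_w: "gradient w q = transpose (jacobian_matrix v q) *v N q + transpose (M q) *v v q"
proof (rule gradientI)
  have "(w has_derivative (\<lambda>h. v q \<bullet> (M q *v h) + (jacobian_matrix v q *v h) \<bullet> N q)) (at q)"
    unfolding w_def[abs_def] M_def by (intro has_derivative_inner has_derivative_jacobian diffs)
  then show "(w has_derivative (\<lambda>h. (transpose (jacobian_matrix v q) *v N q + transpose (M q) *v v q) \<bullet> h)) (at q)"
    by (rule has_derivative_eq_rhs)
      (simp add: fun_eq_iff inner_matrix_vec inner_add_left inner_commute[of _ "N q"])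
qed

text \<open>The classical fact that the shape derivative of the unit normal is minus the tangential
  gradient of the normal velocity; \<open>M q *v u q\<close> is the transport by the tangential
  motion.\<close>

lemma Ndot_eq: "Ndot q - M q *v u q = - \<tau> q"
  by (simp add: Ndot_def \<tau>_def gradient_w matrix_vector_right_distrib P_transpose_M u_def)

lemma Pdot_eq: "Pdot q - dd P q (u q) = tensor (\<tau> q) (N q) + tensor (N q) (\<tau> q)"
proof -
  interpret bounded_bilinear "tensor :: real^'n \<Rightarrow> real^'n \<Rightarrow> real^'n^'n" by (rule bounded_bilinear_tensor)
  have "\<tau> q = - (Ndot q - M q *v u q)" by (simp add: Ndot_eq)
  then have "\<tau> q = M q *v u q - Ndot q" by simp
  then show ?thesis by (simp add: Pdot_def dd_P diff_left diff_right)
qed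

lemma jacobian_u: "jacobian_matrix u q = jacobian_matrix v q - tensor (N q) (gradient w q) - w q *\<^sub>R M q"
proof (rule jacobianI)
  have u_eq: "u = (\<lambda>x. v x - w x *\<^sub>R N x)"
    by (rule ext) (simp add: u_def P_def tproj_vec w_def inner_commute)
  have "(u has_derivative (\<lambda>h. jacobian_matrix v q *v h - (w q *\<^sub>R (M q *v h) + (gradient w q \<bullet> h) *\<^sub>R N q))) (at q)"
    unfolding u_eq M_def
    by (intro has_derivative_diff has_derivative_scaleR has_derivative_jacobian has_derivative_gradient diffs)
  then show "(u has_derivative (\<lambda>h. (jacobian_matrix v q - tensor (N q) (gradient w q) - w q *\<^sub>R M q) *v h)) (at q)"
    by (rule has_derivative_eq_rhs)
      (simp add: fun_eq_iff matrix_vector_mult_diff_rdistrib tensor_vec scaleR_matrix_vector_assoc[symmetric])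
qed

lemma gradient_Zs:
  "gradient Zs q = gradient G q - jacobian_matrix (gradient Z) q *v u q
    - transpose (jacobian_matrix v q) *v gradient Z q
    + (gradient Z q \<bullet> N q) *\<^sub>R gradient w q + w q *\<^sub>R (transpose (M q) *v gradient Z q)"
proof (rule gradientI)
  have Z2: "Ck_on 2 Z U" using Ck_on_mono[OF Z3] by simp
  have "(Zs has_derivative (\<lambda>h. gradient G q \<bullet> h - (gradient Z q \<bullet> (jacobian_matrix u q *v h)
      + (jacobian_matrix (gradient Z) q *v h) \<bullet> u q))) (at q)"
    unfolding Zs_def[abs_def]
    by (intro has_derivative_diff has_derivative_inner has_derivative_jacobian has_derivative_gradient diffs)
  then show "(Zs has_derivative (\<lambda>h. (gradient G q - jacobian_matrix (gradient Z) q *v u q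
    - transpose (jacobian_matrix v q) *v gradient Z q
    + (gradient Z q \<bullet> N q) *\<^sub>R gradient w q + w q *\<^sub>R (transpose (M q) *v gradient Z q)) \<bullet> h)) (at q)"
  proof (rule has_derivative_eq_rhs, intro ext)
    fix h
    have "(jacobian_matrix (gradient Z) q *v h) \<bullet> u q = (jacobian_matrix (gradient Z) q *v u q) \<bullet> h"
      using gradient_jacobian_symmetric[OF U q Z2] by (metis inner_commute inner_matrix_vec)
    then show "gradient G q \<bullet> h - (gradient Z q \<bullet> (jacobian_matrix u q *v h)
      + (jacobian_matrix (gradient Z) q *v h) \<bullet> u q) = (gradient G q - jacobian_matrix (gradient Z) q *v u q
    - transpose (jacobian_matrix v q) *v gradient Z q
    + (gradient Z q \<bullet> N q) *\<^sub>R gradient w q + w q *\<^sub>R (transpose (M q) *v gradient Z q)) \<bullet> h"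
      by (simp add: jacobian_u inner_diff_left inner_add_left inner_matrix_vec[symmetric]
          matrix_vector_mult_diff_rdistrib tensor_vec scaleR_matrix_vector_assoc[symmetric] inner_diff_right)
  qed
qed

lemma jacobian_W_vec: "jacobian_matrix W q *v h = P q *v (jacobian_matrix (gradient Z) q *v h) + dd P q h *v gradient Z q"
proof -
  have "(W has_derivative (\<lambda>h. P q *v (jacobian_matrix (gradient Z) q *v h) + dd P q h *v gradient Z q)) (at q)"
    unfolding W_def[abs_def]
    by (intro matrix_vec_has_derivative has_derivative_dd has_derivative_jacobian diffs)
  from dd_eqI[OF this] show ?thesis using dd_jacobian[OF diffs(5)] by metis
qed

text \<open>Removing transport from the material derivative leaves the shape derivative. The turning
  projection contributes the normal derivative of \<open>Z\<close> times \<open>\<tau> q\<close>;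
  the same term arises in the projected gradient of \<open>Zs\<close> from the Jacobian of the
  tangential velocity.\<close>

lemma Wdot_eq: "Wdot q = \<omega> q + jacobian_matrix W q *v u q"
proof -
  have "Wdot q - jacobian_matrix W q *v u q
    = P q *v (gradient G q - transpose (jacobian_matrix v q) *v gradient Z q - jacobian_matrix (gradient Z) q *v u q)
      + (Pdot q - dd P q (u q)) *v gradient Z q"
    unfolding Wdot_def jacobian_W_vec
    by (simp add: matrix_vector_mult_diff_distrib matrix_vector_mult_diff_rdistrib)
  also have "\<dots> = P q *v (gradient G q - transpose (jacobian_matrix v q) *v gradient Z q - jacobian_matrix (gradient Z) q *v u q)
      + (N q \<bullet> gradient Z q) *\<^sub>R \<tau> q + (\<tau> q \<bullet> gradient Z q) *\<^sub>R N q"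
    unfolding Pdot_eq by (simp add: matrix_vector_mult_add_rdistrib tensor_vec)
  also have "\<dots> = \<omega> q"
    unfolding \<omega>_def gradient_Zs
    by (simp add: matrix_vector_mult_diff_distrib matrix_vector_right_distrib matrix_vector_mult_scaleR
        P_transpose_M W_def \<tau>_def[symmetric] inner_commute algebra_simps)
  finally show ?thesis by (simp add: algebra_simps)
qed

text \<open>Differentiate \<open>N x \<bullet> W x = 0\<close>: the normal component of the
  derivative of a tangent field is given by the second fundamental form.\<close>

lemma N_inner_jacobian_W: "N q \<bullet> (jacobian_matrix W q *v h) = - (W q \<bullet> (M q *v h))"
proof -
  have "((\<lambda>x. N x \<bullet> W x) has_derivative (\<lambda>h. N q \<bullet> (jacobian_matrix W q *v h) + (M q *v h) \<bullet> W q)) (at q)"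
    unfolding M_def by (intro has_derivative_inner has_derivative_jacobian diffs)
  moreover have "((\<lambda>x. N x \<bullet> W x) has_derivative (\<lambda>h. 0)) (at q)"
    by (rule has_derivative_transform_within_open[OF has_derivative_const U q, of 0])
      (use unit in \<open>simp add: W_def P_def tproj_orthogonal\<close>)
  ultimately have "(\<lambda>h. N q \<bullet> (jacobian_matrix W q *v h) + (M q *v h) \<bullet> W q) = (\<lambda>h. 0)"
    by (rule has_derivative_unique)
  then have "N q \<bullet> (jacobian_matrix W q *v h) + (M q *v h) \<bullet> W q = 0" by (rule fun_cong)
  then show ?thesis by (simp add: inner_commute)
qed

interpretation mm: bounded_bilinear "(**) :: real^'n^'n \<Rightarrow> real^'n^'n \<Rightarrow> real^'n^'n"
  by (rule bounded_bilinear_matrix_mul)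

lemma dd_trace_mul_P:
  assumes "A differentiable (at q)"
  shows "dd (\<lambda>x. trace (A x ** P x)) q h = trace (dd A q h ** P q) + trace (A q ** dd P q h)"
proof -
  have "((\<lambda>x. trace (A x ** P x)) has_derivative (\<lambda>h. trace (A q ** dd P q h + dd A q h ** P q))) (at q)"
    by (intro bounded_linear.has_derivative[OF bounded_linear_trace] matrix_mul_has_derivative
        has_derivative_dd diffs assms)
  from dd_eqI[OF this] show ?thesis by (simp add: trace_add)
qed

text \<open>In the tangential divergence of \<open>f\<close> times the normal, the gradient of
  \<open>f\<close> meets the projected normal, which is zero.\<close>

lemma trace_div_scaled_normal:
  assumes f: "f differentiable (at q)"
  shows "trace (jacobian_matrix (\<lambda>x. f x *\<^sub>R N x) q ** P q) = f q * \<kappa> q"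
proof -
  have "((\<lambda>x. f x *\<^sub>R N x) has_derivative (\<lambda>h. f q *\<^sub>R (M q *v h) + (gradient f q \<bullet> h) *\<^sub>R N q)) (at q)"
    unfolding M_def by (intro has_derivative_scaleR has_derivative_jacobian has_derivative_gradient diffs f)
  then have "((\<lambda>x. f x *\<^sub>R N x) has_derivative (\<lambda>h. (f q *\<^sub>R M q + tensor (N q) (gradient f q)) *v h)) (at q)"
    by (rule has_derivative_eq_rhs)
      (simp add: fun_eq_iff matrix_vector_mult_add_rdistrib tensor_vec scaleR_matrix_vector_assoc[symmetric])
  from jacobianI[OF this] show ?thesis
    by (simp add: mm.add_left mm.scaleR_left trace_add trace_scaleR \<kappa>_def trace_tensor_mul P_def
        tproj_normal unit q)
qed

text \<open>A form of the Codazzi equation, and the source of the gradient of the mean curvature: by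
  symmetry of second derivatives the derivative of \<open>M\<close> in direction \<open>h\<close>,
  applied to \<open>W q\<close>, is its derivative in direction \<open>W q\<close>, applied to
  \<open>h\<close>. The trace of the latter is the derivative of \<open>\<kappa>\<close> along
  \<open>W q\<close> up to the motion of \<open>P\<close>.\<close>

lemma trace_div_shape_operator:
  "trace (jacobian_matrix (\<lambda>x. M x *v W x) q ** P q)
    = gradient \<kappa> q \<bullet> W q + trace (M q ** P q ** jacobian_matrix W q ** P q)"
proof -
  let ?C = "jacobian_matrix W q"
  have "((\<lambda>x. M x *v W x) has_derivative (\<lambda>h. M q *v (?C *v h) + dd M q h *v W q)) (at q)"
    by (intro matrix_vec_has_derivative has_derivative_dd has_derivative_jacobian diffs)
  moreover have "dd M q h *v W q = dd M q (W q) *v h" for h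
    unfolding M_def[abs_def] by (rule dd_jacobian_symmetric[OF U q N2])
  ultimately have "((\<lambda>x. M x *v W x) has_derivative (\<lambda>h. (M q ** ?C + dd M q (W q)) *v h)) (at q)"
    by (simp add: matrix_vector_mult_add_rdistrib matrix_vector_mul_assoc)
  from jacobianI[OF this] have J: "trace (jacobian_matrix (\<lambda>x. M x *v W x) q ** P q)
      = trace (M q ** ?C ** P q) + trace (dd M q (W q) ** P q)"
    by (simp add: mm.add_left trace_add)
  have "gradient \<kappa> q \<bullet> W q = dd \<kappa> q (W q)"
    using dd_gradient[OF Ck_on_differentiable[OF \<kappa>1 _ q]] by simp
  also have "\<dots> = trace (dd M q (W q) ** P q) + trace (M q ** dd P q (W q))"
    unfolding \<kappa>_def[abs_def] by (rule dd_trace_mul_P[OF diffs(9)])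
  also have "trace (M q ** dd P q (W q)) = - ((M q *v N q) \<bullet> (M q *v W q))"
    by (simp add: dd_P mm.minus_right mm.diff_right matrix_mul_tensor trace_sub trace_tensor
        trace_minus normal_inner_M inner_commute[of _ "N q"])
  finally have K: "gradient \<kappa> q \<bullet> W q = trace (dd M q (W q) ** P q) - (M q *v N q) \<bullet> (M q *v W q)" by simp
  \<comment> \<open>Two corrections contain \<open>M q *v N q\<close>: one from the motion of
    \<open>P\<close>, one from inserting \<open>P\<close> between the factors. They cancel in the
    end.\<close>
  have MP: "M q ** P q = M q - tensor (M q *v N q) (N q)"
    by (simp add: P_def tproj_def mm.diff_right matrix_mul_tensor)
  have "M q ** P q ** ?C ** P q = M q ** ?C ** P q - tensor (M q *v N q) (N q) ** (?C ** P q)"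
    unfolding MP by (simp add: mm.diff_left matrix_mul_assoc)
  then have "trace (M q ** P q ** ?C ** P q) = trace (M q ** ?C ** P q) - N q \<bullet> (?C *v (P q *v (M q *v N q)))"
    by (simp add: trace_sub trace_tensor_mul matrix_vector_mul_assoc[symmetric])
  also have "N q \<bullet> (?C *v (P q *v (M q *v N q))) = - (W q \<bullet> (M q *v (M q *v N q)))"
    by (simp add: P_M N_inner_jacobian_W)
  also have "W q \<bullet> (M q *v (M q *v N q)) = (M q *v W q) \<bullet> (M q *v N q)"
    by (rule M_symmetric[OF P_W P_M, symmetric])
  finally show ?thesis
    using J K by (simp add: inner_commute)
qed

end

text \<open>Insert the splitting of \<open>Wdot\<close> into \<open>\<omega>\<close> and transport,
  and take traces. The second derivatives of \<open>W\<close> along \<open>u\<close> cancel with the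
  transport of \<open>L\<close>. The curvature trace with \<open>w q\<close> comes once from the
  divergence of \<open>\<omega>\<close> and once from the difference of the Jacobians of
  \<open>u\<close> and \<open>v\<close>; the term with \<open>M q\<close> and
  \<open>\<tau> q\<close> comes once from \<open>\<omega>\<close> and once from the turning
  projection. These are the two factors 2.\<close>

lemma shape_derivative_identity:
  assumes q: "q \<in> U"
  shows "trace (jacobian_matrix Wdot q ** P q) - trace (jacobian_matrix W q ** jacobian_matrix v q ** P q)
     + trace (jacobian_matrix W q ** Pdot q) - gradient L q \<bullet> u q
   = trace (jacobian_matrix (\<lambda>x. P x *v gradient Zs x) q ** P q)
     - 2 * w q * trace (M q ** P q ** jacobian_matrix W q ** P q)
     + (\<kappa> q *\<^sub>R \<tau> q - 2 *\<^sub>R (M q *v (P q *v \<tau> q)) - w q *\<^sub>R (P q *v gradient \<kappa> q)) \<bullet> W q"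
proof -
  interpret mm: bounded_bilinear "(**) :: real^'n^'n \<Rightarrow> real^'n^'n \<Rightarrow> real^'n^'n"
    by (rule bounded_bilinear_matrix_mul)
  note diffs = diffs[OF q] and P_M = P_M[OF q] and inner_P = inner_P[OF q] and M_symmetric = M_symmetric[OF q]
    and P_W = P_W[OF q] and P_\<tau> = P_\<tau>[OF q]
  let ?C = "jacobian_matrix W q"
  have "((\<lambda>x. \<omega> x + jacobian_matrix W x *v u x) has_derivative
      (\<lambda>h. jacobian_matrix \<omega> q *v h + (?C *v (jacobian_matrix u q *v h) + dd (jacobian_matrix W) q h *v u q))) (at q)"
    by (intro has_derivative_add matrix_vec_has_derivative has_derivative_dd has_derivative_jacobian diffs)
  then have "(Wdot has_derivative
      (\<lambda>h. jacobian_matrix \<omega> q *v h + (?C *v (jacobian_matrix u q *v h) + dd (jacobian_matrix W) q h *v u q))) (at q)"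
    by (rule has_derivative_transform_within_open[OF _ U q]) (simp add: Wdot_eq)
  \<comment> \<open>Symmetry makes this a fixed matrix acting on \<open>h\<close>; its trace against
    \<open>P q\<close> is the first summand of \<open>gradient L q \<bullet> u q\<close>.\<close>
  moreover have "dd (jacobian_matrix W) q h *v u q = dd (jacobian_matrix W) q (u q) *v h" for h
    by (rule dd_jacobian_symmetric[OF U q W2])
  ultimately have "(Wdot has_derivative
      (\<lambda>h. (jacobian_matrix \<omega> q + ?C ** jacobian_matrix u q + dd (jacobian_matrix W) q (u q)) *v h)) (at q)"
    by (simp add: matrix_vector_mult_add_rdistrib matrix_vector_mul_assoc add.assoc)
  note JWdot = jacobianI[OF this]
  have gL: "gradient L q \<bullet> u q = trace (dd (jacobian_matrix W) q (u q) ** P q) + trace (?C ** dd P q (u q))"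
    using dd_gradient[OF Ck_on_differentiable[OF L1 _ q], of "u q"] dd_trace_mul_P[OF q diffs(11), of "u q"]
    by (simp add: L_def[abs_def])
  \<comment> \<open>The term with \<open>?C *v N q\<close> records how \<open>W\<close> varies along
    the normal; it cancels against the same term in \<open>Pd\<close>.\<close>
  have Cu: "trace (?C ** jacobian_matrix u q ** P q) = trace (?C ** jacobian_matrix v q ** P q)
      - (?C *v N q) \<bullet> \<tau> q - w q * trace (?C ** M q ** P q)"
    by (simp add: jacobian_u[OF q] mm.diff_left mm.diff_right mm.scaleR_left mm.scaleR_right trace_sub trace_scaleR
        matrix_mul_tensor trace_tensor_mul \<tau>_def inner_P inner_commute[of "gradient w q"])
  have Pd: "trace (?C ** Pdot q) - trace (?C ** dd P q (u q)) = (?C *v \<tau> q) \<bullet> N q + (?C *v N q) \<bullet> \<tau> q"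
    unfolding trace_sub[symmetric] mm.diff_right[symmetric] Pdot_eq[OF q]
    by (simp add: mm.add_right trace_add trace_mul_tensor)
  \<comment> \<open>Cyclicity of the trace, with the middle projection absorbed by
    \<open>M q\<close>.\<close>
  have CMP: "trace (?C ** M q ** P q) = trace (M q ** P q ** ?C ** P q)"
  proof -
    have PM: "P q ** M q = M q" by (rule matrix_eqI) (simp add: matrix_vector_mul_assoc[symmetric] P_M)
    have "trace (M q ** P q ** ?C ** P q) = trace ((?C ** P q) ** (M q ** P q))"
      by (subst trace_mul_sym) (simp add: matrix_mul_assoc)
    also have "(?C ** P q) ** (M q ** P q) = ?C ** (P q ** M q) ** P q" by (simp add: matrix_mul_assoc)
    finally show ?thesis by (simp add: PM)
  qed
  have NC: "(?C *v \<tau> q) \<bullet> N q = - ((M q *v \<tau> q) \<bullet> W q)"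
    using N_inner_jacobian_W[OF q, of "\<tau> q"] by (simp add: inner_commute)
  define f where "f x = \<tau> x \<bullet> gradient Z x" for x
  have df: "f differentiable (at q)"
    unfolding f_def[abs_def]
    using Ck_on_differentiable[OF Ck_on_inner[OF U \<tau>1 Ck_on_mono[OF gradZ2, of 1]]] q by simp
  have d1: "(\<lambda>x. P x *v gradient Zs x) differentiable (at q)"
    using Ck_on_differentiable[OF Ck_on_matrix_vec[OF U Ck_on_mono[OF P2, of 1] gradZs1]] q by simp
  have d2: "(\<lambda>x. f x *\<^sub>R N x) differentiable (at q)"
    using df diffs(1) by (intro differentiable_scaleR)
  have d3: "(\<lambda>x. M x *v W x) differentiable (at q)"
    using Ck_on_differentiable[OF Ck_on_matrix_vec[OF U M1 Ck_on_mono[OF W2, of 1]]] q by simp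
  have "(\<omega> has_derivative (\<lambda>h. jacobian_matrix (\<lambda>x. P x *v gradient Zs x) q *v h
      + jacobian_matrix (\<lambda>x. f x *\<^sub>R N x) q *v h
      - (w q *\<^sub>R (jacobian_matrix (\<lambda>x. M x *v W x) q *v h) + (gradient w q \<bullet> h) *\<^sub>R (M q *v W q)))) (at q)"
    unfolding \<omega>_def[abs_def] f_def[symmetric]
    by (intro has_derivative_add has_derivative_diff has_derivative_scaleR has_derivative_jacobian
        has_derivative_gradient diffs d1 d2 d3)
  then have "(\<omega> has_derivative (\<lambda>h. (jacobian_matrix (\<lambda>x. P x *v gradient Zs x) q
      + jacobian_matrix (\<lambda>x. f x *\<^sub>R N x) q
      - (w q *\<^sub>R jacobian_matrix (\<lambda>x. M x *v W x) q + tensor (M q *v W q) (gradient w q))) *v h)) (at q)"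
    by (rule has_derivative_eq_rhs)
      (simp add: fun_eq_iff matrix_vector_mult_add_rdistrib matrix_vector_mult_diff_rdistrib tensor_vec
        scaleR_matrix_vector_assoc[symmetric])
  from jacobianI[OF this]
  have "trace (jacobian_matrix \<omega> q ** P q) = trace (jacobian_matrix (\<lambda>x. P x *v gradient Zs x) q ** P q)
      + f q * \<kappa> q - (w q * (gradient \<kappa> q \<bullet> W q + trace (M q ** P q ** ?C ** P q)) + \<tau> q \<bullet> (M q *v W q))"
    by (simp add: mm.add_left mm.diff_left mm.scaleR_left trace_add trace_sub trace_scaleR
        trace_div_scaled_normal[OF q df] trace_div_shape_operator[OF q] trace_tensor_mul \<tau>_def inner_P)
  moreover have "f q = \<tau> q \<bullet> W q"
    unfolding f_def W_def by (metis P_\<tau> inner_P)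
  moreover have "\<tau> q \<bullet> (M q *v W q) = (M q *v \<tau> q) \<bullet> W q"
    by (rule M_symmetric[OF P_\<tau> P_W, symmetric])
  moreover have "(P q *v gradient \<kappa> q) \<bullet> W q = gradient \<kappa> q \<bullet> W q"
    by (simp add: inner_P P_W)
  ultimately have \<omega>: "trace (jacobian_matrix \<omega> q ** P q) = trace (jacobian_matrix (\<lambda>x. P x *v gradient Zs x) q ** P q)
      + \<kappa> q * (\<tau> q \<bullet> W q) - w q * ((P q *v gradient \<kappa> q) \<bullet> W q) - w q * trace (M q ** P q ** ?C ** P q)
      - (M q *v \<tau> q) \<bullet> W q"
    by (simp add: algebra_simps)
  have "trace (jacobian_matrix Wdot q ** P q) = trace (jacobian_matrix \<omega> q ** P q)
      + trace (?C ** jacobian_matrix u q ** P q) + trace (dd (jacobian_matrix W) q (u q) ** P q)"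
    by (simp add: JWdot mm.add_left trace_add)
  then show ?thesis
    using gL Cu Pd CMP NC \<omega>
    by (simp add: inner_add_left inner_diff_left P_\<tau>)
qed

end

section \<open>The Laplace-Beltrami operator along the flow\<close>

text \<open>Differentiating the normalising factor gives a tensor with
  \<open>gradient \<Phi>\<close> on the left, which the projection annihilates; a multiple of the
  projected Hessian remains.\<close>

lemma normalized_gradient_symmetric:
  fixes \<Phi> :: "real^'n \<Rightarrow> real"
  assumes U: "open U" "q \<in> U" and \<Phi>: "Ck_on 2 \<Phi> U" "\<And>y. y \<in> U \<Longrightarrow> gradient \<Phi> y \<noteq> 0"
    and N: "\<And>y. y \<in> U \<Longrightarrow> N y = gradient \<Phi> y /\<^sub>R norm (gradient \<Phi> y)"
  shows "transpose (tproj (N q) ** jacobian_matrix N q ** tproj (N q)) = tproj (N q) ** jacobian_matrix N q ** tproj (N q)"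
proof -
  let ?g = "gradient \<Phi>" and ?H = "jacobian_matrix (gradient \<Phi>) q" and ?P = "tproj (N q)"
  define r where "r y = (?g y \<bullet> ?g y) powr (- (1 / 2))" for y
  have g1: "Ck_on 1 ?g U" using Ck_on_gradient[of U 1 \<Phi>] U \<Phi> by (simp add: numeral_2_eq_2)
  have dg: "?g differentiable (at q)" using Ck_on_differentiable[OF g1] U by simp
  have "Ck_on 1 r U" unfolding r_def[abs_def]
    by (rule Ck_on_compose[OF U(1) open_greaterThan _ Ck_on_inner[OF U(1) g1 g1] Ck_on_powr]) (use \<Phi>(2) in auto)
  then have dr: "r differentiable (at q)" using Ck_on_differentiable[of 1 r U q] U(2) by simp
  have "((\<lambda>y. r y *\<^sub>R ?g y) has_derivative (\<lambda>h. r q *\<^sub>R (?H *v h) + (gradient r q \<bullet> h) *\<^sub>R ?g q)) (at q)"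
    by (intro has_derivative_scaleR has_derivative_jacobian has_derivative_gradient dr dg)
  then have "(N has_derivative (\<lambda>h. r q *\<^sub>R (?H *v h) + (gradient r q \<bullet> h) *\<^sub>R ?g q)) (at q)"
    by (rule has_derivative_transform_within_open[OF _ U]) (simp add: N r_def inverse_norm_powr)
  then have "(N has_derivative (\<lambda>h. (r q *\<^sub>R ?H + tensor (?g q) (gradient r q)) *v h)) (at q)"
    by (rule has_derivative_eq_rhs)
      (simp add: fun_eq_iff matrix_vector_mult_add_rdistrib tensor_vec scaleR_matrix_vector_assoc[symmetric])
  then have J: "jacobian_matrix N q = r q *\<^sub>R ?H + tensor (?g q) (gradient r q)" by (rule jacobianI)
  have nN: "norm (N q) = 1" using N[OF U(2)] \<Phi>(2)[OF U(2)] by simp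
  have "?g q = norm (?g q) *\<^sub>R N q" using N[OF U(2)] \<Phi>(2)[OF U(2)] by simp
  then have Pg: "?P *v ?g q = 0" using tproj_normal[OF nN] by (metis matrix_vector_mult_scaleR scaleR_zero_right)
  interpret mm: bounded_bilinear "(**) :: real^'n^'n \<Rightarrow> real^'n^'n \<Rightarrow> real^'n^'n" by (rule bounded_bilinear_matrix_mul)
  have "tensor 0 (gradient r q) = (0 :: real^'n^'n)" by (simp add: tensor_def vec_eq_iff)
  then have "?P ** jacobian_matrix N q ** ?P = r q *\<^sub>R (?P ** ?H ** ?P)"
    by (simp add: J mm.add_right mm.scaleR_right mm.scaleR_left matrix_mul_tensor Pg)
  moreover have "transpose (?P ** ?H ** ?P) = ?P ** ?H ** ?P"
    using gradient_jacobian_symmetric[OF U \<Phi>(1)]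
    by (simp add: matrix_transpose_mul transpose_tproj matrix_mul_assoc)
  moreover have "transpose (c *\<^sub>R A) = c *\<^sub>R transpose A" for c and A :: "real^'n^'n"
    by (simp add: transpose_def vec_eq_iff)
  ultimately show ?thesis by simp
qed

lemma near_zero_of_bound:
  fixes f :: "real \<Rightarrow> 'a::t2_space \<Rightarrow> 'b::real_normed_vector"
  assumes "\<And>e. e > 0 \<Longrightarrow> \<forall>\<^sub>F t in at_right 0. \<forall>q. norm (f t q) \<le> K * e" and "0 < K"
  shows "((\<lambda>(t, q). f t q) \<longlongrightarrow> 0) (near p)"
proof (rule tendstoI)
  fix e :: real assume e: "e > 0"
  then have "\<forall>\<^sub>F t in at_right 0. \<forall>q. norm (f t q) \<le> K * (e / (2 * K))"
    using assms by (intro assms) simp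
  from eventually_near_time[OF this, of p]
  show "\<forall>\<^sub>F z in near p. dist (case z of (t, q) \<Rightarrow> f t q) 0 < e"
  proof eventually_elim
    case (elim z)
    obtain t q where z: "z = (t, q)" by (cases z)
    have "norm (f t q) \<le> K * (e / (2 * K))" using elim z by simp
    also have "\<dots> = e / 2" using assms(2) by simp
    finally show ?case using e z by simp
  qed
qed

text \<open>All data live on one neighbourhood \<open>U\<close> of the boundary. \<open>Z\<close>
  and \<open>G\<close> extend the function and its material derivative; \<open>R t\<close> is the
  remainder of the first order expansion of the pulled back function, divided by \<open>t\<close>,
  and \<open>R_small\<close> says that it tends to 0 in C^2.\<close>

locale moving_boundary =
  flow: C3_flow V x T C + tangential_setting U N "V 0" Z G
  for V x :: "real \<Rightarrow> real^'n \<Rightarrow> real^'n" and T C U N Z G +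
  fixes \<Omega> :: "(real^'n) set" and \<Phi> :: "real^'n \<Rightarrow> real" and z :: "'n boundary_function" and R :: "real \<Rightarrow> real^'n \<Rightarrow> real"
  assumes \<Omega>: "Ck_domain 1 \<Omega>" and sub: "frontier \<Omega> \<subseteq> U" and \<Phi>: "defining_function 1 \<Omega> U \<Phi>"
    and N_eq: "q \<in> U \<Longrightarrow> N q = gradient \<Phi> q /\<^sub>R norm (gradient \<Phi> q)"
    and z_eq: "X \<in> frontier \<Omega> \<Longrightarrow> z (frontier \<Omega>) X = Z X"
    and R2: "Ck_on 2 (R t) UNIV"
    and R_small: "e > 0 \<Longrightarrow> \<forall>\<^sub>F t in at_right 0. \<forall>hs q. set hs \<subseteq> Basis \<longrightarrow> length hs \<le> 2 \<longrightarrow>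
      norm (iterated_deriv hs (R t) q) \<le> e"
    and zt_eq: "\<forall>\<^sub>F t in at_right 0. \<forall>X\<in>frontier \<Omega>. z (x t ` frontier \<Omega>) (x t X) = Z X + t * (G X + R t X)"
begin

abbreviation "\<Gamma> \<equiv> frontier \<Omega>"

definition "B t q = matrix_inv (jacobian_matrix (x t) q)"
definition "a t q = transpose (B t q) *v N q"
definition "Nt t q = (a t q \<bullet> a t q) powr (- (1 / 2)) *\<^sub>R a t q"
definition "Pt t q = tproj (Nt t q)"
definition "gZ t q = gradient Z q + t *\<^sub>R (gradient G q + gradient (R t) q)"
definition "Wt t q = Pt t q *v (transpose (B t q) *v gZ t q)"
definition "Lt t q = trace (jacobian_matrix (Wt t) q ** B t q ** Pt t q)"
definition "gL q = trace (jacobian_matrix Wdot q ** P q)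
  - trace (jacobian_matrix W q ** jacobian_matrix (V 0) q ** P q) + trace (jacobian_matrix W q ** Pdot q)"

section \<open>First order expansion of the pulled back normal, projection and gradient\<close>

lemma diffeo: "t \<in> {0..T} \<Longrightarrow> small_diffeo (x t)"
  by (rule small_diffeo.intro[OF flow.x_C2 flow.x_lipschitz_perturbation])

lemma B_eq: "t \<in> {0..T} \<Longrightarrow> B t = small_diffeo.B (x t)"
  using small_diffeo.B_def[OF diffeo] by (auto simp: B_def)

lemma x0: "x 0 = (\<lambda>X. X)"
  by (rule ext) (rule flow.start)

lemma J0: "jacobian_matrix (x 0) q = mat 1"
  unfolding x0 by (rule jacobianI) simp

lemma B0: "B 0 q = mat 1"
  using small_diffeo.jacobian_inverse(2)[OF diffeo, of 0 q] flow.params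
  by (simp add: B_eq J0)

lemma eventually_T: "\<forall>\<^sub>F t in at_right 0. t \<in> {0<..<T}"
  using flow.params by (intro eventually_at_right_real)

text \<open>Treated column by column, because the limits of the second derivatives of the flow are
  available along basis vectors.\<close>

lemma J_family: "C1_family (\<lambda>t. jacobian_matrix (x t)) (jacobian_matrix (V 0)) p"
proof -
  have column: "C1_family (\<lambda>t q. dd (x t) q b) (\<lambda>q. dd (V 0) q b) p" if b: "b \<in> Basis" for b
  proof (rule C1_familyI)
    have b1: "norm b \<le> 1" using b by simp
    have x0b: "(\<lambda>q. dd (x 0) q b) = (\<lambda>q. b)" by (rule ext) (rule flow.dd_x_start)
    have V1: "Ck_on 1 (\<lambda>q. dd (V 0) q b) UNIV"
      using flow.C2[of 0] flow.params by (simp add: numeral_2_eq_2)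
    show "\<exists>U. open U \<and> p \<in> U \<and> Ck_on 1 (\<lambda>q. dd (x 0) q b) U \<and> Ck_on 1 (\<lambda>q. dd (V 0) q b) U"
      using V1 Ck_on_const unfolding x0b by blast
    show "\<forall>\<^sub>F (t, q) in near p. (\<lambda>q. dd (x t) q b) differentiable (at q)"
      using eventually_near_time[OF eventually_T, of p]
      by eventually_elim (auto intro!: flow.dd_x_derivative(1)[OF b1])
    show "has_time_derivative (\<lambda>t q. dd (x t) q b) p (dd (V 0) p b)"
      unfolding has_time_derivative_def x0b using flow.dd_x_quotient[of b p]
      by (simp add: flow.dd_x_start)
    show "has_time_derivative (\<lambda>t q. dd (\<lambda>q. dd (x t) q b) q h) p (dd (\<lambda>q. dd (V 0) q b) p h)" for h
      unfolding has_time_derivative_def x0b using flow.dd_dd_x_quotient[OF b, of h p]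
      by (simp add: frechet_derivative_const)
  qed
  have "C1_family (\<lambda>t q. \<Sum>i\<in>UNIV. tensor (dd (x t) q (axis i 1)) (axis i 1))
      (\<lambda>q. \<Sum>i\<in>UNIV. tensor (dd (V 0) q (axis i 1)) (axis i 1)) p"
    by (intro C1_family_sum C1_family_linear[OF bounded_bilinear.bounded_linear_left[OF bounded_bilinear_tensor]]
        column) auto
  then show ?thesis by (simp add: jacobian_columns[abs_def])
qed

lemma B_family: "C1_family B (\<lambda>q. - jacobian_matrix (V 0) q) p"
proof -
  obtain K where K: "0 < K" "\<And>(A::real^'n^'n) c. (\<And>h. norm (A *v h) \<le> c * norm h) \<Longrightarrow> 0 \<le> c \<Longrightarrow> norm A \<le> K * c"
    using norm_matrix_bound by blast
  show ?thesis
  proof (rule C1_family_inverse[where J="\<lambda>t. jacobian_matrix (x t)" and K="K * 2", OF J_family])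
    show "jacobian_matrix (x 0) q = mat 1" "B 0 q = mat 1" for q by (rule J0, rule B0)
    show "\<forall>\<^sub>F t in at_right 0. \<forall>q. B t q ** jacobian_matrix (x t) q = mat 1 \<and> norm (B t q) \<le> K * 2 \<and>
      (B t has_derivative (\<lambda>h. - (B t q ** dd (jacobian_matrix (x t)) q h ** B t q))) (at q)"
      using eventually_T
    proof eventually_elim
      case (elim t)
      then have t: "t \<in> {0..T}" by simp
      interpret d: small_diffeo "x t" by (rule diffeo[OF t])
      show ?case
        unfolding B_eq[OF t] using d.jacobian_inverse d.B_has_derivative
        by (auto intro!: K d.B_vec_bound)
    qed
  qed
qed

lemma BT_family: "C1_family (\<lambda>t q. transpose (B t q)) (\<lambda>q. - transpose (jacobian_matrix (V 0) q)) p"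
proof -
  interpret bounded_linear "transpose :: real^'n^'n \<Rightarrow> real^'n^'n" by (rule bounded_linear_transpose)
  show ?thesis
    using C1_family_linear[OF bounded_linear_transpose B_family] by (simp add: neg)
qed

lemma BT0: "transpose (B 0 q) = mat 1"
  by (simp add: B0 transpose_mat)

lemma N1: "Ck_on 1 N U"
  using Ck_on_mono[OF N2, of 1] by simp

lemma a_family:
  assumes "p \<in> U"
  shows "C1_family a (\<lambda>q. - (transpose (jacobian_matrix (V 0) q) *v N q)) p"
proof -
  interpret bb: bounded_bilinear "(*v) :: real^'n^'n \<Rightarrow> real^'n \<Rightarrow> real^'n" by (rule bounded_bilinear_matrix_vec)
  show ?thesis
    using C1_family_bilinear[OF bounded_bilinear_matrix_vec BT_family C1_family_const[OF U assms N1]]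
    by (simp add: a_def[abs_def] bb.minus_left)
qed

lemma a0: "a 0 q = N q"
  by (simp add: a_def BT0)

text \<open>Normalisation, differentiated at a unit vector, projects onto the complement of that
  vector; this is the projection in \<open>Ndot\<close>.\<close>

lemma Nt_family:
  assumes p: "p \<in> U"
  shows "C1_family Nt Ndot p"
proof -
  let ?b = "\<lambda>q. - (transpose (jacobian_matrix (V 0) q) *v N q)"
  have s: "C1_family (\<lambda>t q. a t q \<bullet> a t q) (\<lambda>q. ?b q \<bullet> a 0 q + a 0 q \<bullet> ?b q) p"
    by (intro C1_family_bilinear[OF bounded_bilinear_inner] a_family p)
  have "C1_family (\<lambda>t q. (a t q \<bullet> a t q) powr (- (1 / 2))) (\<lambda>q. - (1 / 2) * (?b q \<bullet> a 0 q + a 0 q \<bullet> ?b q)) p"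
    by (rule C1_family_powr[OF s U p]) (simp add: a0 unit dot_square_norm)
  from C1_family_bilinear[OF bounded_bilinear_scaleR this a_family[OF p]]
  have "C1_family Nt (\<lambda>q. (- (1 / 2) * (?b q \<bullet> a 0 q + a 0 q \<bullet> ?b q)) *\<^sub>R a 0 q
      + (a 0 q \<bullet> a 0 q) powr (- (1 / 2)) *\<^sub>R ?b q) p"
    by (simp only: Nt_def[abs_def])
  then show ?thesis
  proof (rule C1_family_cong_derivative[OF _ U p])
    fix q assume "q \<in> U"
    then show "(- (1 / 2) * (?b q \<bullet> a 0 q + a 0 q \<bullet> ?b q)) *\<^sub>R a 0 q
      + (a 0 q \<bullet> a 0 q) powr (- (1 / 2)) *\<^sub>R ?b q = Ndot q"
      by (simp add: a0 unit dot_square_norm Ndot_def P_def tproj_vec inner_commute[of _ "N q"])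
  qed
qed

lemma Nt0: "q \<in> U \<Longrightarrow> Nt 0 q = N q"
  by (simp add: Nt_def a0 unit dot_square_norm)

lemma Pt0: "q \<in> U \<Longrightarrow> Pt 0 q = P q"
  by (simp add: Pt_def P_def Nt0)

lemma Pt_family:
  assumes p: "p \<in> U"
  shows "C1_family Pt Pdot p"
proof -
  have bl: "bounded_linear (uminus :: real^'n^'n \<Rightarrow> real^'n^'n)"
    by (rule bounded_linear_minus[OF bounded_linear_ident])
  have "C1_family (\<lambda>t q. mat 1 + - tensor (Nt t q) (Nt t q))
      (\<lambda>q. 0 + - (tensor (Ndot q) (Nt 0 q) + tensor (Nt 0 q) (Ndot q))) p"
    by (intro C1_family_add C1_family_const[OF U p] Ck_on_const C1_family_linear[OF bl]
        C1_family_bilinear[OF bounded_bilinear_tensor] Nt_family p)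
  then have "C1_family Pt (\<lambda>q. - (tensor (Ndot q) (Nt 0 q) + tensor (Nt 0 q) (Ndot q))) p"
    by (simp add: Pt_def[abs_def] tproj_def)
  then show ?thesis
    by (rule C1_family_cong_derivative[OF _ U p]) (simp add: Pdot_def Nt0)
qed

text \<open>Smallness of \<open>R t\<close> in C^2 gives smallness of its gradient in C^1; a
  derivative in a general direction costs a factor of the dimension.\<close>

lemma gZ_family:
  assumes p: "p \<in> U"
  shows "C1_family gZ (gradient G) p"
proof -
  let ?d = "real DIM(real^'n)"
  have d0: "0 < ?d" by (simp add: DIM_positive)
  have cols: "gradient (R t) = (\<lambda>q. \<Sum>i\<in>UNIV. dd (R t) q (axis i 1) *\<^sub>R axis i 1)" for t
    using basis_expansion[of "gradient (R t) _"] by (auto simp: scalar_mult_eq_scaleR gradient_def)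
  have diff2: "\<forall>\<^sub>F t in at_right 0. \<forall>q h. (\<lambda>q. dd (R t) q h) differentiable (at q)"
    using R2 by (intro always_eventually) (simp add: numeral_2_eq_2)
  have r1: "((\<lambda>(t, q). dd (R t) q (axis i 1)) \<longlongrightarrow> 0) (near p)" for i
  proof (rule near_zero_of_bound[where K=1])
    fix e :: real assume "e > 0"
    from R_small[OF this] show "\<forall>\<^sub>F t in at_right 0. \<forall>q. norm (dd (R t) q (axis i 1)) \<le> 1 * e"
    proof eventually_elim
      case (elim t)
      show ?case using elim[rule_format, of "[axis i 1]"] by simp
    qed
  qed simp
  have r2: "((\<lambda>(t, q). dd (\<lambda>q. dd (R t) q (axis i 1)) q h) \<longlongrightarrow> 0) (near p)" for i h
  proof (rule near_zero_of_bound[where K="?d * (norm h + 1)"])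
    fix e :: real assume e: "e > 0"
    from R_small[OF this] diff2
    show "\<forall>\<^sub>F t in at_right 0. \<forall>q. norm (dd (\<lambda>q. dd (R t) q (axis i 1)) q h) \<le> ?d * (norm h + 1) * e"
    proof eventually_elim
      case (elim t)
      show ?case
      proof
        fix q
        have "norm (dd (\<lambda>q. dd (R t) q (axis i 1)) q b) \<le> e" if "b \<in> Basis" for b
          using elim(1)[rule_format, of "[axis i 1, b]" q] that by simp
        then have "norm (dd (\<lambda>q. dd (R t) q (axis i 1)) q h) \<le> ?d * e * norm h"
          using elim(2) by (intro dd_bound_of_basis) auto
        also have "\<dots> \<le> ?d * (norm h + 1) * e" using e by (simp add: algebra_simps)
        finally show "norm (dd (\<lambda>q. dd (R t) q (axis i 1)) q h) \<le> ?d * (norm h + 1) * e" .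
      qed
    qed
  qed (use d0 in \<open>simp add: add_nonneg_pos\<close>)
  have derivR: "(gradient (R t) has_derivative (\<lambda>h. \<Sum>i\<in>UNIV. dd (\<lambda>q. dd (R t) q (axis i 1)) q h *\<^sub>R axis i 1)) (at q)"
    if "\<forall>q h. (\<lambda>q. dd (R t) q h) differentiable (at q)" for t q
    unfolding cols using that by (intro has_derivative_sum has_derivative_scaleR_left has_derivative_dd) auto
  show ?thesis
    unfolding gZ_def[abs_def]
  proof (rule C1_family_perturbation[OF U p])
    show "Ck_on 1 (gradient Z) U" using Ck_on_mono[OF gradZ2, of 1] by simp
    show "Ck_on 1 (gradient G) U" using Ck_on_gradient[of U 1 G] U G2 by (simp add: numeral_2_eq_2)
    show "\<forall>\<^sub>F t in at_right 0. \<forall>q. gradient (R t) differentiable (at q)"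
      using diff2 by eventually_elim (blast intro: differentiableI derivR)
    have "((\<lambda>z. \<Sum>i\<in>UNIV. (case z of (t, q) \<Rightarrow> dd (R t) q (axis i 1)) *\<^sub>R (axis i 1 :: real^'n)) \<longlongrightarrow>
        (\<Sum>i\<in>UNIV. 0 *\<^sub>R axis i 1)) (near p)"
      by (intro tendsto_sum tendsto_scaleR r1 tendsto_const)
    then show "((\<lambda>(t, q). gradient (R t) q) \<longlongrightarrow> 0) (near p)"
      unfolding cols by (simp add: case_prod_unfold)
    fix h
    have "((\<lambda>z. \<Sum>i\<in>UNIV. (case z of (t, q) \<Rightarrow> dd (\<lambda>q. dd (R t) q (axis i 1)) q h) *\<^sub>R (axis i 1 :: real^'n)) \<longlongrightarrow>
        (\<Sum>i\<in>UNIV. 0 *\<^sub>R axis i 1)) (near p)"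
      by (intro tendsto_sum tendsto_scaleR r2 tendsto_const)
    then have "((\<lambda>z. \<Sum>i\<in>UNIV. (case z of (t, q) \<Rightarrow> dd (\<lambda>q. dd (R t) q (axis i 1)) q h) *\<^sub>R (axis i 1 :: real^'n)) \<longlongrightarrow> 0) (near p)"
      by simp
    moreover have "\<forall>\<^sub>F z in near p. (\<Sum>i\<in>UNIV. (case z of (t, q) \<Rightarrow> dd (\<lambda>q. dd (R t) q (axis i 1)) q h) *\<^sub>R axis i 1)
        = (case z of (t, q) \<Rightarrow> dd (gradient (R t)) q h)"
      using eventually_near_time[OF diff2, of p]
    proof eventually_elim
      case (elim z)
      obtain t q where z: "z = (t, q)" by (cases z)
      have "\<forall>q h. (\<lambda>q. dd (R t) q h) differentiable (at q)" using elim z by simp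
      from dd_eqI[OF derivR[OF this]] show ?case by (simp add: z)
    qed
    ultimately show "((\<lambda>(t, q). dd (gradient (R t)) q h) \<longlongrightarrow> 0) (near p)"
      by (rule Lim_transform_eventually)
  qed
qed

lemma gZ0: "gZ 0 q = gradient Z q"
  by (simp add: gZ_def)

lemma Wt_family:
  assumes p: "p \<in> U"
  shows "C1_family Wt Wdot p"
proof -
  interpret bb: bounded_bilinear "(*v) :: real^'n^'n \<Rightarrow> real^'n \<Rightarrow> real^'n" by (rule bounded_bilinear_matrix_vec)
  have "C1_family Wt (\<lambda>q. Pdot q *v (transpose (B 0 q) *v gZ 0 q)
      + Pt 0 q *v (- transpose (jacobian_matrix (V 0) q) *v gZ 0 q + transpose (B 0 q) *v gradient G q)) p"
    unfolding Wt_def[abs_def]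
    by (intro C1_family_bilinear[OF bounded_bilinear_matrix_vec] Pt_family BT_family gZ_family p)
  then show ?thesis
    by (rule C1_family_cong_derivative[OF _ U p])
      (simp add: Wdot_def BT0 gZ0 Pt0 bb.minus_left algebra_simps)
qed

lemma Wt0: "q \<in> U \<Longrightarrow> Wt 0 q = W q"
  by (simp add: Wt_def W_def Pt0 BT0 gZ0)

lemma jacobian_Wt0: "q \<in> U \<Longrightarrow> jacobian_matrix (Wt 0) q = jacobian_matrix W q"
  unfolding jacobian_matrix_def using dd_transform[OF U _ Wt0] by simp

lemma Lt0: "q \<in> U \<Longrightarrow> Lt 0 q = L q"
  by (simp add: Lt_def L_def jacobian_Wt0 B0 Pt0)

lemma Lt_derivative:
  assumes p: "p \<in> U"
  shows "has_time_derivative Lt p (gL p)"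
proof -
  interpret mm: bounded_bilinear "(**) :: real^'n^'n \<Rightarrow> real^'n^'n \<Rightarrow> real^'n^'n" by (rule bounded_bilinear_matrix_mul)
  have "has_time_derivative Lt p (trace ((jacobian_matrix Wdot p ** B 0 p + jacobian_matrix (Wt 0) p ** (- jacobian_matrix (V 0) p)) ** Pt 0 p
     + (jacobian_matrix (Wt 0) p ** B 0 p) ** Pdot p))"
    unfolding Lt_def[abs_def]
    by (intro has_time_derivative_linear[OF bounded_linear_trace]
        has_time_derivative_bilinear[OF bounded_bilinear_matrix_mul] C1_family_jacobian[OF Wt_family[OF p]]
        C1_familyD(1)[OF B_family] C1_familyD(1)[OF Pt_family[OF p]])
  then show ?thesis
    using p by (simp add: gL_def B0 Pt0 jacobian_Wt0 mm.add_left mm.diff_left mm.minus_left mm.minus_right trace_add trace_minus trace_sub)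
qed

section \<open>Regularity of the pulled back Laplacian and its identification\<close>

lemma Wdot_C1: "Ck_on 1 Wdot U"
proof (rule Ck_on_cong[OF U])
  show "Ck_on 1 (\<lambda>q. \<omega> q + jacobian_matrix W q *v u q) U"
    using Ck_on_mono[OF u2, of 1] by (intro Ck_on_add Ck_on_matrix_vec U \<omega>1 C1) simp
qed (simp add: Wdot_eq)

lemma gL_continuous: "continuous_on U gL"
proof -
  have C0: "Ck_on 0 f U" if "Ck_on 1 f U" for f :: "real^'n \<Rightarrow> 'b::real_normed_vector"
    using Ck_on_mono[OF that, of 0] by simp
  have P0: "Ck_on 0 P U" and N0: "Ck_on 0 N U"
    using Ck_on_mono[OF P2, of 0] Ck_on_mono[OF N2, of 0] by simp_all
  have V0: "Ck_on 0 (jacobian_matrix (V 0)) U"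
    using Ck_on_jacobian[OF U, of 0 "V 0"] Ck_on_mono[OF v2, of 1] by simp
  have Wd: "Ck_on 0 (jacobian_matrix Wdot) U"
    using Ck_on_jacobian[OF U, of 0 Wdot] Wdot_C1 by simp
  have Nd: "Ck_on 0 Ndot U"
    unfolding Ndot_def[abs_def] by (intro Ck_on_minus Ck_on_matrix_vec Ck_on_transpose U P0 V0 N0)
  have Pd: "Ck_on 0 Pdot U"
    unfolding Pdot_def[abs_def] by (intro Ck_on_minus Ck_on_add Ck_on_tensor U N0 Nd)
  have "Ck_on 0 gL U"
    unfolding gL_def[abs_def]
    by (intro Ck_on_add Ck_on_diff Ck_on_bounded_linear[OF bounded_linear_trace] Ck_on_matrix_mul U
        Wd P0 C0[OF C1] V0 Pd)
  then show ?thesis by simp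
qed

lemma Wt_C1:
  assumes t: "t \<in> {0..T}"
  shows "Ck_on 1 (Wt t) U" "Ck_on 1 (Nt t) U" "Ck_on 1 (B t) U"
proof -
  interpret d: small_diffeo "x t" by (rule diffeo[OF t])
  show B: "Ck_on 1 (B t) U" unfolding B_eq[OF t] by (rule Ck_on_subset[OF d.B_C1]) simp
  have a: "Ck_on 1 (a t) U" unfolding a_def[abs_def] by (intro Ck_on_matrix_vec Ck_on_transpose U B N1)
  have "a t q \<noteq> 0" if "q \<in> U" for q
  proof -
    have "N q \<noteq> 0" using unit[OF that] by auto
    then show ?thesis using d.transpose_B_nonzero[of "N q" q] by (simp add: a_def B_eq[OF t])
  qed
  from Ck_on_normalize[OF U a this] show N: "Ck_on 1 (Nt t) U"
    by (simp add: Nt_def[abs_def] inverse_norm_powr)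
  have "Ck_on 1 (gradient (R t)) UNIV" using Ck_on_gradient[of UNIV 1 "R t"] R2[of t] by (simp add: numeral_2_eq_2)
  then have gR: "Ck_on 1 (gradient (R t)) U" by (rule Ck_on_subset) simp
  have gG: "Ck_on 1 (gradient G) U" using Ck_on_gradient[of U 1 G] U G2 by (simp add: numeral_2_eq_2)
  have gZ: "Ck_on 1 (gradient Z) U" using Ck_on_mono[OF gradZ2, of 1] by simp
  show "Ck_on 1 (Wt t) U"
    unfolding Wt_def[abs_def] Pt_def gZ_def
    by (intro Ck_on_matrix_vec Ck_on_tproj Ck_on_transpose Ck_on_add Ck_on_scaleR Ck_on_const U B N gR gG gZ)
qed

lemma Lt_continuous:
  assumes t: "t \<in> {0..T}"
  shows "continuous_on U (Lt t)"
proof -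
  note C = Wt_C1[OF assms]
  have "Ck_on 0 (jacobian_matrix (Wt t)) U" using Ck_on_jacobian[OF U, of 0 "Wt t"] C(1) by simp
  moreover have "Ck_on 0 (Nt t) U" "Ck_on 0 (B t) U" using Ck_on_mono[OF C(2), of 0] Ck_on_mono[OF C(3), of 0] by simp_all
  ultimately have "Ck_on 0 (Lt t) U"
    unfolding Lt_def[abs_def] Pt_def
    by (intro Ck_on_bounded_linear[OF bounded_linear_trace] Ck_on_matrix_mul Ck_on_tproj U)
  then show ?thesis by simp
qed

text \<open>The normal of the image depends on the covector only up to a positive factor, so
  \<open>gradient \<Phi>\<close> may be replaced by the unit field \<open>N\<close>. Then the
  pushforward formula applies with the explicit field \<open>Wt t\<close>.\<close>

lemma laplace_beltrami_moving:
  assumes t: "t \<in> {0..T}"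
    and zt: "\<And>X. X \<in> \<Gamma> \<Longrightarrow> z (x t ` \<Gamma>) (x t X) = Z X + t * (G X + R t X)" and X: "X \<in> \<Gamma>"
  shows "laplace_beltrami (x t ` \<Gamma>) (z (x t ` \<Gamma>)) (x t X) = Lt t X"
proof -
  interpret d: small_diffeo "x t" by (rule diffeo[OF t])
  let ?F = "\<lambda>X. Z X + t * (G X + R t X)"
  have con: "conormal (B t q) (gradient \<Phi> q) = Nt t q" if q: "q \<in> U" for q
  proof -
    have nz: "gradient \<Phi> q \<noteq> 0" using \<Phi> q by (simp add: defining_function_def)
    have "gradient \<Phi> q = norm (gradient \<Phi> q) *\<^sub>R N q" using N_eq[OF q] nz by simp
    then have "conormal (B t q) (gradient \<Phi> q) = conormal (B t q) (N q)"
      using conormal_scaleR[of "norm (gradient \<Phi> q)" "B t q" "N q"] nz by simp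
    then show ?thesis by (simp add: conormal_def Nt_def a_def inverse_norm_powr)
  qed
  have R': "Ck_on 2 (R t) U" by (rule Ck_on_subset[OF R2]) simp
  have Z2: "Ck_on 2 Z U" using Ck_on_mono[OF Z3, of 2] by simp
  have F2: "Ck_on 2 ?F U" by (intro Ck_on_add Ck_on_mult Ck_on_const U Z2 G2 R')
  have gF: "gradient ?F q = gZ t q" if q: "q \<in> U" for q
  proof -
    have "Z differentiable (at q)" "G differentiable (at q)" "R t differentiable (at q)"
      using Z2 G2 R' q by (auto intro: Ck_on_differentiable)
    then have "(?F has_derivative (\<lambda>h. gradient Z q \<bullet> h + t * (gradient G q \<bullet> h + gradient (R t) q \<bullet> h))) (at q)"
      by (intro has_derivative_add has_derivative_mult_right has_derivative_gradient)
    then have "(?F has_derivative (\<lambda>h. gZ t q \<bullet> h)) (at q)"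
      by (simp add: gZ_def inner_add_left)
    then show ?thesis by (rule gradientI)
  qed
  have "laplace_beltrami (x t ` \<Gamma>) (z (x t ` \<Gamma>)) (x t X)
      = trace (jacobian_matrix (Wt t) X ** d.B X ** tproj (conormal (d.B X) (gradient \<Phi> X)))"
  proof (rule d.laplace_beltrami_pushforward[OF \<Omega> sub \<Phi> U sub F2 zt Wt_C1(1)[OF t] _ X])
    fix Y assume "Y \<in> \<Gamma>"
    then have "Y \<in> U" using sub by blast
    then show "Wt t Y = tproj (conormal (d.B Y) (gradient \<Phi> Y)) *v (transpose (d.B Y) *v gradient ?F Y)"
      by (simp add: Wt_def Pt_def con gF flip: B_eq[OF t])
  qed
  then show ?thesis
    using X sub by (auto simp: Lt_def Pt_def con simp flip: B_eq[OF t])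
qed

end

section \<open>Material derivatives\<close>

lemma Ck_bd_norm_lessD:
  assumes "Ck_bd_norm k \<Gamma> f < c"
  obtains F where "Ck_on k F UNIV" "\<And>x. x \<in> \<Gamma> \<Longrightarrow> F x = f x" "Ck_norm k F < c"
  using assms unfolding Ck_bd_norm_def INF_less_iff by auto

lemma Ck_bd_norm_pointwise:
  assumes "Ck_bd_norm k \<Gamma> f < ennreal e" "X \<in> \<Gamma>"
  shows "norm (f X) \<le> e"
proof -
  obtain F where F: "\<And>x. x \<in> \<Gamma> \<Longrightarrow> F x = f x" "Ck_norm k F < ennreal e"
    using Ck_bd_norm_lessD[OF assms(1)] by blast
  have "0 < ennreal e" using F(2) by (rule le_less_trans[rotated]) simp
  then have "0 \<le> e" by simp
  then have "norm (iterated_deriv [] F X) \<le> e"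
    using F(2) by (intro Ck_norm_bound[of k]) auto
  then show ?thesis using F(1)[OF assms(2)] by simp
qed

text \<open>Tietze's theorem extends a continuous function with the same bound, so at order 0 the
  quotient norm is controlled by the supremum over the boundary.\<close>

lemma Ck_bd_norm_0_le:
  fixes f :: "'a::euclidean_space \<Rightarrow> real"
  assumes "closed \<Gamma>" "continuous_on \<Gamma> f" "0 \<le> e" "\<And>X. X \<in> \<Gamma> \<Longrightarrow> norm (f X) \<le> e"
  shows "Ck_bd_norm 0 \<Gamma> f \<le> ennreal e"
proof -
  obtain F where F: "continuous_on UNIV F" "\<And>X. X \<in> \<Gamma> \<Longrightarrow> F X = f X" "\<And>X. X \<in> UNIV \<Longrightarrow> norm (F X) \<le> e"
    using Tietze[OF assms(2) _ assms(3,4), of UNIV] assms(1) by (metis closed_closedin subtopology_UNIV)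
  have "Ck_norm 0 F \<le> ennreal e"
    unfolding Ck_norm_def using F(3) by (auto intro!: SUP_least ennreal_leI)
  then show ?thesis
    unfolding Ck_bd_norm_def using F by (intro INF_lower2[of F]) auto
qed

text \<open>The norm dominates the values on the boundary, so two limits agree there and the choice
  in \<open>material_derivative\<close> is determined at boundary points.\<close>

lemma has_material_derivative_unique:
  assumes "has_material_derivative r z \<Gamma> x g" "has_material_derivative r z \<Gamma> x h" "X \<in> \<Gamma>"
  shows "g X = h X"
proof -
  let ?q = "\<lambda>t X. (z (x t ` \<Gamma>) (x t X) - z \<Gamma> X) / t"
  have "norm (g X - h X) \<le> 0 + e" if e: "e > 0" for e
  proof -
    have half: "0 < ennreal (e / 2)" using e by simp
    have "\<forall>\<^sub>F t in at_right 0. Ck_bd_norm (r - 1) \<Gamma> (\<lambda>X. ?q t X - g X) < ennreal (e / 2)"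
      "\<forall>\<^sub>F t in at_right 0. Ck_bd_norm (r - 1) \<Gamma> (\<lambda>X. ?q t X - h X) < ennreal (e / 2)"
      using assms(1,2) half unfolding has_material_derivative_def by (auto intro: order_tendstoD)
    then have "\<forall>\<^sub>F t::real in at_right 0. norm (g X - h X) \<le> e"
    proof eventually_elim
      case (elim t)
      have "norm (?q t X - g X) \<le> e / 2" "norm (?q t X - h X) \<le> e / 2"
        using Ck_bd_norm_pointwise[OF elim(1) assms(3)] Ck_bd_norm_pointwise[OF elim(2) assms(3)] by auto
      then show ?case unfolding real_norm_def by linarith
    qed
    then show ?thesis by simp
  qed
  then have "norm (g X - h X) \<le> 0" by (rule field_le_epsilon)
  then show ?thesis by simp
qed

lemma material_derivative_eq:
  assumes "has_material_derivative r z \<Gamma> x g" "X \<in> \<Gamma>"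
  shows "material_derivative r z \<Gamma> x X = g X"
  unfolding material_derivative_def
  by (rule has_material_derivative_unique[OF someI[of "has_material_derivative r z \<Gamma> x", OF assms(1)] assms(1,2)])

text \<open>Finitely many product neighbourhoods cover the compact set, and times below all their
  finitely many bounds serve for every point.\<close>

lemma compact_near_uniform:
  assumes K: "compact K" and P: "\<And>p. p \<in> K \<Longrightarrow> \<forall>\<^sub>F (t, q) in near p. Q t q"
  shows "\<forall>\<^sub>F t in at_right 0. \<forall>q\<in>K. Q t q"
proof -
  have "\<forall>p\<in>K. \<exists>d S. d > 0 \<and> open S \<and> p \<in> S \<and> (\<forall>t q. 0 < t \<longrightarrow> t < d \<longrightarrow> q \<in> S \<longrightarrow> Q t q)"
    using eventually_near_product[OF P] by blast
  then obtain d S where dS: "\<And>p. p \<in> K \<Longrightarrow> d p > (0::real)" "\<And>p. p \<in> K \<Longrightarrow> open (S p)" "\<And>p. p \<in> K \<Longrightarrow> p \<in> S p"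
    "\<And>p t q. p \<in> K \<Longrightarrow> 0 < t \<Longrightarrow> t < d p \<Longrightarrow> q \<in> S p \<Longrightarrow> Q t q"
    by metis
  obtain F where F: "F \<subseteq> K" "finite F" "K \<subseteq> (\<Union>p\<in>F. S p)"
    using compactE_image[OF K, of K S] dS(2,3) by blast
  have "\<forall>\<^sub>F t in at_right 0. \<forall>p\<in>F. t \<in> {0<..<d p}"
    using F dS(1) by (intro eventually_ball_finite ballI eventually_at_right_real) auto
  then show ?thesis
  proof eventually_elim
    case (elim t)
    show ?case
    proof
      fix q assume "q \<in> K"
      then obtain p where p: "p \<in> F" "q \<in> S p" using F(3) by blast
      then have "p \<in> K" "0 < t" "t < d p" using F(1) elim by auto
      then show "Q t q" using dS(4) p(2) by blast
    qed
  qed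
qed

section \<open>From the pulled back Laplacian to the shape derivative\<close>

context moving_boundary
begin

lemma \<Gamma>_compact: "compact \<Gamma>"
  using \<Omega> by (simp add: Ck_domain_def compact_frontier_bounded)

lemma \<Gamma>_C1: "C1_boundary \<Gamma>"
  using \<Omega> by (auto simp: C1_boundary_def)

lemma normal_N: "X \<in> \<Gamma> \<Longrightarrow> normal \<Gamma> X = N X"
  using normal_eq[OF \<Omega> \<Phi>, of X] N_eq[of X] sub by auto

lemma extension_on_U:
  assumes "Ck_on 1 F U" "\<And>X. X \<in> \<Gamma> \<Longrightarrow> f X = F X"
  shows "Ck_extension 1 \<Gamma> f F"
  using assms U sub unfolding Ck_extension_def by auto

lemma tgrad_on_U:
  assumes "Ck_on 1 F U" "\<And>X. X \<in> \<Gamma> \<Longrightarrow> f X = F X" "X \<in> \<Gamma>"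
  shows "tgrad \<Gamma> f X = P X *v gradient F X"
  using tgrad_extension[OF \<Gamma>_C1 assms(3) extension_on_U[OF assms(1,2)]] normal_N[OF assms(3)]
  by (simp add: P_def)

lemma tderiv_on_U:
  assumes "Ck_on 1 F U" "\<And>X. X \<in> \<Gamma> \<Longrightarrow> f X = F X" "X \<in> \<Gamma>"
  shows "tderiv \<Gamma> f X = jacobian_matrix F X ** P X"
  using tderiv_extension[OF \<Gamma>_C1 assms(3) extension_on_U[OF assms(1,2)]] normal_N[OF assms(3)]
  by (simp add: P_def)

lemma tdiv_on_U:
  assumes "Ck_on 1 F U" "\<And>X. X \<in> \<Gamma> \<Longrightarrow> f X = F X" "X \<in> \<Gamma>"
  shows "tdiv \<Gamma> f X = trace (jacobian_matrix F X ** P X)"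
  using tdiv_extension[OF \<Gamma>_C1 assms(3) extension_on_U[OF assms(1,2)]] normal_N[OF assms(3)]
  by (simp add: P_def)

lemma tgrad_z: "X \<in> \<Gamma> \<Longrightarrow> tgrad \<Gamma> (z \<Gamma>) X = W X"
  using tgrad_on_U[of Z "z \<Gamma>"] Ck_on_mono[OF Z3, of 1] z_eq by (simp add: W_def del: One_nat_def)

lemma laplace_beltrami_z: "X \<in> \<Gamma> \<Longrightarrow> laplace_beltrami \<Gamma> (z \<Gamma>) X = L X"
  unfolding laplace_beltrami_def L_def
  using tdiv_on_U[OF Ck_on_mono[OF W2, of 1] tgrad_z] by simp

lemma laplace_beltrami_on_U:
  assumes F: "Ck_on 2 F U" "\<And>X. X \<in> \<Gamma> \<Longrightarrow> f X = F X" and X: "X \<in> \<Gamma>"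
  shows "laplace_beltrami \<Gamma> f X = trace (jacobian_matrix (\<lambda>q. P q *v gradient F q) X ** P X)"
proof -
  have "Ck_on 1 (gradient F) U" using Ck_on_gradient[of U 1 F] U F by (simp add: numeral_2_eq_2)
  then have "Ck_on 1 (\<lambda>q. P q *v gradient F q) U"
    using Ck_on_mono[OF P2, of 1] by (intro Ck_on_matrix_vec U) simp
  then show ?thesis
    unfolding laplace_beltrami_def
    by (rule tdiv_on_U[OF _ tgrad_on_U[OF Ck_on_mono[OF F(1)] F(2)] X]) simp
qed

text \<open>At order 1 the convergence is measured in the C^0 norm. The local expansions of
  \<open>Lt\<close> become uniform on the compact boundary, and a uniform bound there bounds the
  norm.\<close>

lemma material_derivative_laplace:
  "has_material_derivative 1 (\<lambda>G. laplace_beltrami G (z G)) \<Gamma> x gL"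
proof -
  let ?Lz = "\<lambda>G. laplace_beltrami G (z G)"
  let ?q = "\<lambda>t X. (?Lz (x t ` \<Gamma>) (x t X) - ?Lz \<Gamma> X) / t - gL X"
  have closed: "closed \<Gamma>" by (rule frontier_closed)
  have "?Lz \<Gamma> \<in> Ck_bd 1 \<Gamma>"
    using extension_on_U[OF L1 laplace_beltrami_z] by (auto simp: Ck_bd_def)
  moreover have "gL \<in> Ck_bd 0 \<Gamma>"
    unfolding Ck_bd_def Ck_extension_def using U sub gL_continuous by auto
  moreover have "((\<lambda>t. Ck_bd_norm 0 \<Gamma> (?q t)) \<longlongrightarrow> 0) (at_right 0)"
  proof (rule tendsto_zero_ennreal)
    fix e :: real assume e: "0 < e"
    have "\<forall>\<^sub>F t in at_right 0. \<forall>q\<in>\<Gamma>. norm ((Lt t q - Lt 0 q) /\<^sub>R t - gL q) < e / 2"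
    proof (rule compact_near_uniform[OF \<Gamma>_compact])
      fix p assume "p \<in> \<Gamma>"
      then have p: "p \<in> U" using sub by blast
      have c: "isCont gL p" using gL_continuous U p by (simp add: continuous_on_eq_continuous_at)
      have l: "((\<lambda>(t, q). (Lt t q - Lt 0 q) /\<^sub>R t) \<longlongrightarrow> gL p) (near p)"
        using Lt_derivative[OF p] by (simp add: has_time_derivative_def)
      have "((\<lambda>(t, q). (Lt t q - Lt 0 q) /\<^sub>R t - gL q) \<longlongrightarrow> 0) (near p)"
        using tendsto_diff[OF l isCont_near[OF c]] by (simp add: case_prod_unfold)
      then have "\<forall>\<^sub>F z in near p. dist (case z of (t, q) \<Rightarrow> (Lt t q - Lt 0 q) /\<^sub>R t - gL q) 0 < e / 2"
        by (rule tendstoD) (use e in simp)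
      then show "\<forall>\<^sub>F (t, q) in near p. norm ((Lt t q - Lt 0 q) /\<^sub>R t - gL q) < e / 2"
        by eventually_elim auto
    qed
    with eventually_T zt_eq show "\<forall>\<^sub>F t in at_right 0. Ck_bd_norm 0 \<Gamma> (?q t) < ennreal e"
    proof eventually_elim
      case (elim t)
      then have t: "t \<in> {0..T}" by simp
      have eq: "?q t X = (Lt t X - Lt 0 X) /\<^sub>R t - gL X" if X: "X \<in> \<Gamma>" for X
      proof -
        have "X \<in> U" using X sub by blast
        then show ?thesis
          using laplace_beltrami_moving[OF t _ X] elim(2) laplace_beltrami_z[OF X]
          by (simp add: Lt0 divide_inverse mult.commute)
      qed
      have L0: "continuous_on U (Lt 0)" using Lt_continuous[of 0] flow.params by simp
      have "continuous_on U (\<lambda>X. (Lt t X - Lt 0 X) /\<^sub>R t - gL X)"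
        by (intro continuous_intros L0 Lt_continuous t gL_continuous)
      then have "continuous_on \<Gamma> (\<lambda>X. (Lt t X - Lt 0 X) /\<^sub>R t - gL X)"
        using sub by (rule continuous_on_subset)
      then have "continuous_on \<Gamma> (?q t)"
        by (rule continuous_on_eq) (simp add: eq)
      then have "Ck_bd_norm 0 \<Gamma> (?q t) \<le> ennreal (e / 2)"
        using e elim(3) by (intro Ck_bd_norm_0_le closed) (auto simp: eq)
      also have "\<dots> < ennreal e" using e by (simp add: ennreal_lessI)
      finally show ?case .
    qed
  qed
  ultimately show ?thesis by (simp add: has_material_derivative_def)
qed

text \<open>The pointwise identity read on the boundary, where the extended fields represent the
  tangential operators. The second claim, the symmetry of the tangential derivative of the normal,
  is what converts the first form of the result into the second.\<close>

lemma shape_derivative_laplace: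
  fixes z' :: "real^'n \<Rightarrow> real"
  assumes z': "\<And>X. X \<in> \<Gamma> \<Longrightarrow> z' X = G X - W X \<bullet> V 0 X" and X: "X \<in> \<Gamma>"
  defines "vn \<equiv> (\<lambda>X. V 0 X \<bullet> normal \<Gamma> X)"
  shows "shape_derivative 1 (\<lambda>G. laplace_beltrami G (z G)) \<Gamma> x (V 0) X = laplace_beltrami \<Gamma> z' X
     - 2 * vn X * ddot (tderiv \<Gamma> (normal \<Gamma>) X) (thessian \<Gamma> (z \<Gamma>) X)
     + (mean_curvature \<Gamma> X *\<^sub>R tgrad \<Gamma> vn X - 2 *\<^sub>R (tderiv \<Gamma> (normal \<Gamma>) X *v tgrad \<Gamma> vn X)
         - vn X *\<^sub>R tgrad \<Gamma> (mean_curvature \<Gamma>) X) \<bullet> tgrad \<Gamma> (z \<Gamma>) X" (is ?first)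
    and "tgrad \<Gamma> vn X \<bullet> (tderiv \<Gamma> (normal \<Gamma>) X *v tgrad \<Gamma> (z \<Gamma>) X)
      = (tderiv \<Gamma> (normal \<Gamma>) X *v tgrad \<Gamma> vn X) \<bullet> tgrad \<Gamma> (z \<Gamma>) X" (is ?second)
proof -
  have q: "X \<in> U" using X sub by blast
  note on1 = Ck_on_mono[of 2 _ U 1]
  have tn: "tderiv \<Gamma> (normal \<Gamma>) X = M X ** P X"
    unfolding M_def by (rule tderiv_on_U[OF N1 normal_N X])
  have th: "thessian \<Gamma> (z \<Gamma>) X = jacobian_matrix W X ** P X"
    unfolding thessian_def by (rule tderiv_on_U[OF on1[OF W2] tgrad_z X]) simp
  have kap: "mean_curvature \<Gamma> Y = \<kappa> Y" if "Y \<in> \<Gamma>" for Y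
    unfolding mean_curvature_def \<kappa>_def M_def by (rule tdiv_on_U[OF N1 normal_N that])
  have tk: "tgrad \<Gamma> (mean_curvature \<Gamma>) X = P X *v gradient \<kappa> X"
    by (rule tgrad_on_U[OF \<kappa>1 kap X])
  have vn: "vn Y = w Y" if "Y \<in> \<Gamma>" for Y
    by (simp add: vn_def w_def normal_N that)
  have tv: "tgrad \<Gamma> vn X = \<tau> X"
    unfolding \<tau>_def by (rule tgrad_on_U[OF on1[OF w2] vn X]) simp
  have Wu: "gradient Z Y \<bullet> u Y = W Y \<bullet> V 0 Y" if "Y \<in> \<Gamma>" for Y
    using inner_P[of Y "gradient Z Y" "V 0 Y"] that sub by (auto simp: W_def u_def)
  have lz: "laplace_beltrami \<Gamma> z' X = trace (jacobian_matrix (\<lambda>q. P q *v gradient Zs q) X ** P X)"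
    by (rule laplace_beltrami_on_U[OF Zs2 _ X]) (simp add: Zs_def z' Wu)
  \<comment> \<open>A tangential gradient sees only the tangential part \<open>u\<close> of the
    velocity, so the convective term is the transport of \<open>L\<close> in the pointwise
    identity.\<close>
  have tL: "tgrad \<Gamma> (laplace_beltrami \<Gamma> (z \<Gamma>)) X \<bullet> V 0 X = gradient L X \<bullet> u X"
    using inner_P[OF q] tgrad_on_U[OF L1 laplace_beltrami_z X] by (simp add: u_def)
  have "transpose (P X) = P X" by (simp add: P_def transpose_tproj)
  then have MPs: "transpose (M X ** P X) = M X ** P X"
    by (intro matrix_eqI)
      (simp add: matrix_transpose_mul P_transpose_M[OF q] flip: matrix_vector_mul_assoc)
  have dd: "ddot (M X ** P X) (jacobian_matrix W X ** P X) = trace (M X ** P X ** jacobian_matrix W X ** P X)"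
    by (simp add: ddot_def MPs matrix_mul_assoc)
  have md: "material_derivative 1 (\<lambda>G. laplace_beltrami G (z G)) \<Gamma> x X = gL X"
    by (rule material_derivative_eq[OF material_derivative_laplace X])
  show ?first
    unfolding shape_derivative_def md tL gL_def shape_derivative_identity[OF q]
    by (simp add: lz tn th dd kap[OF X] tk vn[OF X] tv tgrad_z[OF X] flip: matrix_vector_mul_assoc)
  show ?second
    unfolding tn tv tgrad_z[OF X] inner_matrix_vec[of "\<tau> X"] MPs ..
qed

end

theorem theorem37:
  fixes D \<Gamma> :: "(real^'n) set"
    and z :: "'n boundary_function"
    and V x :: "real \<Rightarrow> real^'n \<Rightarrow> real^'n"
    and \<epsilon> :: real
  defines "n \<equiv> normal \<Gamma>"
    and "\<kappa> \<equiv> mean_curvature \<Gamma>"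
    and "v\<^sub>n \<equiv> (\<lambda>X. V 0 X \<bullet> normal \<Gamma> X)"
    and "z' \<equiv> shape_derivative 3 z \<Gamma> x (V 0)"
    and "Lz \<equiv> (\<lambda>G. laplace_beltrami G (z G))"
  assumes "open D"
    and "0 < \<epsilon>"
    and "velocity_field 3 D \<epsilon> V"
    and "trajectories \<epsilon> V x"
    and "admissible_boundary 3 D \<Gamma>"
    and "z \<Gamma> \<in> Ck_bd 3 \<Gamma>"
    and "shape_differentiable 3 z \<Gamma> x"
  shows "shape_differentiable 1 Lz \<Gamma> x \<and>
    (\<forall>X\<in>\<Gamma>.
       shape_derivative 1 Lz \<Gamma> x (V 0) X =
         laplace_beltrami \<Gamma> z' X
         - 2 * v\<^sub>n X * ddot (tderiv \<Gamma> n X) (thessian \<Gamma> (z \<Gamma>) X)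
         + (\<kappa> X *\<^sub>R tgrad \<Gamma> v\<^sub>n X - 2 *\<^sub>R (tderiv \<Gamma> n X *v tgrad \<Gamma> v\<^sub>n X) - v\<^sub>n X *\<^sub>R tgrad \<Gamma> \<kappa> X)
             \<bullet> tgrad \<Gamma> (z \<Gamma>) X \<and>
       shape_derivative 1 Lz \<Gamma> x (V 0) X =
         laplace_beltrami \<Gamma> z' X
         - v\<^sub>n X * (2 * ddot (tderiv \<Gamma> n X) (thessian \<Gamma> (z \<Gamma>) X) + tgrad \<Gamma> \<kappa> X \<bullet> tgrad \<Gamma> (z \<Gamma>) X)
         + tgrad \<Gamma> v\<^sub>n X \<bullet> (\<kappa> X *\<^sub>R tgrad \<Gamma> (z \<Gamma>) X - 2 *\<^sub>R (tderiv \<Gamma> n X *v tgrad \<Gamma> (z \<Gamma>) X)))"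
proof -
  note local_defs = n_def \<kappa>_def v\<^sub>n_def z'_def Lz_def
  obtain \<Omega> where \<Omega>3: "Ck_domain 3 \<Omega>" and \<Gamma>: "\<Gamma> = frontier \<Omega>"
    using assms(10) by (auto simp: admissible_boundary_def)
  have \<Omega>: "Ck_domain 1 \<Omega>" using Ck_domain_mono[OF \<Omega>3] by simp
  obtain U0 \<Phi> where U0: "frontier \<Omega> \<subseteq> U0" "defining_function 3 \<Omega> U0 \<Phi>"
    using global_defining_function[of 2 \<Omega>] \<Omega>3 by (auto simp: numeral_3_eq_3 numeral_2_eq_2)
  obtain Z UZ where Z: "open UZ" "\<Gamma> \<subseteq> UZ" "Ck_on 3 Z UZ" "\<And>X. X \<in> \<Gamma> \<Longrightarrow> Z X = z \<Gamma> X"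
    using assms(11) by (auto simp: Ck_bd_def Ck_extension_def)
  obtain g where g: "has_material_derivative 3 z \<Gamma> x g"
    using assms(12) by (auto simp: shape_differentiable_def)
  let ?q = "\<lambda>t X. (z (x t ` \<Gamma>) (x t X) - z \<Gamma> X) / t - g X"
  have "g \<in> Ck_bd 2 \<Gamma>" and glim: "((\<lambda>t. Ck_bd_norm 2 \<Gamma> (?q t)) \<longlongrightarrow> 0) (at_right 0)"
    using g by (simp_all add: has_material_derivative_def)
  then obtain G UG where G: "open UG" "\<Gamma> \<subseteq> UG" "Ck_on 2 G UG" "\<And>X. X \<in> \<Gamma> \<Longrightarrow> G X = g X"
    by (auto simp: Ck_bd_def Ck_extension_def)
  define U where "U = U0 \<inter> UZ \<inter> UG"
  define N where "N q = gradient \<Phi> q /\<^sub>R norm (gradient \<Phi> q)" for q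
  have U: "open U" "\<Gamma> \<subseteq> U"
    using U0 Z G by (auto simp: U_def \<Gamma> defining_function_def)
  have \<Phi>3: "Ck_on 3 \<Phi> U" and \<Phi>nz: "\<And>q. q \<in> U \<Longrightarrow> gradient \<Phi> q \<noteq> 0"
    using U0(2) Ck_on_subset[of 3 \<Phi> U0 U] by (auto simp: defining_function_def U_def)
  have \<Phi>: "defining_function 1 \<Omega> U \<Phi>"
    using U0(2) U(1) Ck_on_mono[OF \<Phi>3, of 1] unfolding defining_function_def U_def by auto
  have N2: "Ck_on 2 N U"
    unfolding N_def[abs_def] using Ck_on_gradient[OF U(1), of 2 \<Phi>] \<Phi>3 \<Phi>nz
    by (intro Ck_on_normalize U) (simp_all add: numeral_3_eq_3 numeral_2_eq_2)
  have V3: "Ck_on 3 (V 0) UNIV"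
    using assms(7,8) by (simp add: velocity_field_def Ck_fields_def)
  obtain T C where flow: "C3_flow V x T C"
    using velocity_field_C3_flow[OF assms(7,8,9)] by blast
  \<comment> \<open>The quotient norm is an infimum, so an extension is taken whose norm exceeds it
    by less than \<open>t\<close>; this excess tends to 0 as well. Where the norm is infinite or the
    time is not positive, the zero function is the default, so that every \<open>R t\<close> is of
    class C^2.\<close>
  have ex: "\<exists>F. Ck_on 2 F UNIV \<and> (0 < t \<longrightarrow> Ck_bd_norm 2 \<Gamma> (?q t) < top \<longrightarrow>
      (\<forall>X\<in>\<Gamma>. F X = ?q t X) \<and> Ck_norm 2 F < Ck_bd_norm 2 \<Gamma> (?q t) + ennreal t)" for t
  proof (cases "0 < t \<and> Ck_bd_norm 2 \<Gamma> (?q t) < top")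
    case True
    then have "Ck_bd_norm 2 \<Gamma> (?q t) + 0 < Ck_bd_norm 2 \<Gamma> (?q t) + ennreal t"
      by (subst ennreal_add_left_cancel_less) auto
    then have lt: "Ck_bd_norm 2 \<Gamma> (?q t) < Ck_bd_norm 2 \<Gamma> (?q t) + ennreal t" by simp
    show ?thesis
    proof (rule Ck_bd_norm_lessD[OF lt])
      fix F assume "Ck_on 2 F UNIV" "\<And>X. X \<in> \<Gamma> \<Longrightarrow> F X = ?q t X"
        "Ck_norm 2 F < Ck_bd_norm 2 \<Gamma> (?q t) + ennreal t"
      then show ?thesis by (intro exI[of _ F]) simp
    qed
  next
    case False
    then show ?thesis using Ck_on_const[of 2 0 UNIV] by blast
  qed
  obtain R where "\<forall>t. Ck_on 2 (R t) UNIV \<and> (0 < t \<longrightarrow> Ck_bd_norm 2 \<Gamma> (?q t) < top \<longrightarrow>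
      (\<forall>X\<in>\<Gamma>. R t X = ?q t X) \<and> Ck_norm 2 (R t) < Ck_bd_norm 2 \<Gamma> (?q t) + ennreal t)"
    using choice[OF allI[OF ex]] by (rule exE)
  then have R: "Ck_on 2 (R t) UNIV"
    "0 < t \<Longrightarrow> Ck_bd_norm 2 \<Gamma> (?q t) < top \<Longrightarrow> X \<in> \<Gamma> \<Longrightarrow> R t X = ?q t X"
    "0 < t \<Longrightarrow> Ck_bd_norm 2 \<Gamma> (?q t) < top \<Longrightarrow> Ck_norm 2 (R t) < Ck_bd_norm 2 \<Gamma> (?q t) + ennreal t"
    for t X
    by simp_all
  have fin: "\<forall>\<^sub>F t in at_right 0. Ck_bd_norm 2 \<Gamma> (?q t) < top"
    using glim by (rule order_tendstoD) simp
  have pos: "\<forall>\<^sub>F t::real in at_right 0. 0 < t" by (simp add: eventually_at_right_less)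
  interpret moving_boundary V x T C U N Z G \<Omega> \<Phi> z R
  proof (intro moving_boundary.intro moving_boundary_axioms.intro tangential_setting.intro flow)
    show "open U" "Ck_on 2 N U" "frontier \<Omega> \<subseteq> U" using U N2 by (simp_all add: \<Gamma>)
    show "Ck_on 3 Z U" "Ck_on 2 G U" "Ck_on 2 (V 0) U"
      using Ck_on_subset[OF Z(3), of U] Ck_on_subset[OF G(3), of U]
        Ck_on_subset[OF Ck_on_mono[OF V3, of 2], of U] by (auto simp: U_def)
    show "Ck_domain 1 \<Omega>" "defining_function 1 \<Omega> U \<Phi>" by fact+
    show "Ck_on 2 (R t) UNIV" for t by (rule R)
    show "N q = gradient \<Phi> q /\<^sub>R norm (gradient \<Phi> q)" for q by (rule N_def)
    show "z (frontier \<Omega>) X = Z X" if "X \<in> frontier \<Omega>" for X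
      using Z(4) that by (simp add: \<Gamma>)
    show "norm (N q) = 1" if "q \<in> U" for q using \<Phi>nz[OF that] by (simp add: N_def)
    show "transpose (tproj (N q) ** jacobian_matrix N q ** tproj (N q)) = tproj (N q) ** jacobian_matrix N q ** tproj (N q)"
      if "q \<in> U" for q
      using Ck_on_mono[OF \<Phi>3, of 2] \<Phi>nz
      by (intro normalized_gradient_symmetric[OF U(1) that, of \<Phi>]) (simp_all add: N_def)
    show "\<forall>\<^sub>F t in at_right 0. \<forall>hs q. set hs \<subseteq> Basis \<longrightarrow> length hs \<le> 2 \<longrightarrow> norm (iterated_deriv hs (R t) q) \<le> e"
      if e: "e > 0" for e
    proof -
      have "((\<lambda>t. ennreal t) \<longlongrightarrow> ennreal 0) (at_right 0)" by (intro tendsto_ennrealI tendsto_ident_at)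
      from tendsto_add[OF glim this]
      have "\<forall>\<^sub>F t in at_right 0. Ck_bd_norm 2 \<Gamma> (?q t) + ennreal t < ennreal e"
        using e by (intro order_tendstoD) auto
      then show ?thesis
        using fin pos
      proof eventually_elim
        case (elim t)
        then have "Ck_norm 2 (R t) \<le> ennreal e" using R(3)[of t] by (meson less_imp_le less_trans)
        then show ?case using Ck_norm_bound[of 2 "R t" e] e by auto
      qed
    qed
    show "\<forall>\<^sub>F t in at_right 0. \<forall>X\<in>frontier \<Omega>. z (x t ` frontier \<Omega>) (x t X) = Z X + t * (G X + R t X)"
      using fin pos
    proof eventually_elim
      case (elim t)
      show ?case
      proof
        fix X assume X: "X \<in> frontier \<Omega>"
        then have "R t X = ?q t X" "G X = g X" "Z X = z \<Gamma> X"
          using R(2)[of t X] G(4) Z(4) elim by (simp_all add: \<Gamma>)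
        then show "z (x t ` frontier \<Omega>) (x t X) = Z X + t * (G X + R t X)"
          using elim by (simp add: \<Gamma> field_simps)
      qed
    qed
  qed
  have z'_eq: "z' X = G X - W X \<bullet> V 0 X" if "X \<in> frontier \<Omega>" for X
    using that material_derivative_eq[OF g, of X] G(4)[of X] tgrad_z[of X]
    by (simp add: local_defs shape_derivative_def \<Gamma>)
  have "shape_differentiable 1 Lz \<Gamma> x"
    using material_derivative_laplace unfolding shape_differentiable_def local_defs \<Gamma> by blast
  moreover have "shape_derivative 1 Lz \<Gamma> x (V 0) X =
         laplace_beltrami \<Gamma> z' X
         - 2 * v\<^sub>n X * ddot (tderiv \<Gamma> n X) (thessian \<Gamma> (z \<Gamma>) X)
         + (\<kappa> X *\<^sub>R tgrad \<Gamma> v\<^sub>n X - 2 *\<^sub>R (tderiv \<Gamma> n X *v tgrad \<Gamma> v\<^sub>n X) - v\<^sub>n X *\<^sub>R tgrad \<Gamma> \<kappa> X)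
             \<bullet> tgrad \<Gamma> (z \<Gamma>) X"
    and "tgrad \<Gamma> v\<^sub>n X \<bullet> (tderiv \<Gamma> n X *v tgrad \<Gamma> (z \<Gamma>) X)
      = (tderiv \<Gamma> n X *v tgrad \<Gamma> v\<^sub>n X) \<bullet> tgrad \<Gamma> (z \<Gamma>) X" if "X \<in> \<Gamma>" for X
    using shape_derivative_laplace[OF z'_eq, of X] that
    unfolding local_defs \<Gamma> by simp_all
  ultimately show ?thesis
    by (auto simp: inner_add_left inner_diff_left inner_diff_right algebra_simps)
qed

end
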